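(* Let $G$ be a finite non-solvable group such that $Sub(G) = 76$. Then $G \cong SL(2,5)$, the group of $2 \times 2$ matrices of determinant $1$ over the field with $5$ elements.
   Context: For a finite group $G$, $Sub(G)$ denotes the number of subgroups of $G$, including the trivial subgroup and $G$ itself (subgroups are counted as subsets, not up to conjugacy or isomorphism). *)

theory Defs
  imports
    "HOL-Analysis.Determinants"
    "HOL-Algebra.Solvable_Groups"
    "HOL-Library.Numeral_Type"
begin

definition Sub :: "('a, 'b) monoid_scheme \<Rightarrow> nat"
  where "Sub G = card {H. subgroup H G}"

definition special_linear :: "('a::comm_ring_1 ^ 'n::finite ^ 'n) monoid"
  where "special_linear = \<lparr>carrier = {A. det A = 1}, mult = (**), one = mat 1\<rparr>"

text \<open>
  The numeral type \<open>5\<close> carries arithmetic modulo 5.  The library has no \<open>field\<close> instance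
  for it, because the instances for numeral types are uniform in the modulus; the two lemmas below
  record that it is nevertheless the field with five elements.
\<close>

type_synonym F5 = 5

abbreviation SL_2_5 :: "(F5 ^ 2 ^ 2) monoid"
  where "SL_2_5 \<equiv> special_linear"

lemma card_F5: "CARD(F5) = 5"
  by simp

lemma F5_inverse:
  assumes "(x :: F5) \<noteq> 0"
  shows "\<exists>y. x * y = 1"
proof -
  obtain z where z: "x = of_int z" "0 \<le> z" "z < 5"
    by (cases x) auto
  then have "z = 1 \<or> z = 2 \<or> z = 3 \<or> z = 4"
    using assms by (cases "z = 0") auto
  then have "x = 1 \<or> x = 2 \<or> x = 3 \<or> x = 4"
    using z(1) by auto
  moreover have "(1::F5) * 1 = 1" "(2::F5) * 3 = 1" "(3::F5) * 2 = 1" "(4::F5) * 4 = 1"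
    by simp_all
  ultimately show ?thesis
    by metis
qed

lemma group_special_linear_2: "group (special_linear :: ('a::comm_ring_1 ^ 2 ^ 2) monoid)"
proof (rule groupI)
  fix A :: "'a ^ 2 ^ 2"
  assume "A \<in> carrier special_linear"
  then have d: "A$1$1 * A$2$2 - A$1$2 * A$2$1 = 1"
    by (simp add: special_linear_def det_2)
  define B :: "'a ^ 2 ^ 2" where
    "B = vector [vector [A$2$2, - A$1$2], vector [- A$2$1, A$1$1]]"
  have "det B = 1"
    using d by (simp add: det_2 B_def algebra_simps)
  moreover have "B ** A = mat 1"
    using d by (simp add: B_def matrix_matrix_mult_def mat_def vec_eq_iff forall_2 sum_2 algebra_simps)
  ultimately show "\<exists>B\<in>carrier special_linear. B \<otimes>\<^bsub>special_linear\<^esub> A = \<one>\<^bsub>special_linear\<^esub>"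
    by (auto simp add: special_linear_def)
qed (auto simp add: special_linear_def det_mul matrix_mul_assoc)

end

theory Submission
  imports
    Defs
    "HOL-Algebra.Sylow"
    "HOL-Algebra.SimpleGroups"
    "HOL-Algebra.Sym_Groups"
    "HOL-Algebra.Multiplicative_Group"
begin

text \<open>
  A finite non-solvable group \<open>G\<close> has a section \<open>S = H/N\<close> that is simple of non-prime order; one of least
  order is chosen (\<open>minimal_simple_section\<close>). The subgroups of \<open>S\<close> correspond to subgroups of \<open>G\<close>, so \<open>S\<close>
  has at most 74 proper non-trivial subgroups, and by minimality each of them that has composite order
  has a proper non-trivial normal subgroup.

  These two facts force \<open>S\<close> to have order 60. A maximal subgroup of \<open>S\<close> is its own normalizer, so it has as
  many conjugates as its index. It does not have prime order (\<open>no_prime_maximal\<close>), so it is the normalizer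
  of a smaller non-trivial subgroup, and each maximal subgroup contributes two of the 74. Hence there are at most 37 maximal subgroups, and the different
  indices of maximal subgroups add up to at most 37 (\<open>sum_indices\<close>). For each prime \<open>p\<close> dividing the order
  there is a maximal subgroup above the normalizer of a Sylow \<open>p\<close>-subgroup, and its index is 1 modulo \<open>p\<close>.
  If all indices are at least 8, only four patterns of indices are left (\<open>index_set_arith\<close>), and counting
  subgroups of different orders excludes them. If the least index \<open>d\<close> is at most 7, then \<open>S\<close> embeds into the
  alternating group of degree \<open>d\<close> (\<open>order_dvd_half_fact\<close>), and Sylow counting leaves the order 60
  (\<open>order_eq_60\<close>).

  A simple group of order 60 has exactly 59 subgroups (\<open>card_subgroups\<close>). If \<open>N\<close> is trivial, then \<open>S\<close> is
  the subgroup \<open>H\<close> of \<open>G\<close>: for \<open>H = G\<close> there are 59 subgroups, and for a proper subgroup \<open>H\<close> at least 77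
  (\<open>subgroups_above_simple_60\<close>). If \<open>N\<close> is not trivial, then 59 subgroups of \<open>H\<close> contain \<open>N\<close>. Counting
  2-subgroups shows that \<open>N\<close> is a 2-group, and then at least 17 subgroups do not contain it: the trivial one and lifts of the ten subgroups of order 3 and the six of order 5. As
  59 + 17 = 76, there are no others. Hence \<open>N\<close> has order 2 and contains every involution
  (\<open>central_extension\<close>); and \<open>H\<close> alone accounts for all 76 subgroups, so that \<open>H = G\<close>.

  It remains to recognize \<open>G\<close>, a group of order 120 with a single involution \<open>z\<close> and a simple quotient by
  it. The normalizer \<open>B\<close> of a Sylow 5-subgroup \<open>Q\<close> has order 20 and plays the part of the upper triangular
  matrices: there is a Bruhat decomposition \<open>G = B \<union> B x Q\<close> with an element \<open>x\<close> of order 4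
  (\<open>bi_frame\<close>). Computing the products \<open>x v x\<close> for \<open>v\<close> in \<open>Q\<close> yields generators \<open>w\<close>, \<open>h\<close>, \<open>x\<close> that
  satisfy the same relations as three matrices in \<open>SL(2,5)\<close> (\<open>standard_generators\<close>). By these relations
  the words \<open>w\<^sup>i h\<^sup>k\<close> and \<open>w\<^sup>i h\<^sup>k x w\<^sup>j\<close> are closed under multiplication; formed from the pairs of
  generators in \<open>G \<times> SL(2,5)\<close>, they are the graph of an isomorphism (\<open>sl_relations_unique\<close>).
\<close>

section \<open>Group actions and conjugation\<close>

lemma multiplicity_prime_power_times:
  fixes p :: nat
  assumes "prime p" "\<not> p dvd m" shows "multiplicity p (p ^ a * m) = a"
proof (rule multiplicity_eqI)
  have "p ^ a \<noteq> 0" using assms(1) prime_gt_0_nat by auto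
  then show "\<not> p ^ Suc a dvd p ^ a * m" using assms(2) by (simp add: mult.commute)
qed simp

lemma (in group) prime_order_commute:
  assumes p: "prime (order G)" and a: "a \<in> carrier G" and b: "b \<in> carrier G"
  shows "a \<otimes> b = b \<otimes> a"
proof (cases "a = \<one>")
  case False
  have f: "finite (carrier G)" using prime_gt_0_nat[OF p] order_gt_0_iff_finite by simp
  have "ord a dvd order G" by (rule ord_dvd_group_order[OF a])
  moreover have "ord a \<noteq> 1" using ord_eq_1[OF a] False by simp
  ultimately have o: "ord a = order G" using p prime_nat_iff by blast
  have "(\<lambda>i. a [^] i) ` {0..ord a - 1} = carrier G"
  proof (rule card_subset_eq[OF f])
    show "(\<lambda>i. a [^] i) ` {0..ord a - 1} \<subseteq> carrier G" using a by auto
    show "card ((\<lambda>i. a [^] i) ` {0..ord a - 1}) = card (carrier G)"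
      using ord_inj[OF a] o prime_gt_0_nat[OF p] by (simp add: card_image order_def)
  qed
  then obtain i where "b = a [^] (i::nat)" using b by blast
  then show ?thesis using a by (simp add: nat_pow_comm[of a 1 i, simplified])
qed (use b in simp)

locale fin_group = group G for G (structure) +
  assumes fin: "finite (carrier G)"
begin

lemma finite_subgroups: "finite {K. subgroup K G}"
  by (rule finite_subset[of _ "Pow (carrier G)"]) (use fin in \<open>auto dest: subgroup.subset\<close>)

lemma sub_fin: "subgroup H G \<Longrightarrow> finite H"
  using fin finite_subset subgroup.subset by blast

lemma sub_card_pos: "subgroup H G \<Longrightarrow> card H > 0"
  using sub_fin subgroup.one_closed card_gt_0_iff by blast

lemma card_dvd:
  assumes "subgroup H G" "subgroup K G" "H \<subseteq> K"
  shows "card H dvd card K"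
proof -
  interpret K: group "G\<lparr>carrier := K\<rparr>" by (rule subgroup.subgroup_is_group[OF assms(2) is_group])
  have "subgroup H (G\<lparr>carrier := K\<rparr>)" by (rule subgroup_incl[OF assms])
  then have "card (rcosets\<^bsub>G\<lparr>carrier := K\<rparr>\<^esub> H) * card H = card K"
    using K.lagrange by (simp add: order_def)
  then show ?thesis by (metis dvd_triv_right)
qed

lemma card_dvd_order: "subgroup H G \<Longrightarrow> card H dvd card (carrier G)"
  using card_dvd subgroup.subset subgroup_self by blast

definition acts :: "'a set \<Rightarrow> 'x set \<Rightarrow> ('a \<Rightarrow> 'x \<Rightarrow> 'x) \<Rightarrow> bool" where
  "acts P X f \<longleftrightarrow> (\<forall>g\<in>P. \<forall>x\<in>X. f g x \<in> X) \<and> (\<forall>x\<in>X. f \<one> x = x) \<and>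
    (\<forall>g\<in>P. \<forall>h\<in>P. \<forall>x\<in>X. f (g \<otimes> h) x = f g (f h x))"

lemma acts_closed: "acts P X f \<Longrightarrow> g \<in> P \<Longrightarrow> x \<in> X \<Longrightarrow> f g x \<in> X"
  and acts_one: "acts P X f \<Longrightarrow> x \<in> X \<Longrightarrow> f \<one> x = x"
  and acts_mult: "acts P X f \<Longrightarrow> g \<in> P \<Longrightarrow> h \<in> P \<Longrightarrow> x \<in> X \<Longrightarrow> f (g \<otimes> h) x = f g (f h x)"
  unfolding acts_def by blast+

definition orbit :: "'a set \<Rightarrow> ('a \<Rightarrow> 'x \<Rightarrow> 'x) \<Rightarrow> 'x \<Rightarrow> 'x set" where
  "orbit P f x = (\<lambda>g. f g x) ` P"

lemma orbit_stabilizer: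
  assumes P: "subgroup P G" and a: "acts P X f" and x: "x \<in> X"
  shows "card (orbit P f x) * card {g \<in> P. f g x = x} = card P"
proof -
  have fP: "finite P" using sub_fin P .
  have fib: "card {g \<in> P. f g x = y} = card {g \<in> P. f g x = x}" if "y \<in> orbit P f x" for y
  proof -
    obtain g0 where g0: "g0 \<in> P" "y = f g0 x" using \<open>y \<in> _\<close> unfolding orbit_def by auto
    have gc: "g0 \<in> carrier G" using P g0 subgroup.mem_carrier by metis
    have "bij_betw (\<lambda>s. g0 \<otimes> s) {g \<in> P. f g x = x} {g \<in> P. f g x = y}"
    proof (rule bij_betw_byWitness[where f' = "\<lambda>s. inv g0 \<otimes> s"])
      show "\<forall>s\<in>{g \<in> P. f g x = x}. inv g0 \<otimes> (g0 \<otimes> s) = s"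
        using P gc by (auto simp: m_assoc[symmetric] subgroup.mem_carrier)
      show "\<forall>s\<in>{g \<in> P. f g x = y}. g0 \<otimes> (inv g0 \<otimes> s) = s"
        using P gc by (auto simp: m_assoc[symmetric] subgroup.mem_carrier)
      show "(\<lambda>s. g0 \<otimes> s) ` {g \<in> P. f g x = x} \<subseteq> {g \<in> P. f g x = y}"
        using P g0 a x by (auto simp: acts_def subgroup.m_closed)
      show "(\<lambda>s. inv g0 \<otimes> s) ` {g \<in> P. f g x = y} \<subseteq> {g \<in> P. f g x = x}"
      proof clarify
        fix s assume s: "s \<in> P" "y = f s x"
        have i: "inv g0 \<in> P" using P g0 by (simp add: subgroup.m_inv_closed)
        have "f (inv g0 \<otimes> s) x = f (inv g0) (f g0 x)" using a i s x g0 by (simp add: acts_def)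
        also have "\<dots> = f (inv g0 \<otimes> g0) x" using a i g0 x by (simp add: acts_def)
        also have "\<dots> = x" using a x gc by (simp add: acts_def)
        finally show "inv g0 \<otimes> s \<in> P \<and> f (inv g0 \<otimes> s) x = x" using P i s by (simp add: subgroup.m_closed)
      qed
    qed
    from bij_betw_same_card[OF this] show ?thesis by simp
  qed
  have "card P = (\<Sum>y\<in>orbit P f x. card {g \<in> P. f g x = y})"
    using sum.image_gen[OF fP, of "\<lambda>_. 1::nat" "\<lambda>g. f g x"] by (simp add: orbit_def)
  then show ?thesis using fib by simp
qed

lemma orb_closed: "acts P X f \<Longrightarrow> x \<in> X \<Longrightarrow> orbit P f x \<subseteq> X"
  by (auto simp: acts_def orbit_def)

lemma orb_refl: "subgroup P G \<Longrightarrow> acts P X f \<Longrightarrow> x \<in> X \<Longrightarrow> x \<in> orbit P f x"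
  unfolding orbit_def acts_def using subgroup.one_closed by (metis image_eqI)

lemma orb_eq:
  assumes P: "subgroup P G" and a: "acts P X f" and x: "x \<in> X" and y: "y \<in> orbit P f x"
  shows "orbit P f y = orbit P f x"
proof -
  obtain g where g: "g \<in> P" "y = f g x" using y unfolding orbit_def by auto
  have gc: "g \<in> carrier G" using P g subgroup.mem_carrier by metis
  have i: "inv g \<in> P" using P g by (simp add: subgroup.m_inv_closed)
  have "f h y \<in> orbit P f x" if "h \<in> P" for h
  proof -
    have "f h y = f (h \<otimes> g) x" using a that g x by (simp add: acts_def)
    then show ?thesis unfolding orbit_def using P that g by (auto simp: subgroup.m_closed)
  qed
  moreover have "f h x \<in> orbit P f y" if "h \<in> P" for h
  proof -
    have "f (h \<otimes> inv g) y = f (h \<otimes> inv g \<otimes> g) x" using a that g x i P by (simp add: acts_def subgroup.m_closed)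
    also have "\<dots> = f h x" using gc that P by (simp add: m_assoc subgroup.mem_carrier)
    finally show ?thesis unfolding orbit_def using P that i by (metis image_eqI subgroup.m_closed)
  qed
  ultimately show ?thesis unfolding orbit_def by blast
qed

lemma orbits_dvd:
  assumes P: "subgroup P G" and a: "acts P X f" and X: "finite X"
    and k: "\<And>x. x \<in> X \<Longrightarrow> k dvd card (orbit P f x)"
  shows "k dvd card X"
proof -
  have U: "\<Union>(orbit P f ` X) = X" using orb_closed[OF a] orb_refl[OF P a] by blast
  have "k dvd card (\<Union>(orbit P f ` X))"
  proof (rule dvd_partition)
    show "finite (\<Union>(orbit P f ` X))" using U X by simp
    show "\<forall>c\<in>orbit P f ` X. k dvd card c" using k by auto
    show "\<forall>c1\<in>orbit P f ` X. \<forall>c2\<in>orbit P f ` X. c1 \<noteq> c2 \<longrightarrow> c1 \<inter> c2 = {}"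
    proof (intro ballI impI)
      fix c1 c2 assume c: "c1 \<in> orbit P f ` X" "c2 \<in> orbit P f ` X" "c1 \<noteq> c2"
      show "c1 \<inter> c2 = {}"
      proof (rule ccontr)
        assume "c1 \<inter> c2 \<noteq> {}"
        then obtain y where "y \<in> c1" "y \<in> c2" by auto
        then have "c1 = orbit P f y" "c2 = orbit P f y" using c orb_eq[OF P a] by auto
        then show False using c by simp
      qed
    qed
  qed
  then show ?thesis using U by simp
qed

text \<open>
  The orbits of the other points have sizes that are powers of \<open>p\<close> different from 1.
\<close>

lemma fixed_points_mod:
  assumes P: "subgroup P G" and p: "prime p" and cP: "card P = p ^ a" and a: "acts P X f" and X: "finite X"
  shows "card {x \<in> X. \<forall>g\<in>P. f g x = x} mod p = card X mod p"
proof -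
  define F where "F = {x \<in> X. \<forall>g\<in>P. f g x = x}"
  have o: "orbit P f x \<subseteq> X - F" if x: "x \<in> X - F" for x
  proof
    fix y assume y: "y \<in> orbit P f x"
    then have "y \<in> X" using orb_closed[OF a] x by auto
    moreover have "y \<notin> F"
    proof
      assume "y \<in> F"
      then have "orbit P f y \<subseteq> {y}" by (auto simp: F_def orbit_def)
      then have "x = y" using orb_eq[OF P a _ y] orb_refl[OF P a, of x] x by auto
      then show False using \<open>y \<in> F\<close> x by simp
    qed
    ultimately show "y \<in> X - F" by simp
  qed
  have aY: "acts P (X - F) f"
    using a o unfolding acts_def orbit_def by blast
  have "p dvd card (X - F)"
  proof (rule orbits_dvd[OF P aY])
    fix x assume x: "x \<in> X - F"
    have d: "card (orbit P f x) dvd p ^ a"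
      using orbit_stabilizer[OF P aY x] cP by (metis dvd_triv_left)
    have "card (orbit P f x) \<noteq> 1"
    proof
      assume "card (orbit P f x) = 1"
      then obtain z where z: "orbit P f x = {z}" by (auto simp: card_Suc_eq)
      then have "orbit P f x = {x}" using orb_refl[OF P a, of x] x by auto
      then have "\<forall>g\<in>P. f g x = x" unfolding orbit_def by blast
      then show False using x by (simp add: F_def)
    qed
    then show "p dvd card (orbit P f x)" using d p
      by (metis divides_primepow_nat dvd_power not_gr_zero power_0)
  qed (use X in simp)
  moreover have fs: "F \<subseteq> X" by (auto simp: F_def)
  have "card X = card F + card (X - F)"
    using card_Diff_subset[OF finite_subset[OF fs X] fs] card_mono[OF X fs] by simp
  ultimately show ?thesis unfolding F_def[symmetric] by (auto simp: dvd_def)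
qed

definition conjugate :: "'a \<Rightarrow> 'a set \<Rightarrow> 'a set" where
  "conjugate g A = (\<lambda>x. g \<otimes> x \<otimes> inv g) ` A"

definition normalizer :: "'a set \<Rightarrow> 'a set" where
  "normalizer A = {g \<in> carrier G. conjugate g A = A}"

definition conj_class :: "'a set \<Rightarrow> 'a set set" where
  "conj_class A = (\<lambda>g. conjugate g A) ` carrier G"

lemma cj_one: "A \<subseteq> carrier G \<Longrightarrow> conjugate \<one> A = A"
  unfolding conjugate_def by (force simp: image_def)

lemma cj_mult:
  assumes "g \<in> carrier G" "h \<in> carrier G" "A \<subseteq> carrier G"
  shows "conjugate (g \<otimes> h) A = conjugate g (conjugate h A)"
  unfolding conjugate_def image_image using assms
  by (intro image_cong) (auto simp: m_assoc inv_mult_group subset_iff)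

lemma cj_closed: "g \<in> carrier G \<Longrightarrow> A \<subseteq> carrier G \<Longrightarrow> conjugate g A \<subseteq> carrier G"
  unfolding conjugate_def by auto

lemma cj_mono: "A \<subseteq> B \<Longrightarrow> conjugate g A \<subseteq> conjugate g B"
  unfolding conjugate_def by auto

lemma cj_inv: "g \<in> carrier G \<Longrightarrow> A \<subseteq> carrier G \<Longrightarrow> conjugate (inv g) (conjugate g A) = A"
  using cj_mult[of "inv g" g A] cj_one by simp

lemma cj_inv': "g \<in> carrier G \<Longrightarrow> A \<subseteq> carrier G \<Longrightarrow> conjugate g (conjugate (inv g) A) = A"
  using cj_mult[of g "inv g" A] cj_one by simp

lemma cj_eq_iff:
  assumes "g \<in> carrier G" "h \<in> carrier G" "A \<subseteq> carrier G"
  shows "conjugate g A = conjugate h A \<longleftrightarrow> conjugate (inv h \<otimes> g) A = A"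
  using assms cj_mult[of "inv h" g A] cj_inv[of h] cj_inv'[of h "conjugate g A"] by (metis cj_closed inv_closed)

lemma cj_inj: "g \<in> carrier G \<Longrightarrow> inj_on (\<lambda>x. g \<otimes> x \<otimes> inv g) (carrier G)"
  by (rule inj_onI) (simp add: m_assoc)

lemma card_cj: "g \<in> carrier G \<Longrightarrow> A \<subseteq> carrier G \<Longrightarrow> card (conjugate g A) = card A"
  unfolding conjugate_def by (rule card_image) (use inj_on_subset[OF cj_inj] in blast)

lemma subgroup_cj:
  assumes g: "g \<in> carrier G" and H: "subgroup H G" shows "subgroup (conjugate g H) G"
proof (rule subgroupI)
  show "conjugate g H \<subseteq> carrier G" by (rule cj_closed[OF g subgroup.subset[OF H]])
  show "conjugate g H \<noteq> {}" using subgroup.one_closed[OF H] by (auto simp: conjugate_def)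
  fix a assume "a \<in> conjugate g H"
  then obtain x where x: "x \<in> H" "a = g \<otimes> x \<otimes> inv g" by (auto simp: conjugate_def)
  have xc: "x \<in> carrier G" using x H subgroup.mem_carrier by metis
  have "inv a = g \<otimes> inv x \<otimes> inv g" using x g xc by (simp add: inv_mult_group m_assoc)
  then show "inv a \<in> conjugate g H" using x H by (auto simp: conjugate_def subgroup.m_inv_closed)
  fix b assume "b \<in> conjugate g H"
  then obtain y where y: "y \<in> H" "b = g \<otimes> y \<otimes> inv g" by (auto simp: conjugate_def)
  have yc: "y \<in> carrier G" using y H subgroup.mem_carrier by metis
  have "inv g \<otimes> (g \<otimes> (y \<otimes> inv g)) = y \<otimes> inv g" using g yc by (simp add: m_assoc[symmetric])
  then have "a \<otimes> b = g \<otimes> (x \<otimes> y) \<otimes> inv g" using x y g xc yc by (simp add: m_assoc)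
  then show "a \<otimes> b \<in> conjugate g H" using x y H by (auto simp: conjugate_def subgroup.m_closed)
qed

lemma cj_self:
  assumes H: "subgroup H G" and g: "g \<in> H" shows "conjugate g H = H"
proof (rule card_seteq[OF sub_fin[OF H]])
  show "conjugate g H \<subseteq> H" using H g by (auto simp: conjugate_def subgroup.m_closed subgroup.m_inv_closed)
  show "card H \<le> card (conjugate g H)" using card_cj H g by (metis order_refl subgroup.mem_carrier subgroup.subset)
qed

lemma mem_cj: "g \<in> carrier G \<Longrightarrow> A \<subseteq> carrier G \<Longrightarrow> x \<in> carrier G \<Longrightarrow>
    x \<in> conjugate g A \<longleftrightarrow> inv g \<otimes> x \<otimes> g \<in> A"
  unfolding conjugate_def by (auto simp: m_assoc image_iff subset_iff intro!: bexI[of _ "inv g \<otimes> (x \<otimes> g)"])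
    (simp_all add: m_assoc[symmetric])

lemma nrm_subgroup:
  assumes A: "A \<subseteq> carrier G" shows "subgroup (normalizer A) G"
proof (rule subgroupI)
  show "normalizer A \<subseteq> carrier G" by (auto simp: normalizer_def)
  show "normalizer A \<noteq> {}" using cj_one[OF A] by (auto simp: normalizer_def)
  show "\<And>a. a \<in> normalizer A \<Longrightarrow> inv a \<in> normalizer A" using cj_inv[OF _ A] by (force simp: normalizer_def)
  show "\<And>a b. a \<in> normalizer A \<Longrightarrow> b \<in> normalizer A \<Longrightarrow> a \<otimes> b \<in> normalizer A" using cj_mult[OF _ _ A] by (auto simp: normalizer_def)
qed

lemma int_nrm_subgroup: "subgroup M G \<Longrightarrow> A \<subseteq> carrier G \<Longrightarrow> subgroup (M \<inter> normalizer A) G"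
  by (rule subgroups_Inter_pair) (simp_all add: nrm_subgroup)

lemma sub_nrm: "subgroup H G \<Longrightarrow> H \<subseteq> normalizer H"
  using cj_self by (auto simp: normalizer_def subgroup.mem_carrier)

lemma nrm_closed: "normalizer A \<subseteq> carrier G"
  by (auto simp: normalizer_def)

lemma acts_cj: "subgroup M G \<Longrightarrow> (\<And>g A. g \<in> M \<Longrightarrow> A \<in> X \<Longrightarrow> conjugate g A \<in> X) \<Longrightarrow> (\<And>A. A \<in> X \<Longrightarrow> A \<subseteq> carrier G)
    \<Longrightarrow> acts M X conjugate"
  unfolding acts_def by (auto simp: cj_one cj_mult subgroup.mem_carrier)

lemma card_conjs_in:
  assumes M: "subgroup M G" and A: "A \<subseteq> carrier G"
  shows "card ((\<lambda>g. conjugate g A) ` M) * card (M \<inter> normalizer A) = card M"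
proof -
  have a: "acts M (Pow (carrier G)) conjugate"
    using M by (intro acts_cj) (auto dest: cj_closed subgroup.mem_carrier)
  have e: "{g \<in> M. conjugate g A = A} = M \<inter> normalizer A" using M by (auto simp: normalizer_def subgroup.mem_carrier)
  show ?thesis using orbit_stabilizer[OF M a, of A] A by (simp add: orbit_def e)
qed

lemma card_conjs: "A \<subseteq> carrier G \<Longrightarrow> card (conj_class A) * card (normalizer A) = card (carrier G)"
  using card_conjs_in[OF subgroup_self, of A] nrm_closed by (simp add: conj_class_def Int_absorb1)

lemma conjs_subgroup: "subgroup H G \<Longrightarrow> K \<in> conj_class H \<Longrightarrow> subgroup K G \<and> card K = card H"
  by (auto simp: conj_class_def subgroup_cj card_cj subgroup.subset)

lemma nrm_cj:
  assumes g: "g \<in> carrier G" and A: "A \<subseteq> carrier G"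
  shows "normalizer (conjugate g A) = conjugate g (normalizer A)"
proof (rule Set.set_eqI)
  fix x
  show "x \<in> normalizer (conjugate g A) \<longleftrightarrow> x \<in> conjugate g (normalizer A)"
  proof (cases "x \<in> carrier G")
    case True
    have "conjugate x (conjugate g A) = conjugate (x \<otimes> g) A" using True g A by (simp add: cj_mult)
    then have "x \<in> normalizer (conjugate g A) \<longleftrightarrow> conjugate (inv g \<otimes> (x \<otimes> g)) A = A"
      using True g A cj_eq_iff[of "x \<otimes> g" g A] by (simp add: normalizer_def)
    then show ?thesis using True g A mem_cj[OF g nrm_closed True] by (simp add: normalizer_def m_assoc)
  next
    case False
    then show ?thesis using g cj_closed[OF g nrm_closed] by (auto simp: normalizer_def)
  qed
qed

section \<open>Sylow subgroups of a subgroup\<close>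

text \<open>
  Sylow subgroups of a subgroup \<open>M\<close>, kept as subsets of the ambient group: Sylow subgroups of different
  subgroups can be compared, and conjugated by elements outside \<open>M\<close>, without changing the carrier.
\<close>

definition sylows :: "nat \<Rightarrow> 'a set \<Rightarrow> 'a set set" where
  "sylows p M = {P. subgroup P G \<and> P \<subseteq> M \<and> card P = p ^ multiplicity p (card M)}"

lemma prime_power_subgroup_ex:
  assumes M: "subgroup M G" and p: "prime p" and d: "p ^ a dvd card M"
  shows "\<exists>P. subgroup P G \<and> P \<subseteq> M \<and> card P = p ^ a"
proof -
  interpret K: group "G\<lparr>carrier := M\<rparr>" by (rule subgroup.subgroup_is_group[OF M is_group])
  obtain k where "card M = p ^ a * k" using d by (auto simp: dvd_def)
  then obtain P where P: "subgroup P (G\<lparr>carrier := M\<rparr>)" "card P = p ^ a"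
    using sylow_thm[OF p K.is_group, of a k] sub_fin[OF M] by (auto simp: order_def)
  then show ?thesis using incl_subgroup[OF M] subgroup.subset by fastforce
qed

lemma syl_ex: "subgroup M G \<Longrightarrow> prime p \<Longrightarrow> \<exists>P. P \<in> sylows p M"
  using prime_power_subgroup_ex[of M p "multiplicity p (card M)"] multiplicity_dvd by (auto simp: sylows_def)

definition left_cosets :: "'a set \<Rightarrow> 'a set \<Rightarrow> 'a set set" where
  "left_cosets M R = (\<lambda>g. (\<lambda>x. g \<otimes> x) ` R) ` M"

lemma acts_lcos:
  assumes M: "subgroup M G" and P: "subgroup P G" "P \<subseteq> M" and R: "R \<subseteq> carrier G"
  shows "acts P (left_cosets M R) (\<lambda>g. (`) (\<lambda>x. g \<otimes> x))"
proof -
  have e: "(\<lambda>x. g \<otimes> x) ` (\<lambda>x. h \<otimes> x) ` R = (\<lambda>x. (g \<otimes> h) \<otimes> x) ` R" if "g \<in> carrier G" "h \<in> carrier G" for g h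
    unfolding image_image using that R by (intro image_cong) (auto simp: m_assoc)
  have c: "g \<in> M \<Longrightarrow> g \<in> carrier G" for g using M by (simp add: subgroup.mem_carrier)
  show ?thesis unfolding acts_def
  proof (intro conjI ballI)
    fix g A assume g: "g \<in> P" and "A \<in> left_cosets M R"
    then obtain h where h: "h \<in> M" "A = (\<lambda>x. h \<otimes> x) ` R" by (auto simp: left_cosets_def)
    have "(\<lambda>x. g \<otimes> x) ` A = (\<lambda>x. (g \<otimes> h) \<otimes> x) ` R" using e c g h P(2) by blast
    moreover have "g \<otimes> h \<in> M" using subgroup.m_closed[OF M] g h P(2) by blast
    ultimately show "(\<lambda>x. g \<otimes> x) ` A \<in> left_cosets M R" unfolding left_cosets_def by blast
  next
    fix A assume "A \<in> left_cosets M R"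
    then obtain h where h: "h \<in> M" "A = (\<lambda>x. h \<otimes> x) ` R" by (auto simp: left_cosets_def)
    show "(\<lambda>x. \<one> \<otimes> x) ` A = A" using e[of \<one> h] c h by simp
  next
    fix g g' A assume g: "g \<in> P" "g' \<in> P" and "A \<in> left_cosets M R"
    then obtain h where h: "h \<in> M" "A = (\<lambda>x. h \<otimes> x) ` R" by (auto simp: left_cosets_def)
    then have "A \<subseteq> carrier G" using c R by auto
    then show "(\<lambda>x. g \<otimes> g' \<otimes> x) ` A = (\<lambda>x. g \<otimes> x) ` (\<lambda>x. g' \<otimes> x) ` A"
      unfolding image_image using g P(2) c by (intro image_cong) (auto simp: m_assoc subset_iff)
  qed
qed

lemma lcos_fixed:
  assumes R: "subgroup R G" and g: "g \<in> carrier G" and m: "m \<in> carrier G"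
    and e: "(\<lambda>x. g \<otimes> x) ` (\<lambda>x. m \<otimes> x) ` R = (\<lambda>x. m \<otimes> x) ` R"
  shows "g \<in> conjugate m R"
proof -
  have "g \<otimes> (m \<otimes> \<one>) \<in> (\<lambda>x. m \<otimes> x) ` R" using e subgroup.one_closed[OF R] by blast
  then obtain r where r: "r \<in> R" "g \<otimes> m = m \<otimes> r" using m by auto
  have "g = m \<otimes> r \<otimes> inv m" using r g m R by (metis inv_solve_right m_closed subgroup.mem_carrier)
  then show ?thesis using r by (auto simp: conjugate_def)
qed

lemma card_lcos:
  assumes M: "subgroup M G" and R: "subgroup R G" "R \<subseteq> M"
  shows "card (left_cosets M R) * card R = card M"
proof -
  have a: "acts M (left_cosets M R) (\<lambda>g. (`) (\<lambda>x. g \<otimes> x))" using acts_lcos[OF M M] R subgroup.subset by blast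
  have mem: "R \<in> left_cosets M R"
    unfolding left_cosets_def using subgroup.one_closed[OF M] subgroup.subset[OF R(1)]
    by (intro image_eqI[of _ _ \<one>]) (force simp: image_def)+
  have "{g \<in> M. (\<lambda>x. g \<otimes> x) ` R = R} = R"
  proof
    show "{g \<in> M. (\<lambda>x. g \<otimes> x) ` R = R} \<subseteq> R"
    proof clarify
      fix g assume g: "g \<in> M" "(\<lambda>x. g \<otimes> x) ` R = R"
      have "g \<otimes> \<one> \<in> R" using g(2) subgroup.one_closed[OF R(1)] by blast
      then show "g \<in> R" using g M by (simp add: subgroup.mem_carrier)
    qed
    show "R \<subseteq> {g \<in> M. (\<lambda>x. g \<otimes> x) ` R = R}"
    proof clarify
      fix g assume g: "g \<in> R"
      have gc: "g \<in> carrier G" using g R subgroup.mem_carrier by metis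
      have "(\<lambda>x. g \<otimes> x) ` R = R"
      proof (rule card_seteq[OF sub_fin[OF R(1)]])
        show "(\<lambda>x. g \<otimes> x) ` R \<subseteq> R" using g R by (auto simp: subgroup.m_closed)
        have "inj_on (\<lambda>x. g \<otimes> x) R" using gc R by (auto simp: inj_on_def subgroup.mem_carrier)
        then show "card R \<le> card ((\<lambda>x. g \<otimes> x) ` R)" by (simp add: card_image)
      qed
      then show "g \<in> M \<and> (\<lambda>x. g \<otimes> x) ` R = R" using g R by auto
    qed
  qed
  moreover have "orbit M (\<lambda>g. (`) (\<lambda>x. g \<otimes> x)) R = left_cosets M R" by (simp add: orbit_def left_cosets_def)
  ultimately show ?thesis using orbit_stabilizer[OF M a mem] by simp
qed

text \<open>
  \<open>P\<close> acts by left multiplication on the cosets of \<open>R\<close> in \<open>M\<close>. Their number is prime to \<open>p\<close>, so some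
  coset \<open>g R\<close> is fixed, which means that \<open>P\<close> lies in the conjugate of \<open>R\<close> by \<open>g\<close>.
\<close>

lemma syl_subset_conj:
  assumes M: "subgroup M G" and p: "prime p" and R: "R \<in> sylows p M"
    and P: "subgroup P G" "P \<subseteq> M" "card P = p ^ b"
  shows "\<exists>g\<in>M. P \<subseteq> conjugate g R"
proof -
  have R': "subgroup R G" "R \<subseteq> M" "card R = p ^ multiplicity p (card M)" using R by (auto simp: sylows_def)
  have a: "acts P (left_cosets M R) (\<lambda>g. (`) (\<lambda>x. g \<otimes> x))" using acts_lcos[OF M P(1,2)] R' subgroup.subset by blast
  have f: "finite (left_cosets M R)" using sub_fin[OF M] by (simp add: left_cosets_def)
  have np: "\<not> p dvd card (left_cosets M R)"
  proof
    assume "p dvd card (left_cosets M R)"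
    then have "p * p ^ multiplicity p (card M) dvd card M"
      using card_lcos[OF M R'(1,2)] R'(3) by (metis mult_dvd_mono dvd_refl)
    then have "p ^ Suc (multiplicity p (card M)) dvd card M" by simp
    moreover have "card M \<noteq> 0" using sub_card_pos[OF M] by simp
    moreover have "\<not> is_unit p" using p not_prime_unit by blast
    ultimately show False using power_dvd_iff_le_multiplicity[of "card M" p "Suc (multiplicity p (card M))"] by simp
  qed
  have "card {x \<in> left_cosets M R. \<forall>g\<in>P. (\<lambda>y. g \<otimes> y) ` x = x} mod p \<noteq> 0"
    using fixed_points_mod[OF P(1) p P(3) a f] np by (simp add: dvd_eq_mod_eq_0)
  then have "{x \<in> left_cosets M R. \<forall>g\<in>P. (\<lambda>y. g \<otimes> y) ` x = x} \<noteq> {}" by (metis card.empty mod_0)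
  then obtain m where m: "m \<in> M" "\<forall>g\<in>P. (\<lambda>y. g \<otimes> y) ` (\<lambda>x. m \<otimes> x) ` R = (\<lambda>x. m \<otimes> x) ` R"
    by (auto simp: left_cosets_def)
  have "P \<subseteq> conjugate m R"
    using lcos_fixed[OF R'(1)] m P(1) M by (auto simp: subgroup.mem_carrier)
  then show ?thesis using m by blast
qed

lemma syl_conj:
  assumes M: "subgroup M G" and p: "prime p" and R: "R \<in> sylows p M" and P: "P \<in> sylows p M"
  shows "\<exists>g\<in>M. P = conjugate g R"
proof -
  obtain g where g: "g \<in> M" "P \<subseteq> conjugate g R" using syl_subset_conj[OF M p R, of P "multiplicity p (card M)"] P by (auto simp: sylows_def)
  have gc: "g \<in> carrier G" using g M subgroup.mem_carrier by metis
  have R': "subgroup R G" using R by (simp add: sylows_def)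
  have "P = conjugate g R"
    by (rule card_subset_eq[OF sub_fin[OF subgroup_cj[OF gc R']] g(2)])
       (use R P gc in \<open>simp add: sylows_def card_cj subgroup.subset\<close>)
  then show ?thesis using g by blast
qed

lemma syl_cj:
  assumes M: "subgroup M G" and g: "g \<in> M" and R: "R \<in> sylows p M" shows "conjugate g R \<in> sylows p M"
proof -
  have gc: "g \<in> carrier G" using g M subgroup.mem_carrier by metis
  have "conjugate g R \<subseteq> M" using cj_mono[of R M g] cj_self[OF M g] R by (auto simp: sylows_def)
  then show ?thesis using R gc by (auto simp: sylows_def subgroup_cj card_cj subgroup.subset)
qed

lemma acts_syl:
  assumes M: "subgroup M G" and P: "subgroup P G" "P \<subseteq> M"
  shows "acts P (sylows p M) conjugate"
proof (rule acts_cj[OF P(1)])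
  show "\<And>g A. g \<in> P \<Longrightarrow> A \<in> sylows p M \<Longrightarrow> conjugate g A \<in> sylows p M" using syl_cj[OF M] P(2) by blast
  show "\<And>A. A \<in> sylows p M \<Longrightarrow> A \<subseteq> carrier G" by (auto simp: sylows_def dest: subgroup.subset)
qed

lemma syl_mid:
  assumes "subgroup M G" "subgroup K G" "K \<subseteq> M" "P \<subseteq> K" "prime p" "P \<in> sylows p M"
  shows "P \<in> sylows p K"
proof -
  have nz: "card K \<noteq> 0" "card M \<noteq> 0" using assms(1,2) sub_card_pos by fastforce+
  have P: "subgroup P G" "card P = p ^ multiplicity p (card M)" using assms(6) by (auto simp: sylows_def)
  have nu: "\<not> is_unit p" using assms(5) not_prime_unit by blast
  have "multiplicity p (card K) \<le> multiplicity p (card M)"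
    using card_dvd[OF assms(2,1,3)] nz dvd_imp_multiplicity_le by blast
  moreover have "p ^ multiplicity p (card M) dvd card K" using card_dvd[OF P(1) assms(2,4)] P(2) by simp
  then have "multiplicity p (card M) \<le> multiplicity p (card K)"
    using nz nu by (simp add: power_dvd_iff_le_multiplicity)
  ultimately show ?thesis using P assms(4) by (simp add: sylows_def)
qed

text \<open>
  Both are Sylow subgroups of the normalizer of \<open>R\<close> in \<open>M\<close>, where \<open>R\<close> has no other conjugates.
\<close>

lemma syl_normalized_eq:
  assumes M: "subgroup M G" and p: "prime p" and R: "R \<in> sylows p M" and P: "P \<in> sylows p M" and n: "P \<subseteq> normalizer R"
  shows "P = R"
proof -
  have R': "subgroup R G" "R \<subseteq> M" using R by (auto simp: sylows_def)
  have K: "subgroup (M \<inter> normalizer R) G" by (rule int_nrm_subgroup[OF M subgroup.subset[OF R'(1)]])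
  have "P \<in> sylows p (M \<inter> normalizer R)" "R \<in> sylows p (M \<inter> normalizer R)"
    using syl_mid[OF M K _ _ p P] syl_mid[OF M K _ _ p R] P n R' sub_nrm[OF R'(1)] by (auto simp: sylows_def)
  from syl_conj[OF K p this(2,1)] show ?thesis by (auto simp: normalizer_def)
qed

lemma syl_finite: "finite (sylows p M)"
  by (rule finite_subset[of _ "Pow (carrier G)"]) (use fin in \<open>auto simp: sylows_def dest: subgroup.subset\<close>)

text \<open>
  A Sylow subgroup acting by conjugation fixes no Sylow subgroup besides itself.
\<close>

lemma card_syl_mod:
  assumes M: "subgroup M G" and p: "prime p" shows "card (sylows p M) mod p = 1"
proof -
  obtain R where R: "R \<in> sylows p M" using syl_ex[OF M p] by blast
  have R': "subgroup R G" "R \<subseteq> M" "card R = p ^ multiplicity p (card M)" using R by (auto simp: sylows_def)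
  have a: "acts R (sylows p M) conjugate" by (rule acts_syl[OF M R'(1,2)])
  have "{x \<in> sylows p M. \<forall>g\<in>R. conjugate g x = x} = {R}"
  proof
    show "{x \<in> sylows p M. \<forall>g\<in>R. conjugate g x = x} \<subseteq> {R}"
    proof clarify
      fix x assume x: "x \<in> sylows p M" "\<forall>g\<in>R. conjugate g x = x"
      then have "R \<subseteq> normalizer x" using R' by (auto simp: normalizer_def subgroup.mem_carrier)
      then show "x = R" using syl_normalized_eq[OF M p x(1) R] by simp
    qed
    show "{R} \<subseteq> {x \<in> sylows p M. \<forall>g\<in>R. conjugate g x = x}" using R cj_self[OF R'(1)] by auto
  qed
  then show ?thesis using fixed_points_mod[OF R'(1) p R'(3) a syl_finite] prime_gt_1_nat[OF p] by simp
qed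

lemma syl_orbit:
  assumes M: "subgroup M G" and p: "prime p" and R: "R \<in> sylows p M"
  shows "sylows p M = (\<lambda>g. conjugate g R) ` M"
  using syl_conj[OF M p R] syl_cj[OF M _ R] by auto

lemma card_syl:
  assumes M: "subgroup M G" and p: "prime p" and R: "R \<in> sylows p M"
  shows "card (sylows p M) * card (M \<inter> normalizer R) = card M"
proof -
  have R': "R \<subseteq> carrier G" using R by (auto simp: sylows_def dest: subgroup.subset)
  show ?thesis unfolding syl_orbit[OF M p R] by (rule card_conjs_in[OF M R'])
qed

lemma card_syl_dvd:
  assumes M: "subgroup M G" and p: "prime p" and c: "card M = p ^ a * m" and np: "\<not> p dvd m"
  shows "card (sylows p M) dvd m"
proof -
  obtain R where R: "R \<in> sylows p M" using syl_ex[OF M p] by blast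
  have R': "subgroup R G" "R \<subseteq> M" "card R = p ^ multiplicity p (card M)" using R by (auto simp: sylows_def)
  have "multiplicity p (p ^ a * m) = a"
    by (rule multiplicity_prime_power_times[OF p np])
  then have cR: "card R = p ^ a" using R' c by simp
  have "card R dvd card (M \<inter> normalizer R)"
    using card_dvd[OF R'(1) int_nrm_subgroup[OF M subgroup.subset[OF R'(1)]]] R' sub_nrm[OF R'(1)] by blast
  then obtain k where k: "card (M \<inter> normalizer R) = p ^ a * k" using cR by (auto simp: dvd_def)
  have "card (sylows p M) * (p ^ a * k) = p ^ a * m" using card_syl[OF M p R] k c by simp
  then have "card (sylows p M) * k = m" using prime_gt_0_nat[OF p] by (simp add: mult.left_commute)
  then show ?thesis by (metis dvd_triv_left)
qed

lemma syl_prime_powerI: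
  assumes "prime p" "card M = p ^ a * m" "\<not> p dvd m"
  shows "sylows p M = {P. subgroup P G \<and> P \<subseteq> M \<and> card P = p ^ a}"
proof -
  have "multiplicity p (p ^ a * m) = a"
    by (rule multiplicity_prime_power_times[OF assms(1,3)])
  then show ?thesis using assms by (simp add: sylows_def)
qed

text \<open>
  The cosets of \<open>D\<close> in \<open>P\<close> that are fixed by left multiplication with \<open>D\<close> are a multiple of \<open>p\<close>, and \<open>D\<close>
  is one of them. Another one is \<open>m D\<close> for some \<open>m\<close> that normalizes \<open>D\<close>.
\<close>

lemma normalizer_grows:
  assumes P: "subgroup P G" "card P = p ^ a" and p: "prime p" and D: "subgroup D G" "D \<subset> P"
  shows "\<exists>m\<in>P. m \<notin> D \<and> m \<in> normalizer D"
proof -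
  have "card D dvd p ^ a" using card_dvd[OF D(1) P(1)] D P(2) by auto
  then obtain b where b: "card D = p ^ b" using p divides_primepow_nat by blast
  have a: "acts D (left_cosets P D) (\<lambda>g. (`) (\<lambda>x. g \<otimes> x))"
    using acts_lcos[OF P(1) D(1)] D subgroup.subset[OF D(1)] by auto
  have f: "finite (left_cosets P D)" using sub_fin[OF P(1)] by (simp add: left_cosets_def)
  have cl: "card (left_cosets P D) * card D = p ^ a" using card_lcos[OF P(1) D(1)] D P(2) by auto
  have "card (left_cosets P D) \<noteq> 1"
  proof
    assume "card (left_cosets P D) = 1"
    then have "card D = card P" using cl P by simp
    then show False using D card_subset_eq[OF sub_fin[OF P(1)], of D] by auto
  qed
  then have pd: "p dvd card (left_cosets P D)" using cl p
    by (metis divides_primepow_nat dvd_power dvd_triv_left not_gr_zero power_0)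
  define F where "F = {x \<in> left_cosets P D. \<forall>g\<in>D. (\<lambda>y. g \<otimes> y) ` x = x}"
  have pF: "p dvd card F"
    using fixed_points_mod[OF D(1) p b a f] pd unfolding F_def by (simp add: dvd_eq_mod_eq_0)
  have DF: "D \<in> F"
  proof -
    have "D = (\<lambda>x. \<one> \<otimes> x) ` D" using subgroup.subset[OF D(1)] by (force simp: image_def)
    then have 1: "D \<in> left_cosets P D" unfolding left_cosets_def using subgroup.one_closed[OF P(1)] by blast
    have "(\<lambda>y. g \<otimes> y) ` D = D" if "g \<in> D" for g
    proof (rule card_seteq[OF sub_fin[OF D(1)]])
      show "(\<lambda>x. g \<otimes> x) ` D \<subseteq> D" using that D by (auto simp: subgroup.m_closed)
      have "inj_on (\<lambda>x. g \<otimes> x) D" using that D by (auto simp: inj_on_def subgroup.mem_carrier)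
      then show "card D \<le> card ((\<lambda>x. g \<otimes> x) ` D)" by (simp add: card_image)
    qed
    then show ?thesis using 1 by (simp add: F_def)
  qed
  have "F \<noteq> {D}" using pF prime_gt_1_nat[OF p] by auto
  then obtain C where C: "C \<in> F" "C \<noteq> D" using DF by blast
  then obtain m where m: "m \<in> P" "C = (\<lambda>x. m \<otimes> x) ` D" by (auto simp: F_def left_cosets_def)
  have mc: "m \<in> carrier G" using m P subgroup.mem_carrier by metis
  have "D \<subseteq> conjugate m D"
    using lcos_fixed[OF D(1) _ mc] C m D(1) by (auto simp: F_def subgroup.mem_carrier)
  then have "conjugate m D = D"
    using card_subset_eq[OF sub_fin[OF subgroup_cj[OF mc D(1)]]] card_cj[OF mc subgroup.subset[OF D(1)]] by metis
  then have "m \<in> normalizer D" using mc by (simp add: normalizer_def)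
  moreover have "m \<notin> D"
  proof
    assume "m \<in> D"
    then have "C \<subseteq> D" using m D(1) by (auto simp: subgroup.m_closed)
    moreover have "inj_on (\<lambda>x. m \<otimes> x) D" using mc D by (auto simp: inj_on_def subgroup.mem_carrier)
    then have "card C = card D" using m by (simp add: card_image)
    ultimately show False using C card_subset_eq[OF sub_fin[OF D(1)]] by auto
  qed
  ultimately show ?thesis using m by blast
qed

lemma prime_index_normal:
  assumes P: "subgroup P G" "card P = p ^ a" and p: "prime p" and D: "subgroup D G" "D \<subseteq> P" "card P = p * card D"
  shows "P \<subseteq> normalizer D"
proof -
  have "card D < card P" using D(3) sub_card_pos[OF D(1)] prime_gt_1_nat[OF p] by simp
  then have "D \<subset> P" using D by auto
  then obtain m where m: "m \<in> P" "m \<notin> D" "m \<in> normalizer D" using normalizer_grows[OF P p D(1)] by blast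
  have K: "subgroup (P \<inter> normalizer D) G"
    by (rule int_nrm_subgroup[OF P(1) subgroup.subset[OF D(1)]])
  have DK: "D \<subset> P \<inter> normalizer D" using m D sub_nrm[OF D(1)] by auto
  obtain k where k: "card (P \<inter> normalizer D) = card D * k"
    using card_dvd[OF D(1) K] DK by (auto simp: dvd_def)
  have "card (P \<inter> normalizer D) dvd card P" by (rule card_dvd[OF K P(1)]) simp
  then have "k dvd p" using k D(3) sub_card_pos[OF D(1)] by (simp add: mult.commute)
  moreover have "k \<noteq> 1" using k psubset_card_mono[OF sub_fin[OF K] DK] by auto
  ultimately have "k = p" using p prime_nat_iff by blast
  then have "card (P \<inter> normalizer D) = card P" using k D(3) by simp
  then have "P \<inter> normalizer D = P" using card_subset_eq[OF sub_fin[OF P(1)], of "P \<inter> normalizer D"] by auto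
  then show ?thesis by auto
qed

text \<open>
  The conjugate of \<open>P\<close> by \<open>g\<close> is again a Sylow subgroup of \<open>H\<close>, so it is also the conjugate of \<open>P\<close> by some
  element of \<open>H\<close>.
\<close>

lemma frattini:
  assumes H: "subgroup H G" "normalizer H = carrier G" and p: "prime p" and P: "P \<in> sylows p H" and g: "g \<in> carrier G"
  shows "\<exists>h\<in>H. inv h \<otimes> g \<in> normalizer P"
proof -
  have P': "subgroup P G" "P \<subseteq> H" using P by (auto simp: sylows_def)
  have "conjugate g H = H" using H g by (auto simp: normalizer_def)
  then have "conjugate g P \<in> sylows p H" using P g cj_mono[of P H g]
    by (auto simp: sylows_def subgroup_cj card_cj subgroup.subset)
  then obtain h where h: "h \<in> H" "conjugate g P = conjugate h P" using syl_conj[OF H(1) p P] by blast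
  then have "inv h \<otimes> g \<in> normalizer P"
    using g H(1) P'(1) cj_eq_iff[of g h P] by (simp add: normalizer_def subgroup.mem_carrier subgroup.subset)
  then show ?thesis using h by blast
qed

text \<open>
  This counts the elements of prime order, and those of Sylow subgroups that meet trivially.
\<close>

lemma card_partition_union:
  assumes F: "finite F" "\<And>A. A \<in> F \<Longrightarrow> subgroup A G \<and> card A = q"
    and d: "\<And>A B. A \<in> F \<Longrightarrow> B \<in> F \<Longrightarrow> A \<noteq> B \<Longrightarrow> A \<inter> B = {\<one>}"
  shows "card (\<Union>A\<in>F. A - {\<one>}) = card F * (q - 1)"
proof -
  have "card (\<Union>A\<in>F. A - {\<one>}) = (\<Sum>A\<in>F. card (A - {\<one>}))"
    by (rule card_UN_disjoint) (use F d sub_fin in \<open>auto\<close>)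
  also have "\<dots> = (\<Sum>A\<in>F. q - 1)"
  proof (rule sum.cong[OF refl])
    fix A assume "A \<in> F"
    then have "\<one> \<in> A" "card A = q" using F(2) subgroup.one_closed by blast+
    then show "card (A - {\<one>}) = q - 1" by (simp add: card_Diff_singleton)
  qed
  finally show ?thesis by simp
qed

lemma prime_card_commute:
  assumes "subgroup Q G" "prime (card Q)" "a \<in> Q" "b \<in> Q"
  shows "a \<otimes> b = b \<otimes> a"
  using group.prime_order_commute[OF subgroup.subgroup_is_group[OF assms(1) is_group]] assms
  by (simp add: order_def)

lemma coprime_int_trivial:
  assumes "subgroup A G" "subgroup B G" "coprime (card A) (card B)"
  shows "A \<inter> B = {\<one>}"
proof -
  have K: "subgroup (A \<inter> B) G" using assms subgroups_Inter_pair by blast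
  have "card (A \<inter> B) dvd card A" "card (A \<inter> B) dvd card B" using card_dvd[OF K] assms by auto
  then have "card (A \<inter> B) = 1" using assms(3) by (metis coprime_common_divisor_nat nat_dvd_1_iff_1)
  then obtain x where "A \<inter> B = {x}" by (auto simp: card_Suc_eq)
  then show ?thesis using subgroup.one_closed[OF K] by auto
qed

lemma prime_int_trivial:
  assumes "subgroup A G" "subgroup B G" "prime (card A)" "\<not> A \<subseteq> B"
  shows "A \<inter> B = {\<one>}"
proof -
  have K: "subgroup (A \<inter> B) G" using assms subgroups_Inter_pair by blast
  have "card (A \<inter> B) dvd card A" using card_dvd[OF K] assms by auto
  moreover have "card (A \<inter> B) \<noteq> card A" using card_subset_eq[OF sub_fin[OF assms(1)], of "A \<inter> B"] assms by auto
  ultimately have "card (A \<inter> B) = 1" using assms(3) prime_nat_iff by metis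
  then obtain x where "A \<inter> B = {x}" by (auto simp: card_Suc_eq)
  then show ?thesis using subgroup.one_closed[OF K] by auto
qed

text \<open>
  \<open>Q\<close> normalizes no other Sylow subgroup. So its orbits on the \<open>p\<close> others have more than one point, and
  only \<open>p\<close> is left for the size of an orbit.
\<close>

lemma syl_orbit_rest:
  assumes p: "prime p" and Q: "Q \<in> sylows p (carrier G)" "card Q = p" and n: "card (sylows p (carrier G)) = p + 1"
    and R: "R \<in> sylows p (carrier G)" "R \<noteq> Q"
  shows "orbit Q conjugate R = sylows p (carrier G) - {Q}"
proof -
  let ?S = "sylows p (carrier G)"
  have Q': "subgroup Q G" "Q \<subseteq> carrier G" using Q by (auto simp: sylows_def)
  have a: "acts Q ?S conjugate" by (rule acts_syl[OF subgroup_self Q'])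
  have os: "card (orbit Q conjugate R) * card {g \<in> Q. conjugate g R = R} = p" using orbit_stabilizer[OF Q'(1) a R(1)] Q by simp
  have "card {g \<in> Q. conjugate g R = R} \<noteq> p"
  proof
    assume "card {g \<in> Q. conjugate g R = R} = p"
    then have "{g \<in> Q. conjugate g R = R} = Q" using card_subset_eq[OF sub_fin[OF Q'(1)], of "{g \<in> Q. conjugate g R = R}"] Q by auto
    then have "Q \<subseteq> normalizer R" using Q' by (auto simp: normalizer_def)
    then show False using syl_normalized_eq[OF subgroup_self p R(1) Q(1)] R by simp
  qed
  moreover have "card (orbit Q conjugate R) dvd p" by (rule dvdI[OF os[symmetric]])
  then have "card (orbit Q conjugate R) = 1 \<or> card (orbit Q conjugate R) = p" using p prime_nat_iff by blast
  ultimately have co: "card (orbit Q conjugate R) = p" using os by auto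
  have no: "Q \<notin> orbit Q conjugate R"
  proof
    assume "Q \<in> orbit Q conjugate R"
    then have "orbit Q conjugate Q = orbit Q conjugate R" using orb_eq[OF Q'(1) a R(1)] by simp
    moreover have "orbit Q conjugate Q \<subseteq> {Q}" using cj_self[OF Q'(1)] by (auto simp: orbit_def)
    ultimately show False using orb_refl[OF Q'(1) a R(1)] R by auto
  qed
  show ?thesis
    by (rule card_subset_eq) (use syl_finite orb_closed[OF a R(1)] no co n Q in \<open>auto simp: card_Diff_singleton\<close>)
qed

text \<open>
  An element \<open>g\<close> that centralizes \<open>Q\<close> permutes the \<open>p\<close> other Sylow subgroups and commutes with the
  transitive action of \<open>Q\<close> on them. At one of them it agrees with an element of \<open>Q\<close>, hence at all of them.
\<close>

lemma syl_centralizing: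
  assumes p: "prime p" and Q: "Q \<in> sylows p (carrier G)" "card Q = p" and n: "card (sylows p (carrier G)) = p + 1"
    and g: "g \<in> carrier G" "\<And>q. q \<in> Q \<Longrightarrow> g \<otimes> q = q \<otimes> g"
  shows "\<exists>v\<in>Q. \<forall>R\<in>sylows p (carrier G). v \<otimes> g \<in> normalizer R"
proof -
  let ?S = "sylows p (carrier G)"
  have Q': "subgroup Q G" "Q \<subseteq> carrier G" using Q by (auto simp: sylows_def)
  have S: "R \<in> ?S \<Longrightarrow> R \<subseteq> carrier G" for R by (auto simp: sylows_def)
  have "\<not> ?S \<subseteq> {Q}" using n prime_gt_1_nat[OF p] card_mono[of "{Q}" ?S] by auto
  then obtain R where R: "R \<in> ?S" "R \<noteq> Q" by blast
  have O: "orbit Q conjugate R = ?S - {Q}" by (rule syl_orbit_rest[OF p Q n R])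
  have gQ: "conjugate g Q = Q"
  proof -
    have "g \<otimes> q \<otimes> inv g = q" if "q \<in> Q" for q
      using g(2)[OF that] g(1) that Q' by (simp add: m_assoc subset_iff)
    then show ?thesis by (simp add: conjugate_def)
  qed
  have "conjugate g R \<in> ?S" using syl_cj[OF subgroup_self g(1) R(1)] .
  moreover have "conjugate g R \<noteq> Q"
    using gQ R g(1) S cj_inv[OF g(1), of R] cj_inv[OF g(1), of Q] Q' by metis
  ultimately have "conjugate g R \<in> orbit Q conjugate R" using O by simp
  then obtain u where u: "u \<in> Q" "conjugate g R = conjugate u R" by (auto simp: orbit_def)
  have uc: "u \<in> carrier G" using u Q' by auto
  define v where "v = inv u"
  have v: "v \<in> Q" using u Q' by (simp add: v_def subgroup.m_inv_closed)
  have vc: "v \<in> carrier G" using v Q' by auto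
  have fR: "conjugate (v \<otimes> g) R = R" using cj_eq_iff[of g u R] u uc g S R by (simp add: v_def)
  have comm: "v \<otimes> g \<otimes> q = q \<otimes> (v \<otimes> g)" if "q \<in> Q" for q
  proof -
    have "v \<otimes> q = q \<otimes> v" using prime_card_commute[OF Q'(1)] Q(2) p v that by simp
    then show ?thesis using g(2)[OF that] g(1) vc subsetD[OF Q'(2) that] by (metis m_assoc)
  qed
  have "v \<otimes> g \<in> normalizer T" if T: "T \<in> ?S" for T
  proof (cases "T = Q")
    case True
    have "conjugate (v \<otimes> g) Q = Q" using cj_mult[OF vc g(1) Q'(2)] gQ cj_self[OF Q'(1) v] by simp
    then show ?thesis using True vc g by (simp add: normalizer_def)
  next
    case False
    then have "T \<in> orbit Q conjugate R" using O T by simp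
    then obtain q where q: "q \<in> Q" "T = conjugate q R" by (auto simp: orbit_def)
    have qc: "q \<in> carrier G" using q Q' by auto
    have "conjugate (v \<otimes> g) T = conjugate (v \<otimes> g \<otimes> q) R" using q qc vc g(1) S[OF R(1)] by (simp add: cj_mult)
    also have "\<dots> = conjugate q (conjugate (v \<otimes> g) R)" using comm[OF q(1)] cj_mult[OF qc _ S[OF R(1)], of "v \<otimes> g"] vc g by simp
    finally show ?thesis using fR q vc g by (simp add: normalizer_def)
  qed
  then show ?thesis using v by blast
qed

lemma pow_card_subgroup:
  assumes K: "subgroup K G" and k: "k \<in> K" shows "k [^] card K = \<one>"
proof -
  have "k [^]\<^bsub>G\<lparr>carrier := K\<rparr>\<^esub> order (G\<lparr>carrier := K\<rparr>) = \<one>\<^bsub>G\<lparr>carrier := K\<rparr>\<^esub>"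
    by (rule group.pow_order_eq_1[OF subgroup.subgroup_is_group[OF K is_group]]) (use k in simp)
  then show ?thesis by (simp add: nat_pow_consistent[symmetric] order_def)
qed

lemma prime_card_cyclic:
  assumes K: "subgroup K G" "prime (card K)" and u: "u \<in> K" and v: "v \<in> K" "v \<noteq> \<one>"
  shows "\<exists>i::nat. u = v [^] i"
proof -
  have vc: "v \<in> carrier G" using v K subgroup.mem_carrier by metis
  have subgroups_of_order: "subgroup (generate G {v}) G" by (rule generate_is_subgroup) (use vc in simp)
  have v': "v \<in> generate G {v}" by (rule generate.incl) simp
  have sub: "generate G {v} \<subseteq> K" by (rule generate_subgroup_incl[OF _ K(1)]) (use v in simp)
  have "K \<subseteq> generate G {v}"
  proof (rule ccontr)
    assume "\<not> K \<subseteq> generate G {v}"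
    then have "K \<inter> generate G {v} = {\<one>}" by (rule prime_int_trivial[OF K(1) subgroups_of_order K(2)])
    then show False using v v' by blast
  qed
  then show ?thesis using u generate_pow_on_finite_carrier[OF fin vc] by auto
qed

end

lemma fin_groupI: "group G \<Longrightarrow> finite (carrier G) \<Longrightarrow> fin_group G"
  by (simp add: fin_group_def fin_group_axioms_def)

section \<open>Simple sections of non-solvable groups\<close>

lemma comm_group_solvable:
  assumes "comm_group G" shows "solvable G"
proof -
  interpret comm_group G by fact
  have "solvable_seq G {\<one>\<^bsub>G\<^esub>}" by (rule solvable_seq.unity)
  moreover have "{\<one>\<^bsub>G\<^esub>} \<lhd> G\<lparr>carrier := carrier G\<rparr>" using one_is_normal by simp
  moreover have "comm_group (G\<lparr>carrier := carrier G\<rparr> Mod {\<one>\<^bsub>G\<^esub>})"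
    using abelian_FactGroup[OF triv_subgroup] by simp
  ultimately show ?thesis unfolding solvable_def by (rule solvable_seq.extension[OF _ _ subgroup_self])
qed

text \<open>
  Divide by a maximal normal subgroup. If the quotient has prime order, it is solvable, so the normal
  subgroup is not, and the induction continues with it.
\<close>

lemma nonsolvable_simple_section:
  fixes G :: "('a, 'b) monoid_scheme"
  assumes "group G" "finite (carrier G)" "\<not> solvable G"
  shows "\<exists>H N. subgroup H G \<and> N \<lhd> G\<lparr>carrier := H\<rparr> \<and> simple_group (G\<lparr>carrier := H\<rparr> Mod N) \<and>
    \<not> prime (order (G\<lparr>carrier := H\<rparr> Mod N))"
  using assms
proof (induction "order G" arbitrary: G rule: less_induct)
  case less
  interpret group G by (rule less.prems(1))
  note f = less.prems(2)
  have ntriv: "carrier G \<noteq> {\<one>\<^bsub>G\<^esub>}"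
    using less.prems(3) solvable_seq.unity[of G] unfolding solvable_def by metis
  define P where "P = {N. N \<lhd> G \<and> N \<noteq> carrier G}"
  have "finite P"
    by (rule finite_subset[of _ "Pow (carrier G)"])
       (use f in \<open>auto simp: P_def dest!: normal_imp_subgroup subgroup.subset\<close>)
  moreover have "{\<one>\<^bsub>G\<^esub>} \<in> P" using one_is_normal ntriv by (auto simp: P_def)
  ultimately obtain N where N: "N \<in> P" "\<And>K. K \<in> P \<Longrightarrow> N \<subseteq> K \<Longrightarrow> K = N"
    using finite_has_maximal[of P] by (metis empty_iff)
  then have nN: "N \<lhd> G" "N \<noteq> carrier G" by (auto simp: P_def)
  interpret N: normal N G by fact
  interpret Q: group "G Mod N" by (rule N.factorgroup_is_group)
  have sN: "subgroup N G" using nN normal_imp_subgroup by blast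
  have "order (G Mod N) \<noteq> 1"
  proof
    assume "order (G Mod N) = 1"
    then have "card (rcosets\<^bsub>G\<^esub> N) = 1" by (simp add: order_def FactGroup_def)
    then have "card N = order G" using lagrange[OF sN] by simp
    then have "N = carrier G" using card_subset_eq[OF f subgroup.subset[OF sN]] by (simp add: order_def)
    then show False using nN by simp
  qed
  moreover have fQ: "finite (carrier (G Mod N))" using f by (simp add: carrier_FactGroup)
  then have "order (G Mod N) > 0" using Q.order_gt_0_iff_finite by simp
  ultimately have gt1: "order (G Mod N) > 1" by simp
  have simple: "simple_group (G Mod N)"
  proof (intro simple_group.intro simple_group_axioms.intro Q.is_group gt1)
    fix K assume K: "K \<lhd> G Mod N"
    have sK: "subgroup K (G Mod N)" using K normal_imp_subgroup by blast
    have ch: "\<Union>K = {x \<in> carrier G. N #>\<^bsub>G\<^esub> x \<in> K}" by (rule N.factgroup_subgroup_union_char[OF sK])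
    have n: "\<Union>K \<lhd> G" by (rule N.factgroup_subgroup_union_normal[OF K])
    have "N \<in> K" using subgroup.one_closed[OF sK] by simp
    then have NK: "N \<subseteq> \<Union>K" by auto
    have "\<Union>K = N \<or> \<Union>K = carrier G"
      using N(2)[of "\<Union>K"] n NK by (auto simp: P_def)
    then show "K = carrier (G Mod N) \<or> K = {\<one>\<^bsub>G Mod N\<^esub>}"
    proof
      assume e: "\<Union>K = N"
      have "C = N" if C: "C \<in> K" for C
      proof -
        have "C \<in> carrier (G Mod N)" using C subgroup.subset[OF sK] by auto
        then obtain x where x: "x \<in> carrier G" "C = N #>\<^bsub>G\<^esub> x" by (auto simp: carrier_FactGroup)
        then have "x \<in> N" using ch e C by auto
        then show ?thesis using x coset_join2[OF _ sN] by simp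
      qed
      then have "K = {N}" using \<open>N \<in> K\<close> by blast
      then show ?thesis by simp
    next
      assume e: "\<Union>K = carrier G"
      have "carrier (G Mod N) \<subseteq> K" using ch e by (auto simp: carrier_FactGroup)
      then show ?thesis using subgroup.subset[OF sK] by auto
    qed
  qed
  show ?case
  proof (cases "prime (order (G Mod N))")
    case False
    then show ?thesis using simple nN subgroup_self by (intro exI[of _ "carrier G"] exI[of _ N]) simp
  next
    case True
    have "comm_group (G Mod N)"
      by (rule Q.group_comm_groupI) (rule Q.prime_order_commute[OF True])
    then have solQ: "solvable (G Mod N)" by (rule comm_group_solvable)
    have "\<not> solvable (G\<lparr>carrier := N\<rparr>)"
    proof
      assume s: "solvable (G\<lparr>carrier := N\<rparr>)"
      have "solvable G"
      proof (rule solvable_condition[of "G\<lparr>carrier := N\<rparr>" G id "G Mod N" "\<lambda>x. N #>\<^bsub>G\<^esub> x"])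
        show "group_hom (G\<lparr>carrier := N\<rparr>) G id" by (rule canonical_inj_is_hom[OF sN])
        show "group_hom G (G Mod N) (\<lambda>x. N #>\<^bsub>G\<^esub> x)"
          by (intro group_hom.intro group_hom_axioms.intro N.r_coset_hom_Mod is_group Q.is_group)
        show "(\<lambda>x. N #>\<^bsub>G\<^esub> x) ` carrier G = carrier (G Mod N)" by (simp add: carrier_FactGroup)
        show "kernel G (G Mod N) (\<lambda>x. N #>\<^bsub>G\<^esub> x) \<subseteq> id ` carrier (G\<lparr>carrier := N\<rparr>)"
          using coset_join1[OF _ _ sN] sN by (auto simp: kernel_def subgroup.subset)
      qed (fact s solQ)+
      then show False using less.prems by simp
    qed
    moreover have "order (G\<lparr>carrier := N\<rparr>) < order G"
      using nN subgroup.subset[OF sN] f by (simp add: order_def psubset_card_mono psubsetI)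
    moreover have "group (G\<lparr>carrier := N\<rparr>)" by (rule subgroup.subgroup_is_group[OF sN is_group])
    moreover have "finite (carrier (G\<lparr>carrier := N\<rparr>))" using f subgroup.subset[OF sN] finite_subset by auto
    ultimately obtain H N' where H: "subgroup H (G\<lparr>carrier := N\<rparr>)" "N' \<lhd> G\<lparr>carrier := N\<rparr>\<lparr>carrier := H\<rparr>"
      "simple_group (G\<lparr>carrier := N\<rparr>\<lparr>carrier := H\<rparr> Mod N')" "\<not> prime (order (G\<lparr>carrier := N\<rparr>\<lparr>carrier := H\<rparr> Mod N'))"
      using less.hyps[of "G\<lparr>carrier := N\<rparr>"] by blast
    then show ?thesis using incl_subgroup[OF sN H(1)] by auto
  qed
qed

text \<open>
  Take a section of least order among the simple ones of non-prime order. A subgroup \<open>M\<close> of it without a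
  proper non-trivial normal subgroup would be simple, and it is again a section, formed with its preimage.
  The trivial subgroup of the quotient is written as \<open>{N}\<close>, since \<open>N\<close> is its neutral element.
\<close>

lemma minimal_simple_section:
  fixes G :: "('a, 'b) monoid_scheme"
  assumes "group G" "finite (carrier G)" "\<not> solvable G"
  shows "\<exists>H N. subgroup H G \<and> N \<lhd> G\<lparr>carrier := H\<rparr> \<and> simple_group (G\<lparr>carrier := H\<rparr> Mod N) \<and>
    \<not> prime (order (G\<lparr>carrier := H\<rparr> Mod N)) \<and>
    (\<forall>M. subgroup M (G\<lparr>carrier := H\<rparr> Mod N) \<longrightarrow> M \<noteq> carrier (G\<lparr>carrier := H\<rparr> Mod N) \<longrightarrow> M \<noteq> {N} \<longrightarrow>
      \<not> prime (card M) \<longrightarrow> (\<exists>A. A \<lhd> (G\<lparr>carrier := H\<rparr> Mod N)\<lparr>carrier := M\<rparr> \<and> A \<noteq> {N} \<and> A \<noteq> M))"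
proof -
  let ?S = "\<lambda>H N. G\<lparr>carrier := H\<rparr> Mod N"
  define P where "P = (\<lambda>(H, N). subgroup H G \<and> N \<lhd> G\<lparr>carrier := H\<rparr> \<and> simple_group (?S H N) \<and> \<not> prime (order (?S H N)))"
  have "\<exists>x. P x" using nonsolvable_simple_section[OF assms] by (auto simp: P_def)
  then obtain x where "P x" and min: "\<And>y. P y \<Longrightarrow> order (?S (fst x) (snd x)) \<le> order (?S (fst y) (snd y))"
    using ex_has_least_nat[of P _ "\<lambda>y. order (?S (fst y) (snd y))"] by blast
  then obtain H N where x: "x = (H, N)" and HN: "subgroup H G" "N \<lhd> G\<lparr>carrier := H\<rparr>" "simple_group (?S H N)" "\<not> prime (order (?S H N))"
    by (cases x) (auto simp: P_def)
  interpret G: group G by fact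
  interpret H: group "G\<lparr>carrier := H\<rparr>" by (rule subgroup.subgroup_is_group[OF HN(1) assms(1)])
  interpret N: normal N "G\<lparr>carrier := H\<rparr>" by (rule HN(2))
  interpret S: simple_group "?S H N" by (rule HN(3))
  have fH: "finite H" using finite_subset[OF subgroup.subset[OF HN(1)] assms(2)] .
  have fS: "finite (carrier (?S H N))" using fH by (simp add: carrier_FactGroup)
  have "\<exists>A. A \<lhd> (?S H N)\<lparr>carrier := M\<rparr> \<and> A \<noteq> {N} \<and> A \<noteq> M"
    if M: "subgroup M (?S H N)" "M \<noteq> carrier (?S H N)" "M \<noteq> {N}" "\<not> prime (card M)" for M
  proof (rule ccontr)
    assume c: "\<not> ?thesis"
    define K where "K = \<Union>M"
    have "subgroup K (G\<lparr>carrier := H\<rparr>)" unfolding K_def by (rule N.factgroup_subgroup_union_subgroup[OF M(1)])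
    then have K: "subgroup K G" "K \<subseteq> H" using G.incl_subgroup[OF HN(1)] subgroup.subset by fastforce+
    have "N \<in> M" using subgroup.one_closed[OF M(1)] by simp
    then have NK: "N \<subseteq> K" by (auto simp: K_def)
    have sN: "subgroup N G" using G.incl_subgroup[OF HN(1) normal_imp_subgroup[OF HN(2)]] .
    have nK: "N \<lhd> G\<lparr>carrier := K\<rparr>"
      using G.normal_restrict_supergroup[of K N] HN(2) K NK sN
      by (metis G.normal_Int_subgroup H.normal_restrict_supergroup \<open>subgroup K (G\<lparr>carrier := H\<rparr>)\<close>
          monoid.surjective partial_object.update_convs(1))
    have e: "?S K N = (?S H N)\<lparr>carrier := M\<rparr>"
      using N.factgroup_subgroup_union_factor[OF M(1)] by (simp add: FactGroup_def K_def set_mult_def fun_eq_iff)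
    interpret M: group "(?S H N)\<lparr>carrier := M\<rparr>" by (rule subgroup.subgroup_is_group[OF M(1) S.is_group])
    have fM: "finite M" using finite_subset[OF subgroup.subset[OF M(1)] fS] .
    have "card M \<noteq> 1"
    proof
      assume "card M = 1"
      then obtain y where "M = {y}" by (auto simp: card_Suc_eq)
      then show False using \<open>N \<in> M\<close> M(3) by auto
    qed
    moreover have "card M > 0" using fM \<open>N \<in> M\<close> card_gt_0_iff by blast
    ultimately have "simple_group (?S K N)"
      unfolding e by (intro simple_group.intro simple_group_axioms.intro M.is_group)
        (use c in \<open>auto simp: order_def\<close>)
    then have "P (K, N)" using K nK M(4) by (simp add: P_def e order_def)
    then have "order (?S H N) \<le> order (?S K N)" using min[of "(K, N)"] x by simp
    then have "card (carrier (?S H N)) \<le> card M" unfolding e by (simp add: order_def)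
    then show False using card_seteq[OF fS subgroup.subset[OF M(1)]] M(2) by simp
  qed
  then show ?thesis using HN by blast
qed

lemma (in fin_group) normal_iff_nrm: "N \<lhd> G \<longleftrightarrow> subgroup N G \<and> normalizer N = carrier G"
proof
  assume N: "N \<lhd> G"
  have sN: "subgroup N G" using N normal_imp_subgroup by blast
  have "conjugate x N = N" if "x \<in> carrier G" for x
  proof (rule card_seteq[OF sub_fin[OF sN]])
    show "conjugate x N \<subseteq> N" using N that by (auto simp: conjugate_def normal_inv_iff)
    show "card N \<le> card (conjugate x N)" using card_cj[OF that subgroup.subset[OF sN]] by simp
  qed
  then show "subgroup N G \<and> normalizer N = carrier G" using sN by (auto simp: normalizer_def)
next
  assume "subgroup N G \<and> normalizer N = carrier G"
  then show "N \<lhd> G" unfolding normal_inv_iff by (auto simp: normalizer_def conjugate_def)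
qed

lemma (in fin_group) normal_in_subgroup:
  assumes M: "subgroup M G" and A: "A \<lhd> G\<lparr>carrier := M\<rparr>"
  shows "subgroup A G \<and> A \<subseteq> M \<and> M \<subseteq> normalizer A"
proof -
  interpret M: group "G\<lparr>carrier := M\<rparr>" by (rule subgroup.subgroup_is_group[OF M is_group])
  have sA: "subgroup A G" using incl_subgroup[OF M normal_imp_subgroup[OF A]] .
  have AM: "A \<subseteq> M" using subgroup.subset[OF normal_imp_subgroup[OF A]] by simp
  have "m \<in> normalizer A" if m: "m \<in> M" for m
  proof -
    have mc: "m \<in> carrier G" using m M subgroup.mem_carrier by metis
    have "conjugate m A \<subseteq> A" using A m M.normal_inv_iff m_inv_consistent[OF M m] by (auto simp: conjugate_def)
    then have "conjugate m A = A" using card_seteq[OF sub_fin[OF sA]] card_cj[OF mc subgroup.subset[OF sA]] by simp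
    then show ?thesis using mc by (simp add: normalizer_def)
  qed
  then show ?thesis using sA AM by blast
qed

section \<open>Maximal subgroups of a finite simple group\<close>

text \<open>
  Normality is expressed by normalizers of subsets, and groups of prime order are excluded, so that a
  non-abelian finite simple group is described without changing the carrier.
\<close>

locale simple_fin = fin_group +
  assumes simple: "\<And>K. subgroup K G \<Longrightarrow> normalizer K = carrier G \<Longrightarrow> K = {\<one>} \<or> K = carrier G"
    and gt1: "card (carrier G) > 1"
    and not_prime: "\<not> prime (card (carrier G))"
begin

abbreviation n :: nat where "n \<equiv> card (carrier G)"

definition proper_subgroups :: "'a set set" where
  "proper_subgroups = {K. subgroup K G \<and> K \<noteq> {\<one>} \<and> K \<noteq> carrier G}"

definition maximal_subgroups :: "'a set set" where
  "maximal_subgroups = {M. subgroup M G \<and> M \<noteq> carrier G \<and> (\<forall>K. subgroup K G \<longrightarrow> M \<subseteq> K \<longrightarrow> K = M \<or> K = carrier G)}"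

definition index :: "'a set \<Rightarrow> nat" where
  "index M = n div card M"

definition count_order :: "nat \<Rightarrow> nat" where
  "count_order k = card {K \<in> proper_subgroups. card K = k}"

lemma finite_props: "finite proper_subgroups"
  by (rule finite_subset[of _ "Pow (carrier G)"]) (use fin in \<open>auto simp: proper_subgroups_def dest: subgroup.subset\<close>)

lemma idx_mult: "subgroup M G \<Longrightarrow> index M * card M = n"
  using card_dvd_order by (simp add: index_def)

lemma idx_pos: "subgroup M G \<Longrightarrow> index M > 0"
  using idx_mult[of M] gt1 by (cases "index M = 0") auto

lemma card_conjs_idx:
  assumes K: "subgroup K G" shows "card (conj_class K) = index (normalizer K)"
proof -
  have "n = card (conj_class K) * card (normalizer K)" using card_conjs[OF subgroup.subset[OF K]] by simp
  moreover have "card (normalizer K) > 0" by (rule sub_card_pos[OF nrm_subgroup[OF subgroup.subset[OF K]]])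
  ultimately show ?thesis unfolding index_def by simp
qed

lemma idx_dvd:
  assumes "subgroup K G" "subgroup M G" "K \<subseteq> M" shows "index M dvd index K"
proof -
  obtain t where t: "card M = card K * t" using card_dvd[OF assms] by (auto simp: dvd_def)
  have "index K * card K = index M * t * card K" using idx_mult assms t by (metis mult.assoc mult.commute)
  then show ?thesis using sub_card_pos[OF assms(1)] by auto
qed

lemma max_above:
  assumes K: "subgroup K G" "K \<noteq> carrier G" shows "\<exists>M\<in>maximal_subgroups. K \<subseteq> M"
proof -
  let ?P = "{L. subgroup L G \<and> L \<noteq> carrier G}"
  have f: "finite ?P" by (rule finite_subset[of _ "Pow (carrier G)"]) (use fin in \<open>auto dest: subgroup.subset\<close>)
  obtain M where M: "M \<in> ?P" "K \<subseteq> M" "\<forall>L\<in>?P. M \<subseteq> L \<longrightarrow> M = L"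
    using finite_has_maximal2[OF f, of K] K by auto
  then have "M \<in> maximal_subgroups" by (auto simp: maximal_subgroups_def)
  then show ?thesis using M by blast
qed

lemma maxs_props: "maximal_subgroups \<subseteq> proper_subgroups"
proof
  fix M assume M: "M \<in> maximal_subgroups"
  have "M \<noteq> {\<one>}"
  proof
    assume e: "M = {\<one>}"
    obtain p where p: "prime p" "p dvd n" using gt1 prime_factor_nat[of n] by auto
    then obtain P where P: "subgroup P G" "card P = p"
      using prime_power_subgroup_ex[OF subgroup_self p(1), of 1] by auto
    have "{\<one>} \<subseteq> P" using subgroup.one_closed[OF P(1)] by simp
    then have "P = {\<one>} \<or> P = carrier G" using M P e unfolding maximal_subgroups_def by blast
    then show False using P p not_prime prime_gt_1_nat[OF p(1)] by auto
  qed
  then show "M \<in> proper_subgroups" using M by (auto simp: maximal_subgroups_def proper_subgroups_def)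
qed

lemma props_nrm: "K \<in> proper_subgroups \<Longrightarrow> normalizer K \<noteq> carrier G"
  using simple by (auto simp: proper_subgroups_def)

text \<open>
  The normalizer of \<open>A\<close> is a proper subgroup, because the group is simple.
\<close>

lemma nrm_max:
  assumes M: "M \<in> maximal_subgroups" and A: "A \<in> proper_subgroups" "M \<subseteq> normalizer A" shows "normalizer A = M"
proof -
  have "subgroup (normalizer A) G" using A by (intro nrm_subgroup) (auto simp: proper_subgroups_def dest: subgroup.subset)
  then show ?thesis using M A(2) props_nrm[OF A(1)] unfolding maximal_subgroups_def by blast
qed

lemma max_self_normalizing: "M \<in> maximal_subgroups \<Longrightarrow> normalizer M = M"
  using nrm_max[of M M] maxs_props sub_nrm by (auto simp: proper_subgroups_def)

lemma conjs_props:
  assumes "K \<in> proper_subgroups" shows "conj_class K \<subseteq> {L \<in> proper_subgroups. card L = card K}"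
proof
  fix L assume L: "L \<in> conj_class K"
  have K: "subgroup K G" "K \<noteq> {\<one>}" "K \<noteq> carrier G" using assms by (auto simp: proper_subgroups_def)
  have sL: "subgroup L G" "card L = card K" using conjs_subgroup[OF K(1) L] by auto
  have "L \<noteq> {\<one>}"
  proof
    assume "L = {\<one>}"
    then have "card K = 1" using sL by simp
    then show False using K subgroup.one_closed[OF K(1)] by (auto simp: card_Suc_eq)
  qed
  moreover have "L \<noteq> carrier G"
    using sL K card_subset_eq[OF fin subgroup.subset[OF K(1)]] by auto
  ultimately show "L \<in> {L \<in> proper_subgroups. card L = card K}" using sL by (simp add: proper_subgroups_def)
qed

lemma conjs_maxs:
  assumes M: "M \<in> maximal_subgroups" shows "conj_class M \<subseteq> maximal_subgroups"
proof
  fix L assume "L \<in> conj_class M"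
  then obtain g where g: "g \<in> carrier G" "L = conjugate g M" by (auto simp: conj_class_def)
  have sM: "subgroup M G" using M by (simp add: maximal_subgroups_def)
  have L: "subgroup L G" "L \<noteq> carrier G"
    using conjs_props[of M] maxs_props M \<open>L \<in> conj_class M\<close> by (auto simp: proper_subgroups_def)
  have "K = L \<or> K = carrier G" if K: "subgroup K G" "L \<subseteq> K" for K
  proof -
    have i: "inv g \<in> carrier G" using g by simp
    have "M \<subseteq> conjugate (inv g) K"
      using cj_mono[OF K(2), of "inv g"] cj_inv[OF g(1) subgroup.subset[OF sM]] g by simp
    then have "conjugate (inv g) K = M \<or> conjugate (inv g) K = carrier G"
      using M subgroup_cj[OF i K(1)] unfolding maximal_subgroups_def by blast
    then show ?thesis
    proof
      assume "conjugate (inv g) K = M"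
      then show ?thesis using cj_inv'[OF g(1) subgroup.subset[OF K(1)]] g by simp
    next
      assume "conjugate (inv g) K = carrier G"
      then have "card K = n" using card_cj[OF i subgroup.subset[OF K(1)]] by simp
      then show ?thesis using card_subset_eq[OF fin subgroup.subset[OF K(1)]] by simp
    qed
  qed
  then show "L \<in> maximal_subgroups" using L by (auto simp: maximal_subgroups_def)
qed

lemma card_conjs_max: "M \<in> maximal_subgroups \<Longrightarrow> card (conj_class M) = index M"
  using card_conjs_idx[of M] max_self_normalizing[of M] by (auto simp: maximal_subgroups_def)

lemma idx_conjs: "M \<in> maximal_subgroups \<Longrightarrow> L \<in> conj_class M \<Longrightarrow> index L = index M"
  using conjs_subgroup[of M L] by (auto simp: maximal_subgroups_def index_def)

lemma finite_maxs: "finite maximal_subgroups"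
  using finite_subset[OF maxs_props finite_props] .

lemma maxs_ex: "\<exists>M. M \<in> maximal_subgroups"
proof -
  have "{\<one>} \<noteq> carrier G"
  proof
    assume "{\<one>} = carrier G"
    then have "n = card {\<one>}" by simp
    then show False using gt1 by simp
  qed
  then show ?thesis using max_above[OF triv_subgroup] by blast
qed

text \<open>
  A maximal subgroup of index \<open>j\<close> has \<open>j\<close> conjugates, and they have index \<open>j\<close> too.
\<close>

lemma sum_indices_le:
  assumes Y: "Y \<subseteq> maximal_subgroups" "\<And>M. M \<in> Y \<Longrightarrow> conj_class M \<subseteq> Y"
  shows "\<Sum>(index ` Y) \<le> card Y"
proof -
  have fY: "finite Y" using finite_subset[OF Y(1) finite_maxs] .
  have "\<Sum>(index ` Y) \<le> (\<Sum>j\<in>index ` Y. card {M \<in> Y. index M = j})"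
  proof (rule sum_mono)
    fix j assume "j \<in> index ` Y"
    then obtain M where M: "M \<in> Y" "j = index M" by auto
    then have "conj_class M \<subseteq> {M \<in> Y. index M = j}" using Y idx_conjs by auto
    then have "card (conj_class M) \<le> card {M \<in> Y. index M = j}" using fY by (intro card_mono) auto
    then show "j \<le> card {M \<in> Y. index M = j}" using M card_conjs_max Y(1) by auto
  qed
  also have "\<dots> = card Y" using sum.image_gen[OF fY, of "\<lambda>_. 1::nat" index] by simp
  finally show ?thesis .
qed

text \<open>
  In a group of prime power order a proper subgroup is smaller than its normalizer.
\<close>

lemma not_prime_power:
  assumes p: "prime p" shows "n \<noteq> p ^ a"
proof
  assume e: "n = p ^ a"
  obtain M where M: "M \<in> maximal_subgroups" using maxs_ex by blast
  then have sM: "subgroup M G" "M \<subset> carrier G" using subgroup.subset by (auto simp: maximal_subgroups_def)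
  show False using normalizer_grows[OF subgroup_self e p sM] max_self_normalizing[OF M] by auto
qed

lemma prime_power_props:
  assumes "prime p" "p ^ a dvd n" "a \<noteq> 0"
  shows "\<exists>K\<in>proper_subgroups. card K = p ^ a"
proof -
  obtain P where P: "subgroup P G" "card P = p ^ a"
    using prime_power_subgroup_ex[OF subgroup_self assms(1,2)] by auto
  have "p ^ a > 1" using assms prime_gt_1_nat one_less_power by blast
  then have "P \<noteq> {\<one>}" using P by auto
  moreover have "P \<noteq> carrier G" using not_prime_power[OF assms(1), of a] P by auto
  ultimately show ?thesis using P by (auto simp: proper_subgroups_def)
qed

text \<open>
  Let \<open>M\<close> be a maximal subgroup above the normalizer of \<open>P\<close>. The numbers of Sylow subgroups of \<open>M\<close> and of
  the group are the indices of this same normalizer, so the index of \<open>M\<close> is their quotient; and both are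
  1 modulo \<open>p\<close>.
\<close>

lemma sylow_in_max:
  assumes p: "prime p" "p dvd n"
  shows "\<exists>M\<in>maximal_subgroups. index M mod p = 1 \<and> card (sylows p (carrier G)) = index M * card (sylows p M) \<and>
     (\<exists>P\<in>sylows p (carrier G). normalizer P \<subseteq> M)"
proof -
  obtain P where P: "P \<in> sylows p (carrier G)" using syl_ex[OF subgroup_self p(1)] by blast
  have sP: "subgroup P G" "card P = p ^ multiplicity p n" using P by (auto simp: sylows_def)
  have "multiplicity p n \<noteq> 0" using p gt1 by (simp add: prime_multiplicity_gt_zero_iff)
  then have "card P > 1" using sP prime_gt_1_nat[OF p(1)] one_less_power by (metis neq0_conv)
  then have "P \<in> proper_subgroups" using sP not_prime_power[OF p(1)] by (auto simp: proper_subgroups_def)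
  then obtain M where M: "M \<in> maximal_subgroups" "normalizer P \<subseteq> M"
    using max_above[OF nrm_subgroup[OF subgroup.subset[OF sP(1)]]] props_nrm by blast
  have sM: "subgroup M G" using M by (simp add: maximal_subgroups_def)
  have PM: "P \<in> sylows p M"
    using syl_mid[OF subgroup_self sM subgroup.subset[OF sM] _ p(1) P] M(2) sub_nrm[OF sP(1)] by auto
  have 1: "card (sylows p (carrier G)) * card (normalizer P) = n"
    using card_syl[OF subgroup_self p(1) P] nrm_closed by (simp add: Int_absorb1)
  have 2: "card (sylows p M) * card (normalizer P) = card M"
    using card_syl[OF sM p(1) PM] M(2) by (simp add: Int_absorb1)
  have "card (sylows p (carrier G)) * card (normalizer P) = index M * card (sylows p M) * card (normalizer P)"
    using 1 idx_mult[OF sM] 2[symmetric] by (simp add: mult.assoc)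
  then have 3: "card (sylows p (carrier G)) = index M * card (sylows p M)"
    using sub_card_pos[OF nrm_subgroup[OF subgroup.subset[OF sP(1)]]] by simp
  then have "1 = (index M * card (sylows p M)) mod p" using card_syl_mod[OF subgroup_self p(1)] by simp
  also have "\<dots> = index M mod p"
    using card_syl_mod[OF sM p(1)] by (metis mod_mult_right_eq mult.right_neutral)
  finally show ?thesis using M 3 P by auto
qed

lemma cnt_ge_conjs: "K \<in> proper_subgroups \<Longrightarrow> card (conj_class K) \<le> count_order (card K)"
  unfolding count_order_def using conjs_props finite_props by (intro card_mono) auto

lemma cnt_ge_idx: "M \<in> maximal_subgroups \<Longrightarrow> index M \<le> count_order (card M)"
  using cnt_ge_conjs[of M] card_conjs_max maxs_props by auto

lemma conjs_ge:
  assumes d: "\<And>M. M \<in> maximal_subgroups \<Longrightarrow> d \<le> index M" and K: "K \<in> proper_subgroups"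
  shows "d \<le> card (conj_class K)"
proof -
  have sK: "subgroup K G" using K by (simp add: proper_subgroups_def)
  have sN: "subgroup (normalizer K) G" by (rule nrm_subgroup[OF subgroup.subset[OF sK]])
  obtain M where M: "M \<in> maximal_subgroups" "normalizer K \<subseteq> M" using max_above[OF sN props_nrm[OF K]] by blast
  then have "index M dvd index (normalizer K)" using idx_dvd[OF sN] by (simp add: maximal_subgroups_def)
  then have "index M \<le> index (normalizer K)" using idx_pos[OF sN] by (simp add: dvd_imp_le)
  then show ?thesis using d[OF M(1)] card_conjs_idx[OF sK] by simp
qed

lemma cnt_ge_prime_power:
  assumes d: "\<And>M. M \<in> maximal_subgroups \<Longrightarrow> d \<le> index M" and "prime p" "p ^ a dvd n" "a \<noteq> 0"
  shows "d \<le> count_order (p ^ a)"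
  using prime_power_props[OF assms(2-4)] conjs_ge[OF d] cnt_ge_conjs order_trans by metis

lemma idx_ge_proper:
  assumes d: "\<And>M. M \<in> maximal_subgroups \<Longrightarrow> d \<le> index M" and K: "subgroup K G" "K \<noteq> carrier G"
  shows "d \<le> index K"
proof -
  obtain M where M: "M \<in> maximal_subgroups" "K \<subseteq> M" using max_above[OF K] by blast
  then have "index M dvd index K" using idx_dvd[OF K(1)] by (simp add: maximal_subgroups_def)
  then have "index M \<le> index K" using idx_pos[OF K(1)] by (simp add: dvd_imp_le)
  then show ?thesis using d[OF M(1)] by simp
qed

lemma sum_cnt_le: "distinct ks \<Longrightarrow> sum_list (map count_order ks) \<le> card proper_subgroups"
proof -
  assume d: "distinct ks"
  have "sum_list (map count_order ks) = (\<Sum>k\<in>set ks. count_order k)" using d by (simp add: sum_list_distinct_conv_sum_set)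
  also have "\<dots> = card (\<Union>k\<in>set ks. {K \<in> proper_subgroups. card K = k})"
    unfolding count_order_def by (rule card_UN_disjoint[symmetric]) (use finite_props in auto)
  also have "\<dots> \<le> card proper_subgroups" by (rule card_mono[OF finite_props]) auto
  finally show ?thesis .
qed

text \<open>
  The intersection of the normalizers of all Sylow \<open>p\<close>-subgroups is a normal subgroup.
\<close>

lemma syl_core_trivial:
  assumes p: "prime p" "p dvd n" and g: "g \<in> carrier G" "\<And>R. R \<in> sylows p (carrier G) \<Longrightarrow> g \<in> normalizer R"
  shows "g = \<one>"
proof -
  let ?S = "sylows p (carrier G)"
  define C where "C = {g \<in> carrier G. \<forall>R\<in>?S. g \<in> normalizer R}"
  have S: "R \<in> ?S \<Longrightarrow> R \<subseteq> carrier G" for R by (auto simp: sylows_def)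
  have sC: "subgroup C G"
  proof (rule subgroupI)
    show "C \<subseteq> carrier G" by (auto simp: C_def)
    have "\<one> \<in> C" using subgroup.one_closed[OF nrm_subgroup] S by (auto simp: C_def)
    then show "C \<noteq> {}" by auto
    show "\<And>a. a \<in> C \<Longrightarrow> inv a \<in> C" using subgroup.m_inv_closed[OF nrm_subgroup] S by (auto simp: C_def)
    show "\<And>a b. a \<in> C \<Longrightarrow> b \<in> C \<Longrightarrow> a \<otimes> b \<in> C" using subgroup.m_closed[OF nrm_subgroup] S by (auto simp: C_def)
  qed
  have "x \<in> normalizer C" if x: "x \<in> carrier G" for x
  proof -
    have "conjugate x C \<subseteq> C"
    proof
      fix y assume "y \<in> conjugate x C"
      then obtain c where c: "c \<in> C" "y = x \<otimes> c \<otimes> inv x" by (auto simp: conjugate_def)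
      have cc: "c \<in> carrier G" using c by (simp add: C_def)
      have "y \<in> normalizer R" if R: "R \<in> ?S" for R
      proof -
        have i: "conjugate (inv x) R \<in> ?S" using syl_cj[OF subgroup_self _ R] x by simp
        have "y \<in> conjugate x (normalizer (conjugate (inv x) R))" using c i by (auto simp: C_def conjugate_def)
        also have "\<dots> = normalizer R" using nrm_cj[OF x S[OF i]] cj_inv'[OF x S[OF R]] by simp
        finally show ?thesis .
      qed
      then show "y \<in> C" using c x cc by (auto simp: C_def)
    qed
    then have "conjugate x C = C" using card_seteq[OF sub_fin[OF sC]] card_cj[OF x subgroup.subset[OF sC]] by simp
    then show ?thesis using x by (simp add: normalizer_def)
  qed
  then have "normalizer C = carrier G" using nrm_closed by auto
  then have "C = {\<one>} \<or> C = carrier G" by (rule simple[OF sC])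
  moreover have "C \<noteq> carrier G"
  proof
    assume e: "C = carrier G"
    obtain M P where M: "M \<in> maximal_subgroups" "P \<in> ?S" "normalizer P \<subseteq> M" using sylow_in_max[OF p] by blast
    have "carrier G \<subseteq> normalizer P" using e M(2) by (auto simp: C_def)
    then have "M = carrier G" using M(1,3) subgroup.subset[of M G] unfolding maximal_subgroups_def by blast
    then show False using M by (simp add: maximal_subgroups_def)
  qed
  ultimately show ?thesis using g by (auto simp: C_def)
qed

text \<open>
  With \<open>p + 1\<close> Sylow subgroups of order \<open>p\<close>, the subgroup \<open>Q\<close> contains its centralizer, by
  \<open>syl_centralizing\<close> and \<open>syl_core_trivial\<close>. So the stabilizer of each non-trivial element of \<open>Q\<close> in the
  normalizer is \<open>Q\<close> itself, and \<open>Q - {\<one>}\<close> splits into orbits of size \<open>k\<close>.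
\<close>

lemma sylow_prime_normalizer:
  assumes p: "prime p" and Q: "Q \<in> sylows p (carrier G)" "card Q = p" and c: "card (sylows p (carrier G)) = p + 1"
  shows "\<exists>k. card (normalizer Q) = p * k \<and> k dvd p - 1"
proof -
  have sQ: "subgroup Q G" "Q \<subseteq> carrier G" using Q by (auto simp: sylows_def)
  have pn: "p dvd n" using card_dvd_order[OF sQ(1)] Q by simp
  have sN: "subgroup (normalizer Q) G" by (rule nrm_subgroup[OF sQ(2)])
  have central: "g \<in> Q" if g: "g \<in> carrier G" "\<And>q. q \<in> Q \<Longrightarrow> g \<otimes> q = q \<otimes> g" for g
  proof -
    obtain v where v: "v \<in> Q" "\<forall>R\<in>sylows p (carrier G). v \<otimes> g \<in> normalizer R"
      using syl_centralizing[OF p Q c g] by blast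
    have vc: "v \<in> carrier G" using v sQ by auto
    have "v \<otimes> g = \<one>" using syl_core_trivial[OF p pn] v vc g by simp
    then have "g = inv v" using vc g by (metis inv_equality m_closed inv_comm)
    then show ?thesis using v sQ by (simp add: subgroup.m_inv_closed)
  qed
  let ?f = "\<lambda>g x. g \<otimes> x \<otimes> inv g"
  have inQ: "?f g x \<in> Q - {\<one>}" if "g \<in> normalizer Q" "x \<in> Q - {\<one>}" for g x
  proof -
    have gc: "g \<in> carrier G" "x \<in> carrier G" using that nrm_closed sQ by auto
    have "conjugate g Q = Q" using that by (simp add: normalizer_def)
    then have "?f g x \<in> Q" using that by (auto simp: conjugate_def)
    moreover have "?f g x \<noteq> \<one>"
    proof
      assume "?f g x = \<one>"
      then have "?f g x = ?f g \<one>" using gc by simp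
      then show False using cj_inj[OF gc(1)] gc that unfolding inj_on_def by blast
    qed
    ultimately show ?thesis by simp
  qed
  have a: "acts (normalizer Q) (Q - {\<one>}) ?f"
    unfolding acts_def using inQ nrm_closed sQ(2)
    by (auto simp: m_assoc inv_mult_group subset_iff)
  have stab: "{g \<in> normalizer Q. ?f g x = x} = Q" if x: "x \<in> Q - {\<one>}" for x
  proof
    have xc: "x \<in> carrier G" using x sQ by auto
    show "{g \<in> normalizer Q. ?f g x = x} \<subseteq> Q"
    proof clarify
      fix g assume g: "g \<in> normalizer Q" "?f g x = x"
      have gc: "g \<in> carrier G" using g nrm_closed by auto
      have gx: "g \<otimes> x = x \<otimes> g" using g(2) gc xc by (metis inv_solve_right m_closed)
      define D where "D = {q \<in> Q. g \<otimes> q = q \<otimes> g}"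
      have sD: "subgroup D G"
      proof (rule subgroupI)
        show "D \<subseteq> carrier G" using sQ by (auto simp: D_def)
        show "D \<noteq> {}" using subgroup.one_closed[OF sQ(1)] gc by (auto simp: D_def)
        fix q assume q: "q \<in> D"
        then have qc: "q \<in> carrier G" "q \<in> Q" "g \<otimes> q = q \<otimes> g" using sQ by (auto simp: D_def)
        have "g \<otimes> inv q = inv q \<otimes> g" using qc gc by (metis inv_solve_left inv_solve_right m_assoc m_closed inv_closed)
        then show "inv q \<in> D" using qc sQ by (auto simp: D_def subgroup.m_inv_closed)
        fix r assume r: "r \<in> D"
        then have rc: "r \<in> carrier G" "r \<in> Q" "g \<otimes> r = r \<otimes> g" using sQ by (auto simp: D_def)
        have "g \<otimes> (q \<otimes> r) = q \<otimes> r \<otimes> g" using qc rc gc by (metis m_assoc)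
        then show "q \<otimes> r \<in> D" using qc rc sQ by (auto simp: D_def subgroup.m_closed)
      qed
      have "card D dvd p" using card_dvd[OF sD sQ(1)] Q by (auto simp: D_def)
      moreover have "card D \<noteq> 1"
      proof
        assume "card D = 1"
        then obtain y where "D = {y}" by (auto simp: card_Suc_eq)
        moreover have "x \<in> D" using x gx by (auto simp: D_def)
        moreover have "\<one> \<in> D" by (rule subgroup.one_closed[OF sD])
        ultimately show False using x by auto
      qed
      ultimately have "card D = card Q" using p Q prime_nat_iff by blast
      then have "D = Q" using card_subset_eq[OF sub_fin[OF sQ(1)], of D] by (auto simp: D_def)
      then show "g \<in> Q" using central[OF gc] by (auto simp: D_def)
    qed
    show "Q \<subseteq> {g \<in> normalizer Q. ?f g x = x}"
    proof
      fix g assume g: "g \<in> Q"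
      have gc: "g \<in> carrier G" using g sQ by auto
      have "g \<otimes> x = x \<otimes> g" using prime_card_commute[OF sQ(1)] p Q g x by auto
      then have "?f g x = x" using gc xc by (simp add: m_assoc)
      then show "g \<in> {g \<in> normalizer Q. ?f g x = x}" using sub_nrm[OF sQ(1)] g by auto
    qed
  qed
  obtain k where k: "card (normalizer Q) = p * k" using card_dvd[OF sQ(1) sN sub_nrm[OF sQ(1)]] Q by (auto simp: dvd_def)
  have "k dvd card (Q - {\<one>})"
  proof (rule orbits_dvd[OF sN a])
    fix x assume x: "x \<in> Q - {\<one>}"
    have "card (orbit (normalizer Q) ?f x) * p = p * k"
      using orbit_stabilizer[OF sN a x] stab[OF x] Q k by simp
    then show "k dvd card (orbit (normalizer Q) ?f x)" using prime_gt_0_nat[OF p] by simp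
  qed (use sub_fin[OF sQ(1)] in simp)
  moreover have "card (Q - {\<one>}) = p - 1" using Q subgroup.one_closed[OF sQ(1)] by (simp add: card_Diff_singleton)
  ultimately show ?thesis using k by auto
qed

text \<open>
  The action on the cosets of \<open>M\<close> is faithful, and the sign of these permutations is a homomorphism with
  trivial image. So the group embeds into an alternating group, whose order is half a factorial.
\<close>

lemma order_dvd_half_fact:
  assumes M: "subgroup M G" "M \<noteq> carrier G"
  shows "2 * n dvd fact (index M)"
proof -
  let ?X = "left_cosets (carrier G) M" let ?d = "index M"
  define A where "A = (\<lambda>g. (`) (\<lambda>x. g \<otimes> x))"
  have Mc: "M \<subseteq> carrier G" using M subgroup.subset by blast
  have a: "acts (carrier G) ?X A" unfolding A_def by (rule acts_lcos[OF subgroup_self subgroup_self order_refl Mc])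
  have cX: "card ?X = ?d" using card_lcos[OF subgroup_self M(1) Mc] idx_mult[OF M(1)] sub_card_pos[OF M(1)]
    by (metis mult_right_cancel neq0_conv)
  have fX: "finite ?X" using fin by (simp add: left_cosets_def)
  then obtain b where b: "bij_betw b {1..?d} ?X" using ex_bij_betw_nat_finite_1[OF fX] cX by auto
  define c where "c = inv_into {1..?d} b"
  have cb: "bij_betw c ?X {1..?d}" unfolding c_def by (rule bij_betw_inv_into[OF b])
  have bc: "b (c x) = x" if "x \<in> ?X" for x using bij_betw_inv_into_right[OF b that] by (simp add: c_def)
  define \<phi> where "\<phi> g k = (if k \<in> {1..?d} then c (A g (b k)) else k)" for g k
  have bX: "k \<in> {1..?d} \<Longrightarrow> b k \<in> ?X" for k using b by (auto simp: bij_betw_def)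
  have cX': "x \<in> ?X \<Longrightarrow> c x \<in> {1..?d}" for x using cb by (auto simp: bij_betw_def)
  have AX: "A g x \<in> ?X" if "g \<in> carrier G" "x \<in> ?X" for g x by (rule acts_closed[OF a that])
  have Amult: "A (g \<otimes> h) x = A g (A h x)" if "g \<in> carrier G" "h \<in> carrier G" "x \<in> ?X" for g h x
    by (rule acts_mult[OF a that])
  have A1: "A \<one> x = x" if "x \<in> ?X" for x by (rule acts_one[OF a that])
  have perm: "\<phi> g permutes {1..?d}" if g: "g \<in> carrier G" for g
  proof (rule bij_imp_permutes)
    have "bij_betw (A g) ?X ?X"
    proof (rule bij_betw_byWitness[where f' = "A (inv g)"])
      show "\<forall>x\<in>?X. A (inv g) (A g x) = x" using Amult[of "inv g" g] A1 g by (metis inv_closed l_inv)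
      show "\<forall>x\<in>?X. A g (A (inv g) x) = x" using Amult[of g "inv g"] A1 g by (metis inv_closed r_inv)
    qed (use AX g in auto)
    then have "bij_betw (c \<circ> A g \<circ> b) {1..?d} {1..?d}"
      using bij_betw_trans[OF b bij_betw_trans[OF _ cb]] by (simp add: comp_assoc)
    then show "bij_betw (\<phi> g) {1..?d} {1..?d}"
      by (rule bij_betw_cong[THEN iffD1, rotated]) (simp add: \<phi>_def)
    show "\<And>x. x \<notin> {1..?d} \<Longrightarrow> \<phi> g x = x" by (auto simp: \<phi>_def)
  qed
  have mult: "\<phi> (g \<otimes> h) = \<phi> g \<circ> \<phi> h" if g: "g \<in> carrier G" "h \<in> carrier G" for g h
  proof
    fix k show "\<phi> (g \<otimes> h) k = (\<phi> g \<circ> \<phi> h) k"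
      using Amult[OF g bX] bc[OF AX[OF g(2) bX]] cX'[OF AX[OF g(2) bX]] by (auto simp: \<phi>_def)
  qed
  interpret \<phi>: group_hom G "sym_group ?d" \<phi>
    by (intro group_hom.intro group_hom_axioms.intro is_group sym_group_is_group)
       (auto simp: hom_def sym_group_carrier sym_group_mult perm mult simp del: One_nat_def)
  have ker: "K = {\<one>} \<or> K = carrier G" if "K \<lhd> G" for K
    using that simple normal_iff_nrm by blast
  have kt: "kernel G (sym_group ?d) \<phi> \<noteq> carrier G"
  proof
    assume k: "kernel G (sym_group ?d) \<phi> = carrier G"
    have MX: "M \<in> ?X" unfolding left_cosets_def
      by (rule image_eqI[of _ _ \<one>]) (use Mc in \<open>force simp: image_def\<close>)+
    have "carrier G \<subseteq> M"
    proof
      fix g assume g: "g \<in> carrier G"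
      have "\<phi> g = id" using k g by (auto simp: kernel_def sym_group_one)
      then have "c (A g (b (c M))) = c M" using cX'[OF MX] by (metis \<phi>_def id_apply)
      then have "A g M = M" using bc[OF MX] bc[OF AX[OF g MX]] by metis
      then have "g \<otimes> \<one> \<in> M" using subgroup.one_closed[OF M(1)] unfolding A_def by blast
      then show "g \<in> M" using g by simp
    qed
    then show False using M Mc by auto
  qed
  then have inj: "inj_on \<phi> (carrier G)"
    using ker[OF \<phi>.normal_kernel] \<phi>.trivial_ker_imp_inj by auto
  interpret s: group_hom G sign_img "sign \<circ> \<phi>"
    by (intro group_hom.intro group_hom_axioms.intro is_group sign_img_is_group)
       (rule Group.hom_compose[OF \<phi>.homh sign_is_hom])
  have "kernel G sign_img (sign \<circ> \<phi>) = carrier G"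
  proof (rule ccontr)
    assume "\<not> ?thesis"
    then have "inj_on (sign \<circ> \<phi>) (carrier G)" using ker[OF s.normal_kernel] s.trivial_ker_imp_inj by auto
    then have "n = card ((sign \<circ> \<phi>) ` carrier G)" by (rule card_image[symmetric])
    also have "\<dots> \<le> card {-1, 1 :: int}" using s.hom_closed by (intro card_mono) (auto simp: sign_img_def)
    finally have "n \<le> 2" by simp
    then have "n = 2" using gt1 by simp
    then show False using not_prime two_is_prime_nat by simp
  qed
  then have ev: "evenperm (\<phi> g)" if "g \<in> carrier G" for g
    using that by (auto simp: kernel_def sign_img_def sign_def split: if_splits)
  have d2: "?d \<ge> 2"
  proof (rule ccontr)
    assume "\<not> ?thesis"
    then have "?d = 1" using idx_pos[OF M(1)] by simp
    then have "card M = n" using idx_mult[OF M(1)] by simp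
    then show False using card_subset_eq[OF fin Mc] M by simp
  qed
  interpret alt: group "alt_group ?d" by (rule alt_group_is_group)
  have "\<phi> \<in> hom G (alt_group ?d)"
    by (auto simp: hom_def alt_group_carrier alt_group_mult sym_group_mult perm ev mult simp del: One_nat_def)
  then interpret p2: group_hom G "alt_group ?d" \<phi>
    by (intro group_hom.intro group_hom_axioms.intro is_group alt.is_group)
  have "subgroup (\<phi> ` carrier G) (alt_group ?d)" by (rule p2.img_is_subgroup)
  from alt.lagrange[OF this] have "card (\<phi> ` carrier G) dvd card (carrier (alt_group ?d))"
    by (metis dvd_triv_right order_def)
  then have "n dvd card (carrier (alt_group ?d))" using inj by (simp add: card_image)
  then show ?thesis using alt_group_card_carrier[OF d2] by (metis dvd_refl mult_dvd_mono)
qed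

end

lemma simple_group_simple_fin:
  fixes G (structure)
  assumes "simple_group G" "finite (carrier G)" "\<not> prime (order G)"
  shows "simple_fin G"
proof -
  interpret simple_group G by fact
  interpret fin_group G by (rule fin_groupI[OF is_group assms(2)])
  show ?thesis
  proof (intro simple_fin.intro fin_group_axioms fin_groupI simple_fin_axioms.intro)
    show "K = {\<one>} \<or> K = carrier G" if "subgroup K G" "normalizer K = carrier G" for K
      using no_real_normal_subgroup[of K] that by (simp add: normal_iff_nrm disj_commute)
  qed (use order_gt_one assms in \<open>simp_all add: order_def\<close>)
qed

section \<open>Arithmetic of indices\<close>

text \<open>
  The centre is the set of fixed points of conjugation, so its size is a multiple of \<open>p\<close>.
\<close>

lemma (in fin_group) p_group_central_subgroup:
  assumes M: "subgroup M G" "card M = p ^ a" "a \<noteq> 0" and p: "prime p"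
  shows "\<exists>T. subgroup T G \<and> T \<subseteq> M \<and> card T = p \<and> M \<subseteq> normalizer T"
proof -
  define Z where "Z = {x \<in> M. \<forall>g\<in>M. g \<otimes> x \<otimes> inv g = x}"
  have Mc: "x \<in> M \<Longrightarrow> x \<in> carrier G" for x using M(1) by (rule subgroup.mem_carrier)
  have a: "acts M M (\<lambda>g x. g \<otimes> x \<otimes> inv g)"
    unfolding acts_def using M(1) Mc
    by (auto simp: m_assoc inv_mult_group subgroup.m_closed subgroup.m_inv_closed)
  have "card Z mod p = 0"
    using fixed_points_mod[OF M(1) p M(2) a sub_fin[OF M(1)]] M(2,3) unfolding Z_def by simp
  moreover have Z_iff: "x \<in> Z \<longleftrightarrow> x \<in> M \<and> (\<forall>g\<in>M. g \<otimes> x = x \<otimes> g)" for x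
    unfolding Z_def using Mc by (auto, metis inv_solve_right m_closed, metis inv_solve_right m_closed)
  have sZ: "subgroup Z G"
  proof (rule subgroupI)
    show "Z \<subseteq> carrier G" using Mc Z_iff by auto
    show "Z \<noteq> {}" using subgroup.one_closed[OF M(1)] Mc Z_iff by force
    fix x assume "x \<in> Z"
    then have x: "x \<in> M" "\<And>g. g \<in> M \<Longrightarrow> g \<otimes> x = x \<otimes> g" using Z_iff by auto
    have "g \<otimes> inv x = inv x \<otimes> g" if "g \<in> M" for g
      using x(2)[OF that] Mc[OF that] Mc[OF x(1)] by (metis inv_solve_left inv_solve_right m_assoc m_closed inv_closed)
    then show "inv x \<in> Z" using x M(1) Z_iff by (auto simp: subgroup.m_inv_closed)
    fix y assume "y \<in> Z"
    then have y: "y \<in> M" "\<And>g. g \<in> M \<Longrightarrow> g \<otimes> y = y \<otimes> g" using Z_iff by auto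
    have "g \<otimes> (x \<otimes> y) = x \<otimes> y \<otimes> g" if "g \<in> M" for g
      using x(2)[OF that] y(2)[OF that] Mc[OF that] Mc[OF x(1)] Mc[OF y(1)] by (metis m_assoc)
    then show "x \<otimes> y \<in> Z" unfolding Z_iff using subgroup.m_closed[OF M(1) x(1) y(1)] by blast
  qed
  ultimately have "p ^ 1 dvd card Z" by auto
  then obtain T where T: "subgroup T G" "T \<subseteq> Z" "card T = p"
    using prime_power_subgroup_ex[OF sZ p, of 1] by auto
  have "conjugate g T = T" if g: "g \<in> M" for g
  proof -
    have "g \<otimes> x \<otimes> inv g = x" if "x \<in> T" for x using that T(2) g by (auto simp: Z_def)
    then show ?thesis by (simp add: conjugate_def)
  qed
  then have "M \<subseteq> normalizer T" using Mc by (auto simp: normalizer_def)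
  then show ?thesis using T by (auto simp: Z_def)
qed

text \<open>
  This is the final contradiction of \<open>no_prime_maximal\<close> below: \<open>i\<close> is the index of a maximal subgroup of prime
  order \<open>p\<close>, and \<open>p j1\<close>, \<open>p j2\<close> are the indices of two other maximal subgroups, of orders \<open>i div j1\<close> and
  \<open>i div j2\<close>. The bound leaves the primes 2, 3 and 5 and a few small \<open>j1\<close>, \<open>j2\<close>.
\<close>

lemma prime_maximal_arith:
  fixes p i j1 j2 s :: nat
  assumes p: "prime p" "i mod p = 1" and j: "j1 dvd i" "j2 dvd i" "2 \<le> j1" "2 \<le> j2"
    and k: "4 \<le> i div j1" "4 \<le> i div j2"
    and s: "prime s" "s dvd j1" "(p * j2) mod s = 1"
    and le: "i + 2 * p * (j1 + j2) \<le> 74"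
  shows False
proof -
  have ns: "\<not> s dvd j2" using s by (auto simp: dvd_def prime_nat_iff)
  then have ne: "j1 \<noteq> j2" using s by auto
  obtain k1 where k1: "i = j1 * k1" "4 \<le> k1" using j(1,3) k(1) by (auto simp: dvd_def)
  obtain k2 where k2: "i = j2 * k2" "4 \<le> k2" using j(2,4) k(2) by (auto simp: dvd_def)
  have i1: "4 * j1 \<le> i" using k1 by simp
  have i2: "4 * j2 \<le> i" using k2 by simp
  have sum5: "j1 + j2 \<ge> 5" using j(3,4) ne by linarith
  have p2: "p \<ge> 2" using p(1) prime_ge_2_nat by blast
  have "2 * p * 5 \<le> 2 * p * (j1 + j2)" using sum5 by (intro mult_le_mono) auto
  moreover have "i \<ge> 12" using i1 i2 j(3,4) ne by linarith
  ultimately have "p < 7" using le by linarith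
  then have "p = 2 \<or> p = 3 \<or> p = 4 \<or> p = 5 \<or> p = 6" using p2 by linarith
  moreover have "\<not> prime (4::nat)" "\<not> prime (6::nat)" by (auto simp: prime_nat_iff intro: exI[of _ 2])
  ultimately have "p = 2 \<or> p = 3 \<or> p = 5" using p(1) by auto
  then show False
  proof (elim disjE)
    assume [simp]: "p = 5"
    have "j1 \<le> 3" "j2 \<le> 3" using le i1 i2 j(3,4) by simp_all
    then have "j1 = 2 \<and> j2 = 3 \<or> j1 = 3 \<and> j2 = 2" using j ne by linarith
    then have "i mod 5 = 1" "i \<le> 24" "i \<ge> 12" "2 dvd i" "3 dvd i" using p le j i1 i2 by auto
    then show False by presburger
  next
    assume [simp]: "p = 3"
    have b: "j1 \<le> 6" "j2 \<le> 6" using le i1 i2 j(3,4) by simp_all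
    have im: "i mod 3 = 1" using p by simp
    have "\<not> 3 dvd i" using im by presburger
    then have "\<not> 3 dvd j1" "\<not> 3 dvd j2" using j(1,2) dvd_trans by blast+
    moreover have "\<not> (j1 = 2 \<and> j2 = 4)" "\<not> (j1 = 4 \<and> j2 = 2)"
      using s ns by (auto dest: prime_dvd_power[of s 2 2, simplified] dvd_trans[of s 2 4])
    moreover have "\<not> 3 dvd (6::nat) \<Longrightarrow> False" by simp
    ultimately have "(j1 = 5 \<or> j2 = 5) \<and> (j1 = 2 \<or> j2 = 2 \<or> j1 = 4 \<or> j2 = 4)"
    proof -
      have "j1 = 2 \<or> j1 = 3 \<or> j1 = 4 \<or> j1 = 5 \<or> j1 = 6" "j2 = 2 \<or> j2 = 3 \<or> j2 = 4 \<or> j2 = 5 \<or> j2 = 6" using b j by linarith+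
      then show ?thesis using \<open>\<not> 3 dvd j1\<close> \<open>\<not> 3 dvd j2\<close> \<open>\<not> (j1 = 2 \<and> j2 = 4)\<close> \<open>\<not> (j1 = 4 \<and> j2 = 2)\<close> ne by auto
    qed
    then have "5 dvd i" "2 dvd i" "i + 6 * 7 \<le> 74" "i \<ge> 20" using j le i1 i2 dvd_trans[of 2 4 i] by auto
    then show False using im by presburger
  next
    assume [simp]: "p = 2"
    have b: "j1 \<le> 8" "j2 \<le> 8" using le i1 i2 j(3,4) by simp_all
    have im: "i mod 2 = 1" using p by simp
    have "\<not> 2 dvd i" using im by presburger
    then have "\<not> 2 dvd j1" "\<not> 2 dvd j2" using j(1,2) dvd_trans by blast+
    then have d: "j1 = 3 \<or> j1 = 5 \<or> j1 = 7" "j2 = 3 \<or> j2 = 5 \<or> j2 = 7" using b j(3,4) by presburger+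
    show False using d ne j(1,2) im le i1 i2
      by (elim disjE; simp) presburger+
  qed
qed

text \<open>
  \<open>J\<close> is going to be the set of indices of maximal subgroups. A member \<open>v\<close> with a prime factor \<open>p\<close>
  forces a member \<open>k\<close>, different from \<open>v\<close>, that is 1 modulo \<open>p\<close>, and \<open>v + k \<le> 37\<close>. Following these
  chains excludes all odd members, unless one of the four patterns occurs; but a non-empty set of even numbers has no member that is 1 modulo 2.
\<close>

lemma index_set_arith:
  fixes J :: "nat set"
  assumes f: "finite J" and sum: "\<Sum>J \<le> 37" and ge: "\<And>j. j \<in> J \<Longrightarrow> 8 \<le> j" and ne: "J \<noteq> {}"
    and pr: "\<And>p j. prime p \<Longrightarrow> j \<in> J \<Longrightarrow> p dvd j \<Longrightarrow> \<exists>k\<in>J. k mod p = 1"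
  shows "{9, 16} \<subseteq> J \<or> {15, 16} \<subseteq> J \<or> {8, 13, 14} \<subseteq> J \<or> {10, 11, 12} \<subseteq> J"
proof (rule ccontr)
  assume "\<not> ?thesis"
  then have c: "9 \<in> J \<Longrightarrow> 16 \<notin> J" "15 \<in> J \<Longrightarrow> 16 \<notin> J" "8 \<in> J \<Longrightarrow> 13 \<in> J \<Longrightarrow> 14 \<notin> J"
    "10 \<in> J \<Longrightarrow> 11 \<in> J \<Longrightarrow> 12 \<notin> J" by blast+
  have sub: "\<Sum>A \<le> 37" if "A \<subseteq> J" for A using sum_mono2[OF f that, of "\<lambda>x. x"] sum by simp
  have s2: "a + b \<le> 37" if "a \<in> J" "b \<in> J" "a \<noteq> b" for a b using sub[of "{a, b}"] that by simp
  have s3: "a + b + c \<le> 37" if "a \<in> J" "b \<in> J" "c \<in> J" "a \<noteq> b" "a \<noteq> c" "b \<noteq> c" for a b c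
    using sub[of "{a, b, c}"] that by simp
  have step: "\<exists>k\<in>J. k mod p = 1 \<and> k \<noteq> v \<and> 8 \<le> k \<and> v + k \<le> 37" if h: "prime p" "v \<in> J" "p dvd v" for p v
  proof -
    obtain k where k: "k \<in> J" "k mod p = 1" using pr[OF h] by blast
    have "k \<noteq> v" using k h by auto
    then show ?thesis using k ge[OF k(1)] s2[OF h(2) k(1)] by auto
  qed
  have P: "prime (2::nat)" "prime (3::nat)" "prime (5::nat)" "prime (7::nat)" "prime (11::nat)" "prime (13::nat)"
    "prime (17::nat)" "prime (19::nat)" "prime (23::nat)" "prime (29::nat)" by simp_all
  have le29: "v \<le> 29" if v: "v \<in> J" for v
  proof -
    have "v \<noteq> 1" using ge[OF v] by simp
    then obtain p where "prime p" "p dvd v" using prime_factor_nat by blast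
    then show ?thesis using step[of p v] v by auto
  qed
  have n29: "29 \<notin> J" using step[OF P(10), of 29] by auto
  have n19: "19 \<notin> J"
  proof
    assume v: "19 \<in> J"
    obtain k where "k \<in> J" "k mod 19 = 1" "8 \<le> k" "19 + k \<le> 37" using step[OF P(8) v] by auto
    then show False by presburger
  qed
  have n23: "23 \<notin> J"
  proof
    assume v: "23 \<in> J"
    obtain k where "k \<in> J" "k mod 23 = 1" "8 \<le> k" "23 + k \<le> 37" using step[OF P(9) v] by auto
    then show False by presburger
  qed
  have n13: "13 \<notin> J"
  proof
    assume v: "13 \<in> J"
    obtain k where k: "k \<in> J" "k mod 13 = 1" "8 \<le> k" "13 + k \<le> 37" using step[OF P(6) v] by auto
    then have "k = 14" by presburger
    then have w: "14 \<in> J" using k by simp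
    obtain k where k: "k \<in> J" "k mod 7 = 1" "8 \<le> k" "14 + k \<le> 37" using step[OF P(4) w] by auto
    then have "k = 8 \<or> k = 15 \<or> k = 22" by presburger
    then show False using k s3[OF v w k(1)] v w c by auto
  qed
  have n11: "11 \<notin> J"
  proof
    assume v: "11 \<in> J"
    obtain k where k: "k \<in> J" "k mod 11 = 1" "8 \<le> k" "11 + k \<le> 37" using step[OF P(5) v] by auto
    then have "k = 12 \<or> k = 23" by presburger
    then have w: "12 \<in> J" using k n23 by auto
    obtain k where k: "k \<in> J" "k mod 3 = 1" "8 \<le> k" "12 + k \<le> 37" using step[OF P(2) w] by auto
    then have "k \<noteq> 11" "k \<noteq> 12" by auto
    then have "k \<le> 14" using s3[OF v w k(1)] by simp
    then have "k = 10 \<or> k = 13" using k by presburger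
    then show False using k v w c n13 by auto
  qed
  have n17: "17 \<notin> J"
  proof
    assume v: "17 \<in> J"
    obtain k where k: "k \<in> J" "k mod 17 = 1" "8 \<le> k" "17 + k \<le> 37" using step[OF P(7) v] by auto
    then have "k = 18" by presburger
    then have w: "18 \<in> J" using k by simp
    obtain k where k: "k \<in> J" "k mod 3 = 1" "8 \<le> k" "18 + k \<le> 37" using step[OF P(2) w] by auto
    then have "k \<noteq> 17" "k \<noteq> 18" by auto
    then show False using s3[OF v w k(1)] k by simp
  qed
  have three: "False" if v: "v \<in> J" "even v" "k \<in> J" "even k" "v \<noteq> k" "v + k \<ge> 30" for v k
  proof -
    obtain o' where o: "o' \<in> J" "o' mod 2 = 1" "8 \<le> o'" using step[OF P(1) v(1)] v(2) by auto
    then have "o' \<noteq> v" "o' \<noteq> k" using v by auto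
    then show False using s3[OF v(1,3) o(1)] v(5,6) o by simp
  qed
  have ten: "16 \<in> J" if v: "10 \<in> J"
  proof -
    obtain k where k: "k \<in> J" "k mod 5 = 1" "8 \<le> k" "10 + k \<le> 37" using step[OF P(3) v] by auto
    then have "k = 11 \<or> k = 16 \<or> k = 21 \<or> k = 26" by presburger
    moreover have "\<not> (26 \<in> J)" using three[of 26 10] v by auto
    moreover have "\<not> (21 \<in> J)"
    proof
      assume w: "21 \<in> J"
      obtain k where k: "k \<in> J" "k mod 7 = 1" "8 \<le> k" "21 + k \<le> 37" using step[OF P(4) w] by auto
      then have "k \<noteq> 10" "k \<noteq> 21" by auto
      then show False using s3[OF v w k(1)] k by simp
    qed
    ultimately show ?thesis using k n11 by auto
  qed
  have n9: "9 \<notin> J"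
  proof
    assume v: "9 \<in> J"
    obtain k where k: "k \<in> J" "k mod 3 = 1" "8 \<le> k" "9 + k \<le> 37" using step[OF P(2) v] by auto
    then have "k = 10 \<or> k = 13 \<or> k = 16 \<or> k = 19 \<or> k = 22 \<or> k = 25 \<or> k = 28" by presburger
    moreover have "22 \<notin> J"
    proof
      assume w: "22 \<in> J"
      obtain k where k: "k \<in> J" "k mod 11 = 1" "8 \<le> k" "22 + k \<le> 37" using step[OF P(5) w] by auto
      then have "k = 12" by presburger
      then show False using three[of 22 12] w k by simp
    qed
    moreover have "25 \<notin> J"
    proof
      assume w: "25 \<in> J"
      obtain k where k: "k \<in> J" "k mod 5 = 1" "8 \<le> k" "25 + k \<le> 37" using step[OF P(3) w] by auto
      then have "k = 11" by presburger
      then show False using n11 k by simp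
    qed
    moreover have "28 \<notin> J"
    proof
      assume w: "28 \<in> J"
      obtain k where k: "k \<in> J" "k mod 7 = 1" "8 \<le> k" "28 + k \<le> 37" using step[OF P(4) w] by auto
      then have "k = 8" by presburger
      then show False using three[of 28 8] w k by simp
    qed
    ultimately show False using k n13 n19 ten v c by auto
  qed
  have n21: "21 \<notin> J"
  proof
    assume w: "21 \<in> J"
    obtain k where k: "k \<in> J" "k mod 7 = 1" "8 \<le> k" "21 + k \<le> 37" using step[OF P(4) w] by auto
    then have k': "k = 8 \<or> k = 15" by presburger
    obtain l where l: "l \<in> J" "l mod 3 = 1" "8 \<le> l" "21 + l \<le> 37" using step[OF P(2) w] by auto
    then have "l \<noteq> 21" "l \<noteq> k" using k' by auto
    then have "k + l \<le> 16" using s3[OF w k(1) l(1)] k' by auto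
    then show False using l k' by auto
  qed
  have n25: "25 \<notin> J"
  proof
    assume w: "25 \<in> J"
    obtain k where k: "k \<in> J" "k mod 5 = 1" "8 \<le> k" "25 + k \<le> 37" using step[OF P(3) w] by auto
    then have "k = 11" by presburger
    then show False using n11 k by simp
  qed
  have n27: "27 \<notin> J"
  proof
    assume w: "27 \<in> J"
    obtain k where k: "k \<in> J" "k mod 3 = 1" "8 \<le> k" "27 + k \<le> 37" using step[OF P(2) w] by auto
    then have "k = 10" by presburger
    then have "10 \<in> J" using k by simp
    then show False using ten s3[of 27 10 16] w by simp
  qed
  have n15: "15 \<notin> J"
  proof
    assume w: "15 \<in> J"
    obtain k where k: "k \<in> J" "k mod 5 = 1" "8 \<le> k" "15 + k \<le> 37" using step[OF P(3) w] by auto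
    then have "k = 11 \<or> k = 16 \<or> k = 21" by presburger
    then show False using n11 n21 k w c by auto
  qed
  have allowed: "even v" if v: "v \<in> J" for v
  proof (rule ccontr)
    assume "odd v"
    moreover have "8 \<le> v" "v \<le> 29" using ge[OF v] le29[OF v] .
    ultimately have "v = 9 \<or> v = 11 \<or> v = 13 \<or> v = 15 \<or> v = 17 \<or> v = 19 \<or> v = 21 \<or> v = 23 \<or> v = 25 \<or> v = 27 \<or> v = 29"
      by presburger
    then show False using v n9 n11 n13 n15 n17 n19 n21 n23 n25 n27 n29 by auto
  qed
  obtain v where "v \<in> J" using ne by auto
  then obtain k where "k \<in> J" "k mod 2 = 1" using step[OF P(1)] allowed by (meson even_iff_mod_2_eq_zero)
  then show False using allowed by auto
qed

section \<open>Minimal simple groups with few subgroups\<close>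

lemma (in simple_fin) maxs_eqD: "M \<in> maximal_subgroups \<Longrightarrow> subgroup K G \<Longrightarrow> M \<subseteq> K \<Longrightarrow> K \<noteq> carrier G \<Longrightarrow> K = M"
  by (auto simp: maximal_subgroups_def)

text \<open>
  What is known of a simple section of least order in a group with 76 subgroups: \<open>hered\<close> is its minimality,
  and 74 does not count the trivial and the whole group.
\<close>

locale few_subgroups = simple_fin +
  assumes hered: "\<And>M. M \<in> proper_subgroups \<Longrightarrow> \<not> prime (card M) \<Longrightarrow> \<exists>A. subgroup A G \<and> A \<noteq> {\<one>} \<and> A \<subset> M \<and> M \<subseteq> normalizer A"
    and few: "card proper_subgroups \<le> 74"
begin

text \<open>
  A maximal subgroup \<open>M\<close> of composite order is the normalizer of a proper non-trivial subgroup \<open>A\<close>. Since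
  \<open>A\<close> determines \<open>M\<close> and is not maximal, the subgroups \<open>A\<close> double the count.
\<close>

lemma card_maximal_pairs:
  assumes X: "X \<subseteq> maximal_subgroups" and Y: "Y \<subseteq> maximal_subgroups" "X \<inter> Y = {}" "\<And>M. M \<in> Y \<Longrightarrow> \<not> prime (card M)"
  shows "card X + 2 * card Y \<le> 74"
proof -
  have "\<exists>A. A \<in> proper_subgroups \<and> A \<subset> M \<and> normalizer A = M" if M: "M \<in> Y" for M
  proof -
    have Mm: "M \<in> maximal_subgroups" using M Y by auto
    then obtain A where A: "subgroup A G" "A \<noteq> {\<one>}" "A \<subset> M" "M \<subseteq> normalizer A" using hered Y(3)[OF M] maxs_props by blast
    have "A \<noteq> carrier G" using A(3) Mm subgroup.subset by (auto simp: maximal_subgroups_def)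
    then have "A \<in> proper_subgroups" using A by (simp add: proper_subgroups_def)
    then show ?thesis using A nrm_max[OF Mm] by blast
  qed
  then obtain \<alpha> where al: "\<And>M. M \<in> Y \<Longrightarrow> \<alpha> M \<in> proper_subgroups \<and> \<alpha> M \<subset> M \<and> normalizer (\<alpha> M) = M" by metis
  have inj: "inj_on \<alpha> Y" by (rule inj_onI) (metis al)
  have nm: "\<alpha> M \<notin> maximal_subgroups" if "M \<in> Y" for M
    using al[OF that] Y(1) that unfolding maximal_subgroups_def by blast
  have fin': "finite X" "finite Y" using X Y finite_subset[OF _ finite_maxs] by auto
  have "card (X \<union> (Y \<union> \<alpha> ` Y)) = card X + card (Y \<union> \<alpha> ` Y)"
    by (rule card_Un_disjoint) (use fin' Y nm X in auto)
  also have "card (Y \<union> \<alpha> ` Y) = card Y + card (\<alpha> ` Y)"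
    by (rule card_Un_disjoint) (use fin' Y nm in auto)
  also have "card (\<alpha> ` Y) = card Y" by (rule card_image[OF inj])
  finally have "card X + 2 * card Y = card (X \<union> (Y \<union> \<alpha> ` Y))" by simp
  also have "\<dots> \<le> card proper_subgroups"
    by (rule card_mono[OF finite_props]) (use X Y maxs_props al in auto)
  finally show ?thesis using few by simp
qed

text \<open>
  A maximal subgroup \<open>P\<close> of prime order \<open>p\<close> and index \<open>i\<close> is a Sylow subgroup, and its \<open>i\<close> conjugates meet
  trivially, which leaves only \<open>i - 1\<close> non-trivial elements for the maximal subgroups that are not conjugate
  to \<open>P\<close>. These have order prime to \<open>p\<close>, and by counting elements their order is a composite
  proper divisor of \<open>i\<close>. So they count twice in \<open>card_maximal_pairs\<close>, and their indices, which are
  multiples of \<open>p\<close>, are too large.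
\<close>

lemma no_prime_maximal:
  assumes P: "P \<in> maximal_subgroups" shows "\<not> prime (card P)"
proof
  assume pr: "prime (card P)"
  define p where "p = card P"
  have p: "prime p" using pr by (simp add: p_def)
  have sP: "subgroup P G" using P by (simp add: maximal_subgroups_def)
  define i where "i = index P"
  have n: "i * p = n" using idx_mult[OF sP] by (simp add: i_def p_def)
  have p2: "p \<ge> 2" using p by (rule prime_ge_2_nat)
  have ipos: "i > 0" using idx_pos[OF sP] by (simp add: i_def)
  have Psyl: "P \<in> sylows p (carrier G)"
  proof -
    obtain R where R: "R \<in> sylows p (carrier G)" using syl_ex[OF subgroup_self p] by blast
    obtain g where g: "g \<in> carrier G" "P \<subseteq> conjugate g R"
      using syl_subset_conj[OF subgroup_self p R sP subgroup.subset[OF sP], of 1] by (auto simp: p_def)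
    have S: "conjugate g R \<in> sylows p (carrier G)" by (rule syl_cj[OF subgroup_self g(1) R])
    then have S': "subgroup (conjugate g R) G" "card (conjugate g R) = p ^ multiplicity p n" by (auto simp: sylows_def)
    then have "conjugate g R \<noteq> carrier G" using not_prime_power[OF p] by auto
    then have "conjugate g R = P" using P S' g unfolding maximal_subgroups_def by blast
    then show ?thesis using S by simp
  qed
  define F where "F = conj_class P"
  have F: "card F = i" "F = sylows p (carrier G)" "F \<subseteq> maximal_subgroups"
    using card_conjs_max[OF P] syl_orbit[OF subgroup_self p Psyl] conjs_maxs[OF P] by (auto simp: F_def i_def conj_class_def)
  have im: "i mod p = 1" using card_syl_mod[OF subgroup_self p] F by simp
  have Fs: "subgroup A G \<and> card A = p" if "A \<in> F" for A using that conjs_subgroup[OF sP] by (auto simp: F_def p_def)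
  have finF: "finite F" using F(3) finite_maxs finite_subset by blast
  define U where "U = (\<Union>A\<in>F. A - {\<one>})"
  have Fdis: "A \<inter> B = {\<one>}" if "A \<in> F" "B \<in> maximal_subgroups" "A \<noteq> B" for A B
  proof -
    have "\<not> A \<subseteq> B" using that F(3) unfolding maximal_subgroups_def by blast
    then show ?thesis using prime_int_trivial[of A B] Fs[OF that(1)] that(2) p by (auto simp: maximal_subgroups_def)
  qed
  have cU: "card U = i * (p - 1)"
    unfolding U_def by (subst card_partition_union[OF finF Fs]) (use Fdis F in auto)
  have finU: "finite U" using finF Fs sub_fin by (auto simp: U_def)
  have Uc: "U \<subseteq> carrier G - {\<one>}" using Fs subgroup.subset by (fastforce simp: U_def)
  have cc: "card (carrier G - {\<one>}) = n - 1" by (simp add: card_Diff_singleton)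
  have cV: "card (carrier G - {\<one>} - U) = i - 1"
  proof -
    have "card (carrier G - {\<one>} - U) = (n - 1) - i * (p - 1)"
      using card_Diff_subset[OF finU Uc] cc cU by simp
    also have "\<dots> = i - 1" using n p2 by (cases p) (auto simp: algebra_simps)
    finally show ?thesis .
  qed
  define Y where "Y = maximal_subgroups - F"
  \<comment> \<open>The \<open>i - 1\<close> non-trivial elements outside the conjugates of \<open>P\<close> have to contain all of \<open>K\<close>.\<close>
  have KU: "K - {\<one>} \<subseteq> carrier G - {\<one>} - U" if K: "K \<in> Y" for K
  proof
    fix x assume x: "x \<in> K - {\<one>}"
    have "subgroup K G" using K by (simp add: Y_def maximal_subgroups_def)
    moreover have "x \<notin> A" if "A \<in> F" for A using Fdis[of A K] that K x by (auto simp: Y_def)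
    ultimately show "x \<in> carrier G - {\<one>} - U" using x by (auto simp: U_def subgroup.mem_carrier)
  qed
  have Ycl: "conj_class K \<subseteq> Y" if K: "K \<in> Y" for K
  proof
    fix L assume L: "L \<in> conj_class K"
    have Km: "K \<in> maximal_subgroups" "K \<notin> F" using K by (auto simp: Y_def)
    obtain g where g: "g \<in> carrier G" "L = conjugate g K" using L by (auto simp: conj_class_def)
    have sK: "subgroup K G" using Km by (simp add: maximal_subgroups_def)
    have "L \<notin> F"
    proof
      assume "L \<in> F"
      then have "conjugate (inv g) L \<in> F" using syl_cj[OF subgroup_self] g F(2) by simp
      then show False using cj_inv[OF g(1) subgroup.subset[OF sK]] g Km by simp
    qed
    then show "L \<in> Y" using conjs_maxs[OF Km(1)] L by (auto simp: Y_def)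
  qed
  have Yj: "\<exists>j. index K = p * j \<and> j dvd i \<and> 2 \<le> j \<and> i div j = card K \<and> 4 \<le> card K \<and> \<not> prime (card K)" if K: "K \<in> Y" for K
  proof -
    have Km: "K \<in> maximal_subgroups" "K \<notin> F" using K by (auto simp: Y_def)
    have sK: "subgroup K G" using Km by (simp add: maximal_subgroups_def)
    have "\<not> p dvd card K"
    proof
      assume "p dvd card K"
      then obtain A where A: "subgroup A G" "A \<subseteq> K" "card A = p"
        using prime_power_subgroup_ex[OF sK p, of 1] by auto
      then have "A \<in> F" unfolding F(2) using Psyl subgroup.subset by (auto simp: sylows_def p_def[symmetric])
      then have "K = A" using maxs_eqD[of A K] A(2) F(3) Km sK by (auto simp: maximal_subgroups_def)
      then show False using \<open>A \<in> F\<close> Km by simp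
    qed
    then have "coprime (card K) p" using p by (simp add: coprime_commute prime_imp_coprime)
    moreover have "card K dvd i * p" using card_dvd_order[OF sK] n by simp
    ultimately have "card K dvd i" by (simp add: coprime_dvd_mult_left_iff)
    then obtain j where j: "i = j * card K" by (auto simp: dvd_def mult.commute)
    have kpos: "card K > 0" by (rule sub_card_pos[OF sK])
    have "index K * card K = p * j * card K" using idx_mult[OF sK] n j by (simp add: ac_simps)
    then have ij: "index K = p * j" using kpos by simp
    \<comment> \<open>A subgroup \<open>K\<close> of order \<open>i\<close> would fill this set, so it would be equal to its conjugates.\<close>
    have "j \<noteq> 1"
    proof
      assume "j = 1"
      then have cK: "card K = i" using j by simp
      have e: "L - {\<one>} = carrier G - {\<one>} - U" if L: "L \<in> Y" "card L = i" for L
      proof (rule card_subset_eq)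
        have "subgroup L G" using L by (simp add: Y_def maximal_subgroups_def)
        then show "card (L - {\<one>}) = card (carrier G - {\<one>} - U)"
          using cV L(2) subgroup.one_closed[OF \<open>subgroup L G\<close>] by (simp add: card_Diff_singleton)
      qed (use fin KU L in auto)
      have "conjugate g K = K" if g: "g \<in> carrier G" for g
      proof -
        have c: "conjugate g K \<in> Y" "card (conjugate g K) = i"
          using Ycl[OF K] g cK card_cj[OF g subgroup.subset[OF sK]] by (auto simp: conj_class_def)
        have "subgroup (conjugate g K) G" by (rule subgroup_cj[OF g sK])
        then have "\<one> \<in> conjugate g K" "\<one> \<in> K" using sK subgroup.one_closed by blast+
        moreover have "conjugate g K - {\<one>} = K - {\<one>}" using e[OF c] e[OF K cK] by simp
        ultimately show ?thesis by blast
      qed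
      then have "normalizer K = carrier G" by (auto simp: normalizer_def)
      then show False using props_nrm Km maxs_props by auto
    qed
    moreover have "j \<noteq> 0" using j ipos by auto
    ultimately have j2: "2 \<le> j" by simp
    \<comment> \<open>Conjugates of a \<open>K\<close> of prime order would have too many elements for this set.\<close>
    have npK: "\<not> prime (card K)"
    proof
      assume q: "prime (card K)"
      define F' where "F' = conj_class K"
      have F's: "subgroup A G \<and> card A = card K" if "A \<in> F'" for A using that conjs_subgroup[OF sK] by (auto simp: F'_def)
      have F'Y: "F' \<subseteq> Y" using Ycl[OF K] by (simp add: F'_def)
      then have finF': "finite F'" using finite_maxs finite_subset by (auto simp: Y_def)
      have "card (\<Union>A\<in>F'. A - {\<one>}) = card F' * (card K - 1)"
      proof (rule card_partition_union[OF finF' F's])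
        fix A B assume AB: "A \<in> F'" "B \<in> F'" "A \<noteq> B"
        then have "A \<in> maximal_subgroups" "B \<in> maximal_subgroups" using F'Y by (auto simp: Y_def)
        then have "\<not> A \<subseteq> B" using AB unfolding maximal_subgroups_def by blast
        then show "A \<inter> B = {\<one>}" using prime_int_trivial[of A B] F's AB q by simp
      qed
      also have "card F' = p * j" using card_conjs_max[OF Km(1)] ij by (simp add: F'_def)
      finally have c: "card (\<Union>A\<in>F'. A - {\<one>}) = p * j * (card K - 1)" .
      have "(\<Union>A\<in>F'. A - {\<one>}) \<subseteq> carrier G - {\<one>} - U" using KU F'Y by blast
      then have h1: "p * j * (card K - 1) \<le> i - 1"
        using card_mono[of "carrier G - {\<one>} - U"] fin c cV by (metis finite_Diff)
      have "card K \<ge> 2" using q by (rule prime_ge_2_nat)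
      then have h2: "p * j * (card K - 1) \<ge> j * card K"
      proof -
        have "card K \<le> 2 * (card K - 1)" using \<open>card K \<ge> 2\<close> by simp
        also have "\<dots> \<le> p * (card K - 1)" using p2 by simp
        finally have "j * card K \<le> j * (p * (card K - 1))" by simp
        then show ?thesis by (simp add: ac_simps)
      qed
      show False using h1 h2 j ipos by linarith
    qed
    have "card K \<noteq> 1"
    proof
      assume "card K = 1"
      then have "K = {\<one>}" using subgroup.one_closed[OF sK] by (auto simp: card_Suc_eq)
      then show False using Km maxs_props by (auto simp: proper_subgroups_def)
    qed
    moreover have "card K \<noteq> 2" "card K \<noteq> 3" using npK two_is_prime_nat by (auto simp: numeral_3_eq_3[symmetric])
    ultimately have "4 \<le> card K" using kpos by linarith
    then show ?thesis using ij j j2 kpos npK by auto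
  qed
  have "card F + 2 * card Y \<le> 74"
  proof (rule card_maximal_pairs[OF F(3)])
    show "\<And>M. M \<in> Y \<Longrightarrow> \<not> prime (card M)" using Yj by blast
  qed (auto simp: Y_def)
  moreover have "\<Sum>(index ` Y) \<le> card Y" by (rule sum_indices_le[OF _ Ycl]) (auto simp: Y_def)
  ultimately have sum: "i + 2 * \<Sum>(index ` Y) \<le> 74" using F by simp
  \<comment> \<open>The index \<open>i\<close> is not 1 modulo its own prime factor \<open>r\<close>, so \<open>sylow_in_max\<close> yields a member of \<open>Y\<close>.\<close>
  have ex: "\<exists>K\<in>Y. index K mod r = 1" if r: "prime r" "r dvd i" for r
  proof -
    have "r dvd n" using r n by (metis dvd_mult2)
    then obtain K where K: "K \<in> maximal_subgroups" "index K mod r = 1" using sylow_in_max[OF r(1)] by blast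
    have "K \<notin> F"
    proof
      assume "K \<in> F"
      then have "index K = i" using idx_conjs[OF P] by (simp add: F_def i_def)
      then show False using K r by auto
    qed
    then show ?thesis using K by (auto simp: Y_def)
  qed
  have "i \<noteq> 1" using n not_prime p by auto
  then obtain r where r: "prime r" "r dvd i" using prime_factor_nat by blast
  obtain K1 where K1: "K1 \<in> Y" using ex[OF r] by blast
  obtain j1 where j1: "index K1 = p * j1" "j1 dvd i" "2 \<le> j1" "i div j1 = card K1" "4 \<le> card K1" using Yj[OF K1] by blast
  have "j1 \<noteq> 1" using j1 by simp
  then obtain s where s: "prime s" "s dvd j1" using prime_factor_nat by blast
  obtain K2 where K2: "K2 \<in> Y" "index K2 mod s = 1" using ex[OF s(1) dvd_trans[OF s(2) j1(2)]] by blast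
  obtain j2 where j2: "index K2 = p * j2" "j2 dvd i" "2 \<le> j2" "i div j2 = card K2" "4 \<le> card K2" using Yj[OF K2(1)] by blast
  have sne: "index K1 \<noteq> index K2"
  proof
    assume "index K1 = index K2"
    then have "s dvd index K2" using j1(1) s(2) by (metis dvd_mult)
    then show False using K2 by auto
  qed
  have finY: "finite Y" using finite_maxs by (simp add: Y_def)
  have "index K1 + index K2 = \<Sum>{index K1, index K2}" using sne by simp
  also have "\<dots> \<le> \<Sum>(index ` Y)" by (rule sum_mono2) (use finY K1 K2 in auto)
  finally have "i + 2 * p * (j1 + j2) \<le> 74" using sum j1(1) j2(1) by (simp add: algebra_simps)
  then show False
    using prime_maximal_arith[OF p im j1(2) j2(2) j1(3) j2(3) _ _ s] j1 j2 K2 by simp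
qed

text \<open>
  All maximal subgroups have composite order now, so there are at most 37 of them.
\<close>

lemma sum_indices: "\<Sum>(index ` maximal_subgroups) \<le> 37"
proof -
  have "2 * card maximal_subgroups \<le> 74" using card_maximal_pairs[of "{}" maximal_subgroups] no_prime_maximal by simp
  moreover have "\<Sum>(index ` maximal_subgroups) \<le> card maximal_subgroups" by (rule sum_indices_le) (use conjs_maxs in auto)
  ultimately show ?thesis by simp
qed

end

section \<open>The order of a minimal simple group with few subgroups\<close>

text \<open>
  This reduces a statement on the divisors of a numeral to finitely many cases that the simplifier decides.
\<close>

lemma dvd_search:
  assumes "(x::nat) dvd N" "N > 0" "P 1" "N < K" "\<forall>x\<in>set [2..<K]. x dvd N \<longrightarrow> P x" shows "P x"
proof (cases "x \<le> 1")
  case True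
  then show ?thesis using assms(1,2,3) by (cases "x = 0") (auto simp: le_Suc_eq)
next
  case False
  then show ?thesis using assms dvd_imp_le[OF assms(1,2)] by auto
qed

lemma bounded_dvd_search:
  assumes "\<forall>x\<in>set [a..<b]. x dvd N \<longrightarrow> P x" "(j::nat) dvd N" "a \<le> j" "j < b" shows "P j"
  using assms by auto

lemma dvd_cancel_nat: "k * a dvd k * b \<Longrightarrow> k > 0 \<Longrightarrow> a dvd (b::nat)"
  by simp

context few_subgroups begin

lemma idx_sum: "A \<subseteq> index ` maximal_subgroups \<Longrightarrow> \<Sum>A \<le> 37"
  using sum_mono2[of "index ` maximal_subgroups" A "\<lambda>x. x"] finite_maxs sum_indices by simp

lemma cnt_sum: "distinct ks \<Longrightarrow> sum_list (map count_order ks) \<le> 74"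
  using sum_cnt_le few order_trans by blast

lemma idx_dvd_order: "j \<in> index ` maximal_subgroups \<Longrightarrow> j dvd n"
proof -
  assume "j \<in> index ` maximal_subgroups"
  then obtain M where "M \<in> maximal_subgroups" "j = index M" by auto
  then show ?thesis using idx_mult[of M] by (metis (no_types, lifting) dvd_triv_left maximal_subgroups_def mem_Collect_eq)
qed

lemma idx_ge_2: "M \<in> maximal_subgroups \<Longrightarrow> 2 \<le> index M"
proof (rule ccontr)
  assume M: "M \<in> maximal_subgroups" and "\<not> 2 \<le> index M"
  have sM: "subgroup M G" "M \<noteq> carrier G" using M by (auto simp: maximal_subgroups_def)
  have "index M = 1" using idx_pos[OF sM(1)] \<open>\<not> 2 \<le> index M\<close> by simp
  then have "card M = n" using idx_mult[OF sM(1)] by simp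
  then show False using card_subset_eq[OF fin subgroup.subset[OF sM(1)]] sM by simp
qed

lemma cnt_index:
  assumes "j \<in> index ` maximal_subgroups" "n = j * m" shows "j \<le> count_order m"
proof -
  obtain M where M: "M \<in> maximal_subgroups" "j = index M" using assms(1) by auto
  then have "card M = m" using idx_mult[of M] assms(2) idx_pos[of M] by (auto simp: maximal_subgroups_def)
  then show ?thesis using cnt_ge_idx[OF M(1)] M(2) by simp
qed

lemma index_mod_prime:
  assumes "prime p" "p dvd n"
  shows "\<exists>j\<in>index ` maximal_subgroups. j mod p = 1 \<and> (\<exists>c. card (sylows p (carrier G)) = j * c \<and> c mod p = 1)"
proof -
  obtain M where M: "M \<in> maximal_subgroups" "index M mod p = 1" "card (sylows p (carrier G)) = index M * card (sylows p M)"
    using sylow_in_max[OF assms] by blast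
  moreover have "card (sylows p M) mod p = 1" using card_syl_mod[OF _ assms(1)] M(1) by (simp add: maximal_subgroups_def)
  ultimately show ?thesis by blast
qed

lemma sylow_count_ge_2:
  assumes "prime p" "p dvd n" shows "2 \<le> card (sylows p (carrier G))"
proof -
  obtain j c where j: "j \<in> index ` maximal_subgroups" "card (sylows p (carrier G)) = j * c" "c mod p = 1"
    using index_mod_prime[OF assms] by blast
  have "c \<noteq> 0" using j(3) by (cases c) auto
  moreover have "2 \<le> j" using j(1) idx_ge_2 by auto
  ultimately have "2 * 1 \<le> j * c" by (intro mult_le_mono) auto
  then show ?thesis using j by simp
qed

text \<open>
  A maximal subgroup above the normalizer of a Sylow subgroup has index 1 modulo \<open>p\<close> and dividing \<open>p + 1\<close>,
  so it is this normalizer. Its order \<open>p k\<close> is not prime.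
\<close>

lemma sylow_count_minimal:
  assumes p: "prime p" and n: "n = p * m" "\<not> p dvd m" and c: "card (sylows p (carrier G)) = p + 1"
  shows "\<exists>k. n = (p + 1) * p * k \<and> k dvd p - 1 \<and> k \<noteq> 1 \<and> p + 1 \<in> index ` maximal_subgroups"
proof -
  have pn: "p dvd n" using n by simp
  obtain M P where M: "M \<in> maximal_subgroups" "index M mod p = 1" "card (sylows p (carrier G)) = index M * card (sylows p M)"
      "P \<in> sylows p (carrier G)" using sylow_in_max[OF p pn] by blast
  have sM: "subgroup M G" using M by (simp add: maximal_subgroups_def)
  have "card P = p" using M(4) syl_prime_powerI[OF p, of "carrier G" 1 m] n by simp
  then obtain k where k: "card (normalizer P) = p * k" "k dvd p - 1"
    using sylow_prime_normalizer[OF p M(4) _ c] by blast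
  have "(p + 1) * (p * k) = n" using card_syl[OF subgroup_self p M(4)] c k nrm_closed by (simp add: Int_absorb1)
  then have e: "n = (p + 1) * p * k" by (simp only: mult.assoc)
  have "index M dvd p + 1" using M(3) c by (metis dvd_triv_left)
  then have "index M \<le> p + 1" by (rule dvd_imp_le) simp
  moreover have "index M \<noteq> p" using M(2) by auto
  moreover have "\<not> index M < p"
    using M(2) idx_ge_2[OF M(1)] by auto
  ultimately have i: "index M = p + 1" by simp
  then have "(p + 1) * card M = (p + 1) * (p * k)" by (metis idx_mult[OF sM] e mult.assoc)
  then have "card M = p * k" by (metis Suc_eq_plus1 mult_left_cancel nat.simps(3))
  then have "k \<noteq> 1" using no_prime_maximal[OF M(1)] p by auto
  then show ?thesis using e k i M(1) by (metis imageI)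
qed

text \<open>
  There are 16 Sylow 3-subgroups. If two of them met in a subgroup \<open>D\<close> of order 3, the normalizer of \<open>D\<close>
  would contain both; but its order is at most 18, as its index is at least 8, and a group of order 9 or 18
  has a single Sylow 3-subgroup. So they have 128 non-trivial elements, and the remaining 15 leave room for
  one Sylow 2-subgroup only.
\<close>

lemma no_order_144:
  assumes n: "n = 144" and ge: "\<And>M. M \<in> maximal_subgroups \<Longrightarrow> 8 \<le> index M" shows False
proof -
  have P3: "prime (3::nat)" and P2: "prime (2::nat)" by simp_all
  have np: "\<not> 3 dvd (16::nat)" "\<not> 2 dvd (9::nat)" by simp_all
  have n3: "n = 3 ^ 2 * 16" and n2: "n = 2 ^ 4 * 9" using n by simp_all
  let ?S = "sylows 3 (carrier G)"
  have S: "?S = {P. subgroup P G \<and> P \<subseteq> carrier G \<and> card P = 3 ^ 2}" by (rule syl_prime_powerI[OF P3 n3 np(1)])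
  have S2: "sylows 2 (carrier G) = {P. subgroup P G \<and> P \<subseteq> carrier G \<and> card P = 2 ^ 4}" by (rule syl_prime_powerI[OF P2 n2 np(2)])
  have s: "card ?S dvd 16" by (rule card_syl_dvd[OF subgroup_self P3 n3 np(1)])
  obtain R0 where R0: "R0 \<in> ?S" using syl_ex[OF subgroup_self P3] by blast
  have R0p: "R0 \<in> proper_subgroups" using R0 S n by (auto simp: proper_subgroups_def)
  have "card ?S = card (conj_class R0)" using syl_orbit[OF subgroup_self P3 R0] by (simp add: conj_class_def)
  then have s8: "8 \<le> card ?S" using conjs_ge[OF ge R0p] by simp
  have A: "\<forall>x\<in>set [2..<17::nat]. x dvd 16 \<longrightarrow> (x mod 3 = 1 \<and> 8 \<le> x \<longrightarrow> x = 16)" by (simp add: upt_rec_numeral del: set_upt)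
  have s16: "card ?S = 16"
    using dvd_search[OF s _ _ _ A] card_syl_mod[OF subgroup_self P3] s8 by simp
  have ti: "A \<inter> B = {\<one>}" if A: "A \<in> ?S" and B: "B \<in> ?S" and AB: "A \<noteq> B" for A B
  proof (rule ccontr)
    assume nt: "A \<inter> B \<noteq> {\<one>}"
    let ?D = "A \<inter> B"
    have sA: "subgroup A G" "card A = 3 ^ 2" and sB: "subgroup B G" "card B = 3 ^ 2" using A B S by auto
    have sD: "subgroup ?D G" by (rule subgroups_Inter_pair[OF sA(1) sB(1)])
    have "card ?D dvd 3 ^ 2" using card_dvd[OF sD sA(1)] sA by simp
    then have "card ?D dvd 9" by simp
    moreover have A: "\<forall>x\<in>set [2..<10::nat]. x dvd 9 \<longrightarrow> x = 1 \<or> x = 3 \<or> x = 9" by (simp add: upt_rec_numeral del: set_upt)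
    ultimately have "card ?D = 1 \<or> card ?D = 3 \<or> card ?D = 9" using dvd_search[OF _ _ _ _ A, of "card ?D"] by simp
    moreover have "card ?D \<noteq> 1"
    proof
      assume "card ?D = 1"
      then obtain x where "?D = {x}" by (auto simp: card_Suc_eq)
      then show False using subgroup.one_closed[OF sD] nt by auto
    qed
    moreover have "card ?D \<noteq> 9"
    proof
      assume "card ?D = 9"
      then have "?D = A" "?D = B"
        using card_subset_eq[OF sub_fin[OF sA(1)], of ?D] card_subset_eq[OF sub_fin[OF sB(1)], of ?D] sA sB by auto
      then show False using AB by simp
    qed
    ultimately have c3: "card ?D = 3" by simp
    have Dp: "?D \<in> proper_subgroups" using sD c3 n by (auto simp: proper_subgroups_def)
    let ?L = "normalizer ?D"
    have sL: "subgroup ?L G" by (rule nrm_subgroup[OF subgroup.subset[OF sD]])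
    have AL: "A \<subseteq> ?L" by (rule prime_index_normal[OF sA P3 sD]) (use c3 sA in auto)
    have BL: "B \<subseteq> ?L" by (rule prime_index_normal[OF sB P3 sD]) (use c3 sB in auto)
    have i8: "8 \<le> index ?L" by (rule idx_ge_proper[OF ge sL props_nrm[OF Dp]])
    have "index ?L * card ?L = 144" using idx_mult[OF sL] n by simp
    then have "8 * card ?L \<le> 144" using mult_le_mono1[OF i8, of "card ?L"] by simp
    then have "card ?L \<le> 18" by simp
    have "9 dvd card ?L" using card_dvd[OF sA(1) sL AL] sA by simp
    then obtain t where t: "card ?L = 9 * t" by (auto simp: dvd_def)
    have "t > 0" using sub_card_pos[OF sL] t by simp
    then have t12: "t = 1 \<or> t = 2" using \<open>card ?L \<le> 18\<close> t by auto
    then have nt3: "\<not> 3 dvd t" by auto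
    have tL: "card ?L = 3 ^ 2 * t" using t by simp
    have "card (sylows 3 ?L) dvd t" by (rule card_syl_dvd[OF sL P3 tL nt3])
    then have "card (sylows 3 ?L) \<le> 2" using t12 dvd_imp_le[of "card (sylows 3 ?L)" t] \<open>t > 0\<close> by auto
    moreover have "card (sylows 3 ?L) mod 3 = 1" by (rule card_syl_mod[OF sL P3])
    ultimately have "card (sylows 3 ?L) = 1" by (cases "card (sylows 3 ?L) = 0"; cases "card (sylows 3 ?L) = 2") auto
    moreover have "A \<in> sylows 3 ?L" "B \<in> sylows 3 ?L" using syl_prime_powerI[OF P3 tL nt3] sA sB AL BL by auto
    ultimately show False using AB by (metis card_1_singletonE singletonD)
  qed
  define U where "U = (\<Union>A\<in>?S. A - {\<one>})"
  have cU: "card U = 16 * (9 - 1)" unfolding U_def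
    by (subst card_partition_union[OF syl_finite]) (use S ti s16 in auto)
  have Uc: "U \<subseteq> carrier G - {\<one>}" using S by (auto simp: U_def)
  then have finU: "finite U" using fin finite_subset by (metis finite_Diff)
  have cV: "card (carrier G - {\<one>} - U) = 15"
    using card_Diff_subset[OF finU Uc] cU n by (simp add: card_Diff_singleton)
  have e: "P - {\<one>} = carrier G - {\<one>} - U" if P: "P \<in> sylows 2 (carrier G)" for P
  proof (rule card_subset_eq)
    have sP: "subgroup P G" "card P = 2 ^ 4" using P S2 by auto
    show "card (P - {\<one>}) = card (carrier G - {\<one>} - U)"
      using cV sP(2) subgroup.one_closed[OF sP(1)] by (simp add: card_Diff_singleton)
    have "P \<inter> A = {\<one>}" if "A \<in> ?S" for A
      by (rule coprime_int_trivial) (use that S sP in \<open>auto simp: coprime_iff_gcd_eq_1 gcd_nat.simps\<close>)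
    then show "P - {\<one>} \<subseteq> carrier G - {\<one>} - U" using subgroup.subset[OF sP(1)] by (auto simp: U_def)
  qed (use fin in simp)
  obtain P where P: "P \<in> sylows 2 (carrier G)" using syl_ex[OF subgroup_self P2] by blast
  have "P' = P" if P': "P' \<in> sylows 2 (carrier G)" for P'
  proof -
    have "\<one> \<in> P" "\<one> \<in> P'" using P P' subgroup.one_closed by (auto simp: sylows_def)
    then show ?thesis using e[OF P] e[OF P'] by blast
  qed
  then have "sylows 2 (carrier G) = {P}" using P by blast
  then have "card (sylows 2 (carrier G)) = 1" by simp
  moreover have Pp: "P \<in> proper_subgroups" using P S2 n by (auto simp: proper_subgroups_def)
  have "card (sylows 2 (carrier G)) = card (conj_class P)" using syl_orbit[OF subgroup_self P2 P] by (simp add: conj_class_def)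
  ultimately show False using conjs_ge[OF ge Pp] by simp
qed

text \<open>
  In each of the four patterns of \<open>index_set_arith\<close> the order has many divisors. The maximal subgroups and
  subgroups of prime power order have different orders, and each order contributes at least as many
  subgroups as the least index; together these are more than 74.
\<close>

lemma no_index_ge_8:
  assumes ge: "\<And>j. j \<in> index ` maximal_subgroups \<Longrightarrow> 8 \<le> j" shows False
proof -
  let ?J = "index ` maximal_subgroups"
  have geM: "\<And>M. M \<in> maximal_subgroups \<Longrightarrow> 8 \<le> index M" using ge by blast
  have pp: "8 \<le> count_order (p ^ a)" if "prime p" "p ^ a dvd n" "a \<noteq> 0" for p a
    using cnt_ge_prime_power[OF geM that] .
  have pp': "d \<le> count_order (p ^ a)" if "\<And>j. j \<in> ?J \<Longrightarrow> d \<le> j" "prime p" "p ^ a dvd n" "a \<noteq> 0" for p a d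
    using cnt_ge_prime_power[OF _ that(2-4)] that(1) by blast
  have npos: "n \<noteq> 0" using gt1 by simp
  have "{9, 16} \<subseteq> ?J \<or> {15, 16} \<subseteq> ?J \<or> {8, 13, 14} \<subseteq> ?J \<or> {10, 11, 12} \<subseteq> ?J"
  proof (rule index_set_arith)
    fix p j assume p: "prime p" "j \<in> ?J" "p dvd j"
    then have "p dvd n" using idx_dvd_order dvd_trans by blast
    then show "\<exists>k\<in>?J. k mod p = 1" using index_mod_prime[OF p(1)] by blast
  qed (use finite_maxs sum_indices ge maxs_ex in auto)
  then consider "{9, 16} \<subseteq> ?J" "n \<noteq> 144" | "{9, 16} \<subseteq> ?J" "n = 144" | "{15, 16} \<subseteq> ?J" | "{8, 13, 14} \<subseteq> ?J" | "{10, 11, 12} \<subseteq> ?J"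
    by blast
  then show False
  proof cases
    case 1
    have "9 dvd n" "16 dvd n" using 1 idx_dvd_order by auto
    then have "9 * 16 dvd n" by (intro divides_mult) (auto simp: coprime_iff_gcd_eq_1 gcd_nat.simps)
    then obtain m where m: "n = 144 * m" by (auto simp: dvd_def)
    \<comment> \<open>For \<open>m = 1\<close> the maximal subgroups would have the prime power orders 9 and 16.\<close>
    have m2: "m \<ge> 2" using m 1 npos by (cases m) auto
    have c: "9 \<le> count_order (16 * m)" "16 \<le> count_order (9 * m)"
      using 1 cnt_index[of 9 "16 * m"] cnt_index[of 16 "9 * m"] m by auto
    have d: "2 ^ 1 dvd n" "2 ^ 2 dvd n" "2 ^ 3 dvd n" "2 ^ 4 dvd n" "3 ^ 1 dvd n" "3 ^ 2 dvd n"
      using m by (auto intro!: dvd_mult2)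
    show False
    proof (cases "8 \<in> ?J")
      case True
      have "8 \<le> count_order (18 * m)" using True cnt_index[of 8 "18 * m"] m by auto
      moreover have "8 \<le> count_order 2" "8 \<le> count_order 4" "8 \<le> count_order 8" "8 \<le> count_order 16" "8 \<le> count_order 3" "8 \<le> count_order 9"
        using pp[OF _ d(1)] pp[OF _ d(2)] pp[OF _ d(3)] pp[OF _ d(4)] pp[OF _ d(5)] pp[OF _ d(6)] by simp_all
      moreover have "distinct [18 * m, 16 * m, 9 * m, 2, 4, 8, 16, 3, 9]" using m2 by auto
      ultimately show False using c cnt_sum[of "[18 * m, 16 * m, 9 * m, 2, 4, 8, 16, 3, 9]"] by simp
    next
      case False
      have g9: "9 \<le> j" if "j \<in> ?J" for j using ge[OF that] False that by (cases "j = 8") auto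
      have "9 \<le> count_order 2" "9 \<le> count_order 4" "9 \<le> count_order 8" "9 \<le> count_order 16" "9 \<le> count_order 3" "9 \<le> count_order 9"
        using pp'[OF g9 _ d(1)] pp'[OF g9 _ d(2)] pp'[OF g9 _ d(3)] pp'[OF g9 _ d(4)] pp'[OF g9 _ d(5)] pp'[OF g9 _ d(6)] by simp_all
      moreover have "distinct [16 * m, 9 * m, 2, 4, 8, 16, 3, 9]" using m2 by auto
      ultimately show False using c cnt_sum[of "[16 * m, 9 * m, 2, 4, 8, 16, 3, 9]"] by simp
    qed
  next
    case 2
    show False by (rule no_order_144[OF 2(2) geM])
  next
    case 3
    have "15 dvd n" "16 dvd n" using 3 idx_dvd_order by auto
    then have "15 * 16 dvd n" by (intro divides_mult) (auto simp: coprime_iff_gcd_eq_1 gcd_nat.simps)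
    then obtain m where m: "n = 240 * m" by (auto simp: dvd_def)
    have m1: "m \<ge> 1" using m npos by (cases m) auto
    have c: "15 \<le> count_order (16 * m)" "16 \<le> count_order (15 * m)"
      using 3 cnt_index[of 15 "16 * m"] cnt_index[of 16 "15 * m"] m by auto
    have d: "2 ^ 1 dvd n" "2 ^ 2 dvd n" "2 ^ 3 dvd n" "3 ^ 1 dvd n" "5 ^ 1 dvd n"
      using m by (auto intro!: dvd_mult2)
    have g: "15 \<le> j" if j: "j \<in> ?J" for j
      using idx_sum[of "{15, 16, j}"] 3 j ge[OF j] by (cases "j = 15 \<or> j = 16") auto
    have "15 \<le> count_order 2" "15 \<le> count_order 4" "15 \<le> count_order 8" "15 \<le> count_order 3" "15 \<le> count_order 5"
      using pp'[OF g _ d(1)] pp'[OF g _ d(2)] pp'[OF g _ d(3)] pp'[OF g _ d(4)] pp'[OF g _ d(5)] by simp_all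
    moreover have "distinct [16 * m, 15 * m, 2, 4, 8, 3, 5]" using m1 by auto
    ultimately show False using c cnt_sum[of "[16 * m, 15 * m, 2, 4, 8, 3, 5]"] by simp
  next
    case 4
    have "8 dvd n" "13 dvd n" "14 dvd n" using 4 idx_dvd_order by auto
    then have "8 * 13 dvd n" by (intro divides_mult) (auto simp: coprime_iff_gcd_eq_1 gcd_nat.simps)
    moreover have "7 dvd n" using dvd_trans[of 7 14 n] \<open>14 dvd n\<close> by simp
    ultimately have "(8 * 13) * 7 dvd n" by (intro divides_mult) (auto simp: coprime_iff_gcd_eq_1 gcd_nat.simps)
    then obtain m where m: "n = 728 * m" by (auto simp: dvd_def)
    have m1: "m \<ge> 1" using m npos by (cases m) auto
    have c: "8 \<le> count_order (91 * m)" "13 \<le> count_order (56 * m)" "14 \<le> count_order (52 * m)"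
      using 4 cnt_index[of 8 "91 * m"] cnt_index[of 13 "56 * m"] cnt_index[of 14 "52 * m"] m by auto
    have d: "2 ^ 1 dvd n" "2 ^ 2 dvd n" "2 ^ 3 dvd n" "7 ^ 1 dvd n" "13 ^ 1 dvd n"
      using m by (auto intro!: dvd_mult2)
    have "8 \<le> count_order 2" "8 \<le> count_order 4" "8 \<le> count_order 8" "8 \<le> count_order 7" "8 \<le> count_order 13"
      using pp[OF _ d(1)] pp[OF _ d(2)] pp[OF _ d(3)] pp[OF _ d(4)] pp[OF _ d(5)] by simp_all
    moreover have "distinct [91 * m, 56 * m, 52 * m, 2, 4, 8, 7, 13]" using m1 by auto
    ultimately show False using c cnt_sum[of "[91 * m, 56 * m, 52 * m, 2, 4, 8, 7, 13]"] by simp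
  next
    case 5
    have "10 dvd n" "11 dvd n" "12 dvd n" using 5 idx_dvd_order by auto
    then have "12 * 11 dvd n" by (intro divides_mult) (auto simp: coprime_iff_gcd_eq_1 gcd_nat.simps)
    moreover have "5 dvd n" using dvd_trans[of 5 10 n] \<open>10 dvd n\<close> by simp
    ultimately have "(12 * 11) * 5 dvd n" by (intro divides_mult) (auto simp: coprime_iff_gcd_eq_1 gcd_nat.simps)
    then obtain m where m: "n = 660 * m" by (auto simp: dvd_def)
    have m1: "m \<ge> 1" using m npos by (cases m) auto
    have c: "10 \<le> count_order (66 * m)" "11 \<le> count_order (60 * m)" "12 \<le> count_order (55 * m)"
      using 5 cnt_index[of 10 "66 * m"] cnt_index[of 11 "60 * m"] cnt_index[of 12 "55 * m"] m by auto
    have d: "2 ^ 1 dvd n" "2 ^ 2 dvd n" "3 ^ 1 dvd n" "5 ^ 1 dvd n" "11 ^ 1 dvd n"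
      using m by (auto intro!: dvd_mult2)
    have g: "10 \<le> j" if j: "j \<in> ?J" for j
      using idx_sum[of "{10, 11, 12, j}"] 5 j ge[OF j] by (cases "j = 10 \<or> j = 11 \<or> j = 12") auto
    have "10 \<le> count_order 2" "10 \<le> count_order 4" "10 \<le> count_order 3" "10 \<le> count_order 5" "10 \<le> count_order 11"
      using pp'[OF g _ d(1)] pp'[OF g _ d(2)] pp'[OF g _ d(3)] pp'[OF g _ d(4)] pp'[OF g _ d(5)] by simp_all
    moreover have "distinct [66 * m, 60 * m, 55 * m, 2, 4, 3, 5, 11]" using m1 by auto
    ultimately show False using c cnt_sum[of "[66 * m, 60 * m, 55 * m, 2, 4, 3, 5, 11]"] by simp
  qed
qed

text \<open>
  The order divides 7!/2, and some index is 1 modulo 7. The bound 37 leaves 8 and 15, and 15 would force a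
  third index that is 1 modulo 5. For 8 there are eight Sylow 7-subgroups, and the order is 168, that of
  \<open>PSL(2,7)\<close>. With 28 Sylow 3-subgroups and their normalizers there are more than 74
  subgroups. With 7, they all lie in one maximal subgroup of order 21, which is then normal.
\<close>

lemma index_7_imp_False:
  assumes ge: "\<And>j. j \<in> index ` maximal_subgroups \<Longrightarrow> 7 \<le> j" and J7: "7 \<in> index ` maximal_subgroups" shows False
proof -
  let ?J = "index ` maximal_subgroups"
  have geM: "\<And>M. M \<in> maximal_subgroups \<Longrightarrow> 7 \<le> index M" using ge by blast
  obtain M7 where M7: "M7 \<in> maximal_subgroups" "index M7 = 7" using J7 by force
  have "2 * n dvd fact 7" using order_dvd_half_fact[of M7] M7 by (auto simp: maximal_subgroups_def)
  then have "2 * n dvd 2 * 2520" by (simp add: fact_numeral)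
  then have nd: "n dvd 2520" by simp
  have n7: "7 dvd n" using idx_dvd_order[OF J7] .
  have le: "j \<le> 30" if "j \<in> ?J" "j \<noteq> 7" for j using idx_sum[of "{7, j}"] J7 that by auto
  have le2: "j + k \<le> 30" if "j \<in> ?J" "j \<noteq> 7" "k \<in> ?J" "k \<noteq> 7" "j \<noteq> k" for j k using idx_sum[of "{7, j, k}"] J7 that by auto
  have P7: "prime (7::nat)" and P5: "prime (5::nat)" and P3: "prime (3::nat)" by simp_all
  obtain j c where j: "j \<in> ?J" "j mod 7 = 1" "card (sylows 7 (carrier G)) = j * c" "c mod 7 = 1"
    using index_mod_prime[OF P7 n7] by blast
  have jd: "j dvd 2520" using idx_dvd_order[OF j(1)] nd dvd_trans by blast
  have A: "\<forall>x\<in>set [2..<31::nat]. x dvd 2520 \<longrightarrow> x mod 7 = 1 \<longrightarrow> x = 1 \<or> x = 8 \<or> x = 15" by (simp add: upt_rec_numeral del: set_upt)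
  from bounded_dvd_search[OF A jd] have "j = 8 \<or> j = 15" using j(2) le[OF j(1)] ge[OF j(1)] by (cases "j = 7") auto
  moreover have "j \<noteq> 15"
  proof
    assume j15: "j = 15"
    then have "5 dvd n" using idx_dvd_order[OF j(1)] dvd_trans[of 5 15 n] by simp
    then obtain k where k: "k \<in> ?J" "k mod 5 = 1" using index_mod_prime[OF P5] by blast
    have "k \<noteq> 7" "k \<noteq> j" using k j15 by auto
    then have "k \<le> 15" using le2[of j k] j j15 k by auto
    moreover have kd: "k dvd 2520" using idx_dvd_order[OF k(1)] nd dvd_trans by blast
    have A: "\<forall>x\<in>set [2..<16::nat]. x dvd 2520 \<longrightarrow> x mod 5 = 1 \<longrightarrow> x = 1 \<or> x = 6" by (simp add: upt_rec_numeral del: set_upt)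
    note bounded_dvd_search[OF A kd]
    ultimately show False using k(2) ge[OF k(1)] by auto
  qed
  ultimately have j8: "j = 8" by simp
  have "8 dvd n" using idx_dvd_order[OF j(1)] j8 by simp
  then have "7 * 8 dvd n" using n7 by (intro divides_mult) (auto simp: coprime_iff_gcd_eq_1 gcd_nat.simps)
  then obtain m where m: "n = 56 * m" by (auto simp: dvd_def)
  have "56 * m dvd 56 * 45" using nd m by simp
  then have m45: "m dvd 45" by (rule dvd_cancel_nat) simp
  have n7m: "n = 7 * (8 * m)" using m by simp
  have np7: "\<not> 7 dvd 8 * m"
  proof
    assume "7 dvd 8 * m"
    then have "7 dvd m" by presburger
    then have "7 dvd (45::nat)" using m45 dvd_trans by blast
    then show False by simp
  qed
  have "card (sylows 7 (carrier G)) dvd 8 * m"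
    using card_syl_dvd[OF subgroup_self P7, of 1 "8 * m"] n7m np7 by simp
  then have "8 * c dvd 8 * m" using j j8 by simp
  then have "c dvd m" by (rule dvd_cancel_nat) simp
  then have c45: "c dvd 45" using m45 dvd_trans by blast
  have A: "\<forall>x\<in>set [2..<46::nat]. x dvd 45 \<longrightarrow> (x mod 7 = 1 \<longrightarrow> x = 1 \<or> x = 15)" by (simp add: upt_rec_numeral del: set_upt)
  have "c = 1 \<or> c = 15" using dvd_search[OF c45 _ _ _ A] j(4) by simp
  moreover have "sylows 7 (carrier G) \<subseteq> {K \<in> proper_subgroups. card K = 7}"
  proof
    fix P assume "P \<in> sylows 7 (carrier G)"
    then have P: "subgroup P G" "card P = 7" using syl_prime_powerI[OF P7, of "carrier G" 1 "8 * m"] n7m np7 by auto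
    then show "P \<in> {K \<in> proper_subgroups. card K = 7}" using not_prime P7 by (auto simp: proper_subgroups_def)
  qed
  then have c7: "card (sylows 7 (carrier G)) \<le> count_order 7" unfolding count_order_def using finite_props by (intro card_mono) auto
  moreover have "count_order 7 \<le> 74" using cnt_sum[of "[7]"] by simp
  ultimately have c8: "card (sylows 7 (carrier G)) = 7 + 1" using j j8 by auto
  then obtain k where k: "n = (7 + 1) * 7 * k" "k dvd 7 - 1" "k \<noteq> 1"
    using sylow_count_minimal[OF P7 n7m np7] by blast
  have "k = m" using k(1) m by simp
  have A: "\<forall>x\<in>set [2..<46::nat]. x dvd 45 \<longrightarrow> (x dvd 6 \<longrightarrow> x = 1 \<or> x = 3)" by (simp add: upt_rec_numeral del: set_upt)
  have "m = 3" using dvd_search[OF m45 _ _ _ A] k \<open>k = m\<close> by auto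
  then have n168: "n = 168" using m by simp
  have n3: "n = 3 * 56" using n168 by simp
  have np3: "\<not> 3 dvd (56::nat)" by simp
  have S3: "sylows 3 (carrier G) = {P. subgroup P G \<and> P \<subseteq> carrier G \<and> card P = 3 ^ 1}"
    using syl_prime_powerI[OF P3, of "carrier G" 1 56] n3 np3 by simp
  have s3: "card (sylows 3 (carrier G)) dvd 56"
    using card_syl_dvd[OF subgroup_self P3, of 1 56] n3 np3 by simp
  have A: "\<forall>x\<in>set [2..<57::nat]. x dvd 56 \<longrightarrow> (x mod 3 = 1 \<longrightarrow> x = 1 \<or> x = 4 \<or> x = 7 \<or> x = 28)" by (simp add: upt_rec_numeral del: set_upt)
  have "card (sylows 3 (carrier G)) \<in> {1, 4, 7, 28}"
    using dvd_search[OF s3 _ _ _ A]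
      card_syl_mod[OF subgroup_self P3] by simp
  moreover obtain R where R: "R \<in> sylows 3 (carrier G)" using syl_ex[OF subgroup_self P3] by blast
  have sR: "subgroup R G" "card R = 3" using R S3 by auto
  have Rp: "R \<in> proper_subgroups" using sR n168 by (auto simp: proper_subgroups_def)
  have cR: "card (sylows 3 (carrier G)) = index (normalizer R)"
    using card_conjs_idx[OF sR(1)] syl_orbit[OF subgroup_self P3 R] by (simp add: conj_class_def)
  have sNR: "subgroup (normalizer R) G" by (rule nrm_subgroup[OF subgroup.subset[OF sR(1)]])
  have "7 \<le> index (normalizer R)" by (rule idx_ge_proper[OF geM sNR props_nrm[OF Rp]])
  ultimately have "card (sylows 3 (carrier G)) = 7 \<or> card (sylows 3 (carrier G)) = 28" using cR by auto
  then show False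
  proof
    assume s28: "card (sylows 3 (carrier G)) = 28"
    have sub3: "sylows 3 (carrier G) \<subseteq> {K \<in> proper_subgroups. card K = 3}" using S3 n168 by (auto simp: proper_subgroups_def)
    have "28 \<le> count_order 3" unfolding count_order_def s28[symmetric] using finite_props sub3 by (intro card_mono) auto
    \<comment> \<open>The normalizers of the Sylow 3-subgroups have order 6, and they are all different.\<close>
    moreover have "28 \<le> count_order 6"
    proof -
      have inj: "inj_on normalizer (sylows 3 (carrier G))"
      proof (rule inj_onI)
        fix A B assume AB: "A \<in> sylows 3 (carrier G)" "B \<in> sylows 3 (carrier G)" "normalizer A = normalizer B"
        have "A \<subseteq> normalizer A" using sub_nrm AB(1) by (simp add: sylows_def)
        then show "A = B" using syl_normalized_eq[OF subgroup_self P3 AB(2,1)] AB(3) by simp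
      qed
      have "normalizer ` sylows 3 (carrier G) \<subseteq> {K \<in> proper_subgroups. card K = 6}"
      proof clarify
        fix A assume A: "A \<in> sylows 3 (carrier G)"
        have sA: "subgroup (normalizer A) G" using nrm_subgroup A by (auto simp: sylows_def dest: subgroup.subset)
        have "28 * card (normalizer A) = 168" using card_syl[OF subgroup_self P3 A] s28 n168 nrm_closed by (simp add: Int_absorb1)
        then have "card (normalizer A) = 6" by simp
        then show "normalizer A \<in> proper_subgroups \<and> card (normalizer A) = 6" using sA n168 by (auto simp: proper_subgroups_def)
      qed
      then have "card (normalizer ` sylows 3 (carrier G)) \<le> count_order 6" unfolding count_order_def using finite_props by (intro card_mono) auto
      then show ?thesis using card_image[OF inj] s28 by simp
    qed
    moreover have "8 \<le> count_order 21" using cnt_index[of 8 21] j(1) j8 n168 by simp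
    moreover have "7 \<le> count_order 24" using cnt_index[of 7 24] J7 n168 by simp
    moreover have "8 \<le> count_order 7" using c7 c8 by simp
    ultimately show False using cnt_sum[of "[3, 6, 21, 24, 7]"] by simp
  next
    assume s7: "card (sylows 3 (carrier G)) = 7"
    obtain M8 where M8: "M8 \<in> maximal_subgroups" "index M8 = 8" using j(1) j8 by force
    have sM: "subgroup M8 G" using M8 by (simp add: maximal_subgroups_def)
    have c21: "card M8 = 21" using idx_mult[OF sM] M8 n168 by simp
    have S3M: "sylows 3 M8 = {P. subgroup P G \<and> P \<subseteq> M8 \<and> card P = 3 ^ 1}"
      using syl_prime_powerI[OF P3, of M8 1 7] c21 by simp
    have sub: "sylows 3 M8 \<subseteq> sylows 3 (carrier G)" using S3 S3M subgroup.subset[OF sM] by auto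
    have d7: "card (sylows 3 M8) dvd 7" using card_syl_dvd[OF sM P3, of 1 7] c21 by simp
    have "card (sylows 3 M8) = 1 \<or> card (sylows 3 M8) = 7" using d7 P7 prime_nat_iff by blast
    moreover have "card (sylows 3 M8) \<noteq> 1"
    proof
      assume "card (sylows 3 M8) = 1"
      obtain T where T: "T \<in> sylows 3 M8" using syl_ex[OF sM P3] by blast
      have sT: "subgroup T G" "card T = 3" using T S3M by auto
      have "M8 \<inter> normalizer T = M8"
        using card_syl[OF sM P3 T] \<open>card (sylows 3 M8) = 1\<close> card_subset_eq[OF sub_fin[OF sM], of "M8 \<inter> normalizer T"] by simp
      moreover have "T \<in> proper_subgroups" using sT n168 by (auto simp: proper_subgroups_def)
      ultimately have "normalizer T = M8" using nrm_max[OF M8(1)] by blast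
      moreover have "card (sylows 3 (carrier G)) = index (normalizer T)"
        using card_conjs_idx[OF sT(1)] syl_orbit[OF subgroup_self P3, of T] T sub by (auto simp: conj_class_def)
      ultimately show False using s7 M8 by simp
    qed
    ultimately have "card (sylows 3 M8) = 7" by simp
    then have eq: "sylows 3 M8 = sylows 3 (carrier G)" using card_subset_eq[OF syl_finite sub] s7 by simp
    \<comment> \<open>Two conjugates of \<open>M8\<close> share all 14 elements of order 3, and 21 is the only divisor of 21 above 14.\<close>
    have "g \<in> normalizer M8" if g: "g \<in> carrier G" for g
    proof -
      let ?L = "M8 \<inter> conjugate g M8"
      have sL: "subgroup ?L G" by (rule subgroups_Inter_pair[OF sM subgroup_cj[OF g sM]])
      have inL: "P \<subseteq> ?L" if P: "P \<in> sylows 3 (carrier G)" for P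
      proof -
        have sP: "P \<subseteq> carrier G" using P by (simp add: sylows_def)
        have "conjugate (inv g) P \<in> sylows 3 (carrier G)" using syl_cj[OF subgroup_self _ P] g by simp
        then have "conjugate (inv g) P \<subseteq> M8" using eq by (auto simp: sylows_def)
        then have "conjugate g (conjugate (inv g) P) \<subseteq> conjugate g M8" by (rule cj_mono)
        then have "P \<subseteq> conjugate g M8" using cj_inv'[OF g sP] by simp
        moreover have "P \<subseteq> M8" using P eq by (auto simp: sylows_def)
        ultimately show ?thesis by simp
      qed
      have "card (\<Union>P\<in>sylows 3 (carrier G). P - {\<one>}) = 7 * (3 - 1)"
      proof (subst card_partition_union[OF syl_finite])
        show "A \<in> sylows 3 (carrier G) \<Longrightarrow> subgroup A G \<and> card A = 3" for A using S3 by auto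
        fix A B assume AB: "A \<in> sylows 3 (carrier G)" "B \<in> sylows 3 (carrier G)" "A \<noteq> B"
        have "\<not> A \<subseteq> B" using card_subset_eq[of B A] AB S3 sub_fin by auto
        then show "A \<inter> B = {\<one>}" using prime_int_trivial[of A B] AB S3 by auto
      qed (use s7 in simp)
      moreover have "card (\<Union>P\<in>sylows 3 (carrier G). P - {\<one>}) \<le> card (?L - {\<one>})"
        by (rule card_mono) (use sub_fin[OF sL] inL in auto)
      moreover have "card (?L - {\<one>}) < card ?L" using subgroup.one_closed[OF sL] sub_fin[OF sL] by (meson card_Diff1_less)
      ultimately have "15 \<le> card ?L" by simp
      moreover have "card ?L dvd 21" using card_dvd[OF sL sM] c21 by simp
      moreover have A: "\<forall>x\<in>set [2..<22::nat]. x dvd 21 \<longrightarrow> (15 \<le> x \<longrightarrow> x = 21)" by (simp add: upt_rec_numeral del: set_upt)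
      ultimately have "card ?L = 21" using dvd_search[OF _ _ _ _ A, of "card ?L"] by simp
      then have "?L = M8" using card_subset_eq[OF sub_fin[OF sM], of ?L] c21 by simp
      then have "M8 \<subseteq> conjugate g M8" by blast
      then have "M8 = conjugate g M8"
        using card_subset_eq[OF sub_fin[OF subgroup_cj[OF g sM]]] card_cj[OF g subgroup.subset[OF sM]] by simp
      then show ?thesis using g by (simp add: normalizer_def)
    qed
    then have "normalizer M8 = carrier G" using nrm_closed by blast
    then show False using max_self_normalizing[OF M8(1)] M8 by (simp add: maximal_subgroups_def)
  qed
qed

text \<open>
  The order divides 6!/2. Besides 6, the indices 10 and one of 9 and 15 occur, as numbers that are 1 modulo
  3 and modulo 2. The case of 36 Sylow 5-subgroups, as in the alternating group of degree 6, has too many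
  subgroups. With 6 Sylow 5-subgroups the order is 60 or 120; for the order 120, the Sylow 2-subgroups
  of order 8 are maximal, so that there are 15 subgroups of each of the orders 2, 4, 8, again too many.
\<close>

lemma index_6_imp_order_60:
  assumes ge: "\<And>j. j \<in> index ` maximal_subgroups \<Longrightarrow> 6 \<le> j" and J6: "6 \<in> index ` maximal_subgroups" shows "n = 60"
proof -
  let ?J = "index ` maximal_subgroups"
  have geM: "\<And>M. M \<in> maximal_subgroups \<Longrightarrow> 6 \<le> index M" using ge by blast
  obtain M6 where M6: "M6 \<in> maximal_subgroups" "index M6 = 6" using J6 by force
  have "2 * n dvd fact 6" using order_dvd_half_fact[of M6] M6 by (auto simp: maximal_subgroups_def)
  then have "2 * n dvd 2 * 360" by (simp add: fact_numeral)
  then have nd: "n dvd 360" by simp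
  have n6: "6 dvd n" using idx_dvd_order[OF J6] .
  have n2: "2 dvd n" and n3: "3 dvd n" using n6 dvd_trans[of _ 6 n] by auto
  have le: "j \<le> 31" if "j \<in> ?J" "j \<noteq> 6" for j using idx_sum[of "{6, j}"] J6 that by auto
  have jd: "j dvd 360" if "j \<in> ?J" for j using idx_dvd_order[OF that] nd dvd_trans by blast
  have P5: "prime (5::nat)" and P3: "prime (3::nat)" and P2: "prime (2::nat)" by simp_all
  have J10: "10 \<in> ?J"
  proof -
    obtain j where j: "j \<in> ?J" "j mod 3 = 1" using index_mod_prime[OF P3 n3] by blast
    have A: "\<forall>x\<in>set [6..<32::nat]. x dvd 360 \<longrightarrow> x mod 3 = 1 \<longrightarrow> x = 10" by (simp add: upt_rec_numeral del: set_upt)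
    note bounded_dvd_search[OF A jd[OF j(1)]]
    moreover have "j \<noteq> 6" using j(2) by auto
    ultimately have "j = 10" using j(2) le[OF j(1)] ge[OF j(1)] by simp
    then show ?thesis using j by simp
  qed
  have Jodd: "9 \<in> ?J \<or> 15 \<in> ?J"
  proof -
    obtain j where j: "j \<in> ?J" "j mod 2 = 1" using index_mod_prime[OF P2 n2] by blast
    have A: "\<forall>x\<in>set [6..<32::nat]. x dvd 360 \<longrightarrow> x mod 2 = 1 \<longrightarrow> x = 9 \<or> x = 15" by (simp add: upt_rec_numeral del: set_upt)
    note bounded_dvd_search[OF A jd[OF j(1)]]
    moreover have "j \<noteq> 6" using j(2) by auto
    ultimately have "j = 9 \<or> j = 15" using j(2) le[OF j(1)] ge[OF j(1)] by simp
    then show ?thesis using j by auto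
  qed
  have n5: "5 dvd n" using idx_dvd_order[OF J10] dvd_trans[of 5 10 n] by simp
  obtain j c where j: "j \<in> ?J" "j mod 5 = 1" "card (sylows 5 (carrier G)) = j * c" "c mod 5 = 1"
    using index_mod_prime[OF P5 n5] by blast
  have A: "\<forall>x\<in>set [6..<32::nat]. x dvd 360 \<longrightarrow> x mod 5 = 1 \<longrightarrow> x = 6" by (simp add: upt_rec_numeral del: set_upt)
  from bounded_dvd_search[OF A jd[OF j(1)]] have j6: "j = 6" using j(2) le[OF j(1)] ge[OF j(1)] by (cases "j = 6") auto
  have "6 * 5 dvd n" using n6 n5 by (intro divides_mult) (auto simp: coprime_iff_gcd_eq_1 gcd_nat.simps)
  then obtain m where m: "n = 30 * m" by (auto simp: dvd_def)
  have "30 * m dvd 30 * 12" using nd m by simp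
  then have m12: "m dvd 12" by (rule dvd_cancel_nat) simp
  have n5m: "n = 5 * (6 * m)" using m by simp
  have A: "\<forall>x\<in>set [2..<13::nat]. x dvd 12 \<longrightarrow> \<not> 5 dvd 6 * x" by (simp add: upt_rec_numeral del: set_upt)
  have np5: "\<not> 5 dvd 6 * m" using dvd_search[OF m12 _ _ _ A] by simp
  have "card (sylows 5 (carrier G)) dvd 6 * m"
    using card_syl_dvd[OF subgroup_self P5, of 1 "6 * m"] n5m np5 by simp
  then have "6 * c dvd 6 * m" using j j6 by simp
  then have cm: "c dvd m" by (rule dvd_cancel_nat) simp
  have c12: "c dvd 12" using cm m12 dvd_trans by blast
  have A: "\<forall>x\<in>set [2..<13::nat]. x dvd 12 \<longrightarrow> (x mod 5 = 1 \<longrightarrow> x = 1 \<or> x = 6)" by (simp add: upt_rec_numeral del: set_upt)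
  have c16: "c = 1 \<or> c = 6" using dvd_search[OF c12 _ _ _ A] j(4) by simp
  have S5: "sylows 5 (carrier G) \<subseteq> {K \<in> proper_subgroups. card K = 5}"
  proof
    fix P assume "P \<in> sylows 5 (carrier G)"
    then have P: "subgroup P G" "card P = 5" using syl_prime_powerI[OF P5, of "carrier G" 1 "6 * m"] n5m np5 by auto
    then show "P \<in> {K \<in> proper_subgroups. card K = 5}" using not_prime P5 by (auto simp: proper_subgroups_def)
  qed
  have c5: "card (sylows 5 (carrier G)) \<le> count_order 5" unfolding count_order_def using finite_props S5 by (intro card_mono) auto
  have pp: "6 \<le> count_order (p ^ a)" if "prime p" "p ^ a dvd n" "a \<noteq> 0" for p a
    using cnt_ge_prime_power[OF geM that] .
  have c1: "c = 1"
  proof (rule ccontr)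
    assume "c \<noteq> 1"
    then have "c = 6" using c16 by simp
    then obtain t where t: "m = 6 * t" using cm by (auto simp: dvd_def)
    have nt: "n = 180 * t" using m t by simp
    have t1: "t \<ge> 1" using gt1 nt by (cases t) auto
    have d: "2 ^ 1 dvd n" "2 ^ 2 dvd n" "3 ^ 1 dvd n" "3 ^ 2 dvd n" using nt by (auto intro!: dvd_mult2)
    have c: "36 \<le> count_order 5" "6 \<le> count_order (30 * t)" "10 \<le> count_order (18 * t)" "6 \<le> count_order 2" "6 \<le> count_order 4" "6 \<le> count_order 3" "6 \<le> count_order 9"
      using c5 j j6 \<open>c = 6\<close> cnt_index[OF J6, of "30 * t"] cnt_index[OF J10, of "18 * t"] nt
        pp[OF _ d(1)] pp[OF _ d(2)] pp[OF _ d(3)] pp[OF _ d(4)] by simp_all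
    have "9 \<le> count_order (20 * t) \<or> 15 \<le> count_order (12 * t)"
      using Jodd cnt_index[of 9 "20 * t"] cnt_index[of 15 "12 * t"] nt by auto
    moreover have "distinct [20 * t, 30 * t, 18 * t, 5, 2, 4, 3, 9]" "distinct [12 * t, 30 * t, 18 * t, 5, 2, 4, 3, 9]"
      using t1 by auto
    ultimately show False
      using c cnt_sum[of "[20 * t, 30 * t, 18 * t, 5, 2, 4, 3, 9]"] cnt_sum[of "[12 * t, 30 * t, 18 * t, 5, 2, 4, 3, 9]"] by auto
  qed
  have s6: "card (sylows 5 (carrier G)) = 5 + 1" using j j6 c1 by simp
  then obtain k where k: "n = (5 + 1) * 5 * k" "k dvd 5 - 1" "k \<noteq> 1"
    using sylow_count_minimal[OF P5 n5m np5] by blast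
  have k4: "k dvd 4" using k(2) by simp
  have A: "\<forall>x\<in>set [2..<5::nat]. x dvd 4 \<longrightarrow> x = 1 \<or> x = 2 \<or> x = 4" by (simp add: upt_rec_numeral del: set_upt)
  have "k = 2 \<or> k = 4" using dvd_search[OF k4 _ _ _ A] k(3) by simp
  moreover have "k \<noteq> 4"
  proof
    assume "k = 4"
    then have n120: "n = 120" using k(1) by simp
    have "9 \<notin> ?J" using idx_dvd_order[of 9] n120 by auto
    then have J15: "15 \<in> ?J" using Jodd by simp
    then obtain M where M: "M \<in> maximal_subgroups" "index M = 15" by force
    have sM: "subgroup M G" using M by (simp add: maximal_subgroups_def)
    have cM: "card M = 2 ^ 3" using idx_mult[OF sM] M n120 by simp
    obtain T where T: "subgroup T G" "T \<subseteq> M" "card T = 2" "M \<subseteq> normalizer T"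
      using p_group_central_subgroup[OF sM cM _ P2] by auto
    have "2 ^ 2 dvd card M" using cM by simp
    then obtain D where D: "subgroup D G" "D \<subseteq> M" "card D = 2 ^ 2" using prime_power_subgroup_ex[OF sM P2] by blast
    have MD: "M \<subseteq> normalizer D" by (rule prime_index_normal[OF sM cM P2 D(1,2)]) (use cM D in simp)
    have Tp: "T \<in> proper_subgroups" using T n120 by (auto simp: proper_subgroups_def)
    have Dp: "D \<in> proper_subgroups" using D n120 by (auto simp: proper_subgroups_def)
    have "card (conj_class T) = 15" "card (conj_class D) = 15"
      using card_conjs_idx[OF T(1)] card_conjs_idx[OF D(1)] nrm_max[OF M(1) Tp T(4)] nrm_max[OF M(1) Dp MD] M by simp_all
    then have "15 \<le> count_order 2" "15 \<le> count_order 4" using cnt_ge_conjs[OF Tp] cnt_ge_conjs[OF Dp] T D by simp_all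
    moreover have "15 \<le> count_order 8" "10 \<le> count_order 12" "6 \<le> count_order 20" "6 \<le> count_order 5"
      using cnt_index[OF J15, of 8] cnt_index[OF J10, of 12] cnt_index[OF J6, of 20] c5 s6 n120 by simp_all
    moreover have "10 \<le> count_order 3"
    proof -
      have "n = 3 * 40" using n120 by simp
      then have "card (sylows 3 (carrier G)) dvd 40" "sylows 3 (carrier G) = {P. subgroup P G \<and> P \<subseteq> carrier G \<and> card P = 3 ^ 1}"
        using card_syl_dvd[OF subgroup_self P3, of 1 40] syl_prime_powerI[OF P3, of "carrier G" 1 40] by simp_all
      note S = this
      have A: "\<forall>x\<in>set [2..<41::nat]. x dvd 40 \<longrightarrow> (x mod 3 = 1 \<longrightarrow> x = 1 \<or> x = 4 \<or> x = 10 \<or> x = 40)" by (simp add: upt_rec_numeral del: set_upt)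
      have "card (sylows 3 (carrier G)) \<in> {1, 4, 10, 40}"
        using dvd_search[OF S(1) _ _ _ A] card_syl_mod[OF subgroup_self P3] by simp
      moreover obtain R where R: "R \<in> sylows 3 (carrier G)" using syl_ex[OF subgroup_self P3] by blast
      have sR: "subgroup R G" "card R = 3" using R S by auto
      have Rp: "R \<in> proper_subgroups" using sR n120 by (auto simp: proper_subgroups_def)
      have cR: "card (sylows 3 (carrier G)) = card (conj_class R)"
        using syl_orbit[OF subgroup_self P3 R] by (simp add: conj_class_def)
      have "6 \<le> card (conj_class R)" by (rule conjs_ge[OF geM Rp])
      ultimately have "10 \<le> card (conj_class R)" using cR by auto
      then show ?thesis using cnt_ge_conjs[OF Rp] sR by simp
    qed
    ultimately show False using cnt_sum[of "[2, 4, 8, 12, 20, 5, 3]"] by simp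
  qed
  ultimately show ?thesis using k by simp
qed

text \<open>
  The order divides 5!/2 and there are six Sylow 5-subgroups.
\<close>

lemma index_5_imp_order_60:
  assumes ge: "\<And>j. j \<in> index ` maximal_subgroups \<Longrightarrow> 5 \<le> j" and J5: "5 \<in> index ` maximal_subgroups" shows "n = 60"
proof -
  obtain M5 where M5: "M5 \<in> maximal_subgroups" "index M5 = 5" using J5 by force
  have "2 * n dvd fact 5" using order_dvd_half_fact[of M5] M5 by (auto simp: maximal_subgroups_def)
  then have "2 * n dvd 2 * 60" by (simp add: fact_numeral)
  then have nd: "n dvd 60" by simp
  have P5: "prime (5::nat)" by simp
  have n5: "5 dvd n" using idx_dvd_order[OF J5] .
  then obtain m where m: "n = 5 * m" by (auto simp: dvd_def)
  have "5 * m dvd 5 * 12" using nd m by simp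
  then have m12: "m dvd 12" by (rule dvd_cancel_nat) simp
  have A: "\<forall>x\<in>set [2..<13::nat]. x dvd 12 \<longrightarrow> \<not> 5 dvd x" by (simp add: upt_rec_numeral del: set_upt)
  have np: "\<not> 5 dvd m" using dvd_search[OF m12 _ _ _ A] by simp
  have "card (sylows 5 (carrier G)) dvd 12"
    using card_syl_dvd[OF subgroup_self P5, of 1 m] m np m12 dvd_trans by simp
  note s = this
  have A: "\<forall>x\<in>set [2..<13::nat]. x dvd 12 \<longrightarrow> (x mod 5 = 1 \<longrightarrow> x = 1 \<or> x = 6)" by (simp add: upt_rec_numeral del: set_upt)
  have "card (sylows 5 (carrier G)) = 5 + 1"
    using dvd_search[OF s _ _ _ A] card_syl_mod[OF subgroup_self P5] sylow_count_ge_2[OF P5 n5] by auto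
  then obtain k where k: "n = (5 + 1) * 5 * k" "k dvd 5 - 1" "k \<noteq> 1"
    using sylow_count_minimal[OF P5 m np] by blast
  have "30 * k dvd 30 * 2" using k nd by simp
  then have k2: "k dvd 2" by (rule dvd_cancel_nat) simp
  have A: "\<forall>x\<in>set [2..<3::nat]. x dvd 2 \<longrightarrow> x = 1 \<or> x = 2" by (simp add: upt_rec_numeral del: set_upt)
  have "k = 2" using dvd_search[OF k2 _ _ _ A] k(3) by simp
  then show ?thesis using k by simp
qed

text \<open>
  For \<open>d \<le> 3\<close> the order would divide 3. For \<open>d = 4\<close> it would divide 12, and some index, being 1 modulo
  2, would be an odd divisor of 12 that is at least 4.
\<close>

lemma min_index_ge_5:
  assumes ge: "\<And>j. j \<in> index ` maximal_subgroups \<Longrightarrow> d \<le> j" and Jd: "d \<in> index ` maximal_subgroups" shows "5 \<le> d"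
proof (rule ccontr)
  assume "\<not> 5 \<le> d"
  obtain M where M: "M \<in> maximal_subgroups" "index M = d" using Jd by force
  have d2: "2 \<le> d" using idx_ge_2[OF M(1)] M by simp
  then have "d = 2 \<or> d = 3 \<or> d = 4" using \<open>\<not> 5 \<le> d\<close> by linarith
  moreover have h: "2 * n dvd fact d" using order_dvd_half_fact[of M] M by (auto simp: maximal_subgroups_def)
  ultimately have nd: "n dvd 12"
  proof (elim disjE)
    assume "d = 2"
    then have "2 * n dvd 2 * 1" using h by (simp add: fact_numeral)
    then show ?thesis using gt1 by simp
  next
    assume "d = 3"
    then have "2 * n dvd 2 * 3" using h by (simp add: fact_numeral)
    then have "n dvd 3" by simp
    then show ?thesis using dvd_trans[of n 3 12] by simp
  next
    assume "d = 4"
    then have "2 * n dvd 2 * 12" using h by (simp add: fact_numeral)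
    then show ?thesis by simp
  qed
  have dn: "d dvd n" by (rule idx_dvd_order[OF Jd])
  obtain p where p: "prime p" "p dvd d" using d2 prime_factor_nat[of d] by auto
  obtain j where j: "j \<in> index ` maximal_subgroups" "j mod p = 1" using index_mod_prime[OF p(1) dvd_trans[OF p(2) dn]] by blast
  have jd: "j dvd n" "d \<le> j" using idx_dvd_order[OF j(1)] ge[OF j(1)] .
  have "p dvd n" using dvd_trans[OF p(2) dn] .
  have "p = 2 \<or> p = 3"
  proof -
    have "p dvd 2 ^ 2 * 3" using dvd_trans[OF \<open>p dvd n\<close> nd] by simp
    then have "p dvd 2 \<or> p dvd 3" using p(1) by (metis prime_dvd_mult_iff prime_dvd_power)
    then show ?thesis using primes_dvd_imp_eq[OF p(1)] by auto
  qed
  then show False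
  proof
    assume p2: "p = 2"
    have j12: "j dvd 12" using jd(1) nd dvd_trans by blast
    have A: "\<forall>x\<in>set [2..<13::nat]. x dvd 12 \<longrightarrow> (x mod 2 = 1 \<longrightarrow> x = 1 \<or> x = 3)" by (simp add: upt_rec_numeral del: set_upt)
    have j3: "j = 3" using dvd_search[OF j12 _ _ _ A] j jd d2 p2 by auto
    then have "d = 2" using jd p p2 d2 by (cases "d = 3") auto
    then have "2 * n dvd 2 * 1" using h by (simp add: fact_numeral)
    then show False using gt1 by simp
  next
    assume p3: "p = 3"
    then have "d = 3" using p \<open>\<not> 5 \<le> d\<close> d2 by presburger
    then have "2 * n dvd 2 * 3" using h by (simp add: fact_numeral)
    then have "n dvd 3" by simp
    moreover have "prime (3::nat)" by simp
    ultimately have "n = 3" using gt1 by (auto simp only: prime_nat_iff)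
    then show False using not_prime by simp
  qed
qed

theorem order_eq_60: "n = 60"
proof -
  let ?J = "index ` maximal_subgroups"
  define d where "d = Min ?J"
  have f: "finite ?J" "?J \<noteq> {}" using finite_maxs maxs_ex by auto
  have Jd: "d \<in> ?J" using Min_in[OF f] by (simp add: d_def)
  have ge: "\<And>j. j \<in> ?J \<Longrightarrow> d \<le> j" using Min_le[OF f(1)] by (simp add: d_def)
  have d5: "5 \<le> d" using min_index_ge_5[OF ge Jd] .
  have "d < 8" using no_index_ge_8 ge by (meson le_trans not_le_imp_less)
  then have "d = 5 \<or> d = 6 \<or> d = 7" using d5 by linarith
  then show "n = 60" using index_5_imp_order_60 index_6_imp_order_60 index_7_imp_False ge Jd by blast
qed

end

section \<open>The simple group of order 60\<close>

lemma (in fin_group) nrm_inj_syl: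
  assumes M: "subgroup M G" and p: "prime p" shows "inj_on normalizer (sylows p M)"
proof (rule inj_onI)
  fix A B assume AB: "A \<in> sylows p M" "B \<in> sylows p M" "normalizer A = normalizer B"
  have "A \<subseteq> normalizer A" using sub_nrm AB(1) by (simp add: sylows_def)
  then show "A = B" using syl_normalized_eq[OF M p AB(2,1)] AB(3) by simp
qed

lemma (in fin_group) syl_unique_normal:
  assumes M: "subgroup M G" and p: "prime p" and R: "R \<in> sylows p M" and c: "card (sylows p M) = 1"
  shows "M \<subseteq> normalizer R"
proof -
  have "card (M \<inter> normalizer R) = card M" using card_syl[OF M p R] c by simp
  then have "M \<inter> normalizer R = M" using card_subset_eq[OF sub_fin[OF M], of "M \<inter> normalizer R"] by simp
  then show ?thesis by blast
qed

lemma (in fin_group) two_subgroup: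
  assumes "t \<in> carrier G" "t \<otimes> t = \<one>" shows "subgroup {\<one>, t} G"
  using assms by (intro subgroupI) (auto simp: inv_equality)

locale simple_60 = simple_fin +
  assumes n60: "card (carrier G) = 60"
begin

lemma idx5:
  assumes K: "subgroup K G" "K \<noteq> carrier G" shows "5 \<le> index K"
proof (rule ccontr)
  assume "\<not> 5 \<le> index K"
  then have "(fact (index K) :: nat) \<le> fact 4" by (intro fact_mono_nat) simp
  moreover have "120 \<le> (fact (index K) :: nat)"
    using dvd_imp_le[OF order_dvd_half_fact[OF K]] n60 by simp
  ultimately show False by (simp add: fact_numeral)
qed

definition subgroups_of_order :: "nat \<Rightarrow> 'a set set" where "subgroups_of_order k = {K. subgroup K G \<and> card K = k}"

lemma primes_235: "prime (2::nat)" "prime (3::nat)" "prime (5::nat)" by simp_all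

lemma proper_card_le: "subgroup K G \<Longrightarrow> K \<noteq> carrier G \<Longrightarrow> card K \<le> 12"
  using idx_mult[of K] idx5[of K] n60 mult_le_mono1[of 5 "index K" "card K"] by simp

lemma sg_props: "K \<in> subgroups_of_order k \<Longrightarrow> k \<noteq> 1 \<Longrightarrow> k \<noteq> 60 \<Longrightarrow> K \<in> proper_subgroups"
  using n60 by (auto simp: subgroups_of_order_def proper_subgroups_def)

lemma syl_sg: "sylows 5 (carrier G) = subgroups_of_order 5" "sylows 3 (carrier G) = subgroups_of_order 3" "sylows 2 (carrier G) = subgroups_of_order 4"
  using syl_prime_powerI[OF primes_235(3), of "carrier G" 1 12] syl_prime_powerI[OF primes_235(2), of "carrier G" 1 20]
    syl_prime_powerI[OF primes_235(1), of "carrier G" 2 15] n60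
  by (auto simp: subgroups_of_order_def dest: subgroup.subset)

text \<open>
  The Sylow subgroups are as many as the index of a proper subgroup, and such an index is at least 5.
\<close>

lemma card_syl_ge:
  assumes p: "prime p" and k: "sylows p (carrier G) = subgroups_of_order k" "k \<noteq> 1" "k \<noteq> 60"
  shows "5 \<le> card (subgroups_of_order k)" and "K \<in> subgroups_of_order k \<Longrightarrow> card (subgroups_of_order k) * card (normalizer K) = 60" and "K \<in> subgroups_of_order k \<Longrightarrow> normalizer K \<noteq> carrier G"
    and "K \<in> subgroups_of_order k \<Longrightarrow> subgroup (normalizer K) G"
proof -
  show b: "card (subgroups_of_order k) * card (normalizer K) = 60" if "K \<in> subgroups_of_order k" for K
    using card_syl[OF subgroup_self p, of K] that k n60 nrm_closed by (simp add: Int_absorb1)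
  show c: "normalizer K \<noteq> carrier G" if "K \<in> subgroups_of_order k" for K using sg_props[OF that k(2,3)] by (rule props_nrm)
  show d: "subgroup (normalizer K) G" if "K \<in> subgroups_of_order k" for K using that by (intro nrm_subgroup) (auto simp: subgroups_of_order_def dest: subgroup.subset)
  obtain K where K: "K \<in> subgroups_of_order k" using syl_ex[OF subgroup_self p] k by auto
  have "index (normalizer K) = card (subgroups_of_order k)" using b[OF K] idx_mult[OF d[OF K]] n60 sub_card_pos[OF d[OF K]]
    by (metis mult_right_cancel neq0_conv)
  then show "5 \<le> card (subgroups_of_order k)" using idx5[OF d[OF K] c[OF K]] by simp
qed

lemma card_sg5: "card (subgroups_of_order 5) = 6"
proof -
  have s: "card (subgroups_of_order 5) dvd 12" using card_syl_dvd[OF subgroup_self primes_235(3), of 1 12] n60 syl_sg by simp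
  have A: "\<forall>x\<in>set [2..<13::nat]. x dvd 12 \<longrightarrow> (x mod 5 = 1 \<longrightarrow> x = 1 \<or> x = 6)" by (simp add: upt_rec_numeral del: set_upt)
  show ?thesis using dvd_search[OF s _ _ _ A] card_syl_mod[OF subgroup_self primes_235(3)] card_syl_ge(1)[OF primes_235(3) syl_sg(1)] syl_sg by auto
qed

lemma card_sg3: "card (subgroups_of_order 3) = 10"
proof -
  have s: "card (subgroups_of_order 3) dvd 20" using card_syl_dvd[OF subgroup_self primes_235(2), of 1 20] n60 syl_sg by simp
  have A: "\<forall>x\<in>set [2..<21::nat]. x dvd 20 \<longrightarrow> (x mod 3 = 1 \<longrightarrow> x = 1 \<or> x = 4 \<or> x = 10)" by (simp add: upt_rec_numeral del: set_upt)
  show ?thesis using dvd_search[OF s _ _ _ A] card_syl_mod[OF subgroup_self primes_235(2)] card_syl_ge(1)[OF primes_235(2) syl_sg(2)] syl_sg by auto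
qed

lemma card_nrm_5: "Q \<in> subgroups_of_order 5 \<Longrightarrow> card (normalizer Q) = 10"
  using card_syl_ge(2)[OF primes_235(3) syl_sg(1), of Q] card_sg5 by simp

lemma card_nrm_3: "R \<in> subgroups_of_order 3 \<Longrightarrow> card (normalizer R) = 6"
  using card_syl_ge(2)[OF primes_235(2) syl_sg(2), of R] card_sg3 by simp

lemma finite_sg: "finite (subgroups_of_order k)"
  by (rule finite_subset[of _ "Pow (carrier G)"]) (use fin in \<open>auto simp: subgroups_of_order_def dest: subgroup.subset\<close>)

lemma prime_sg_disjoint:
  assumes "prime p" "A \<in> subgroups_of_order p" "B \<in> subgroups_of_order p" "A \<noteq> B" shows "A \<inter> B = {\<one>}"
proof -
  have s: "subgroup A G" "subgroup B G" "card A = p" "card B = p" using assms by (auto simp: subgroups_of_order_def)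
  have "\<not> A \<subseteq> B" using card_subset_eq[OF sub_fin[OF s(2)], of A] s assms(4) by auto
  then show ?thesis using prime_int_trivial[OF s(1,2)] s assms(1) by simp
qed

text \<open>
  The normalizer of a subgroup of order 3 has order 6, so there are four Sylow 3-subgroups. They have eight
  non-trivial elements, which leaves three for a single Sylow 2-subgroup.
\<close>

lemma order_12:
  assumes K: "K \<in> subgroups_of_order 12" and P: "P \<in> sylows 2 K"
  shows "K \<subseteq> normalizer P" and "card P = 4" and "K - P \<subseteq> (\<Union>R\<in>subgroups_of_order 3. R - {\<one>})"
proof -
  have sK: "subgroup K G" "card K = 12" using K by (auto simp: subgroups_of_order_def)
  have S3: "sylows 3 K = {R. subgroup R G \<and> R \<subseteq> K \<and> card R = 3 ^ 1}" using syl_prime_powerI[OF primes_235(2), of K 1 4] sK by simp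
  have S2: "sylows 2 K = {R. subgroup R G \<and> R \<subseteq> K \<and> card R = 2 ^ 2}" using syl_prime_powerI[OF primes_235(1), of K 2 3] sK by simp
  show cP: "card P = 4" using P S2 by simp
  have s: "card (sylows 3 K) dvd 4" using card_syl_dvd[OF sK(1) primes_235(2), of 1 4] sK by simp
  have A: "\<forall>x\<in>set [2..<5::nat]. x dvd 4 \<longrightarrow> (x mod 3 = 1 \<longrightarrow> x = 1 \<or> x = 4)" by (simp add: upt_rec_numeral del: set_upt)
  have "card (sylows 3 K) = 1 \<or> card (sylows 3 K) = 4"
    using dvd_search[OF s _ _ _ A] card_syl_mod[OF sK(1) primes_235(2)] by simp
  moreover have "card (sylows 3 K) \<noteq> 1"
  proof
    assume c: "card (sylows 3 K) = 1"
    obtain R where R: "R \<in> sylows 3 K" using syl_ex[OF sK(1) primes_235(2)] by blast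
    have KR: "K \<subseteq> normalizer R" by (rule syl_unique_normal[OF sK(1) primes_235(2) R c])
    have R3: "R \<in> subgroups_of_order 3" using R S3 by (simp add: subgroups_of_order_def)
    have "card K \<le> card (normalizer R)"
      by (rule card_mono[OF sub_fin[OF card_syl_ge(4)[OF primes_235(2) syl_sg(2) _ _ R3]] KR]) simp_all
    then have "12 \<le> card (normalizer R)" using sK by simp
    then show False using card_nrm_3[OF R3] by simp
  qed
  ultimately have c4: "card (sylows 3 K) = 4" by simp
  define U where "U = (\<Union>R\<in>sylows 3 K. R - {\<one>})"
  have cU: "card U = 4 * (3 - 1)" unfolding U_def
  proof (subst card_partition_union[OF syl_finite])
    show "A \<in> sylows 3 K \<Longrightarrow> subgroup A G \<and> card A = 3" for A using S3 by auto
    show "\<And>A B. A \<in> sylows 3 K \<Longrightarrow> B \<in> sylows 3 K \<Longrightarrow> A \<noteq> B \<Longrightarrow> A \<inter> B = {\<one>}"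
      using prime_sg_disjoint[OF primes_235(2)] S3 by (simp add: subgroups_of_order_def)
  qed (use c4 in simp)
  have oK: "\<one> \<in> K" by (rule subgroup.one_closed[OF sK(1)])
  have fK: "finite K" by (rule sub_fin[OF sK(1)])
  have UK: "U \<subseteq> K - {\<one>}" using S3 by (auto simp: U_def)
  have cV: "card (K - {\<one>} - U) = 3"
    using card_Diff_subset[OF _ UK] finite_subset[OF UK] fK cU sK oK by (simp add: card_Diff_singleton)
  have e: "T - {\<one>} = K - {\<one>} - U" if T: "T \<in> sylows 2 K" for T
  proof (rule card_subset_eq)
    have sT: "subgroup T G" "T \<subseteq> K" "card T = 4" using T S2 by auto
    show "card (T - {\<one>}) = card (K - {\<one>} - U)"
      using cV sT(3) subgroup.one_closed[OF sT(1)] by (simp add: card_Diff_singleton)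
    have "T \<inter> R = {\<one>}" if "R \<in> sylows 3 K" for R
      by (rule coprime_int_trivial) (use that S3 sT in \<open>auto simp: coprime_iff_gcd_eq_1 gcd_nat.simps\<close>)
    then show "T - {\<one>} \<subseteq> K - {\<one>} - U" using sT(2) by (auto simp: U_def)
  qed (use fK in simp)
  have "T = P" if T: "T \<in> sylows 2 K" for T
  proof -
    have "\<one> \<in> P" "\<one> \<in> T" using P T subgroup.one_closed by (auto simp: sylows_def)
    then show ?thesis using e[OF P] e[OF T] by blast
  qed
  then have "sylows 2 K = {P}" using P by blast
  then have "card (sylows 2 K) = 1" by simp
  then show "K \<subseteq> normalizer P" by (rule syl_unique_normal[OF sK(1) primes_235(1) P])
  have "\<one> \<in> P" using P subgroup.one_closed by (auto simp: sylows_def)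
  then have "K - P \<subseteq> U" using e[OF P] by blast
  then show "K - P \<subseteq> (\<Union>R\<in>subgroups_of_order 3. R - {\<one>})" using S3 by (auto simp: U_def subgroups_of_order_def)
qed

text \<open>
  The normalizer of \<open>T\<close> would have order 12. Its involution \<open>t\<close> in \<open>T\<close> commutes with an element \<open>y\<close> of
  order 3, and \<open>t y\<close> has order 6; but by \<open>order_12\<close> it would lie in a subgroup of order 3.
\<close>

lemma no_mixed_order:
  assumes T: "T \<in> subgroups_of_order 2" and R: "R \<in> subgroups_of_order 3" and RT: "R \<subseteq> normalizer T" shows False
proof -
  have sT: "subgroup T G" "card T = 2" and sR: "subgroup R G" "card R = 3" using T R by (auto simp: subgroups_of_order_def)
  have sK: "subgroup (normalizer T) G" by (rule nrm_subgroup[OF subgroup.subset[OF sT(1)]])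
  have Kp: "normalizer T \<noteq> carrier G" using sg_props[OF T] props_nrm by simp
  obtain P0 where P0: "P0 \<in> sylows 2 (carrier G)" using syl_ex[OF subgroup_self primes_235(1)] by blast
  obtain g where g: "g \<in> carrier G" "T \<subseteq> conjugate g P0"
    using syl_subset_conj[OF subgroup_self primes_235(1) P0 sT(1) subgroup.subset[OF sT(1)], of 1] sT by auto
  define P where "P = conjugate g P0"
  have P: "P \<in> subgroups_of_order 4" "T \<subseteq> P" using syl_cj[OF subgroup_self g(1) P0] g syl_sg by (auto simp: P_def)
  have sP: "subgroup P G" "card P = 2 ^ 2" using P by (auto simp: subgroups_of_order_def)
  have PK: "P \<subseteq> normalizer T" by (rule prime_index_normal[OF sP primes_235(1) sT(1) P(2)]) (use sP sT in simp)
  have "4 dvd card (normalizer T)" using card_dvd[OF sP(1) sK PK] sP by simp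
  moreover have "3 dvd card (normalizer T)" using card_dvd[OF sR(1) sK RT] sR by simp
  ultimately have "4 * 3 dvd card (normalizer T)" by (intro divides_mult) (auto simp: coprime_iff_gcd_eq_1 gcd_nat.simps)
  then have c12: "card (normalizer T) = 12" using proper_card_le[OF sK Kp] sub_card_pos[OF sK] by (auto dest: dvd_imp_le)
  then have K12: "normalizer T \<in> subgroups_of_order 12" using sK by (simp add: subgroups_of_order_def)
  have "P \<in> sylows 2 (normalizer T)" using syl_prime_powerI[OF primes_235(1), of "normalizer T" 2 3] c12 sP PK by simp
  note o = order_12(3)[OF K12 this]
  obtain t where t: "t \<in> T" "t \<noteq> \<one>" using sT by (metis card_2_iff' subgroup.one_closed)
  have Te: "T = {\<one>, t}"
    using t sT card_subset_eq[OF sub_fin[OF sT(1)], of "{\<one>, t}"] subgroup.one_closed[OF sT(1)] by auto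
  obtain y where y: "y \<in> R" "y \<noteq> \<one>" using sR subgroup.one_closed[OF sR(1)]
    by (metis One_nat_def card_1_singleton_iff numeral_eq_one_iff semiring_norm(86) subsetI subset_antisym empty_subsetI insert_subset singletonD)
  have c: "t \<in> carrier G" "y \<in> carrier G" using t y sT sR subgroup.mem_carrier by metis+
  have "conjugate y T = T" using RT y by (auto simp: normalizer_def)
  moreover have "y \<otimes> t \<otimes> inv y \<in> conjugate y T" using t by (auto simp: conjugate_def)
  ultimately have "y \<otimes> t \<otimes> inv y \<in> {\<one>, t}" using Te by simp
  moreover have "y \<otimes> t \<otimes> inv y \<noteq> \<one>"
  proof
    assume "y \<otimes> t \<otimes> inv y = \<one>"
    then have "y \<otimes> t \<otimes> inv y = y \<otimes> \<one> \<otimes> inv y" using c by simp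
    then show False using cj_inj[OF c(2)] c t(2) unfolding inj_on_def by blast
  qed
  ultimately have "y \<otimes> t \<otimes> inv y = t" by auto
  then have yt: "y \<otimes> t = t \<otimes> y" using inv_solve_right[of t "y \<otimes> t" y] c by simp
  have "t \<otimes> t \<in> {\<one>, t}" using subgroup.m_closed[OF sT(1) t(1) t(1)] Te by simp
  moreover have "t \<otimes> t \<noteq> t" using c t(2) by simp
  ultimately have tt: "t \<otimes> t = \<one>" by auto
  have "t \<otimes> y \<in> normalizer T - P"
  proof
    show "t \<otimes> y \<in> normalizer T" using subgroup.m_closed[OF sK] t(1) y(1) PK P(2) RT by blast
    show "t \<otimes> y \<notin> P"
    proof
      assume "t \<otimes> y \<in> P"
      then have "inv t \<otimes> (t \<otimes> y) \<in> P" using sP t P(2) by (auto simp: subgroup.m_closed subgroup.m_inv_closed)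
      then have "y \<in> P" using c by (simp add: m_assoc[symmetric])
      moreover have "P \<inter> R = {\<one>}" by (rule coprime_int_trivial[OF sP(1) sR(1)]) (use sP sR in \<open>auto simp: coprime_iff_gcd_eq_1 gcd_nat.simps\<close>)
      ultimately show False using y by auto
    qed
  qed
  then obtain R' where R': "R' \<in> subgroups_of_order 3" "t \<otimes> y \<in> R'" using o by blast
  have pow3: "x [^] (3::nat) = \<one>" if x: "x \<in> A" "A \<in> subgroups_of_order 3" for x A
  proof -
    have sA: "subgroup A G" "card A = 3" using x by (auto simp: subgroups_of_order_def)
    have "x [^]\<^bsub>G\<lparr>carrier := A\<rparr>\<^esub> order (G\<lparr>carrier := A\<rparr>) = \<one>\<^bsub>G\<lparr>carrier := A\<rparr>\<^esub>"
      by (rule group.pow_order_eq_1[OF subgroup.subgroup_is_group[OF sA(1) is_group]]) (use x in simp)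
    then show ?thesis using nat_pow_consistent[of x 3 A] sA by (simp add: order_def)
  qed
  have "(t \<otimes> y) [^] (3::nat) = t [^] (3::nat) \<otimes> y [^] (3::nat)" by (rule pow_mult_distrib[OF yt[symmetric] c])
  then have "\<one> = t [^] (3::nat)" using pow3[OF R'(2,1)] pow3[OF y(1) R] c by simp
  also have "\<dots> = t" using tt c by (simp add: numeral_3_eq_3)
  finally show False using t by simp
qed

text \<open>
  If the intersection has order 2, its normalizer contains both subgroups, but by \<open>no_mixed_order\<close> this
  normalizer has order 4.
\<close>

lemma sg4_disjoint:
  assumes A: "A \<in> subgroups_of_order 4" and B: "B \<in> subgroups_of_order 4" and AB: "A \<noteq> B" shows "A \<inter> B = {\<one>}"
proof (rule ccontr)
  assume nt: "A \<inter> B \<noteq> {\<one>}"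
  let ?D = "A \<inter> B"
  have sA: "subgroup A G" "card A = 2 ^ 2" and sB: "subgroup B G" "card B = 2 ^ 2" using A B by (auto simp: subgroups_of_order_def)
  have sD: "subgroup ?D G" by (rule subgroups_Inter_pair[OF sA(1) sB(1)])
  have d4: "card ?D dvd 4" using card_dvd[OF sD sA(1)] sA by simp
  have E: "\<forall>x\<in>set [2..<5::nat]. x dvd 4 \<longrightarrow> x = 1 \<or> x = 2 \<or> x = 4" by (simp add: upt_rec_numeral del: set_upt)
  have "card ?D = 1 \<or> card ?D = 2 \<or> card ?D = 4" using dvd_search[OF d4 _ _ _ E] by simp
  moreover have "card ?D \<noteq> 1"
  proof
    assume "card ?D = 1"
    then obtain x where "?D = {x}" by (auto simp: card_Suc_eq)
    then show False using subgroup.one_closed[OF sD] nt by auto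
  qed
  moreover have "card ?D \<noteq> 4"
  proof
    assume "card ?D = 4"
    then have "?D = A" "?D = B"
      using card_subset_eq[OF sub_fin[OF sA(1)], of ?D] card_subset_eq[OF sub_fin[OF sB(1)], of ?D] sA sB by auto
    then show False using AB by simp
  qed
  ultimately have D2: "?D \<in> subgroups_of_order 2" using sD by (simp add: subgroups_of_order_def)
  let ?L = "normalizer ?D"
  have sL: "subgroup ?L G" by (rule nrm_subgroup[OF subgroup.subset[OF sD]])
  have AL: "A \<subseteq> ?L" by (rule prime_index_normal[OF sA primes_235(1) sD]) (use D2 sA in \<open>auto simp: subgroups_of_order_def\<close>)
  have BL: "B \<subseteq> ?L" by (rule prime_index_normal[OF sB primes_235(1) sD]) (use D2 sB in \<open>auto simp: subgroups_of_order_def\<close>)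
  have Lp: "?L \<noteq> carrier G" using sg_props[OF D2] props_nrm by simp
  have "\<not> 3 dvd card ?L"
  proof
    assume "3 dvd card ?L"
    then obtain R where "subgroup R G" "R \<subseteq> ?L" "card R = 3" using prime_power_subgroup_ex[OF sL primes_235(2), of 1] by auto
    then show False using no_mixed_order[OF D2, of R] by (simp add: subgroups_of_order_def)
  qed
  moreover have d4': "4 dvd card ?L" using card_dvd[OF sA(1) sL AL] sA by simp
  moreover have "card ?L dvd 60" using card_dvd_order[OF sL] n60 by simp
  then obtain w where w: "60 = card ?L * w" by (auto simp: dvd_def)
  have "card ?L = 4"
  proof -
    have "card ?L = 4 \<or> card ?L = 8 \<or> card ?L = 12"
      using d4' proper_card_le[OF sL Lp] sub_card_pos[OF sL] by presburger
    moreover have "card ?L \<noteq> 8"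
    proof
      assume "card ?L = 8"
      then have "60 = 8 * w" using w by simp
      then show False by presburger
    qed
    moreover have "card ?L \<noteq> 12" using \<open>\<not> 3 dvd card ?L\<close> by presburger
    ultimately show ?thesis by blast
  qed
  then have "A = ?L" "B = ?L"
    using card_subset_eq[OF sub_fin[OF sL] AL] card_subset_eq[OF sub_fin[OF sL] BL] sA sB by simp_all
  then show False using AB by simp
qed

text \<open>
  The 24 elements of order 5, the 20 of order 3 and the non-trivial elements of the subgroups of order 4 are
  different, and there are 59 non-trivial elements.
\<close>

lemma card_sg4: "card (subgroups_of_order 4) = 5"
proof -
  let ?U = "\<lambda>k. \<Union>A\<in>subgroups_of_order k. A - {\<one>}"
  have c5: "card (?U 5) = 6 * (5 - 1)"
    by (subst card_partition_union[OF finite_sg]) (use prime_sg_disjoint[OF primes_235(3)] card_sg5 in \<open>auto simp: subgroups_of_order_def\<close>)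
  have c3: "card (?U 3) = 10 * (3 - 1)"
    by (subst card_partition_union[OF finite_sg]) (use prime_sg_disjoint[OF primes_235(2)] card_sg3 in \<open>auto simp: subgroups_of_order_def\<close>)
  have c4: "card (?U 4) = card (subgroups_of_order 4) * (4 - 1)"
    by (rule card_partition_union[OF finite_sg]) (use sg4_disjoint in \<open>auto simp: subgroups_of_order_def\<close>)
  have f: "finite (?U k)" for k using finite_sg sub_fin by (auto simp: subgroups_of_order_def)
  have cop: "A \<inter> B = {\<one>}" if "A \<in> subgroups_of_order k" "B \<in> subgroups_of_order l" "coprime k l" for A B k l
    using coprime_int_trivial that by (auto simp: subgroups_of_order_def)
  have co: "coprime (5::nat) 3" "coprime (5::nat) 4" "coprime (3::nat) 4" by (auto simp: coprime_iff_gcd_eq_1 gcd_nat.simps)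
  have d53: "?U 5 \<inter> ?U 3 = {}" using cop[OF _ _ co(1)] by blast
  have d54: "?U 5 \<inter> ?U 4 = {}" using cop[OF _ _ co(2)] by blast
  have d34: "?U 3 \<inter> ?U 4 = {}" using cop[OF _ _ co(3)] by blast
  have "card (?U 5 \<union> (?U 3 \<union> ?U 4)) = card (?U 5) + (card (?U 3) + card (?U 4))"
    using card_Un_disjoint[OF f f d34] card_Un_disjoint[OF f, of "?U 3 \<union> ?U 4" 5] f d53 d54 by (simp add: Int_Un_distrib)
  moreover have "?U 5 \<union> (?U 3 \<union> ?U 4) \<subseteq> carrier G - {\<one>}" using subgroup.subset by (fastforce simp: subgroups_of_order_def)
  then have "card (?U 5 \<union> (?U 3 \<union> ?U 4)) \<le> 59"
    using card_mono[of "carrier G - {\<one>}" "?U 5 \<union> (?U 3 \<union> ?U 4)"] fin n60 by (simp add: card_Diff_singleton)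
  ultimately have "card (subgroups_of_order 4) \<le> 5" using c5 c3 c4 by simp
  then show ?thesis using card_syl_ge(1)[OF primes_235(1) syl_sg(3)] by simp
qed

lemma card_nrm_4: "P \<in> subgroups_of_order 4 \<Longrightarrow> card (normalizer P) = 12"
  using card_syl_ge(2)[OF primes_235(1) syl_sg(3), of P] card_sg4 by simp

text \<open>
  An element of order 3 in the normalizer of \<open>P\<close> permutes the three non-trivial elements of \<open>P\<close>
  transitively, by \<open>no_mixed_order\<close>, and one of them is an involution.
\<close>

lemma elementary_4:
  assumes P: "P \<in> subgroups_of_order 4" and x: "x \<in> P" shows "x \<otimes> x = \<one>"
proof -
  have sP: "subgroup P G" "card P = 4" using P by (auto simp: subgroups_of_order_def)
  have Pc: "y \<in> P \<Longrightarrow> y \<in> carrier G" for y using sP subgroup.mem_carrier by metis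
  have sN: "subgroup (normalizer P) G" by (rule card_syl_ge(4)[OF primes_235(1) syl_sg(3) _ _ P]) simp_all
  obtain R where R: "subgroup R G" "R \<subseteq> normalizer P" "card R = 3"
    using prime_power_subgroup_ex[OF sN primes_235(2), of 1] card_nrm_4[OF P] by auto
  have R3: "R \<in> subgroups_of_order 3" using R by (simp add: subgroups_of_order_def)
  have Rc: "y \<in> R \<Longrightarrow> y \<in> carrier G" for y using R subgroup.mem_carrier by metis
  obtain T where T: "subgroup T G" "T \<subseteq> P" "card T = 2"
    using prime_power_subgroup_ex[OF sP(1) primes_235(1), of 1] sP by auto
  obtain t where t: "t \<in> T" "t \<noteq> \<one>" using T by (metis card_2_iff' subgroup.one_closed)
  have Te: "T = {\<one>, t}"
    using t T card_subset_eq[OF sub_fin[OF T(1)], of "{\<one>, t}"] subgroup.one_closed[OF T(1)] by auto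
  have tc: "t \<in> P" "t \<in> carrier G" using t T Pc by auto
  have "t \<otimes> t \<in> {\<one>, t}" using subgroup.m_closed[OF T(1) t(1) t(1)] Te by simp
  moreover have "t \<otimes> t \<noteq> t" using tc t(2) by simp
  ultimately have tt: "t \<otimes> t = \<one>" by auto
  let ?f = "\<lambda>g x. g \<otimes> x \<otimes> inv g"
  have inP: "?f g y \<in> P - {\<one>}" if "g \<in> R" "y \<in> P - {\<one>}" for g y
  proof -
    have gc: "g \<in> carrier G" "y \<in> carrier G" using that Rc Pc by auto
    have "conjugate g P = P" using that R(2) by (auto simp: normalizer_def)
    then have "?f g y \<in> P" using that by (auto simp: conjugate_def)
    moreover have "?f g y \<noteq> \<one>"
    proof
      assume "?f g y = \<one>"
      then have "?f g y = ?f g \<one>" using gc by simp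
      then show False using cj_inj[OF gc(1)] gc that unfolding inj_on_def by blast
    qed
    ultimately show ?thesis by simp
  qed
  have a: "acts R (P - {\<one>}) ?f"
    unfolding acts_def using inP Rc Pc by (auto simp: m_assoc inv_mult_group)
  have tP: "t \<in> P - {\<one>}" using t tc by simp
  have os: "card (orbit R ?f t) * card {g \<in> R. ?f g t = t} = 3" using orbit_stabilizer[OF R(1) a tP] R by simp
  have "card {g \<in> R. ?f g t = t} \<noteq> 3"
  proof
    assume "card {g \<in> R. ?f g t = t} = 3"
    then have e: "{g \<in> R. ?f g t = t} = R" using card_subset_eq[OF sub_fin[OF R(1)], of "{g \<in> R. ?f g t = t}"] R by auto
    have "conjugate g T = T" if "g \<in> R" for g
    proof -
      have "?f g t = t" using e that by blast
      then show ?thesis using Te Rc[OF that] by (simp add: conjugate_def)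
    qed
    then have "R \<subseteq> normalizer T" using Rc by (auto simp: normalizer_def)
    then show False using no_mixed_order[of T R] T R3 by (simp add: subgroups_of_order_def)
  qed
  moreover have "card (orbit R ?f t) dvd 3" by (rule dvdI[OF os[symmetric]])
  then have "card (orbit R ?f t) = 1 \<or> card (orbit R ?f t) = 3" using primes_235(2) prime_nat_iff by blast
  ultimately have "card (orbit R ?f t) = 3" using os by auto
  moreover have "card (P - {\<one>}) = 3" using sP subgroup.one_closed[OF sP(1)] by (simp add: card_Diff_singleton)
  ultimately have "orbit R ?f t = P - {\<one>}"
    using card_subset_eq[OF _ orb_closed[OF a tP]] sub_fin[OF sP(1)] by simp
  then have "x = \<one> \<or> (\<exists>g\<in>R. x = ?f g t)" using x by (auto simp: orbit_def)
  then show ?thesis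
  proof
    assume "\<exists>g\<in>R. x = ?f g t"
    then obtain g where g: "g \<in> R" "x = ?f g t" by blast
    have gc: "g \<in> carrier G" using g Rc by simp
    have "x \<otimes> x = g \<otimes> (t \<otimes> (inv g \<otimes> g) \<otimes> t) \<otimes> inv g" using g gc tc by (simp only: m_assoc m_closed inv_closed)
    also have "\<dots> = \<one>" using gc tc tt by simp
    finally show ?thesis .
  qed simp
qed

lemma two_elements_in_sg4:
  assumes A: "subgroup A G" "card A = 2 ^ a" shows "\<exists>P\<in>subgroups_of_order 4. A \<subseteq> P"
proof -
  obtain P0 where P0: "P0 \<in> sylows 2 (carrier G)" using syl_ex[OF subgroup_self primes_235(1)] by blast
  obtain g where g: "g \<in> carrier G" "A \<subseteq> conjugate g P0"
    using syl_subset_conj[OF subgroup_self primes_235(1) P0 A(1) subgroup.subset[OF A(1)] A(2)] by blast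
  then show ?thesis using syl_cj[OF subgroup_self g(1) P0] syl_sg by auto
qed

lemma pow4_imp_square:
  assumes x: "x \<in> carrier G" "x [^] (4::nat) = \<one>" shows "x \<otimes> x = \<one>"
proof -
  have "ord x dvd 4" using pow_eq_id[OF x(1)] x(2) by simp
  then have "ord x dvd 2 ^ 2" by simp
  then obtain a where "ord x = 2 ^ a" using divides_primepow_nat[OF primes_235(1)] by blast
  moreover have "card (generate G {x}) = ord x" using generate_pow_card[OF x(1)] by simp
  ultimately obtain P where P: "P \<in> subgroups_of_order 4" "generate G {x} \<subseteq> P"
    using two_elements_in_sg4[OF generate_is_subgroup[of "{x}"], of a] x(1) by auto
  then show ?thesis using elementary_4[OF P(1), of x] generate.incl[of x "{x}"] by blast
qed

text \<open>
  Each involution lies in exactly one of the five subgroups of order 4.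
\<close>

lemma card_sg2: "card (subgroups_of_order 2) = 15"
proof -
  let ?U = "\<Union>A\<in>subgroups_of_order 4. A - {\<one>}"
  have c4: "card ?U = 5 * (4 - 1)"
    by (subst card_partition_union[OF finite_sg]) (use sg4_disjoint card_sg4 in \<open>auto simp: subgroups_of_order_def\<close>)
  have "bij_betw (\<lambda>t. {\<one>, t}) ?U (subgroups_of_order 2)"
  proof (rule bij_betw_imageI)
    show "inj_on (\<lambda>t. {\<one>, t}) ?U" by (auto simp: inj_on_def doubleton_eq_iff)
    show "(\<lambda>t. {\<one>, t}) ` ?U = subgroups_of_order 2"
    proof
      show "(\<lambda>t. {\<one>, t}) ` ?U \<subseteq> subgroups_of_order 2"
      proof
        fix T assume "T \<in> (\<lambda>t. {\<one>, t}) ` ?U"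
        then obtain t P where t: "t \<in> P" "t \<noteq> \<one>" "P \<in> subgroups_of_order 4" "T = {\<one>, t}" by auto
        have "t \<in> carrier G" using t(1,3) subgroup.mem_carrier[of P G t] by (simp add: subgroups_of_order_def)
        then show "T \<in> subgroups_of_order 2" using two_subgroup elementary_4[OF t(3,1)] t(2,4) by (simp add: subgroups_of_order_def)
      qed
      show "subgroups_of_order 2 \<subseteq> (\<lambda>t. {\<one>, t}) ` ?U"
      proof
        fix T assume "T \<in> subgroups_of_order 2"
        then have T: "subgroup T G" "card T = 2" by (auto simp: subgroups_of_order_def)
        obtain P where P: "P \<in> subgroups_of_order 4" "T \<subseteq> P" using two_elements_in_sg4[OF T(1), of 1] T by auto
        obtain t where t: "t \<in> T" "t \<noteq> \<one>" using T by (metis card_2_iff' subgroup.one_closed)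
        have Te: "T = {\<one>, t}"
          using t T card_subset_eq[OF sub_fin[OF T(1)], of "{\<one>, t}"] subgroup.one_closed[OF T(1)] by auto
        then show "T \<in> (\<lambda>t. {\<one>, t}) ` ?U" using P t by blast
      qed
    qed
  qed
  then show ?thesis using c4 bij_betw_same_card by fastforce
qed

lemma normalizer_of_sylow_eq:
  assumes p: "prime p" and k: "sylows p (carrier G) = subgroups_of_order k" "k \<noteq> 1" "k \<noteq> 60"
    and K: "K \<in> subgroups_of_order m" and R: "R \<in> sylows p K" "R \<in> subgroups_of_order k" and n: "K \<subseteq> normalizer R" and c: "card (normalizer R) = m"
  shows "K \<in> normalizer ` subgroups_of_order k"
proof -
  have "K = normalizer R"
    by (rule card_subset_eq[OF sub_fin[OF card_syl_ge(4)[OF p k R(2)]] n]) (use K c in \<open>simp add: subgroups_of_order_def\<close>)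
  then show ?thesis using R by blast
qed

text \<open>
  A subgroup of order 6, 10 or 12 has a normal Sylow subgroup, for the prime 3, 5 or 2, and it is its normalizer.
\<close>

lemma sg_normalizers: "subgroups_of_order 6 = normalizer ` subgroups_of_order 3" "subgroups_of_order 10 = normalizer ` subgroups_of_order 5" "subgroups_of_order 12 = normalizer ` subgroups_of_order 4"
proof -
  show "subgroups_of_order 6 = normalizer ` subgroups_of_order 3"
  proof
    show "normalizer ` subgroups_of_order 3 \<subseteq> subgroups_of_order 6" using card_nrm_3 card_syl_ge(4)[OF primes_235(2) syl_sg(2)] by (auto simp: subgroups_of_order_def)
    show "subgroups_of_order 6 \<subseteq> normalizer ` subgroups_of_order 3"
    proof
      fix K assume K: "K \<in> subgroups_of_order 6"
      then have sK: "subgroup K G" "card K = 6" by (auto simp: subgroups_of_order_def)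
      have S: "sylows 3 K = {R. subgroup R G \<and> R \<subseteq> K \<and> card R = 3 ^ 1}" using syl_prime_powerI[OF primes_235(2), of K 1 2] sK by simp
      have "card (sylows 3 K) dvd 2" using card_syl_dvd[OF sK(1) primes_235(2), of 1 2] sK by simp
      then have "card (sylows 3 K) \<le> 2" by (simp add: dvd_imp_le)
      moreover have "card (sylows 3 K) mod 3 = 1" by (rule card_syl_mod[OF sK(1) primes_235(2)])
      ultimately have c: "card (sylows 3 K) = 1" by presburger
      obtain R where R: "R \<in> sylows 3 K" using syl_ex[OF sK(1) primes_235(2)] by blast
      have R3: "R \<in> subgroups_of_order 3" using R S by (simp add: subgroups_of_order_def)
      show "K \<in> normalizer ` subgroups_of_order 3"
        by (rule normalizer_of_sylow_eq[OF primes_235(2) syl_sg(2) _ _ K R R3 syl_unique_normal[OF sK(1) primes_235(2) R c] card_nrm_3[OF R3]]) simp_all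
    qed
  qed
  show "subgroups_of_order 10 = normalizer ` subgroups_of_order 5"
  proof
    show "normalizer ` subgroups_of_order 5 \<subseteq> subgroups_of_order 10" using card_nrm_5 card_syl_ge(4)[OF primes_235(3) syl_sg(1)] by (auto simp: subgroups_of_order_def)
    show "subgroups_of_order 10 \<subseteq> normalizer ` subgroups_of_order 5"
    proof
      fix K assume K: "K \<in> subgroups_of_order 10"
      then have sK: "subgroup K G" "card K = 10" by (auto simp: subgroups_of_order_def)
      have S: "sylows 5 K = {R. subgroup R G \<and> R \<subseteq> K \<and> card R = 5 ^ 1}" using syl_prime_powerI[OF primes_235(3), of K 1 2] sK by simp
      have "card (sylows 5 K) dvd 2" using card_syl_dvd[OF sK(1) primes_235(3), of 1 2] sK by simp
      then have "card (sylows 5 K) \<le> 2" by (simp add: dvd_imp_le)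
      moreover have "card (sylows 5 K) mod 5 = 1" by (rule card_syl_mod[OF sK(1) primes_235(3)])
      ultimately have c: "card (sylows 5 K) = 1" by presburger
      obtain R where R: "R \<in> sylows 5 K" using syl_ex[OF sK(1) primes_235(3)] by blast
      have R3: "R \<in> subgroups_of_order 5" using R S by (simp add: subgroups_of_order_def)
      show "K \<in> normalizer ` subgroups_of_order 5"
        by (rule normalizer_of_sylow_eq[OF primes_235(3) syl_sg(1) _ _ K R R3 syl_unique_normal[OF sK(1) primes_235(3) R c] card_nrm_5[OF R3]]) simp_all
    qed
  qed
  show "subgroups_of_order 12 = normalizer ` subgroups_of_order 4"
  proof
    show "normalizer ` subgroups_of_order 4 \<subseteq> subgroups_of_order 12" using card_nrm_4 card_syl_ge(4)[OF primes_235(1) syl_sg(3)] by (auto simp: subgroups_of_order_def)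
    show "subgroups_of_order 12 \<subseteq> normalizer ` subgroups_of_order 4"
    proof
      fix K assume K: "K \<in> subgroups_of_order 12"
      then have sK: "subgroup K G" "card K = 12" by (auto simp: subgroups_of_order_def)
      obtain R where R: "R \<in> sylows 2 K" using syl_ex[OF sK(1) primes_235(1)] by blast
      have R3: "R \<in> subgroups_of_order 4" using R order_12(2)[OF K R] by (simp add: subgroups_of_order_def sylows_def)
      show "K \<in> normalizer ` subgroups_of_order 4"
        by (rule normalizer_of_sylow_eq[OF primes_235(1) syl_sg(3) _ _ K R R3 order_12(1)[OF K R] card_nrm_4[OF R3]]) simp_all
    qed
  qed
qed

lemma card_sg_normalizers: "card (subgroups_of_order 6) = 10" "card (subgroups_of_order 10) = 6" "card (subgroups_of_order 12) = 5"
  using card_image[OF nrm_inj_syl[OF subgroup_self primes_235(2)]] card_image[OF nrm_inj_syl[OF subgroup_self primes_235(3)]]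
    card_image[OF nrm_inj_syl[OF subgroup_self primes_235(1)]] card_sg3 card_sg4 card_sg5
  by (simp_all add: syl_sg sg_normalizers)

lemma subgroup_orders:
  assumes K: "subgroup K G" shows "card K \<in> {1, 2, 3, 4, 5, 6, 10, 12, 60}"
proof (cases "K = carrier G")
  case False
  have d: "card K dvd 60" using card_dvd_order[OF K] n60 by simp
  have A: "\<forall>x\<in>set [2..<13::nat]. x dvd 60 \<longrightarrow> x \<in> {1, 2, 3, 4, 5, 6, 10, 12, 60}" by (simp add: upt_rec_numeral del: set_upt)
  show ?thesis using bounded_dvd_search[OF A d] sub_card_pos[OF K] proper_card_le[OF K False] by (cases "card K = 1") auto
qed (use n60 in simp)

text \<open>
  Sorted by order, the subgroups are 1 + 15 + 10 + 5 + 6 + 10 + 6 + 5 + 1 in number.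
\<close>

lemma card_subgroups: "card {K. subgroup K G} = 59"
proof -
  let ?O = "{1, 2, 3, 4, 5, 6, 10, 12, 60::nat}"
  have e: "{K. subgroup K G} = (\<Union>k\<in>?O. subgroups_of_order k)" using subgroup_orders by (auto simp: subgroups_of_order_def)
  have "card (\<Union>k\<in>?O. subgroups_of_order k) = (\<Sum>k\<in>?O. card (subgroups_of_order k))"
    by (rule card_UN_disjoint) (use finite_sg in \<open>auto simp: subgroups_of_order_def\<close>)
  moreover have "card (subgroups_of_order 1) = 1"
  proof -
    have "subgroups_of_order 1 = {{\<one>}}" using triv_subgroup subgroup.one_closed by (fastforce simp: subgroups_of_order_def card_1_singleton_iff)
    then show ?thesis by simp
  qed
  moreover have "card (subgroups_of_order 60) = 1"
  proof -
    have "K = carrier G" if "K \<in> subgroups_of_order 60" for K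
      using that card_subset_eq[OF fin, of K] n60 by (simp add: subgroups_of_order_def subgroup.subset)
    moreover have "carrier G \<in> subgroups_of_order 60" using subgroup_self n60 by (simp add: subgroups_of_order_def)
    ultimately have "subgroups_of_order 60 = {carrier G}" by blast
    then show ?thesis by simp
  qed
  ultimately show ?thesis using e card_sg2 card_sg3 card_sg4 card_sg5 card_sg_normalizers by simp
qed

text \<open>
  A proper subgroup has at most 11 non-trivial elements, so it contains at most two subgroups of order 5 and
  at most five of order 3. The others, and their normalizers, are 4 + 4 + 5 + 5 subgroups that it does not
  contain.
\<close>

lemma many_subgroups_outside:
  assumes B: "subgroup B G" "B \<noteq> carrier G"
  shows "18 \<le> card {A. subgroup A G \<and> \<not> A \<subseteq> B}"
proof -
  define out where "out k = {A \<in> subgroups_of_order k. \<not> A \<subseteq> B}" for k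
  have cB: "card B \<le> 12" by (rule proper_card_le[OF B])
  have prime_out: "card (subgroups_of_order p) \<le> card (out p) + c" if p: "prime p" "11 < Suc c * (p - 1)" for p c
  proof -
    define X where "X = {A \<in> subgroups_of_order p. A \<subseteq> B}"
    have fX: "finite X" using finite_sg by (simp add: X_def)
    have "card (\<Union>A\<in>X. A - {\<one>}) = card X * (p - 1)"
      by (rule card_partition_union[OF fX]) (use prime_sg_disjoint[OF p(1)] in \<open>auto simp: X_def subgroups_of_order_def\<close>)
    moreover have "card (\<Union>A\<in>X. A - {\<one>}) \<le> card (B - {\<one>})"
      by (rule card_mono) (use sub_fin[OF B(1)] in \<open>auto simp: X_def\<close>)
    moreover have "card (B - {\<one>}) \<le> 11"
      using cB subgroup.one_closed[OF B(1)] by (simp add: card_Diff_singleton)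
    ultimately have "card X * (p - 1) < Suc c * (p - 1)" using p(2) by linarith
    then have "card X < Suc c" unfolding mult_less_cancel2 by blast
    then have "card X \<le> c" by simp
    moreover have "card (subgroups_of_order p) = card (out p) + card X"
    proof -
      have "subgroups_of_order p = out p \<union> X" "out p \<inter> X = {}" by (auto simp: out_def X_def)
      then show ?thesis using card_Un_disjoint[of "out p" X] fX finite_sg by (simp add: out_def)
    qed
    ultimately show ?thesis by simp
  qed
  have o5: "4 \<le> card (out 5)" using prime_out[of 5 2] card_sg5 by simp
  have o3: "5 \<le> card (out 3)" using prime_out[of 3 5] card_sg3 by simp
  have nrm_out: "card (out k) \<le> card (out m)" if k: "subgroups_of_order m = normalizer ` subgroups_of_order k" "inj_on normalizer (subgroups_of_order k)" for k m
  proof -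
    have "normalizer ` out k \<subseteq> out m" using k(1) sub_nrm by (fastforce simp: out_def subgroups_of_order_def)
    moreover have "finite (out m)" using finite_sg by (simp add: out_def)
    ultimately have "card (normalizer ` out k) \<le> card (out m)" by (rule card_mono[rotated])
    moreover have "inj_on normalizer (out k)" by (rule inj_on_subset[OF k(2)]) (auto simp: out_def)
    ultimately show ?thesis by (simp add: card_image)
  qed
  have o10: "4 \<le> card (out 10)"
    using nrm_out[OF sg_normalizers(2)] nrm_inj_syl[OF subgroup_self primes_235(3)] o5 syl_sg by simp
  have o6: "5 \<le> card (out 6)"
    using nrm_out[OF sg_normalizers(1)] nrm_inj_syl[OF subgroup_self primes_235(2)] o3 syl_sg by simp
  let ?O = "{3, 5, 6, 10::nat}"
  have fo: "finite (out k)" for k using finite_sg by (simp add: out_def)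
  have "card (\<Union>k\<in>?O. out k) = (\<Sum>k\<in>?O. card (out k))"
    by (rule card_UN_disjoint) (use fo in \<open>auto simp: out_def subgroups_of_order_def\<close>)
  moreover have "card (\<Union>k\<in>?O. out k) \<le> card {A. subgroup A G \<and> \<not> A \<subseteq> B}"
  proof (rule card_mono)
    show "finite {A. subgroup A G \<and> \<not> A \<subseteq> B}"
      by (rule finite_subset[of _ "Pow (carrier G)"]) (use fin in \<open>auto dest: subgroup.subset\<close>)
  qed (auto simp: out_def subgroups_of_order_def)
  ultimately show ?thesis using o3 o5 o6 o10 by simp
qed

end

lemma (in few_subgroups) simple_60: "simple_60 G"
  by (intro simple_60.intro simple_60_axioms.intro simple_fin_axioms order_eq_60)

lemma simple_group_simple_60:
  assumes "simple_group G" "order G = 60" shows "simple_60 G"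
proof -
  have "finite (carrier G)" using assms(2) card_gt_0_iff[of "carrier G"] by (simp add: order_def)
  moreover have "\<not> prime (60::nat)"
  proof
    assume "prime (60::nat)"
    then show False using prime_nat_iff[of 60] by (auto dest: spec[of _ 2])
  qed
  ultimately show ?thesis
    using simple_group_simple_fin[OF assms(1)] assms(2)
    by (intro simple_60.intro simple_60_axioms.intro) (simp_all add: order_def)
qed

section \<open>Groups containing the simple group of order 60\<close>

lemma (in fin_group) subgroup_restrict_iff:
  assumes H: "subgroup H G"
  shows "subgroup K (G\<lparr>carrier := H\<rparr>) \<longleftrightarrow> subgroup K G \<and> K \<subseteq> H"
  using subgroup_incl[OF _ H] incl_subgroup[OF H] subgroup.subset[of K "G\<lparr>carrier := H\<rparr>"] by auto

lemma (in fin_group) fin_group_restrict: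
  "subgroup H G \<Longrightarrow> fin_group (G\<lparr>carrier := H\<rparr>)"
  by (intro fin_group.intro fin_group_axioms.intro subgroup.subgroup_is_group is_group) (simp_all add: sub_fin)

text \<open>
  If \<open>H\<close> is normal, then by the Frattini argument the normalizers in \<open>G\<close> of the 5 + 10 + 6 Sylow subgroups of
  \<open>H\<close> do not lie in \<open>H\<close>; they are different, because they determine the Sylow subgroups. Otherwise \<open>H\<close>
  differs from a conjugate, which has 18 subgroups outside the intersection with \<open>H\<close> by
  \<open>many_subgroups_outside\<close>. In both cases at least 18 subgroups join the 59 subgroups of \<open>H\<close>.
\<close>

lemma (in fin_group) subgroups_above_simple_60:
  assumes H: "subgroup H G" "H \<noteq> carrier G" and s: "simple_60 (G\<lparr>carrier := H\<rparr>)"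
  shows "77 \<le> card {K. subgroup K G}"
proof -
  interpret S: simple_60 "G\<lparr>carrier := H\<rparr>" by (rule s)
  have cH: "card H = 60" using S.n60 by simp
  have sgH: "S.subgroups_of_order k = {K. subgroup K G \<and> K \<subseteq> H \<and> card K = k}" for k
    by (auto simp: S.subgroups_of_order_def subgroup_restrict_iff[OF H(1)])
  let ?I = "{K. subgroup K G \<and> K \<subseteq> H}"
  have cI: "card ?I = 59" using S.card_subgroups by (simp add: subgroup_restrict_iff[OF H(1)])
  have more: "77 \<le> card {K. subgroup K G}" if X: "X \<subseteq> {K. subgroup K G}" "X \<inter> ?I = {}" "18 \<le> card X" for X
  proof -
    have f: "finite ?I" "finite X" using finite_subset[OF _ finite_subgroups] X(1) by auto
    have "card (X \<union> ?I) = card X + card ?I" by (rule card_Un_disjoint[OF f(2,1) X(2)])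
    moreover have "card (X \<union> ?I) \<le> card {K. subgroup K G}"
      by (rule card_mono[OF finite_subgroups]) (use X in auto)
    ultimately show ?thesis using X(3) cI by simp
  qed
  show ?thesis
  proof (cases "normalizer H = carrier G")
    case True
    have sylows: "sylows 5 H = S.subgroups_of_order 5" "sylows 3 H = S.subgroups_of_order 3" "sylows 2 H = S.subgroups_of_order 4"
      using syl_prime_powerI[of 5 H 1 12] syl_prime_powerI[of 3 H 1 20] syl_prime_powerI[of 2 H 2 15] cH
      by (simp_all add: sgH)
    have main: "normalizer P \<in> {K. subgroup K G \<and> \<not> K \<subseteq> H \<and> card (H \<inter> K) * card (sylows p H) = 60}"
      if p: "prime p" and P: "P \<in> sylows p H" for p P
    proof -
      have sP: "subgroup P G" using P by (simp add: sylows_def)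
      have "\<not> normalizer P \<subseteq> H"
      proof
        assume sub: "normalizer P \<subseteq> H"
        have "carrier G \<subseteq> H"
        proof
          fix g assume g: "g \<in> carrier G"
          obtain h where h: "h \<in> H" "inv h \<otimes> g \<in> normalizer P" using frattini[OF H(1) True p P g] by blast
          have hc: "h \<in> carrier G" using h(1) H(1) subgroup.mem_carrier by metis
          have "h \<otimes> (inv h \<otimes> g) \<in> H" using subgroup.m_closed[OF H(1) h(1)] h(2) sub by blast
          then show "g \<in> H" using hc g by (simp add: m_assoc[symmetric])
        qed
        then show False using H subgroup.subset[OF H(1)] by blast
      qed
      moreover have "card (H \<inter> normalizer P) * card (sylows p H) = 60"
        using card_syl[OF H(1) p P] cH by (simp add: mult.commute)
      ultimately show ?thesis using nrm_subgroup[OF subgroup.subset[OF sP]] by simp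
    qed
    have cards: "card (normalizer ` sylows p H) = card (sylows p H)" if "prime p" for p
      by (rule card_image[OF nrm_inj_syl[OF H(1) that]])
    have pr: "prime (2::nat)" "prime (3::nat)" "prime (5::nat)" by simp_all
    have cs: "card (sylows 2 H) = 5" "card (sylows 3 H) = 10" "card (sylows 5 H) = 6"
      using sylows S.card_sg3 S.card_sg4 S.card_sg5 by simp_all
    have i2: "normalizer ` sylows 2 H \<subseteq> {K. subgroup K G \<and> \<not> K \<subseteq> H \<and> card (H \<inter> K) = 12}"
      using main[OF pr(1)] cs by auto
    have i3: "normalizer ` sylows 3 H \<subseteq> {K. subgroup K G \<and> \<not> K \<subseteq> H \<and> card (H \<inter> K) = 6}"
      using main[OF pr(2)] cs by auto
    have i5: "normalizer ` sylows 5 H \<subseteq> {K. subgroup K G \<and> \<not> K \<subseteq> H \<and> card (H \<inter> K) = 10}"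
      using main[OF pr(3)] cs by auto
    let ?X = "normalizer ` sylows 2 H \<union> (normalizer ` sylows 3 H \<union> normalizer ` sylows 5 H)"
    have f: "finite (normalizer ` sylows p H)" for p using syl_finite by simp
    have int2: "card (H \<inter> K) = 12" if "K \<in> normalizer ` sylows 2 H" for K using i2 that by blast
    have int3: "card (H \<inter> K) = 6" if "K \<in> normalizer ` sylows 3 H" for K using i3 that by blast
    have int5: "card (H \<inter> K) = 10" if "K \<in> normalizer ` sylows 5 H" for K using i5 that by blast
    have d1: "normalizer ` sylows 3 H \<inter> normalizer ` sylows 5 H = {}"
    proof (rule equals0I)
      fix K assume "K \<in> normalizer ` sylows 3 H \<inter> normalizer ` sylows 5 H"
      then show False using int3[of K] int5[of K] by simp
    qed
    have d2: "normalizer ` sylows 2 H \<inter> (normalizer ` sylows 3 H \<union> normalizer ` sylows 5 H) = {}"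
    proof (rule equals0I)
      fix K assume "K \<in> normalizer ` sylows 2 H \<inter> (normalizer ` sylows 3 H \<union> normalizer ` sylows 5 H)"
      then show False using int2[of K] int3[of K] int5[of K] by auto
    qed
    have "card ?X = 21"
      using card_Un_disjoint[OF f _ d2] card_Un_disjoint[OF f f d1] f cards[OF pr(1)] cards[OF pr(2)] cards[OF pr(3)] cs by simp
    then show ?thesis by (intro more[of ?X]) (use i2 i3 i5 in auto)
  next
    case False
    then obtain g where g: "g \<in> carrier G" "conjugate g H \<noteq> H" by (auto simp: normalizer_def)
    have gi: "inv g \<in> carrier G" using g by simp
    define B where "B = H \<inter> conjugate (inv g) H"
    have Hc: "H \<subseteq> carrier G" by (rule subgroup.subset[OF H(1)])
    have sB: "subgroup B G" unfolding B_def by (rule subgroups_Inter_pair[OF H(1) subgroup_cj[OF gi H(1)]])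
    have "B \<noteq> H"
    proof
      assume "B = H"
      then have "H \<subseteq> conjugate (inv g) H" by (auto simp: B_def)
      then have "conjugate g H \<subseteq> conjugate g (conjugate (inv g) H)" by (rule cj_mono)
      then have "conjugate g H \<subseteq> H" using cj_inv'[OF g(1) Hc] by simp
      then show False using card_subset_eq[OF sub_fin[OF H(1)]] card_cj[OF g(1) Hc] g(2) by simp
    qed
    then have "18 \<le> card {A. subgroup A (G\<lparr>carrier := H\<rparr>) \<and> \<not> A \<subseteq> B}"
      using S.many_subgroups_outside[of B] sB by (simp add: subgroup_restrict_iff[OF H(1)] B_def)
    moreover define Y where "Y = {A. subgroup A (G\<lparr>carrier := H\<rparr>) \<and> \<not> A \<subseteq> B}"
    have Yc: "A \<subseteq> carrier G \<and> A \<subseteq> H \<and> subgroup A G \<and> \<not> A \<subseteq> B" if "A \<in> Y" for A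
      using that subgroup.subset by (auto simp: Y_def subgroup_restrict_iff[OF H(1)])
    have "inj_on (conjugate g) Y" by (rule inj_onI) (metis cj_inv[OF g(1)] Yc)
    ultimately have "18 \<le> card (conjugate g ` Y)" by (simp add: card_image Y_def)
    moreover have "conjugate g ` Y \<subseteq> {K. subgroup K G}" using Yc subgroup_cj[OF g(1)] by auto
    moreover have "conjugate g A \<notin> ?I" if A: "A \<in> Y" for A
    proof
      assume "conjugate g A \<in> ?I"
      then have "conjugate (inv g) (conjugate g A) \<subseteq> conjugate (inv g) H" by (intro cj_mono) simp
      then have "A \<subseteq> conjugate (inv g) H" using cj_inv[OF g(1)] Yc[OF A] by simp
      then show False using Yc[OF A] by (auto simp: B_def)
    qed
    then have "conjugate g ` Y \<inter> ?I = {}" by blast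
    ultimately show ?thesis by (intro more[of "conjugate g ` Y"])
  qed
qed

section \<open>Extensions of the simple group of order 60\<close>

lemma (in fin_group) lcos_stabilizer:
  assumes R: "subgroup R G" and g: "g \<in> carrier G"
  shows "(\<lambda>x. g \<otimes> x) ` R = R \<longleftrightarrow> g \<in> R"
proof
  assume "(\<lambda>x. g \<otimes> x) ` R = R"
  then have "g \<otimes> \<one> \<in> R" using subgroup.one_closed[OF R] by blast
  then show "g \<in> R" using g by simp
next
  assume gR: "g \<in> R"
  show "(\<lambda>x. g \<otimes> x) ` R = R"
  proof (rule card_seteq[OF sub_fin[OF R]])
    show "(\<lambda>x. g \<otimes> x) ` R \<subseteq> R" using gR R by (auto simp: subgroup.m_closed)
    have "inj_on (\<lambda>x. g \<otimes> x) R" using g R by (auto simp: inj_on_def subgroup.mem_carrier)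
    then show "card R \<le> card ((\<lambda>x. g \<otimes> x) ` R)" by (simp add: card_image)
  qed
qed

text \<open>
  \<open>K\<close> acts by left multiplication on the cosets of \<open>N\<close>, and \<open>K \<inter> N\<close> is the stabilizer of \<open>N\<close>.
\<close>

lemma (in fin_group) card_image_quotient:
  assumes N: "N \<lhd> G" and K: "subgroup K G"
  shows "card ((\<lambda>x. N #> x) ` K) * card (K \<inter> N) = card K"
proof -
  have sN: "subgroup N G" using N by (rule normal_imp_subgroup)
  have Nc: "N \<subseteq> carrier G" by (rule subgroup.subset[OF sN])
  let ?A = "\<lambda>g. (`) (\<lambda>x. g \<otimes> x)"
  have a: "acts K (left_cosets (carrier G) N) ?A" by (rule acts_lcos[OF subgroup_self K subgroup.subset[OF K] Nc])
  have "(\<lambda>x. \<one> \<otimes> x) ` N = N" using lcos_stabilizer[OF sN one_closed] subgroup.one_closed[OF sN] by simp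
  then have mem: "N \<in> left_cosets (carrier G) N" unfolding left_cosets_def by (metis imageI one_closed)
  have "orbit K ?A N = (\<lambda>x. N #> x) ` K" unfolding orbit_def
  proof (rule image_cong[OF refl])
    fix x assume "x \<in> K"
    then have x: "x \<in> carrier G" using K subgroup.mem_carrier by metis
    have "N #> x = x <# N" using N x by (simp add: normal.coset_eq)
    then show "(\<lambda>y. x \<otimes> y) ` N = N #> x" by (auto simp: l_coset_def)
  qed
  moreover have "{g \<in> K. ?A g N = N} = K \<inter> N"
    using lcos_stabilizer[OF sN] subgroup.mem_carrier[OF K] by blast
  ultimately show ?thesis using orbit_stabilizer[OF K a mem] by simp
qed

lemma (in fin_group) quotient_preimage:
  assumes N: "N \<lhd> G" and A: "subgroup A (G Mod N)"
  shows "(\<lambda>x. N #> x) ` (\<Union>A) = A"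
proof -
  interpret N: normal N G by (rule N)
  have ch: "\<Union>A = {x \<in> carrier G. N #> x \<in> A}" by (rule N.factgroup_subgroup_union_char[OF A])
  show ?thesis
  proof
    show "(\<lambda>x. N #> x) ` (\<Union>A) \<subseteq> A" using ch by auto
    show "A \<subseteq> (\<lambda>x. N #> x) ` (\<Union>A)"
    proof
      fix c assume c: "c \<in> A"
      then have "c \<in> carrier (G Mod N)" using subgroup.subset[OF A] by auto
      then obtain x where "x \<in> carrier G" "c = N #> x" by (auto simp: carrier_FactGroup)
      then show "c \<in> (\<lambda>x. N #> x) ` (\<Union>A)" using c unfolding ch by auto
    qed
  qed
qed

lemma (in fin_group) card_subgroups_quotient:
  assumes N: "N \<lhd> G"
  shows "card {A. subgroup A (G Mod N)} \<le> card {K. subgroup K G}"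
proof (rule card_inj_on_le)
  show "inj_on Union {A. subgroup A (G Mod N)}"
    by (rule inj_onI) (metis quotient_preimage[OF N] mem_Collect_eq)
  show "Union ` {A. subgroup A (G Mod N)} \<subseteq> {K. subgroup K G}"
    using normal.factgroup_subgroup_union_subgroup[OF N] by blast
qed (rule finite_subgroups)

locale extension_of_simple_60 = fin_group +
  fixes N :: "'a set"
  assumes N: "N \<lhd> G" and S: "simple_60 (G Mod N)"
begin

sublocale S: simple_60 "G Mod N" by (rule S)
sublocale N: normal N G by (rule N)

abbreviation \<pi> :: "'a \<Rightarrow> 'a set" where "\<pi> x \<equiv> N #> x"

lemma sN: "subgroup N G" using N by (rule normal_imp_subgroup)

lemma pi_hom: "group_hom G (G Mod N) (\<lambda>x. \<pi> x)"
  by (intro group_hom.intro group_hom_axioms.intro N.r_coset_hom_Mod is_group S.is_group)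

lemma card_G: "card (carrier G) = 60 * card N"
proof -
  have "card (carrier (G Mod N)) * card N = card (carrier G)"
    using lagrange[OF sN] by (simp add: FactGroup_def order_def)
  then show ?thesis using S.n60 by simp
qed

lemma preimage:
  assumes A: "subgroup A (G Mod N)"
  shows "subgroup (\<Union>A) G" "N \<subseteq> \<Union>A" "(\<lambda>x. \<pi> x) ` (\<Union>A) = A" "card (\<Union>A) = card A * card N"
proof -
  show sA: "subgroup (\<Union>A) G" by (rule N.factgroup_subgroup_union_subgroup[OF A])
  have ch: "\<Union>A = {x \<in> carrier G. \<pi> x \<in> A}" by (rule N.factgroup_subgroup_union_char[OF A])
  show NA: "N \<subseteq> \<Union>A" using subgroup.one_closed[OF A] by auto
  show i: "(\<lambda>x. \<pi> x) ` (\<Union>A) = A" by (rule quotient_preimage[OF N A])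
  show "card (\<Union>A) = card A * card N"
    using card_image_quotient[OF N sA] i NA by (simp add: Int_absorb1)
qed

text \<open>
  Every Sylow \<open>p\<close>-subgroup of the preimage of \<open>A\<close> is mapped onto \<open>A\<close>.
\<close>

lemma prime_power_lift:
  assumes p: "prime p" and A: "subgroup A (G Mod N)" "card A = p ^ a"
  shows "\<exists>K b. subgroup K G \<and> card K = p ^ b \<and> (\<lambda>x. \<pi> x) ` K = A"
proof -
  note M = preimage[OF A(1)]
  obtain K where K: "K \<in> sylows p (\<Union>A)" using syl_ex[OF M(1) p] by blast
  then have sK: "subgroup K G" "K \<subseteq> \<Union>A" "card K = p ^ multiplicity p (card (\<Union>A))" by (auto simp: sylows_def)
  have KA: "(\<lambda>x. \<pi> x) ` K \<subseteq> A" using sK(2) M(3) by blast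
  have Np: "card N > 0" by (rule sub_card_pos[OF sN])
  have nu: "\<not> is_unit p" using p not_prime_unit by blast
  have mu: "multiplicity p (card (\<Union>A)) = a + multiplicity p (card N)"
    using M(4) A(2) p Np prime_gt_1_nat[OF p]
    by (simp add: prime_elem_multiplicity_mult_distrib multiplicity_same_power' prime_imp_prime_elem nu)
  have d: "card (K \<inter> N) dvd p ^ multiplicity p (card (\<Union>A))"
    using card_dvd[OF subgroups_Inter_pair[OF sK(1) sN] sK(1)] sK(3) by auto
  then obtain e where e: "card (K \<inter> N) = p ^ e" using divides_primepow_nat[OF p] by blast
  have "p ^ e dvd card N" using card_dvd[OF subgroups_Inter_pair[OF sK(1) sN] sN] e by auto
  then have "e \<le> multiplicity p (card N)" using Np nu by (simp add: power_dvd_iff_le_multiplicity)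
  then have "p ^ e \<le> p ^ multiplicity p (card N)" using prime_gt_0_nat[OF p] by (intro power_increasing) auto
  moreover have "card ((\<lambda>x. \<pi> x) ` K) * p ^ e = p ^ a * p ^ multiplicity p (card N)"
    using card_image_quotient[OF N sK(1)] sK(3) e mu by (simp add: power_add)
  ultimately have "p ^ a * p ^ e \<le> card ((\<lambda>x. \<pi> x) ` K) * p ^ e" by simp
  then have "p ^ a \<le> card ((\<lambda>x. \<pi> x) ` K)" using prime_gt_0_nat[OF p] by simp
  then have "(\<lambda>x. \<pi> x) ` K = A"
    by (intro card_seteq[OF S.sub_fin[OF A(1)] KA]) (use A in simp)
  then show ?thesis using sK by blast
qed

definition lift :: "nat \<Rightarrow> 'a set set \<Rightarrow> 'a set" where
  "lift p A = (SOME K. subgroup K G \<and> (\<exists>b. card K = p ^ b) \<and> (\<lambda>x. \<pi> x) ` K = A)"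

lemma lift:
  assumes "prime p" "subgroup A (G Mod N)" "card A = p ^ a"
  shows "subgroup (lift p A) G" "\<exists>b. card (lift p A) = p ^ b" "(\<lambda>x. \<pi> x) ` lift p A = A"
  using someI_ex[of "\<lambda>K. subgroup K G \<and> (\<exists>b. card K = p ^ b) \<and> (\<lambda>x. \<pi> x) ` K = A"] prime_power_lift[OF assms]
  unfolding lift_def by blast+

text \<open>
  The 59 subgroups above \<open>N\<close> are the preimages of the subgroups of the quotient.
\<close>

lemma subgroups_not_above:
  assumes X: "X \<subseteq> {K. subgroup K G \<and> \<not> N \<subseteq> K}" shows "59 + card X \<le> card {K. subgroup K G}"
    and "59 + card X = card {K. subgroup K G} \<Longrightarrow> subgroup K G \<Longrightarrow> \<not> N \<subseteq> K \<Longrightarrow> K \<in> X"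
proof -
  let ?A = "{A. subgroup A (G Mod N)}"
  have inj: "inj_on Union ?A" by (rule inj_onI) (metis preimage(3) mem_Collect_eq)
  have cA: "card (Union ` ?A) = 59" using card_image[OF inj] S.card_subgroups by simp
  have A: "Union ` ?A \<subseteq> {K. subgroup K G \<and> N \<subseteq> K}" using preimage(1,2) by blast
  have f: "finite X" "finite (Union ` ?A)" using finite_subset[OF _ finite_subgroups] X A by blast+
  have d: "Union ` ?A \<inter> X = {}" using X A by blast
  have c: "card (Union ` ?A \<union> X) = 59 + card X" using card_Un_disjoint[OF f(2,1) d] cA by simp
  have sub: "Union ` ?A \<union> X \<subseteq> {K. subgroup K G}" using X A by blast
  show "59 + card X \<le> card {K. subgroup K G}" using card_mono[OF finite_subgroups sub] c by simp
  assume e: "59 + card X = card {K. subgroup K G}" and K: "subgroup K G" "\<not> N \<subseteq> K"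
  have "Union ` ?A \<union> X = {K. subgroup K G}" by (rule card_subset_eq[OF finite_subgroups sub]) (use c e in simp)
  then show "K \<in> X" using K A by blast
qed

lemma card_lifts:
  assumes "prime p" "\<And>A. A \<in> F \<Longrightarrow> subgroup A (G Mod N) \<and> (\<exists>a. card A = p ^ a)"
  shows "card (lift p ` F) = card F"
proof (rule card_image, rule inj_onI)
  fix A B assume "A \<in> F" "B \<in> F" "lift p A = lift p B"
  then show "A = B" using lift(3)[OF assms(1)] assms(2) by metis
qed

text \<open>
  If the order of \<open>N\<close> is not a power of 2, then no 2-subgroup contains \<open>N\<close>, and lifts of the 15 + 5
  non-trivial 2-subgroups of the quotient exceed the bound. If it is a power of 2, no subgroup of odd order
  contains \<open>N\<close>; the 10 + 6 lifts of subgroups of order 3 and 5 and the trivial subgroup bring the number to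
  76. So every other subgroup, and in particular each subgroup of order 2, contains \<open>N\<close>.
\<close>

theorem central_extension:
  assumes nt: "N \<noteq> {\<one>}" and few: "card {K. subgroup K G} \<le> 76"
  shows "card N = 2" and "\<And>t. t \<in> carrier G \<Longrightarrow> t \<otimes> t = \<one> \<Longrightarrow> t \<noteq> \<one> \<Longrightarrow> t \<in> N"
    and "card {K. subgroup K G} = 76"
proof -
  have N1: "card N \<noteq> 1"
  proof
    assume "card N = 1"
    then obtain y where "N = {y}" by (auto simp: card_Suc_eq)
    then show False using nt subgroup.one_closed[OF sN] by auto
  qed
  have pr: "prime (2::nat)" "prime (3::nat)" "prime (5::nat)" by simp_all
  have sgp: "A \<in> S.subgroups_of_order k \<Longrightarrow> subgroup A (G Mod N) \<and> card A = k" for A k by (simp add: S.subgroups_of_order_def)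
  obtain b where b: "card N = 2 ^ b"
  proof (rule ccontr)
    assume "\<not> thesis"
    then have nb: "card N \<noteq> 2 ^ b" for b using that by blast
    have sg2: "A \<in> S.subgroups_of_order 2 \<union> S.subgroups_of_order 4 \<Longrightarrow> subgroup A (G Mod N) \<and> (\<exists>a. card A = 2 ^ a)" for A
      using sgp[of A 2] sgp[of A 4] by (auto intro: exI[of _ 1] exI[of _ 2])
    have X: "lift 2 ` (S.subgroups_of_order 2 \<union> S.subgroups_of_order 4) \<subseteq> {K. subgroup K G \<and> \<not> N \<subseteq> K}"
    proof
      fix K assume "K \<in> lift 2 ` (S.subgroups_of_order 2 \<union> S.subgroups_of_order 4)"
      then obtain A a where A: "subgroup A (G Mod N)" "card A = 2 ^ a" "K = lift 2 A" using sg2 by blast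
      obtain c where c: "subgroup K G" "card K = 2 ^ c" using lift[OF pr(1) A(1,2)] A(3) by blast
      have "\<not> N \<subseteq> K"
      proof
        assume "N \<subseteq> K"
        then have "card N dvd 2 ^ c" using card_dvd[OF sN c(1)] c(2) by simp
        then show False using nb divides_primepow_nat[OF pr(1)] by blast
      qed
      then show "K \<in> {K. subgroup K G \<and> \<not> N \<subseteq> K}" using c by simp
    qed
    have "S.subgroups_of_order 2 \<inter> S.subgroups_of_order 4 = {}" by (auto simp: S.subgroups_of_order_def)
    then have "card (S.subgroups_of_order 2 \<union> S.subgroups_of_order 4) = 20"
      using card_Un_disjoint[OF S.finite_sg S.finite_sg] S.card_sg2 S.card_sg4 by simp
    moreover have "card (lift 2 ` (S.subgroups_of_order 2 \<union> S.subgroups_of_order 4)) = card (S.subgroups_of_order 2 \<union> S.subgroups_of_order 4)" by (rule card_lifts[OF pr(1) sg2])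
    ultimately have "card (lift 2 ` (S.subgroups_of_order 2 \<union> S.subgroups_of_order 4)) = 20" by simp
    then show False using subgroups_not_above(1)[OF X] few by simp
  qed
  have b0: "b \<noteq> 0" using b N1 by (cases b) auto
  then have even: "2 dvd card N" using b by simp
  let ?X = "insert {\<one>} (lift 3 ` S.subgroups_of_order 3 \<union> lift 5 ` S.subgroups_of_order 5)"
  have odd: "subgroup K G \<and> odd (card K) \<and> card ((\<lambda>x. \<pi> x) ` K) = k"
    if K: "K \<in> lift k ` S.subgroups_of_order k" and k: "prime k" "odd k" for K k
  proof -
    obtain A where A: "subgroup A (G Mod N)" "card A = k ^ 1" "K = lift k A" using K sgp by auto
    show ?thesis using lift[OF k(1) A(1,2)] A(2,3) k(2) by auto
  qed
  have Xodd: "subgroup K G \<and> odd (card K)" if "K \<in> ?X" for K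
    using that odd[OF _ pr(2)] odd[OF _ pr(3)] triv_subgroup by auto
  have X: "?X \<subseteq> {K. subgroup K G \<and> \<not> N \<subseteq> K}"
  proof
    fix K assume "K \<in> ?X"
    then have K: "subgroup K G" "odd (card K)" using Xodd by auto
    have "\<not> N \<subseteq> K" using card_dvd[OF sN K(1)] even K(2) dvd_trans by blast
    then show "K \<in> {K. subgroup K G \<and> \<not> N \<subseteq> K}" using K by simp
  qed
  have c3: "card (lift 3 ` S.subgroups_of_order 3) = 10"
    using card_lifts[OF pr(2), of "S.subgroups_of_order 3"] sgp[of _ 3] S.card_sg3 by (metis power_one_right)
  have c5: "card (lift 5 ` S.subgroups_of_order 5) = 6"
    using card_lifts[OF pr(3), of "S.subgroups_of_order 5"] sgp[of _ 5] S.card_sg5 by (metis power_one_right)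
  have fl: "finite (lift 3 ` S.subgroups_of_order 3)" "finite (lift 5 ` S.subgroups_of_order 5)" using S.finite_sg by auto
  have d35: "lift 3 ` S.subgroups_of_order 3 \<inter> lift 5 ` S.subgroups_of_order 5 = {}"
  proof (rule ccontr)
    assume "lift 3 ` S.subgroups_of_order 3 \<inter> lift 5 ` S.subgroups_of_order 5 \<noteq> {}"
    then obtain K where "K \<in> lift 3 ` S.subgroups_of_order 3" "K \<in> lift 5 ` S.subgroups_of_order 5" by blast
    then show False using odd[of K 3] odd[of K 5] pr by simp
  qed
  have n1: "{\<one>} \<notin> lift 3 ` S.subgroups_of_order 3 \<union> lift 5 ` S.subgroups_of_order 5"
    using odd[of "{\<one>}" 3] odd[of "{\<one>}" 5] pr by auto
  have cX: "card ?X = 17"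
    using card_Un_disjoint[OF fl d35] c3 c5 n1 fl by simp
  show c76: "card {K. subgroup K G} = 76" using subgroups_not_above(1)[OF X] few cX by simp
  have above: "N \<subseteq> K" if K: "subgroup K G" "even (card K)" for K
  proof (rule ccontr)
    assume "\<not> N \<subseteq> K"
    then have "K \<in> ?X" using subgroups_not_above(2)[OF X _ K(1)] cX c76 by simp
    then show False using Xodd K(2) by blast
  qed
  obtain T where T: "subgroup T G" "T \<subseteq> N" "card T = 2"
    using prime_power_subgroup_ex[OF sN pr(1), of 1] even by auto
  then show cN: "card N = 2" using above[of T] by auto
  fix t assume t: "t \<in> carrier G" "t \<otimes> t = \<one>" "t \<noteq> \<one>"
  have "N \<subseteq> {\<one>, t}" using above[OF two_subgroup[OF t(1,2)]] t(3) by simp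
  then have "N = {\<one>, t}" using card_subset_eq[of "{\<one>, t}" N] cN t(3) by simp
  then show "t \<in> N" by simp
qed

end

section \<open>Multiplication in a double extension with a Bruhat decomposition\<close>

text \<open>
  The model is \<open>SL(2,5)\<close>: \<open>Q\<close> consists of the upper unitriangular matrices, \<open>B\<close> of the upper triangular
  ones, \<open>z\<close> is the negative of the identity, \<open>h\<close> a diagonal matrix of order 4 and \<open>x\<close> an antidiagonal one.
  The assumptions \<open>Bdec\<close> and \<open>dbl\<close> are the Levi and the Bruhat decomposition.
\<close>

locale bi_frame = group G for G (structure) +
  fixes Q B :: "'a set" and z h x :: 'a
  assumes sQ: "subgroup Q G" and sB: "subgroup B G" and QB: "Q \<subseteq> B"
    and Qcomm: "\<And>u v. u \<in> Q \<Longrightarrow> v \<in> Q \<Longrightarrow> u \<otimes> v = v \<otimes> u"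
    and Q5: "\<And>v. v \<in> Q \<Longrightarrow> v [^] (5::nat) = \<one>"
    and Qnt: "\<exists>v\<in>Q. v \<noteq> \<one>" and Qgen: "\<And>u v. u \<in> Q \<Longrightarrow> v \<in> Q \<Longrightarrow> v \<noteq> \<one> \<Longrightarrow> \<exists>i::nat. u = v [^] i"
    and zB: "z \<in> B" and z1: "z \<noteq> \<one>" and zz: "z \<otimes> z = \<one>" and zc: "\<And>g. g \<in> carrier G \<Longrightarrow> g \<otimes> z = z \<otimes> g"
    and hB: "h \<in> B" and hh: "h \<otimes> h = z" and hu: "\<And>u. u \<in> Q \<Longrightarrow> h \<otimes> u = inv u \<otimes> h"
    and xG: "x \<in> carrier G" and xB: "x \<notin> B" and xx: "x \<otimes> x = z" and xh: "x \<otimes> h = z \<otimes> (h \<otimes> x)"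
    and off: "\<And>v. v \<in> Q \<Longrightarrow> v \<noteq> \<one> \<Longrightarrow> x \<otimes> v \<otimes> x \<notin> B"
    and Bdec: "\<And>b. b \<in> B \<Longrightarrow> \<exists>c\<in>{\<one>, z}. \<exists>u\<in>Q. b = c \<otimes> u \<or> b = c \<otimes> (u \<otimes> h)"
    and dbl: "\<And>g. g \<in> carrier G \<Longrightarrow> g \<in> B \<or> (\<exists>b\<in>B. \<exists>v\<in>Q. g = b \<otimes> x \<otimes> v)"
begin

lemma cl [simp]: "u \<in> Q \<Longrightarrow> u \<in> carrier G" "b \<in> B \<Longrightarrow> b \<in> carrier G" "z \<in> carrier G" "h \<in> carrier G" "x \<in> carrier G"
  using sQ sB subgroup.mem_carrier zB hB xG by metis+

lemma invQ [simp]: "u \<in> Q \<Longrightarrow> inv u \<in> Q" "u \<in> Q \<Longrightarrow> v \<in> Q \<Longrightarrow> u \<otimes> v \<in> Q" "\<one> \<in> Q"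
  using sQ by (auto simp: subgroup.m_inv_closed subgroup.m_closed subgroup.one_closed)

lemma QinB [simp]: "u \<in> Q \<Longrightarrow> u \<in> B"
  using QB by auto

lemma Bcl [simp]: "a \<in> B \<Longrightarrow> b \<in> B \<Longrightarrow> a \<otimes> b \<in> B" "a \<in> B \<Longrightarrow> inv a \<in> B" "z \<in> B" "h \<in> B"
  using sB zB hB by (auto simp: subgroup.m_closed subgroup.m_inv_closed)

lemma assoc_rules:
  "r \<in> carrier G \<Longrightarrow> z \<otimes> (z \<otimes> r) = r"
  "r \<in> carrier G \<Longrightarrow> x \<otimes> (x \<otimes> r) = z \<otimes> r"
  "r \<in> carrier G \<Longrightarrow> h \<otimes> (h \<otimes> r) = z \<otimes> r"
  "x \<otimes> z = z \<otimes> x" "h \<otimes> z = z \<otimes> h" "u \<in> Q \<Longrightarrow> u \<otimes> z = z \<otimes> u"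
  "r \<in> carrier G \<Longrightarrow> x \<otimes> (z \<otimes> r) = z \<otimes> (x \<otimes> r)"
  "r \<in> carrier G \<Longrightarrow> h \<otimes> (z \<otimes> r) = z \<otimes> (h \<otimes> r)"
  "u \<in> Q \<Longrightarrow> r \<in> carrier G \<Longrightarrow> u \<otimes> (z \<otimes> r) = z \<otimes> (u \<otimes> r)"
  "r \<in> carrier G \<Longrightarrow> x \<otimes> (h \<otimes> r) = z \<otimes> (h \<otimes> (x \<otimes> r))"
  "u \<in> Q \<Longrightarrow> u \<otimes> h = h \<otimes> inv u"
  "u \<in> Q \<Longrightarrow> r \<in> carrier G \<Longrightarrow> u \<otimes> (h \<otimes> r) = h \<otimes> (inv u \<otimes> r)"
  "u \<in> Q \<Longrightarrow> r \<in> carrier G \<Longrightarrow> inv u \<otimes> (u \<otimes> r) = r"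
  "u \<in> Q \<Longrightarrow> r \<in> carrier G \<Longrightarrow> u \<otimes> (inv u \<otimes> r) = r"
proof -
  have A: "a \<otimes> (b \<otimes> r) = c \<otimes> r" if "a \<otimes> b = c" "a \<in> carrier G" "b \<in> carrier G" "r \<in> carrier G" for a b c r
    using that by (simp flip: m_assoc)
  have A2: "a \<otimes> (b \<otimes> r) = c \<otimes> (d \<otimes> r)"
    if "a \<otimes> b = c \<otimes> d" "a \<in> carrier G" "b \<in> carrier G" "c \<in> carrier G" "d \<in> carrier G" "r \<in> carrier G" for a b c d r
    using that by (simp add: A[OF that(1)] m_assoc)
  show "r \<in> carrier G \<Longrightarrow> z \<otimes> (z \<otimes> r) = r" using A[OF zz] by simp
  show "r \<in> carrier G \<Longrightarrow> x \<otimes> (x \<otimes> r) = z \<otimes> r" using A[OF xx] by simp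
  show "r \<in> carrier G \<Longrightarrow> h \<otimes> (h \<otimes> r) = z \<otimes> r" using A[OF hh] by simp
  show "x \<otimes> z = z \<otimes> x" "h \<otimes> z = z \<otimes> h" "u \<in> Q \<Longrightarrow> u \<otimes> z = z \<otimes> u" by (rule zc, simp)+
  show "r \<in> carrier G \<Longrightarrow> x \<otimes> (z \<otimes> r) = z \<otimes> (x \<otimes> r)" by (rule A2[OF zc]) simp_all
  show "r \<in> carrier G \<Longrightarrow> h \<otimes> (z \<otimes> r) = z \<otimes> (h \<otimes> r)" by (rule A2[OF zc]) simp_all
  show "u \<in> Q \<Longrightarrow> r \<in> carrier G \<Longrightarrow> u \<otimes> (z \<otimes> r) = z \<otimes> (u \<otimes> r)" by (rule A2[OF zc]) simp_all
  show "r \<in> carrier G \<Longrightarrow> x \<otimes> (h \<otimes> r) = z \<otimes> (h \<otimes> (x \<otimes> r))" using A2[OF xh] by (simp add: m_assoc)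
  have uh: "u \<in> Q \<Longrightarrow> u \<otimes> h = h \<otimes> inv u" using hu[of "inv u"] by simp
  then show "u \<in> Q \<Longrightarrow> u \<otimes> h = h \<otimes> inv u" .
  show "u \<in> Q \<Longrightarrow> r \<in> carrier G \<Longrightarrow> u \<otimes> (h \<otimes> r) = h \<otimes> (inv u \<otimes> r)" by (rule A2[OF uh]) simp_all
  show "u \<in> Q \<Longrightarrow> r \<in> carrier G \<Longrightarrow> inv u \<otimes> (u \<otimes> r) = r" using A[OF l_inv] by simp
  show "u \<in> Q \<Longrightarrow> r \<in> carrier G \<Longrightarrow> u \<otimes> (inv u \<otimes> r) = r" using A[OF r_inv] by simp
qed

lemmas calc = m_assoc zz xx hh xh assoc_rules

lemma conj_h:
  assumes "v \<in> Q" shows "h \<otimes> (x \<otimes> (v \<otimes> x)) = x \<otimes> (inv v \<otimes> (x \<otimes> h))"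
  using assms by (simp add: calc)

lemma B_cancel:
  assumes "a \<in> B" "b \<in> B" "y \<in> carrier G" "a \<otimes> (y \<otimes> b) \<in> B" shows "y \<in> B"
proof -
  have "inv a \<otimes> (a \<otimes> (y \<otimes> b)) \<otimes> inv b \<in> B" using assms by simp
  moreover have "inv a \<otimes> (a \<otimes> (y \<otimes> b)) \<otimes> inv b = y"
    using assms by (simp add: inv_solve_right' inv_solve_left')
  ultimately show ?thesis by simp
qed

lemma off_trivial: "v \<in> Q \<Longrightarrow> x \<otimes> (v \<otimes> x) \<in> B \<Longrightarrow> v = \<one>"
  using off[of v] by (auto simp: m_assoc)

lemma inverse_form:
  assumes "v \<in> Q" shows "(x \<otimes> (v \<otimes> x)) \<otimes> (x \<otimes> (inv v \<otimes> x)) = \<one>"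
  using assms by (simp add: calc)

text \<open>
  Up to central factors, \<open>x v x\<close> has the form \<open>u x u'\<close> or the form \<open>u h x u'\<close> with \<open>u\<close>, \<open>u'\<close> in \<open>Q\<close>.
  The suffixes E and O (for an even and an odd power of \<open>h\<close>) refer to these two forms. Conjugation by \<open>h\<close>
  inverts the elements of \<open>Q\<close> and thus carries a form of \<open>x v x\<close> to one of \<open>x v\<^sup>-\<^sup>1 x\<close>.
\<close>

lemma reflect_E:
  assumes v: "v \<in> Q" and c: "c \<in> {\<one>, z}" and u: "u \<in> Q" "u' \<in> Q" and e: "x \<otimes> (v \<otimes> x) = c \<otimes> (u \<otimes> (x \<otimes> u'))"
  shows "x \<otimes> (inv v \<otimes> x) = c \<otimes> (z \<otimes> (inv u \<otimes> (x \<otimes> inv u')))"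
proof -
  have "x \<otimes> (inv v \<otimes> x) \<otimes> h = h \<otimes> (x \<otimes> (v \<otimes> x))" using conj_h[OF v] v by (simp add: m_assoc)
  also have "\<dots> = c \<otimes> (z \<otimes> (inv u \<otimes> (x \<otimes> inv u'))) \<otimes> h" unfolding e using c u by (auto simp: calc)
  finally show ?thesis by (subst (asm) right_cancel) (use v u c in auto)
qed

lemma reflect_O:
  assumes v: "v \<in> Q" and c: "c \<in> {\<one>, z}" and u: "u \<in> Q" "u' \<in> Q" and e: "x \<otimes> (v \<otimes> x) = c \<otimes> (u \<otimes> (h \<otimes> (x \<otimes> u')))"
  shows "x \<otimes> (inv v \<otimes> x) = c \<otimes> (z \<otimes> (inv u \<otimes> (h \<otimes> (x \<otimes> inv u'))))"
proof -
  have "x \<otimes> (inv v \<otimes> x) \<otimes> h = h \<otimes> (x \<otimes> (v \<otimes> x))" using conj_h[OF v] v by (simp add: m_assoc)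
  also have "\<dots> = c \<otimes> (z \<otimes> (inv u \<otimes> (h \<otimes> (x \<otimes> inv u')))) \<otimes> h" unfolding e using c u by (auto simp: calc)
  finally show ?thesis by (subst (asm) right_cancel) (use v u c in auto)
qed

text \<open>
  The product of \<open>x v x\<close> and \<open>x v\<^sup>-\<^sup>1 x\<close> is trivial. Inserting the form and its reflection, everything cancels
  except for a product \<open>x (u' u\<^sup>-\<^sup>1) x\<close>, which therefore lies in \<open>B\<close>; this happens only for \<open>u' = u\<close>.
\<close>

lemma symmetric_E:
  assumes v: "v \<in> Q" and c: "c \<in> {\<one>, z}" and u: "u \<in> Q" "u' \<in> Q" and e: "x \<otimes> (v \<otimes> x) = c \<otimes> (u \<otimes> (x \<otimes> u'))"
  shows "u' = u"
proof -
  have "\<one> = (c \<otimes> (u \<otimes> (x \<otimes> u'))) \<otimes> (c \<otimes> (z \<otimes> (inv u \<otimes> (x \<otimes> inv u'))))"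
    using inverse_form[OF v] unfolding e reflect_E[OF assms] by simp
  also have "\<dots> = z \<otimes> (u \<otimes> ((x \<otimes> ((u' \<otimes> inv u) \<otimes> x)) \<otimes> inv u'))" using c u by (auto simp: calc)
  finally have e1: "z \<otimes> (u \<otimes> ((x \<otimes> ((u' \<otimes> inv u) \<otimes> x)) \<otimes> inv u')) = \<one>" by simp
  have "u \<otimes> ((x \<otimes> ((u' \<otimes> inv u) \<otimes> x)) \<otimes> inv u') \<in> B"
    by (rule B_cancel[of z \<one>]) (use e1 u in simp_all)
  then have "x \<otimes> ((u' \<otimes> inv u) \<otimes> x) \<in> B" by (rule B_cancel[rotated 3]) (use u in simp_all)
  then have "u' \<otimes> inv u = \<one>" using off_trivial[of "u' \<otimes> inv u"] u by simp
  then show ?thesis using u inv_solve_right[of \<one> u' u] by simp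
qed

lemma symmetric_O:
  assumes v: "v \<in> Q" and c: "c \<in> {\<one>, z}" and u: "u \<in> Q" "u' \<in> Q" and e: "x \<otimes> (v \<otimes> x) = c \<otimes> (u \<otimes> (h \<otimes> (x \<otimes> u')))"
  shows "u' = u"
proof -
  have "\<one> = (c \<otimes> (u \<otimes> (h \<otimes> (x \<otimes> u')))) \<otimes> (c \<otimes> (z \<otimes> (inv u \<otimes> (h \<otimes> (x \<otimes> inv u')))))"
    using inverse_form[OF v] unfolding e reflect_O[OF assms] by simp
  also have "\<dots> = z \<otimes> (u \<otimes> ((x \<otimes> ((inv u' \<otimes> u) \<otimes> x)) \<otimes> inv u'))" using c u by (auto simp: calc)
  finally have e1: "z \<otimes> (u \<otimes> ((x \<otimes> ((inv u' \<otimes> u) \<otimes> x)) \<otimes> inv u')) = \<one>" by simp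
  have "u \<otimes> ((x \<otimes> ((inv u' \<otimes> u) \<otimes> x)) \<otimes> inv u') \<in> B"
    by (rule B_cancel[of z \<one>]) (use e1 u in simp_all)
  then have "x \<otimes> ((inv u' \<otimes> u) \<otimes> x) \<in> B" by (rule B_cancel[rotated 3]) (use u in simp_all)
  then have "inv u' \<otimes> u = \<one>" using off_trivial[of "inv u' \<otimes> u"] u by simp
  then show ?thesis using u inv_solve_left[of \<one> u' u] by simp
qed

lemma bruhat_unique:
  assumes b: "a \<in> B" "b \<in> B" and v: "u \<in> Q" "v \<in> Q" and e: "a \<otimes> (x \<otimes> u) = b \<otimes> (x \<otimes> v)"
  shows "u = v"
proof -
  have "x \<otimes> ((u \<otimes> inv v) \<otimes> x) = (inv a \<otimes> (a \<otimes> (x \<otimes> u))) \<otimes> (inv v \<otimes> x)"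
    using b v by (simp add: m_assoc inv_solve_left)
  also have "\<dots> = inv a \<otimes> b \<otimes> (x \<otimes> ((v \<otimes> inv v) \<otimes> x))" unfolding e using b v by (simp add: m_assoc assoc_rules)
  also have "\<dots> = inv a \<otimes> b \<otimes> z" using b v xx by simp
  finally have "x \<otimes> ((u \<otimes> inv v) \<otimes> x) \<in> B" using b by simp
  then have "u \<otimes> inv v = \<one>" using off_trivial[of "u \<otimes> inv v"] v by simp
  then show ?thesis using v inv_solve_right[of \<one> u v] by simp
qed

text \<open>
  Solving the equation for \<open>x u\<^sup>-\<^sup>1 x\<close> gives a form with \<open>u\<close> and \<open>v\<^sup>-\<^sup>1\<close>, or with \<open>u\<^sup>-\<^sup>1\<close> and \<open>v\<^sup>-\<^sup>1\<close>, at the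
  two ends. By symmetry these agree, so \<open>u\<close> is the inverse of \<open>v\<close> in the first form and \<open>v\<close> in the second.
\<close>

lemma outside_form:
  assumes v: "v \<in> Q" "v \<noteq> \<one>"
  shows "(\<exists>c\<in>{\<one>, z}. x \<otimes> (v \<otimes> x) = c \<otimes> (inv v \<otimes> (x \<otimes> inv v))) \<or>
         (\<exists>c\<in>{\<one>, z}. x \<otimes> (v \<otimes> x) = c \<otimes> (v \<otimes> (h \<otimes> (x \<otimes> v))))"
proof -
  have xvx: "x \<otimes> (v \<otimes> x) \<in> carrier G" using v by simp
  have "x \<otimes> (v \<otimes> x) \<notin> B" using off_trivial v by blast
  then obtain b u' where b: "b \<in> B" "u' \<in> Q" "x \<otimes> (v \<otimes> x) = b \<otimes> x \<otimes> u'" using dbl[OF xvx] by blast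
  obtain c u where c: "c \<in> {\<one>, z}" "u \<in> Q" and b': "b = c \<otimes> u \<or> b = c \<otimes> (u \<otimes> h)" using Bdec[OF b(1)] by blast
  show ?thesis using b'
  proof
    assume "b = c \<otimes> u"
    then have e: "x \<otimes> (v \<otimes> x) = c \<otimes> (u \<otimes> (x \<otimes> u'))" using b c by (auto simp: m_assoc)
    have "u' = u" by (rule symmetric_E[OF v(1) c b(2) e])
    with e have e: "x \<otimes> (v \<otimes> x) = c \<otimes> (u \<otimes> (x \<otimes> u))" by simp
    have "x \<otimes> (inv u \<otimes> x) = (x \<otimes> (inv u \<otimes> (x \<otimes> (v \<otimes> x)))) \<otimes> (z \<otimes> (x \<otimes> inv v))"
      using v c by (simp add: calc)
    also have "\<dots> = c \<otimes> (u \<otimes> (x \<otimes> inv v))" unfolding e using v c by (auto simp: calc)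
    finally have f: "x \<otimes> (inv u \<otimes> x) = c \<otimes> (u \<otimes> (x \<otimes> inv v))" .
    have "inv v = u" by (rule symmetric_E[OF _ c(1) c(2) _ f]) (use v c in auto)
    then show ?thesis using e c by auto
  next
    assume "b = c \<otimes> (u \<otimes> h)"
    then have e: "x \<otimes> (v \<otimes> x) = c \<otimes> (u \<otimes> (h \<otimes> (x \<otimes> u')))" using b c by (auto simp: m_assoc)
    have "u' = u" by (rule symmetric_O[OF v(1) c b(2) e])
    with e have e: "x \<otimes> (v \<otimes> x) = c \<otimes> (u \<otimes> (h \<otimes> (x \<otimes> u)))" by simp
    have "x \<otimes> (inv u \<otimes> x) = (x \<otimes> (inv u \<otimes> (x \<otimes> (v \<otimes> x)))) \<otimes> (z \<otimes> (x \<otimes> inv v))"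
      using v c by (simp add: calc)
    also have "\<dots> = (c \<otimes> z) \<otimes> (inv u \<otimes> (h \<otimes> (x \<otimes> inv v)))" unfolding e using v c by (auto simp: calc)
    finally have f: "x \<otimes> (inv u \<otimes> x) = (c \<otimes> z) \<otimes> (inv u \<otimes> (h \<otimes> (x \<otimes> inv v)))" .
    have "inv v = inv u" by (rule symmetric_O[OF _ _ _ _ f]) (use v c zz in auto)
    then have "v = u" using v c by (metis cl(1) inv_inv)
    then show ?thesis using e c by auto
  qed
qed

lemma fifth_power: "v \<in> Q \<Longrightarrow> v \<otimes> (v \<otimes> (v \<otimes> (v \<otimes> v))) = \<one>"
  using Q5[of v] by (simp add: eval_nat_numeral m_assoc)

text \<open>
  The square of \<open>x v x\<close> is \<open>z x v\<^sup>2 x\<close>. If \<open>v\<close> and \<open>v\<^sup>2\<close> have forms of the same type, the two sides have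
  the right ends \<open>v\<^sup>-\<^sup>2\<close> and \<open>v\<close>, or \<open>v\<^sup>2\<close> and \<open>v\<^sup>-\<^sup>1\<close>; they agree, which is impossible for order 5.
\<close>

lemma types_alternate:
  assumes v: "v \<in> Q" "v \<noteq> \<one>" and c: "c \<in> {\<one>, z}" and d: "d \<in> {\<one>, z}"
  shows "\<not> (x \<otimes> (v \<otimes> x) = c \<otimes> (inv v \<otimes> (x \<otimes> inv v)) \<and>
            x \<otimes> ((v \<otimes> v) \<otimes> x) = d \<otimes> (inv (v \<otimes> v) \<otimes> (x \<otimes> inv (v \<otimes> v))))" (is "\<not> (?E1 \<and> ?E2)")
    and "\<not> (x \<otimes> (v \<otimes> x) = c \<otimes> (v \<otimes> (h \<otimes> (x \<otimes> v))) \<and>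
            x \<otimes> ((v \<otimes> v) \<otimes> x) = d \<otimes> ((v \<otimes> v) \<otimes> (h \<otimes> (x \<otimes> (v \<otimes> v)))))" (is "\<not> (?O1 \<and> ?O2)")
proof -
  have nv: False if "v = (v \<otimes> v) \<otimes> (v \<otimes> v)"
  proof -
    have "v \<otimes> v = v \<otimes> ((v \<otimes> v) \<otimes> (v \<otimes> v))" using that by simp
    then have vv: "v \<otimes> v = \<one>" using fifth_power[OF v(1)] v by (simp add: m_assoc)
    then have "v = \<one>" using that v by simp
    then show False using v by simp
  qed
  have sq: "(x \<otimes> (v \<otimes> x)) \<otimes> (x \<otimes> (v \<otimes> x)) = z \<otimes> (x \<otimes> ((v \<otimes> v) \<otimes> x))" using v by (simp add: calc)
  show "\<not> (?E1 \<and> ?E2)"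
  proof
    assume a: "?E1 \<and> ?E2"
    then have e1: ?E1 and e2: ?E2 by auto
    have r: "x \<otimes> (inv (v \<otimes> v) \<otimes> x) = d \<otimes> (z \<otimes> ((v \<otimes> v) \<otimes> (x \<otimes> (v \<otimes> v))))"
      using reflect_E[OF _ d _ _ e2] v by simp
    have "z \<otimes> (d \<otimes> (inv (v \<otimes> v) \<otimes> (x \<otimes> inv (v \<otimes> v)))) = (x \<otimes> (v \<otimes> x)) \<otimes> (x \<otimes> (v \<otimes> x))"
      unfolding sq e2 ..
    also have "\<dots> = inv v \<otimes> ((x \<otimes> (inv (v \<otimes> v) \<otimes> x)) \<otimes> inv v)"
      unfolding e1 using v c by (auto simp: calc inv_mult_group)
    also have "\<dots> = (inv v \<otimes> (d \<otimes> (z \<otimes> (v \<otimes> v)))) \<otimes> (x \<otimes> ((v \<otimes> v) \<otimes> inv v))"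
      unfolding r using v d by (auto simp: m_assoc)
    finally have "(z \<otimes> (d \<otimes> inv (v \<otimes> v))) \<otimes> (x \<otimes> inv (v \<otimes> v)) = (inv v \<otimes> (d \<otimes> (z \<otimes> (v \<otimes> v)))) \<otimes> (x \<otimes> ((v \<otimes> v) \<otimes> inv v))"
      using v d by (auto simp: m_assoc)
    then have "inv (v \<otimes> v) = (v \<otimes> v) \<otimes> inv v"
      by (rule bruhat_unique[rotated 4]) (use v d in auto)
    then have "inv (v \<otimes> v) = v" using v by (simp add: m_assoc)
    then have "v \<otimes> (v \<otimes> v) = \<one>" using v r_inv[of "v \<otimes> v"] by (simp add: m_assoc)
    then have "v = (v \<otimes> v) \<otimes> (v \<otimes> v)" using v by (simp add: m_assoc)
    then show False by (rule nv)
  qed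
  show "\<not> (?O1 \<and> ?O2)"
  proof
    assume a: "?O1 \<and> ?O2"
    then have e1: ?O1 and e2: ?O2 by auto
    have r: "x \<otimes> (inv (v \<otimes> v) \<otimes> x) = d \<otimes> (z \<otimes> (inv (v \<otimes> v) \<otimes> (h \<otimes> (x \<otimes> inv (v \<otimes> v)))))"
      using reflect_O[OF _ d _ _ e2] v by simp
    have "z \<otimes> (d \<otimes> ((v \<otimes> v) \<otimes> (h \<otimes> (x \<otimes> (v \<otimes> v))))) = (x \<otimes> (v \<otimes> x)) \<otimes> (x \<otimes> (v \<otimes> x))"
      unfolding sq e2 ..
    also have "\<dots> = v \<otimes> ((x \<otimes> (inv (v \<otimes> v) \<otimes> x)) \<otimes> v)"
      unfolding e1 using v c by (auto simp: calc inv_mult_group)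
    also have "\<dots> = (v \<otimes> (d \<otimes> (z \<otimes> (inv (v \<otimes> v) \<otimes> h)))) \<otimes> (x \<otimes> (inv (v \<otimes> v) \<otimes> v))"
      unfolding r using v d by (auto simp: m_assoc)
    finally have "(z \<otimes> (d \<otimes> ((v \<otimes> v) \<otimes> h))) \<otimes> (x \<otimes> (v \<otimes> v)) = (v \<otimes> (d \<otimes> (z \<otimes> (inv (v \<otimes> v) \<otimes> h)))) \<otimes> (x \<otimes> (inv (v \<otimes> v) \<otimes> v))"
      using v d by (auto simp: m_assoc)
    then have "v \<otimes> v = inv (v \<otimes> v) \<otimes> v"
      by (rule bruhat_unique[rotated 4]) (use v d in auto)
    then have "v = (v \<otimes> v) \<otimes> (v \<otimes> v)" using v inv_solve_left[of "v \<otimes> v" "v \<otimes> v" v] by simp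
    then show False by (rule nv)
  qed
qed

text \<open>
  One of \<open>v\<close>, \<open>v\<^sup>2\<close> has the type E and is taken for \<open>w\<close>; then \<open>w\<^sup>2\<close> has the type O. The central factors
  in the two forms are absorbed by multiplying \<open>x\<close> and \<open>h\<close> by them.
\<close>

lemma standard_generators:
  "\<exists>w\<in>Q. \<exists>h1\<in>{h, z \<otimes> h}. \<exists>x1\<in>{x, z \<otimes> x}. w \<noteq> \<one> \<and>
     x1 \<otimes> (w \<otimes> x1) = inv w \<otimes> (x1 \<otimes> inv w) \<and>
     x1 \<otimes> ((w \<otimes> w) \<otimes> x1) = (w \<otimes> w) \<otimes> (h1 \<otimes> (x1 \<otimes> (w \<otimes> w)))"
proof -
  have sq1: "v \<otimes> v \<noteq> \<one>" if "v \<in> Q" "v \<noteq> \<one>" for v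
  proof
    assume e: "v \<otimes> v = \<one>"
    have "v \<otimes> ((v \<otimes> v) \<otimes> (v \<otimes> v)) = \<one>" using fifth_power[OF that(1)] that by (simp add: m_assoc)
    then show False using e that by simp
  qed
  have "\<exists>w\<in>Q. w \<noteq> \<one> \<and> (\<exists>c\<in>{\<one>, z}. x \<otimes> (w \<otimes> x) = c \<otimes> (inv w \<otimes> (x \<otimes> inv w)))"
  proof -
    obtain v where v: "v \<in> Q" "v \<noteq> \<one>" using Qnt by blast
    show ?thesis
      using outside_form[OF v] outside_form[of "v \<otimes> v"] types_alternate(2)[OF v] sq1[OF v] v by (meson invQ(2))
  qed
  then obtain w c where w: "w \<in> Q" "w \<noteq> \<one>" and c: "c \<in> {\<one>, z}" "x \<otimes> (w \<otimes> x) = c \<otimes> (inv w \<otimes> (x \<otimes> inv w))" by blast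
  obtain d where d: "d \<in> {\<one>, z}" "x \<otimes> ((w \<otimes> w) \<otimes> x) = d \<otimes> ((w \<otimes> w) \<otimes> (h \<otimes> (x \<otimes> (w \<otimes> w))))"
    using outside_form[of "w \<otimes> w"] types_alternate(1)[OF w] c sq1[OF w] w by (meson invQ(2))
  define x1 where "x1 = c \<otimes> x"
  define h1 where "h1 = c \<otimes> d \<otimes> h"
  have cc: "c \<otimes> c = \<one>" "c \<in> carrier G" "d \<in> carrier G" using c d zz by auto
  have cz: "g \<otimes> c = c \<otimes> g" if "g \<in> carrier G" for g using c(1) zc[OF that] that by auto
  have "h1 \<in> {h, z \<otimes> h}" using c(1) d(1) by (auto simp: h1_def zz)
  moreover have "x1 \<in> {x, z \<otimes> x}" using c(1) by (auto simp: x1_def)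
  moreover have "x1 \<otimes> (w \<otimes> x1) = inv w \<otimes> (x1 \<otimes> inv w)"
  proof -
    have "x1 \<otimes> (w \<otimes> x1) = x \<otimes> (w \<otimes> x)" using c(1) w by (auto simp: x1_def calc)
    also have "\<dots> = inv w \<otimes> (x1 \<otimes> inv w)" unfolding c(2) using c(1) w by (auto simp: x1_def calc)
    finally show ?thesis .
  qed
  moreover have "x1 \<otimes> ((w \<otimes> w) \<otimes> x1) = (w \<otimes> w) \<otimes> (h1 \<otimes> (x1 \<otimes> (w \<otimes> w)))"
  proof -
    have "x1 \<otimes> ((w \<otimes> w) \<otimes> x1) = x \<otimes> ((w \<otimes> w) \<otimes> x)" using c(1) w by (auto simp: x1_def calc)
    also have "\<dots> = (w \<otimes> w) \<otimes> (h1 \<otimes> (x1 \<otimes> (w \<otimes> w)))" unfolding d(2) using c(1) d(1) w by (auto simp: x1_def h1_def calc)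
    finally show ?thesis .
  qed
  ultimately show ?thesis using w by blast
qed

end

section \<open>Normal forms and the isomorphism\<close>

text \<open>
  The relations of \<open>standard_generators\<close> and of the frame, written with positive powers, so that they
  visibly pass to pairs of elements in a direct product.
\<close>

definition sl_relations :: "('a, 'b) monoid_scheme \<Rightarrow> 'a \<Rightarrow> 'a \<Rightarrow> 'a \<Rightarrow> bool" where
  "sl_relations G w h x \<longleftrightarrow> w \<in> carrier G \<and> h \<in> carrier G \<and> x \<in> carrier G \<and>
     w [^]\<^bsub>G\<^esub> (5::nat) = \<one>\<^bsub>G\<^esub> \<and> h [^]\<^bsub>G\<^esub> (4::nat) = \<one>\<^bsub>G\<^esub> \<and> x \<otimes>\<^bsub>G\<^esub> x = h [^]\<^bsub>G\<^esub> (2::nat) \<and>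
     h \<otimes>\<^bsub>G\<^esub> w = w [^]\<^bsub>G\<^esub> (4::nat) \<otimes>\<^bsub>G\<^esub> h \<and> x \<otimes>\<^bsub>G\<^esub> h = h [^]\<^bsub>G\<^esub> (3::nat) \<otimes>\<^bsub>G\<^esub> x \<and>
     x \<otimes>\<^bsub>G\<^esub> (w \<otimes>\<^bsub>G\<^esub> x) = w [^]\<^bsub>G\<^esub> (4::nat) \<otimes>\<^bsub>G\<^esub> (x \<otimes>\<^bsub>G\<^esub> w [^]\<^bsub>G\<^esub> (4::nat)) \<and>
     x \<otimes>\<^bsub>G\<^esub> (w [^]\<^bsub>G\<^esub> (2::nat) \<otimes>\<^bsub>G\<^esub> x) = w [^]\<^bsub>G\<^esub> (2::nat) \<otimes>\<^bsub>G\<^esub> (h \<otimes>\<^bsub>G\<^esub> (x \<otimes>\<^bsub>G\<^esub> w [^]\<^bsub>G\<^esub> (2::nat)))"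

definition normal_forms :: "('a, 'b) monoid_scheme \<Rightarrow> 'a \<Rightarrow> 'a \<Rightarrow> 'a \<Rightarrow> 'a set" where
  "normal_forms G w h x =
     {w [^]\<^bsub>G\<^esub> i \<otimes>\<^bsub>G\<^esub> h [^]\<^bsub>G\<^esub> k | (i::nat) (k::nat). True} \<union>
     {w [^]\<^bsub>G\<^esub> i \<otimes>\<^bsub>G\<^esub> h [^]\<^bsub>G\<^esub> k \<otimes>\<^bsub>G\<^esub> (x \<otimes>\<^bsub>G\<^esub> w [^]\<^bsub>G\<^esub> j) | (i::nat) (k::nat) (j::nat). True}"

text \<open>
  The set is closed under right multiplication by the generators. The only case that takes work is
  \<open>x w\<^sup>j x\<close>: for \<open>j\<close> equal to 1 and 2 modulo 5 it is a relation, and for 4 and 3 it follows by inverting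
  these, since the product of \<open>x w\<^sup>j x\<close> and \<open>x w\<^sup>5\<^sup>-\<^sup>j x\<close> is trivial.
\<close>

lemma (in group) normal_forms_mult:
  assumes r: "sl_relations G w h x" and a: "a \<in> normal_forms G w h x" and b: "b \<in> normal_forms G w h x"
  shows "a \<otimes> b \<in> normal_forms G w h x"
proof -
  let ?X = "normal_forms G w h x"
  have c [simp]: "w \<in> carrier G" "h \<in> carrier G" "x \<in> carrier G" using r by (auto simp: sl_relations_def)
  have w5: "w [^] (5::nat) = \<one>" and h4: "h [^] (4::nat) = \<one>" and xx: "x \<otimes> x = h [^] (2::nat)"
    and hw: "h \<otimes> w = w [^] (4::nat) \<otimes> h" and xh: "x \<otimes> h = h [^] (3::nat) \<otimes> x"
    and E: "x \<otimes> (w \<otimes> x) = w [^] (4::nat) \<otimes> (x \<otimes> w [^] (4::nat))"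
    and O: "x \<otimes> (w [^] (2::nat) \<otimes> x) = w [^] (2::nat) \<otimes> (h \<otimes> (x \<otimes> w [^] (2::nat)))"
    using r by (auto simp: sl_relations_def)
  define F where "F i k = w [^] (i::nat) \<otimes> h [^] (k::nat)" for i k
  have Fc [simp]: "F i k \<in> carrier G" for i k by (simp add: F_def)
  have FX: "F i k \<in> ?X" for i k unfolding F_def normal_forms_def by blast
  have FxX: "F i k \<otimes> (x \<otimes> w [^] (j::nat)) \<in> ?X" for i k j unfolding F_def normal_forms_def by blast
  have Xcase: "(\<exists>i k. y = F i k) \<or> (\<exists>i k j. y = F i k \<otimes> (x \<otimes> w [^] (j::nat)))" if "y \<in> ?X" for y
    using that by (auto simp: normal_forms_def F_def)
  have wmod: "w [^] (j::nat) = w [^] (j mod 5)" for j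
  proof -
    have "w [^] j = w [^] (5 * (j div 5) + j mod 5)" by simp
    also have "\<dots> = (w [^] (5::nat)) [^] (j div 5) \<otimes> w [^] (j mod 5)" by (simp only: nat_pow_mult nat_pow_pow c)
    finally show ?thesis using w5 by simp
  qed
  have hwj: "h \<otimes> w [^] (j::nat) = w [^] (4 * j) \<otimes> h" for j
  proof (induction j)
    case (Suc j)
    have "h \<otimes> w [^] Suc j = (h \<otimes> w [^] j) \<otimes> w" by (simp add: m_assoc)
    also have "\<dots> = w [^] (4 * j) \<otimes> (h \<otimes> w)" using Suc by (simp add: m_assoc)
    also have "\<dots> = (w [^] (4 * j) \<otimes> w [^] (4::nat)) \<otimes> h" unfolding hw by (simp add: m_assoc)
    also have "\<dots> = w [^] (4 * Suc j) \<otimes> h" by (simp add: nat_pow_mult add.commute)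
    finally show ?case .
  qed simp
  have hkw: "h [^] (k::nat) \<otimes> w [^] (j::nat) = w [^] (4 ^ k * j) \<otimes> h [^] k" for k j
  proof (induction k arbitrary: j)
    case (Suc k)
    have "h [^] Suc k \<otimes> w [^] j = h [^] k \<otimes> (h \<otimes> w [^] j)" by (simp add: m_assoc)
    also have "\<dots> = (h [^] k \<otimes> w [^] (4 * j)) \<otimes> h" unfolding hwj by (simp add: m_assoc)
    also have "\<dots> = w [^] (4 ^ Suc k * j) \<otimes> h [^] Suc k" unfolding Suc by (simp add: m_assoc mult.assoc mult.left_commute)
    finally show ?case .
  qed simp
  have FF: "F i k \<otimes> F i' k' = F (i + 4 ^ k * i') (k + k')" for i k i' k'
  proof -
    have "F i k \<otimes> F i' k' = w [^] i \<otimes> (h [^] k \<otimes> w [^] i') \<otimes> h [^] k'" by (simp add: F_def m_assoc)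
    also have "\<dots> = (w [^] i \<otimes> w [^] (4 ^ k * i')) \<otimes> (h [^] k \<otimes> h [^] k')" unfolding hkw by (simp add: m_assoc)
    finally show ?thesis by (simp add: nat_pow_mult F_def)
  qed
  have w1: "w [^] (1::nat) = w" and Fw: "F i 0 = w [^] i" and Fh: "F 0 k = h [^] k" for i k by (simp_all add: F_def)
  have xxc: "F 0 2 \<otimes> w [^] j = w [^] j \<otimes> F 0 2" for j :: nat
  proof -
    have "F 0 2 \<otimes> w [^] j = F (16 * j) 2" using FF[of 0 2 j 0] by (simp add: Fw)
    also have "\<dots> = w [^] (16 * j) \<otimes> h [^] (2::nat)" by (simp add: F_def)
    also have "w [^] (16 * j) = w [^] j" using wmod[of "16 * j"] wmod[of j] by (simp add: mod_mult_left_eq[symmetric, of 16])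
    finally show ?thesis by (simp add: F_def)
  qed
  have rw: "a \<otimes> w \<in> ?X" if "a \<in> ?X" for a
    using Xcase[OF that]
  proof (elim disjE exE)
    fix i k :: nat assume "a = F i k"
    then have "a \<otimes> w = F i k \<otimes> F 1 0" by (simp add: F_def)
    then show ?thesis using FX unfolding FF by simp
  next
    fix i k j :: nat assume "a = F i k \<otimes> (x \<otimes> w [^] j)"
    then have "a \<otimes> w = F i k \<otimes> (x \<otimes> w [^] Suc j)" by (simp add: F_def m_assoc)
    then show ?thesis using FxX[of i k "Suc j"] by simp
  qed
  have wh: "w [^] j \<otimes> h = h \<otimes> w [^] (4 * j)" for j :: nat
  proof -
    have "h \<otimes> w [^] (4 * j) = w [^] (16 * j) \<otimes> h" unfolding hwj by simp
    moreover have "w [^] (16 * j) = w [^] j" using wmod[of "16 * j"] wmod[of j] by (simp add: mod_mult_left_eq[symmetric, of 16])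
    ultimately show ?thesis by simp
  qed
  have rh: "a \<otimes> h \<in> ?X" if "a \<in> ?X" for a
    using Xcase[OF that]
  proof (elim disjE exE)
    fix i k :: nat assume "a = F i k"
    then have "a \<otimes> h = F i (Suc k)" by (simp add: F_def m_assoc)
    then show ?thesis using FX by simp
  next
    fix i k j :: nat assume "a = F i k \<otimes> (x \<otimes> w [^] j)"
    then have "a \<otimes> h = F i k \<otimes> (x \<otimes> (w [^] j \<otimes> h))" by (simp add: F_def m_assoc)
    also have "\<dots> = F i k \<otimes> ((x \<otimes> h) \<otimes> w [^] (4 * j))" unfolding wh by (simp add: m_assoc)
    also have "\<dots> = (F i k \<otimes> F 0 3) \<otimes> (x \<otimes> w [^] (4 * j))" unfolding xh by (simp add: F_def m_assoc)
    finally show ?thesis using FxX unfolding FF by simp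
  qed
  have xwx: "\<exists>i k l. x \<otimes> (w [^] j \<otimes> x) = F i k \<otimes> (x \<otimes> w [^] (l::nat)) \<or> x \<otimes> (w [^] j \<otimes> x) = F i k" for j :: nat
  proof -
    have hx3: "h [^] (4::nat) = \<one>" by (rule h4)
    have zz: "F 0 2 \<otimes> F 0 2 = \<one>" unfolding FF using h4 by (simp add: F_def)
    have pair: "x \<otimes> (w [^] (5 - j) \<otimes> x) = y" if j: "j \<le> 5" and y: "y \<in> carrier G" "(x \<otimes> (w [^] j \<otimes> x)) \<otimes> y = \<one>" for j :: nat and y
    proof -
      have "(x \<otimes> (w [^] j \<otimes> x)) \<otimes> (x \<otimes> (w [^] (5 - j) \<otimes> x)) = x \<otimes> ((w [^] j \<otimes> (x \<otimes> x)) \<otimes> (w [^] (5 - j) \<otimes> x))"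
        by (simp add: m_assoc)
      also have "w [^] j \<otimes> (x \<otimes> x) = F 0 2 \<otimes> w [^] j" using xxc[of j] by (simp add: xx Fh)
      also have "x \<otimes> (F 0 2 \<otimes> w [^] j \<otimes> (w [^] (5 - j) \<otimes> x)) = (x \<otimes> F 0 2) \<otimes> ((w [^] j \<otimes> w [^] (5 - j)) \<otimes> x)"
        by (simp add: m_assoc)
      also have "w [^] j \<otimes> w [^] (5 - j) = \<one>" using j w5 by (simp add: nat_pow_mult)
      also have "(x \<otimes> F 0 2) \<otimes> (\<one> \<otimes> x) = (x \<otimes> x) \<otimes> (x \<otimes> x)" by (simp add: Fh xx[symmetric] m_assoc)
      also have "\<dots> = \<one>" using zz by (simp add: xx Fh)
      finally have "x \<otimes> (w [^] (5 - j) \<otimes> x) = inv (x \<otimes> (w [^] j \<otimes> x))" by (simp add: inv_equality inv_unique' inv_comm)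
      moreover have "y = inv (x \<otimes> (w [^] j \<otimes> x))" using y inv_comm[of "x \<otimes> (w [^] j \<otimes> x)" y] by (simp add: inv_equality)
      ultimately show ?thesis by simp
    qed
    have xh3: "x \<otimes> (h \<otimes> r) = F 0 3 \<otimes> (x \<otimes> r)" if "r \<in> carrier G" for r
      using xh that by (simp add: Fh flip: m_assoc)
    have xF2: "x \<otimes> F 0 2 = F 0 2 \<otimes> x" by (simp add: Fh xx[symmetric] m_assoc)
    have s1: "w [^] (4::nat) \<otimes> F 1 2 = F 0 2"
    proof -
      have "w [^] (4::nat) \<otimes> F 1 2 = F 4 0 \<otimes> F 1 2" by (simp add: Fw)
      also have "\<dots> = F 5 2" by (subst FF) (simp add: eval_nat_numeral)
      also have "\<dots> = F 0 2" unfolding F_def w5 by simp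
      finally show ?thesis .
    qed
    have s2: "w [^] (2::nat) \<otimes> F 3 3 = h \<otimes> F 0 2"
    proof -
      have "w [^] (2::nat) \<otimes> F 3 3 = F 2 0 \<otimes> F 3 3" by (simp add: Fw)
      also have "\<dots> = F 5 3" by (subst FF) (simp add: eval_nat_numeral)
      also have "\<dots> = h [^] (3::nat)" unfolding F_def w5 by simp
      also have "\<dots> = h \<otimes> F 0 2" by (simp add: Fh eval_nat_numeral m_assoc)
      finally show ?thesis .
    qed
    have E4: "x \<otimes> (w [^] (4::nat) \<otimes> x) = F 1 2 \<otimes> (x \<otimes> w [^] (1::nat))"
    proof -
      have "(x \<otimes> (w [^] (1::nat) \<otimes> x)) \<otimes> (F 1 2 \<otimes> (x \<otimes> w)) = w [^] (4::nat) \<otimes> (x \<otimes> ((w [^] (4::nat) \<otimes> F 1 2) \<otimes> (x \<otimes> w)))"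
        using E by (simp add: m_assoc)
      also have "w [^] (4::nat) \<otimes> F 1 2 = F 0 2" by (rule s1)
      also have "x \<otimes> (F 0 2 \<otimes> (x \<otimes> w)) = (F 0 2 \<otimes> (x \<otimes> x)) \<otimes> w"
        using xF2 by (metis Fc c m_assoc m_closed)
      also have "\<dots> = w" using zz by (simp add: xx Fh)
      also have "w [^] (4::nat) \<otimes> w = \<one>" using w5 by (simp add: eval_nat_numeral)
      finally show ?thesis using pair[of 1 "F 1 2 \<otimes> (x \<otimes> w)"] w1 by simp
    qed
    have O3: "x \<otimes> (w [^] (3::nat) \<otimes> x) = F 3 3 \<otimes> (x \<otimes> w [^] (3::nat))"
    proof -
      have "(x \<otimes> (w [^] (2::nat) \<otimes> x)) \<otimes> (F 3 3 \<otimes> (x \<otimes> w [^] (3::nat)))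
          = w [^] (2::nat) \<otimes> (h \<otimes> (x \<otimes> ((w [^] (2::nat) \<otimes> F 3 3) \<otimes> (x \<otimes> w [^] (3::nat)))))"
        unfolding O by (simp add: m_assoc)
      also have "w [^] (2::nat) \<otimes> F 3 3 = h \<otimes> F 0 2" by (rule s2)
      also have "x \<otimes> (h \<otimes> F 0 2 \<otimes> (x \<otimes> w [^] (3::nat))) = F 0 3 \<otimes> ((x \<otimes> F 0 2) \<otimes> (x \<otimes> w [^] (3::nat)))"
        by (simp add: m_assoc xh3)
      also have "\<dots> = F 0 3 \<otimes> ((F 0 2 \<otimes> (x \<otimes> x)) \<otimes> w [^] (3::nat))" unfolding xF2 by (simp add: m_assoc)
      also have "F 0 2 \<otimes> (x \<otimes> x) = \<one>" using zz by (simp add: xx Fh)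
      also have "h \<otimes> (F 0 3 \<otimes> (\<one> \<otimes> w [^] (3::nat))) = (h \<otimes> F 0 3) \<otimes> w [^] (3::nat)" by (simp add: m_assoc)
      also have "h \<otimes> F 0 3 = \<one>" using h4 nat_pow_mult[of h 1 3] by (simp add: Fh)
      also have "w [^] (2::nat) \<otimes> (\<one> \<otimes> w [^] (3::nat)) = \<one>" using w5 by (simp add: nat_pow_mult)
      finally show ?thesis using pair[of 2 "F 3 3 \<otimes> (x \<otimes> w [^] (3::nat))"] by simp
    qed
    have "j mod 5 = 0 \<or> j mod 5 = 1 \<or> j mod 5 = 2 \<or> j mod 5 = 3 \<or> j mod 5 = 4" by presburger
    moreover have e: "x \<otimes> (w [^] j \<otimes> x) = x \<otimes> (w [^] (j mod 5) \<otimes> x)" using wmod[of j] by simp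
    ultimately show ?thesis
    proof (elim disjE)
      assume "j mod 5 = 0"
      then have "x \<otimes> (w [^] j \<otimes> x) = F 0 2" using e by (simp add: xx Fh)
      then show ?thesis by blast
    next
      assume "j mod 5 = 1"
      then have "x \<otimes> (w [^] j \<otimes> x) = F 4 0 \<otimes> (x \<otimes> w [^] (4::nat))" using e E w1 by (simp add: Fw)
      then show ?thesis by blast
    next
      assume "j mod 5 = 2"
      then have "x \<otimes> (w [^] j \<otimes> x) = F 2 1 \<otimes> (x \<otimes> w [^] (2::nat))" using e O by (simp add: F_def m_assoc)
      then show ?thesis by blast
    next
      assume "j mod 5 = 3"
      then have "x \<otimes> (w [^] j \<otimes> x) = F 3 3 \<otimes> (x \<otimes> w [^] (3::nat))" using e O3 by simp
      then show ?thesis by blast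
    next
      assume "j mod 5 = 4"
      then have "x \<otimes> (w [^] j \<otimes> x) = F 1 2 \<otimes> (x \<otimes> w [^] (1::nat))" using e E4 by simp
      then show ?thesis by blast
    qed
  qed
  have rx: "a \<otimes> x \<in> ?X" if "a \<in> ?X" for a
    using Xcase[OF that]
  proof (elim disjE exE)
    fix i k :: nat assume "a = F i k"
    then have "a \<otimes> x = F i k \<otimes> (x \<otimes> w [^] (0::nat))" by (simp add: F_def)
    then show ?thesis using FxX[of i k 0] by simp
  next
    fix i k j :: nat assume "a = F i k \<otimes> (x \<otimes> w [^] j)"
    then have e: "a \<otimes> x = F i k \<otimes> (x \<otimes> (w [^] j \<otimes> x))" by (simp add: F_def m_assoc)
    obtain i' k' l where "x \<otimes> (w [^] j \<otimes> x) = F i' k' \<otimes> (x \<otimes> w [^] (l::nat)) \<or> x \<otimes> (w [^] j \<otimes> x) = F i' k'"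
      using xwx by blast
    then have "a \<otimes> x = (F i k \<otimes> F i' k') \<otimes> (x \<otimes> w [^] l) \<or> a \<otimes> x = F i k \<otimes> F i' k'" using e by (auto simp: m_assoc)
    then show ?thesis using FxX FX unfolding FF by auto
  qed
  have Xc: "a \<in> carrier G" if "a \<in> ?X" for a using that by (auto simp: normal_forms_def)
  have rwj: "a \<otimes> w [^] (j::nat) \<in> ?X" if "a \<in> ?X" for a j
  proof (induction j)
    case (Suc j)
    have "a \<otimes> w [^] Suc j = (a \<otimes> w [^] j) \<otimes> w" using Xc[OF that] by (simp add: m_assoc)
    then show ?case using rw[OF Suc] by simp
  qed (use that Xc in simp)
  have rhk: "a \<otimes> h [^] (k::nat) \<in> ?X" if "a \<in> ?X" for a k
  proof (induction k)
    case (Suc k)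
    have "a \<otimes> h [^] Suc k = (a \<otimes> h [^] k) \<otimes> h" using Xc[OF that] by (simp add: m_assoc)
    then show ?case using rh[OF Suc] by simp
  qed (use that Xc in simp)
  show ?thesis using Xcase[OF b]
  proof (elim disjE exE)
    fix i k :: nat assume "b = F i k"
    then have "a \<otimes> b = (a \<otimes> w [^] i) \<otimes> h [^] k" using Xc[OF a] by (simp add: F_def m_assoc)
    then show ?thesis using rhk[OF rwj[OF a]] by simp
  next
    fix i k j :: nat assume "b = F i k \<otimes> (x \<otimes> w [^] j)"
    then have "a \<otimes> b = (((a \<otimes> w [^] i) \<otimes> h [^] k) \<otimes> x) \<otimes> w [^] j" using Xc[OF a] by (simp add: F_def m_assoc)
    then show ?thesis using rwj[OF rx[OF rhk[OF rwj[OF a]]]] by simp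
  qed
qed

lemma DirProd_nat_pow:
  "(a, b) [^]\<^bsub>G \<times>\<times> H\<^esub> (n::nat) = (a [^]\<^bsub>G\<^esub> n, b [^]\<^bsub>H\<^esub> n)"
  by (induction n) (simp_all add: DirProd_def nat_pow_def)

lemma normal_forms_DirProd:
  assumes "(a, b) \<in> normal_forms (G \<times>\<times> H) (w, w') (h, h') (x, x')"
  shows "(\<exists>(i::nat) (k::nat). a = w [^]\<^bsub>G\<^esub> i \<otimes>\<^bsub>G\<^esub> h [^]\<^bsub>G\<^esub> k \<and> b = w' [^]\<^bsub>H\<^esub> i \<otimes>\<^bsub>H\<^esub> h' [^]\<^bsub>H\<^esub> k) \<or>
    (\<exists>(i::nat) (k::nat) (j::nat). a = w [^]\<^bsub>G\<^esub> i \<otimes>\<^bsub>G\<^esub> h [^]\<^bsub>G\<^esub> k \<otimes>\<^bsub>G\<^esub> (x \<otimes>\<^bsub>G\<^esub> w [^]\<^bsub>G\<^esub> j) \<and>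
       b = w' [^]\<^bsub>H\<^esub> i \<otimes>\<^bsub>H\<^esub> h' [^]\<^bsub>H\<^esub> k \<otimes>\<^bsub>H\<^esub> (x' \<otimes>\<^bsub>H\<^esub> w' [^]\<^bsub>H\<^esub> j))"
  using assms unfolding normal_forms_def DirProd_nat_pow by auto

lemma normal_forms_DirProd_fst:
  assumes "a \<in> normal_forms G w h x" shows "\<exists>b. (a, b) \<in> normal_forms (G \<times>\<times> H) (w, w') (h, h') (x, x')"
  using assms unfolding normal_forms_def DirProd_nat_pow mult_DirProd by blast

lemma normal_forms_DirProd_snd:
  assumes "b \<in> normal_forms H w' h' x'" shows "\<exists>a. (a, b) \<in> normal_forms (G \<times>\<times> H) (w, w') (h, h') (x, x')"
  using assms unfolding normal_forms_def DirProd_nat_pow mult_DirProd by blast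

text \<open>
  Every element has a normal form, and which normal forms are trivial does not depend on the group.
\<close>

definition faithful_normal_forms :: "('a, 'b) monoid_scheme \<Rightarrow> 'a \<Rightarrow> 'a \<Rightarrow> 'a \<Rightarrow> bool" where
  "faithful_normal_forms G w h x \<longleftrightarrow> carrier G \<subseteq> normal_forms G w h x \<and>
     (\<forall>(i::nat) (k::nat). w [^]\<^bsub>G\<^esub> i \<otimes>\<^bsub>G\<^esub> h [^]\<^bsub>G\<^esub> k = \<one>\<^bsub>G\<^esub> \<longleftrightarrow> 5 dvd i \<and> 4 dvd k) \<and>
     (\<forall>(i::nat) (k::nat) (j::nat). w [^]\<^bsub>G\<^esub> i \<otimes>\<^bsub>G\<^esub> h [^]\<^bsub>G\<^esub> k \<otimes>\<^bsub>G\<^esub> (x \<otimes>\<^bsub>G\<^esub> w [^]\<^bsub>G\<^esub> j) \<noteq> \<one>\<^bsub>G\<^esub>)"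

text \<open>
  The normal forms in the pairs of generators are a subset \<open>D\<close> of the direct product that is closed under
  multiplication and projects onto both factors. If one component of a pair in \<open>D\<close> is trivial, so is the
  other one; hence \<open>D\<close> is the graph of a bijection.
\<close>

theorem sl_relations_unique:
  assumes G: "group G" "sl_relations G w h x" "faithful_normal_forms G w h x"
    and H: "group H" "sl_relations H w' h' x'" "faithful_normal_forms H w' h' x'"
  shows "G \<cong> H"
proof -
  interpret G: group G by fact
  interpret H: group H by fact
  let ?K = "G \<times>\<times> H"
  interpret K: group ?K by (rule DirProd_group[OF G(1) H(1)])
  define D where "D = normal_forms ?K (w, w') (h, h') (x, x')"
  have r: "sl_relations ?K (w, w') (h, h') (x, x')"
    using G(2) H(2) unfolding sl_relations_def DirProd_nat_pow mult_DirProd by simp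
  have mult: "(a \<otimes>\<^bsub>G\<^esub> a', b \<otimes>\<^bsub>H\<^esub> b') \<in> D" if "(a, b) \<in> D" "(a', b') \<in> D" for a b a' b'
    using K.normal_forms_mult[OF r, of "(a, b)" "(a', b')"] that by (simp add: D_def)
  have cG: "w \<in> carrier G" "h \<in> carrier G" "x \<in> carrier G" and cH: "w' \<in> carrier H" "h' \<in> carrier H" "x' \<in> carrier H"
    using G(2) H(2) by (auto simp: sl_relations_def)
  have closed: "a \<in> carrier G \<and> b \<in> carrier H" if "(a, b) \<in> D" for a b
    using normal_forms_DirProd[of a b G H w w' h h' x x'] that cG cH unfolding D_def by auto
  have fst: "\<exists>b. (a, b) \<in> D" if "a \<in> carrier G" for a
  proof -
    have "a \<in> normal_forms G w h x" using G(3) that unfolding faithful_normal_forms_def by (meson subsetD)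
    then show ?thesis unfolding D_def by (rule normal_forms_DirProd_fst)
  qed
  have snd: "\<exists>a. (a, b) \<in> D" if "b \<in> carrier H" for b
  proof -
    have "b \<in> normal_forms H w' h' x'" using H(3) that unfolding faithful_normal_forms_def by (meson subsetD)
    then show ?thesis unfolding D_def by (rule normal_forms_DirProd_snd)
  qed
  have one: "a = \<one>\<^bsub>G\<^esub> \<longleftrightarrow> b = \<one>\<^bsub>H\<^esub>" if "(a, b) \<in> D" for a b
    using normal_forms_DirProd[OF that[unfolded D_def]]
  proof (elim disjE exE conjE)
    fix i k :: nat
    assume e: "a = w [^]\<^bsub>G\<^esub> i \<otimes>\<^bsub>G\<^esub> h [^]\<^bsub>G\<^esub> k" "b = w' [^]\<^bsub>H\<^esub> i \<otimes>\<^bsub>H\<^esub> h' [^]\<^bsub>H\<^esub> k"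
    have "a = \<one>\<^bsub>G\<^esub> \<longleftrightarrow> 5 dvd i \<and> 4 dvd k" using G(3) unfolding e faithful_normal_forms_def by iprover
    moreover have "b = \<one>\<^bsub>H\<^esub> \<longleftrightarrow> 5 dvd i \<and> 4 dvd k" using H(3) unfolding e faithful_normal_forms_def by iprover
    ultimately show ?thesis by simp
  next
    fix i k j :: nat
    assume e: "a = w [^]\<^bsub>G\<^esub> i \<otimes>\<^bsub>G\<^esub> h [^]\<^bsub>G\<^esub> k \<otimes>\<^bsub>G\<^esub> (x \<otimes>\<^bsub>G\<^esub> w [^]\<^bsub>G\<^esub> j)"
      "b = w' [^]\<^bsub>H\<^esub> i \<otimes>\<^bsub>H\<^esub> h' [^]\<^bsub>H\<^esub> k \<otimes>\<^bsub>H\<^esub> (x' \<otimes>\<^bsub>H\<^esub> w' [^]\<^bsub>H\<^esub> j)"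
    have "a \<noteq> \<one>\<^bsub>G\<^esub>" using G(3) unfolding e faithful_normal_forms_def by simp
    moreover have "b \<noteq> \<one>\<^bsub>H\<^esub>" using H(3) unfolding e faithful_normal_forms_def by simp
    ultimately show ?thesis by simp
  qed
  have right: "b = b'" if "(a, b) \<in> D" "(a, b') \<in> D" for a b b'
  proof -
    have c: "a \<in> carrier G" "b \<in> carrier H" "b' \<in> carrier H" using closed that by auto
    obtain e where e: "(inv\<^bsub>G\<^esub> a, e) \<in> D" using fst c by blast
    have ec: "e \<in> carrier H" using closed[OF e] by simp
    have "b \<otimes>\<^bsub>H\<^esub> e = \<one>\<^bsub>H\<^esub>" "b' \<otimes>\<^bsub>H\<^esub> e = \<one>\<^bsub>H\<^esub>"
      using one[OF mult[OF that(1) e]] one[OF mult[OF that(2) e]] c by simp_all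
    then have "b \<otimes>\<^bsub>H\<^esub> e = b' \<otimes>\<^bsub>H\<^esub> e" by simp
    then show ?thesis using c ec by simp
  qed
  have left: "a = a'" if "(a, b) \<in> D" "(a', b) \<in> D" for a a' b
  proof -
    have c: "a \<in> carrier G" "a' \<in> carrier G" "b \<in> carrier H" using closed that by auto
    obtain e where e: "(e, inv\<^bsub>H\<^esub> b) \<in> D" using snd c by blast
    have ec: "e \<in> carrier G" using closed[OF e] by simp
    have "a \<otimes>\<^bsub>G\<^esub> e = \<one>\<^bsub>G\<^esub>" "a' \<otimes>\<^bsub>G\<^esub> e = \<one>\<^bsub>G\<^esub>"
      using one[OF mult[OF that(1) e]] one[OF mult[OF that(2) e]] c by simp_all
    then have "a \<otimes>\<^bsub>G\<^esub> e = a' \<otimes>\<^bsub>G\<^esub> e" by simp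
    then show ?thesis using c ec by simp
  qed
  define f where "f a = (SOME b. (a, b) \<in> D)" for a
  have f: "(a, f a) \<in> D" if "a \<in> carrier G" for a
    unfolding f_def using fst[OF that] by (rule someI_ex)
  have "f \<in> iso G H"
  proof (rule isoI)
    show "f \<in> hom G H"
    proof (rule homI)
      show "f a \<in> carrier H" if "a \<in> carrier G" for a using closed[OF f[OF that]] by simp
      show "f (a \<otimes>\<^bsub>G\<^esub> b) = f a \<otimes>\<^bsub>H\<^esub> f b" if "a \<in> carrier G" "b \<in> carrier G" for a b
        using right[OF f[of "a \<otimes>\<^bsub>G\<^esub> b"] mult[OF f[OF that(1)] f[OF that(2)]]] that by simp
    qed
    show "bij_betw f (carrier G) (carrier H)"
    proof (rule bij_betw_imageI)
      show "inj_on f (carrier G)" by (rule inj_onI) (metis f left)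
      show "f ` carrier G = carrier H"
      proof
        show "f ` carrier G \<subseteq> carrier H" using closed f by blast
        show "carrier H \<subseteq> f ` carrier G"
        proof
          fix b assume "b \<in> carrier H"
          then obtain a where a: "(a, b) \<in> D" using snd by blast
          then have "a \<in> carrier G" using closed by blast
          then show "b \<in> f ` carrier G" using right[OF a f] by blast
        qed
      qed
    qed
  qed
  then show ?thesis by (rule is_isoI)
qed

section \<open>The standard generators of SL(2,5)\<close>

definition mat2 :: "'a::zero \<Rightarrow> 'a \<Rightarrow> 'a \<Rightarrow> 'a \<Rightarrow> 'a ^ 2 ^ 2" where
  "mat2 a b c d = vector [vector [a, b], vector [c, d]]"

lemma mat2_nth [simp]:
  "mat2 a b c d $ 1 $ 1 = a" "mat2 a b c d $ 1 $ 2 = b" "mat2 a b c d $ 2 $ 1 = c" "mat2 a b c d $ 2 $ 2 = d"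
  by (simp_all add: mat2_def)

lemma mat2_eq_iff: "A = mat2 a b c d \<longleftrightarrow> A $ 1 $ 1 = a \<and> A $ 1 $ 2 = b \<and> A $ 2 $ 1 = c \<and> A $ 2 $ 2 = d"
  by (auto simp: vec_eq_iff forall_2)

lemma mat2_mult: "mat2 a b c d ** mat2 a' b' c' d' =
    mat2 (a * a' + b * c') (a * b' + b * d') (c * a' + d * c') (c * b' + d * (d' :: 'a :: comm_ring_1))"
  by (simp add: mat2_eq_iff matrix_matrix_mult_def sum_2)

lemma mat2_one: "mat 1 = mat2 1 0 0 (1 :: 'a :: comm_ring_1)"
  by (simp add: mat2_eq_iff mat_def)

lemma mat2_in_SL: "mat2 a b c d \<in> carrier special_linear \<longleftrightarrow> a * d - b * c = (1 :: 'a :: comm_ring_1)"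
  by (simp add: special_linear_def det_2)

lemma SL_mult: "A \<otimes>\<^bsub>special_linear\<^esub> B = A ** B" and SL_one: "\<one>\<^bsub>special_linear\<^esub> = mat 1"
  by (simp_all add: special_linear_def)

lemma F5_cases: "(y :: F5) = 0 \<or> y = 1 \<or> y = 2 \<or> y = 3 \<or> y = 4"
proof -
  obtain z where z: "y = of_int z" "0 \<le> z" "z < 5" by (cases y) auto
  then have "z = 0 \<or> z = 1 \<or> z = 2 \<or> z = 3 \<or> z = 4" by auto
  then show ?thesis using z(1) by auto
qed

abbreviation Wm :: "F5 ^ 2 ^ 2" where "Wm \<equiv> mat2 1 1 0 1"
abbreviation Hm :: "F5 ^ 2 ^ 2" where "Hm \<equiv> mat2 3 0 0 2"
abbreviation Xm :: "F5 ^ 2 ^ 2" where "Xm \<equiv> mat2 0 (- 1) 1 0"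

lemma Wm_pow: "Wm [^]\<^bsub>SL_2_5\<^esub> (i::nat) = mat2 1 (of_nat i) 0 1"
  by (induction i) (simp_all add: SL_one SL_mult mat2_one mat2_mult nat_pow_def)

lemma Hm_pow: "Hm [^]\<^bsub>SL_2_5\<^esub> (k::nat) = mat2 (3 ^ k) 0 0 (2 ^ k)"
  by (induction k) (simp_all add: SL_one SL_mult mat2_one mat2_mult nat_pow_def mult.commute)

lemma sl_relations_SL_2_5: "sl_relations SL_2_5 Wm Hm Xm"
  unfolding sl_relations_def Wm_pow Hm_pow SL_mult SL_one mat2_in_SL mat2_one mat2_mult mat2_eq_iff
  by simp

lemma F5_numerals: "(5 :: F5) = 0" "(6 :: F5) = 1" "(16 :: F5) = 1" by simp_all

lemma of_nat_F5_eq_0_iff: "(of_nat i :: F5) = 0 \<longleftrightarrow> 5 dvd i"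
proof -
  have "(of_nat i :: F5) = of_nat (5 * (i div 5) + i mod 5)" by simp
  also have "\<dots> = of_nat (i mod 5)" by (simp only: of_nat_add of_nat_mult) (simp add: F5_numerals)
  finally have e: "(of_nat i :: F5) = of_nat (i mod 5)" .
  have "i mod 5 = 0 \<or> i mod 5 = 1 \<or> i mod 5 = 2 \<or> i mod 5 = 3 \<or> i mod 5 = 4" by presburger
  then show ?thesis unfolding e dvd_eq_mod_eq_0 by (elim disjE) simp_all
qed

lemma F5_power: "(3 :: F5) ^ k * 2 ^ k = 1" "(2 :: F5) ^ k = 1 \<longleftrightarrow> 4 dvd k"
proof -
  show "(3 :: F5) ^ k * 2 ^ k = 1" by (simp add: F5_numerals flip: power_mult_distrib)
  have "(2 :: F5) ^ k = 2 ^ (4 * (k div 4) + k mod 4)" by simp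
  also have "\<dots> = 2 ^ (k mod 4)" by (simp only: power_add power_mult) (simp add: F5_numerals)
  finally have e: "(2 :: F5) ^ k = 2 ^ (k mod 4)" .
  have "k mod 4 = 0 \<or> k mod 4 = 1 \<or> k mod 4 = 2 \<or> k mod 4 = 3" by presburger
  then show "(2 :: F5) ^ k = 1 \<longleftrightarrow> 4 dvd k" unfolding e dvd_eq_mod_eq_0 by (elim disjE) simp_all
qed

lemma F5_is_power_of_2: "(y :: F5) \<noteq> 0 \<Longrightarrow> \<exists>k. y = 2 ^ k"
proof -
  assume "y \<noteq> 0"
  then have "y = 2 ^ 0 \<or> y = 2 ^ 1 \<or> y = 2 ^ 3 \<or> y = 2 ^ 2" using F5_cases[of y] by auto
  then show ?thesis by metis
qed

lemma F5_is_of_nat: "\<exists>i. (y :: F5) = of_nat i"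
proof -
  have "y = of_nat 0 \<or> y = of_nat 1 \<or> y = of_nat 2 \<or> y = of_nat 3 \<or> y = of_nat 4" using F5_cases[of y] by auto
  then show ?thesis by metis
qed

text \<open>
  For a lower left entry 0 the matrix is upper triangular, with diagonal entries that are powers of 3 and 2.
  Otherwise this entry is a power \<open>2\<^sup>k\<close>, and the diagonal entries determine \<open>i\<close> and \<open>j\<close>.
\<close>

lemma faithful_normal_forms_SL_2_5: "faithful_normal_forms SL_2_5 Wm Hm Xm"
  unfolding faithful_normal_forms_def
proof (intro conjI allI)
  fix i k j :: nat
  show "Wm [^]\<^bsub>SL_2_5\<^esub> i \<otimes>\<^bsub>SL_2_5\<^esub> Hm [^]\<^bsub>SL_2_5\<^esub> k = \<one>\<^bsub>SL_2_5\<^esub> \<longleftrightarrow> 5 dvd i \<and> 4 dvd k"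
  proof -
    have "(3::F5) ^ k = 1" if "(2::F5) ^ k = 1" using F5_power(1)[of k] that by simp
    then show ?thesis unfolding Wm_pow Hm_pow SL_mult SL_one mat2_mult mat2_one mat2_eq_iff
      using F5_power(2)[of k] of_nat_F5_eq_0_iff[of i] by auto
  qed
  have "(2::F5) ^ k \<noteq> 0" using F5_power(1)[of k] by auto
  then show "Wm [^]\<^bsub>SL_2_5\<^esub> i \<otimes>\<^bsub>SL_2_5\<^esub> Hm [^]\<^bsub>SL_2_5\<^esub> k \<otimes>\<^bsub>SL_2_5\<^esub> (Xm \<otimes>\<^bsub>SL_2_5\<^esub> Wm [^]\<^bsub>SL_2_5\<^esub> j) \<noteq> \<one>\<^bsub>SL_2_5\<^esub>"
    unfolding Wm_pow Hm_pow SL_mult SL_one mat2_mult mat2_one mat2_eq_iff by simp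
next
  show "carrier SL_2_5 \<subseteq> normal_forms SL_2_5 Wm Hm Xm"
  proof
    fix A :: "F5 ^ 2 ^ 2" assume A: "A \<in> carrier SL_2_5"
    define a b c d where "a = A $ 1 $ 1" and "b = A $ 1 $ 2" and "c = A $ 2 $ 1" and "d = A $ 2 $ 2"
    have Ae: "A = mat2 a b c d" by (simp add: mat2_eq_iff a_def b_def c_def d_def)
    have det: "a * d - b * c = 1" using A unfolding Ae mat2_in_SL .
    show "A \<in> normal_forms SL_2_5 Wm Hm Xm"
    proof (cases "c = 0")
      case True
      then have "d \<noteq> 0" using det by auto
      then obtain k where k: "d = 2 ^ k" using F5_is_power_of_2 by blast
      obtain i where i: "b * 3 ^ k = of_nat i" using F5_is_of_nat by blast
      have ak: "a = 3 ^ k"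
      proof -
        have "a = a * (3 ^ k * 2 ^ k)" using F5_power(1)[of k] by simp
        also have "\<dots> = (a * d) * 3 ^ k" using k by (simp only: ac_simps)
        finally show ?thesis using det True by simp
      qed
      have bk: "b = of_nat i * 2 ^ k" unfolding i[symmetric] using F5_power(1)[of k] by (simp add: mult.assoc)
      have "A = Wm [^]\<^bsub>SL_2_5\<^esub> i \<otimes>\<^bsub>SL_2_5\<^esub> Hm [^]\<^bsub>SL_2_5\<^esub> k"
        unfolding Ae Wm_pow Hm_pow SL_mult mat2_mult mat2_eq_iff using True k ak bk by simp
      then show ?thesis unfolding normal_forms_def by blast
    next
      case False
      then obtain k where k: "c = 2 ^ k" using F5_is_power_of_2 by blast
      obtain i where i: "a * 3 ^ k = of_nat i" using F5_is_of_nat by blast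
      obtain j where j: "d * 3 ^ k = of_nat j" using F5_is_of_nat by blast
      have ak: "a = of_nat i * 2 ^ k" unfolding i[symmetric] using F5_power(1)[of k] by (simp add: mult.assoc)
      have dk: "d = of_nat j * 2 ^ k" unfolding j[symmetric] using F5_power(1)[of k] by (simp add: mult.assoc)
      have bk: "b = - (3 ^ k) + of_nat i * 2 ^ k * of_nat j"
      proof -
        have "b * c = a * d - 1" using det by (simp add: algebra_simps)
        then have "b * (c * 3 ^ k) = (a * d - 1) * 3 ^ k" by (metis mult.assoc)
        moreover have "c * 3 ^ k = 1" using F5_power(1)[of k] k by (simp add: mult.commute)
        ultimately have "b = (a * d - 1) * 3 ^ k" by simp
        also have "\<dots> = a * (d * 3 ^ k) - 3 ^ k" by (simp add: algebra_simps)
        finally show ?thesis unfolding j ak by simp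
      qed
      have "A = Wm [^]\<^bsub>SL_2_5\<^esub> i \<otimes>\<^bsub>SL_2_5\<^esub> Hm [^]\<^bsub>SL_2_5\<^esub> k \<otimes>\<^bsub>SL_2_5\<^esub> (Xm \<otimes>\<^bsub>SL_2_5\<^esub> Wm [^]\<^bsub>SL_2_5\<^esub> j)"
        unfolding Ae Wm_pow Hm_pow SL_mult mat2_mult mat2_eq_iff using k ak dk bk by (simp add: mult.commute)
      then show ?thesis unfolding normal_forms_def by blast
    qed
  qed
qed

context bi_frame begin

text \<open>
  By the Bruhat decomposition the generators of \<open>standard_generators\<close> have all elements as normal forms.
\<close>

theorem iso_SL_2_5: "G \<cong> SL_2_5"
proof -
  obtain w h1 x1 where w: "w \<in> Q" "w \<noteq> \<one>" and h1: "h1 \<in> {h, z \<otimes> h}" and x1: "x1 \<in> {x, z \<otimes> x}"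
    and E: "x1 \<otimes> (w \<otimes> x1) = inv w \<otimes> (x1 \<otimes> inv w)"
    and O: "x1 \<otimes> ((w \<otimes> w) \<otimes> x1) = (w \<otimes> w) \<otimes> (h1 \<otimes> (x1 \<otimes> (w \<otimes> w)))"
    using standard_generators by blast
  have wc: "w \<in> carrier G" and h1c: "h1 \<in> carrier G" and x1c: "x1 \<in> carrier G" using w h1 x1 by auto
  have h11: "h1 \<otimes> h1 = z" and x11: "x1 \<otimes> x1 = z" using h1 x1 by (auto simp: calc)
  have h1B: "h1 \<in> B" using h1 by auto
  have w4: "w [^] (4::nat) = inv w"
  proof -
    have "w [^] (4::nat) \<otimes> w = \<one>" using Q5[OF w(1)] by (simp add: eval_nat_numeral)
    then show ?thesis using wc inv_equality by fastforce
  qed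
  have pw2: "w [^] (2::nat) = w \<otimes> w" "h1 [^] (2::nat) = z" using wc h1c h11 by (simp_all add: eval_nat_numeral)
  have h3: "h1 [^] (3::nat) = z \<otimes> h1" using h1c h11 by (simp add: eval_nat_numeral)
  have h4: "h1 [^] (4::nat) = \<one>"
  proof -
    have "h1 [^] (4::nat) = h1 [^] (2::nat) \<otimes> h1 [^] (2::nat)" using h1c by (simp add: nat_pow_mult)
    then show ?thesis using zz pw2 by simp
  qed
  have rel: "sl_relations G w h1 x1"
    unfolding sl_relations_def w4 pw2 h3 h4 x11
  proof (intro conjI)
    show "w [^] (5::nat) = \<one>" by (rule Q5[OF w(1)])
    show "h1 \<otimes> w = inv w \<otimes> h1" using h1 w hu[OF w(1)] by (auto simp: m_assoc assoc_rules)
    show "x1 \<otimes> h1 = z \<otimes> h1 \<otimes> x1" using h1 x1 by (auto simp: calc)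
  qed (use wc h1c x1c E O in auto)
  have pQ: "w [^] (i::nat) \<in> Q" for i
    using w(1) by (induction i) auto
  have pB: "h1 [^] (k::nat) \<in> B" for k
    using h1B by (induction k) auto
  have x1B: "x1 \<notin> B"
  proof
    assume a: "x1 \<in> B"
    then have "z \<otimes> x1 \<in> B" by simp
    moreover have "z \<otimes> x1 \<in> {x, z \<otimes> x}" using x1 by (auto simp: assoc_rules)
    ultimately show False using a x1 xB zz by (auto simp: assoc_rules)
  qed
  have ordw: "ord w = 5"
  proof -
    have "ord w dvd 5" using pow_eq_id[OF wc] Q5[OF w(1)] by simp
    moreover have "ord w \<noteq> 1" using ord_eq_1[OF wc] w by simp
    moreover have "prime (5::nat)" by simp
    ultimately show ?thesis by (meson prime_nat_iff)
  qed
  have h1k: "h1 [^] (k::nat) = \<one> \<longleftrightarrow> 4 dvd k" for k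
  proof -
    have "ord h1 dvd 4" using pow_eq_id[OF h1c] h4 by simp
    moreover have "\<not> ord h1 dvd 2" using pow_eq_id[OF h1c, of 2] pw2(2) z1 by simp
    ultimately have "ord h1 = 4"
    proof -
      have A: "\<forall>x\<in>set [2..<5::nat]. x dvd 4 \<longrightarrow> x = 1 \<or> x = 2 \<or> x = 4" by (simp add: upt_rec_numeral del: set_upt)
      have "ord h1 = 1 \<or> ord h1 = 2 \<or> ord h1 = 4" using dvd_search[OF \<open>ord h1 dvd 4\<close> _ _ _ A] by simp
      then show ?thesis using \<open>\<not> ord h1 dvd 2\<close> by auto
    qed
    then show ?thesis using pow_eq_id[OF h1c] by simp
  qed
  have c1: "w [^] (i::nat) \<otimes> h1 [^] (k::nat) = \<one> \<longleftrightarrow> 5 dvd i \<and> 4 dvd k" for i k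
  proof
    assume "w [^] i \<otimes> h1 [^] k = \<one>"
    then have e: "h1 [^] k = inv (w [^] i)" using wc h1c inv_equality[of "w [^] i" "h1 [^] k"] inv_inv[of "h1 [^] k"]
      by (metis nat_pow_closed)
    then have "(h1 [^] k) [^] (5::nat) = \<one>" using Q5[OF invQ(1)[OF pQ]] by simp
    then have "4 dvd k * 5" using h1k h1c by (simp add: nat_pow_pow)
    then have k4: "4 dvd k" by presburger
    then have "h1 [^] k = \<one>" using h1k by blast
    then have "w [^] i = \<one>" using \<open>w [^] i \<otimes> h1 [^] k = \<one>\<close> wc by simp
    then show "5 dvd i \<and> 4 dvd k" using pow_eq_id[OF wc, of i] ordw k4 by simp
  next
    assume "5 dvd i \<and> 4 dvd k"
    then have "w [^] i = \<one>" "h1 [^] k = \<one>" using pow_eq_id[OF wc, of i] ordw h1k[of k] by simp_all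
    then show "w [^] i \<otimes> h1 [^] k = \<one>" by simp
  qed
  have c2: "w [^] (i::nat) \<otimes> h1 [^] (k::nat) \<otimes> (x1 \<otimes> w [^] (j::nat)) \<noteq> \<one>" for i k j
  proof
    assume "w [^] i \<otimes> h1 [^] k \<otimes> (x1 \<otimes> w [^] j) = \<one>"
    then have "w [^] i \<otimes> h1 [^] k \<otimes> (x1 \<otimes> w [^] j) \<in> B" using QinB[OF invQ(3)] by simp
    then have "x1 \<in> B" by (rule B_cancel[rotated 3]) (use pQ pB x1c in auto)
    then show False using x1B by simp
  qed
  have Qpow: "\<exists>i::nat. u = w [^] i" if "u \<in> Q" for u using Qgen[OF that w] .
  have Bform: "\<exists>(i::nat) (k::nat). b = w [^] i \<otimes> h1 [^] k" if b: "b \<in> B" for b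
  proof -
    obtain c u where c: "c \<in> {\<one>, z}" "u \<in> Q" "b = c \<otimes> u \<or> b = c \<otimes> (u \<otimes> h)" using Bdec[OF b] by blast
    obtain i :: nat where i: "u = w [^] i" using Qpow[OF c(2)] by blast
    have ch: "\<exists>k::nat. c = h1 [^] k" "\<exists>k::nat. c \<otimes> h = h1 [^] k"
    proof -
      have k: "h1 [^] (0::nat) = \<one>" "h1 [^] (1::nat) = h1" using h1c by simp_all
      show "\<exists>k::nat. c = h1 [^] k" using c(1) k(1) pw2(2) by (metis empty_iff insert_iff)
      have "c \<otimes> h \<in> {h1, z \<otimes> h1}" using c(1) h1 by (auto simp: assoc_rules)
      then show "\<exists>k::nat. c \<otimes> h = h1 [^] k" using k(2) h3 by (metis empty_iff insert_iff)
    qed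
    have cu: "c \<otimes> u = u \<otimes> c" using c zc[of u] by auto
    show ?thesis using c(3)
    proof
      assume "b = c \<otimes> u"
      then show ?thesis using ch(1) cu i by metis
    next
      assume "b = c \<otimes> (u \<otimes> h)"
      then have "b = u \<otimes> (c \<otimes> h)" using cu c by (auto simp: assoc_rules)
      then show ?thesis using ch(2) i by metis
    qed
  qed
  have all: "carrier G \<subseteq> normal_forms G w h1 x1"
  proof
    fix g assume g: "g \<in> carrier G"
    show "g \<in> normal_forms G w h1 x1"
    proof (cases "g \<in> B")
      case True
      then show ?thesis using Bform unfolding normal_forms_def by blast
    next
      case False
      then obtain b v where b: "b \<in> B" "v \<in> Q" "g = b \<otimes> x \<otimes> v" using dbl[OF g] by blast
      have "\<exists>b'\<in>B. g = b' \<otimes> (x1 \<otimes> v)"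
      proof (cases "x1 = x")
        case True
        then show ?thesis using b by (auto simp: m_assoc)
      next
        case False
        then have "x1 = z \<otimes> x" using x1 by simp
        then have "g = (b \<otimes> z) \<otimes> (x1 \<otimes> v)" using b by (simp add: m_assoc assoc_rules)
        then show ?thesis using b(1) by (metis Bcl(1,3))
      qed
      then obtain b' where b': "b' \<in> B" "g = b' \<otimes> (x1 \<otimes> v)" by blast
      obtain i k :: nat where ik: "b' = w [^] i \<otimes> h1 [^] k" using Bform[OF b'(1)] by blast
      obtain j :: nat where "v = w [^] j" using Qpow[OF b(2)] by blast
      then show ?thesis using b' ik unfolding normal_forms_def by blast
    qed
  qed
  have "faithful_normal_forms G w h1 x1" unfolding faithful_normal_forms_def using all c1 c2 by blast
  then show ?thesis
    by (rule sl_relations_unique[OF is_group rel _ group_special_linear_2 sl_relations_SL_2_5 faithful_normal_forms_SL_2_5])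
qed

end

section \<open>The double cover of the simple group of order 60\<close>

locale double_cover_of_simple_60 = extension_of_simple_60 +
  fixes z :: 'a
  assumes Nz: "N = {\<one>, z}" and z1: "z \<noteq> \<one>"
    and involution: "\<And>t. t \<in> carrier G \<Longrightarrow> t \<otimes> t = \<one> \<Longrightarrow> t = \<one> \<or> t = z"
begin

lemma primes_2_5: "prime (2::nat)" "prime (5::nat)" by simp_all

lemma n120: "card (carrier G) = 120"
  using card_G z1 by (simp add: Nz)

lemma zG: "z \<in> carrier G" using subgroup.subset[OF sN] Nz by simp

lemma zz: "z \<otimes> z = \<one>"
proof -
  have "z \<otimes> z \<in> N" using subgroup.m_closed[OF sN, of z z] Nz by blast
  moreover have "z \<otimes> z \<noteq> z" using zG z1 by simp
  ultimately show ?thesis using Nz by simp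
qed

lemma zc: assumes g: "g \<in> carrier G" shows "g \<otimes> z = z \<otimes> g"
proof -
  have "g \<otimes> z \<otimes> inv g \<in> N" using N.inv_op_closed2[OF g] Nz by simp
  moreover have "g \<otimes> z \<otimes> inv g \<noteq> \<one>"
  proof
    assume "g \<otimes> z \<otimes> inv g = \<one>"
    then have "g \<otimes> z = g" using g zG by (metis inv_closed inv_equality inv_inv m_closed)
    then show False using g zG z1 by simp
  qed
  ultimately have "g \<otimes> z \<otimes> inv g = z" using Nz by simp
  then show ?thesis using g zG by (metis inv_solve_right m_closed)
qed

lemma pi_conj:
  assumes g: "g \<in> carrier G" and K: "K \<subseteq> carrier G"
  shows "S.conjugate (\<pi> g) ((\<lambda>x. \<pi> x) ` K) = (\<lambda>x. \<pi> x) ` conjugate g K"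
proof -
  interpret h: group_hom G "G Mod N" "\<lambda>x. \<pi> x" by (rule pi_hom)
  have "\<pi> g \<otimes>\<^bsub>G Mod N\<^esub> \<pi> k \<otimes>\<^bsub>G Mod N\<^esub> inv\<^bsub>G Mod N\<^esub> \<pi> g = \<pi> (g \<otimes> k \<otimes> inv g)" if "k \<in> K" for k
    using g K that by (simp add: subset_iff)
  then show ?thesis unfolding S.conjugate_def conjugate_def image_image by (rule image_cong[OF refl])
qed

lemma lift_5:
  assumes A: "A \<in> S.subgroups_of_order 5" shows "lift 5 A \<in> sylows 5 (carrier G)"
proof -
  have A': "subgroup A (G Mod N)" "card A = 5 ^ 1" using A by (auto simp: S.subgroups_of_order_def)
  let ?K = "lift 5 A"
  have K: "subgroup ?K G" "(\<lambda>x. \<pi> x) ` ?K = A" using lift[OF primes_2_5(2) A'] by auto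
  obtain b where b: "card ?K = 5 ^ b" using lift(2)[OF primes_2_5(2) A'] by blast
  have d: "5 ^ b dvd (120::nat)" using card_dvd_order[OF K(1)] b n120 by simp
  have "5 * card (?K \<inter> N) = 5 ^ b" using card_image_quotient[OF N K(1)] K(2) A'(2) b by simp
  then have "b \<noteq> 0" by (cases b) auto
  moreover have "\<not> 2 \<le> b"
  proof
    assume "2 \<le> b"
    then have "(5::nat) ^ 2 dvd 120" using d le_imp_power_dvd dvd_trans by blast
    then show False by simp
  qed
  ultimately have "b = 1" by simp
  then show ?thesis
    using K(1) b subgroup.subset[OF K(1)] syl_prime_powerI[OF primes_2_5(2), of "carrier G" 1 24] n120 by simp
qed

text \<open>
  Lifting the subgroups of order 5 of the quotient gives six, and among the divisors of 24 that are at least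
  6 only 6 is 1 modulo 5.
\<close>

lemma card_syl_5: "card (sylows 5 (carrier G)) = 6"
proof -
  let ?c = "card (sylows 5 (carrier G))"
  have "card (lift 5 ` S.subgroups_of_order 5) = 6"
    using card_lifts[OF primes_2_5(2), of "S.subgroups_of_order 5"] S.card_sg5 by (metis (mono_tags, lifting) S.subgroups_of_order_def mem_Collect_eq power_one_right)
  moreover have "lift 5 ` S.subgroups_of_order 5 \<subseteq> sylows 5 (carrier G)" using lift_5 by blast
  ultimately have "6 \<le> ?c" using card_mono[OF syl_finite] by metis
  moreover have A: "\<forall>c\<in>set [2..<25::nat]. c dvd 24 \<longrightarrow> c mod 5 = 1 \<longrightarrow> c = 1 \<or> c = 6"
    by (simp add: upt_rec_numeral del: set_upt)
  have "?c dvd 24" using card_syl_dvd[OF subgroup_self primes_2_5(2), of 1 24] n120 by simp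
  then have "?c mod 5 = 1 \<longrightarrow> ?c = 1 \<or> ?c = 6" using dvd_search[OF _ _ _ _ A] by simp
  ultimately show ?thesis using card_syl_mod[OF subgroup_self primes_2_5(2)] by simp
qed

lemma syl_5_card: "Q \<in> sylows 5 (carrier G) \<Longrightarrow> subgroup Q G \<and> Q \<subseteq> carrier G \<and> card Q = 5"
  using syl_prime_powerI[OF primes_2_5(2), of "carrier G" 1 24] n120 by simp

text \<open>
  The image of \<open>g\<close> normalizes all Sylow 5-subgroups of the quotient, which is simple.
\<close>

lemma syl_5_kernel:
  assumes g: "g \<in> carrier G" and fix_all: "\<And>R. R \<in> sylows 5 (carrier G) \<Longrightarrow> g \<in> normalizer R"
  shows "g \<in> N"
proof -
  interpret h: group_hom G "G Mod N" "\<lambda>x. \<pi> x" by (rule pi_hom)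
  have "\<pi> g \<in> S.normalizer R" if R: "R \<in> S.sylows 5 (carrier (G Mod N))" for R
  proof -
    have A: "R \<in> S.subgroups_of_order 5" using R S.syl_sg by simp
    have L: "lift 5 R \<in> sylows 5 (carrier G)" by (rule lift_5[OF A])
    have "(\<lambda>x. \<pi> x) ` lift 5 R = R" using lift(3)[OF primes_2_5(2), of R 1] A by (simp add: S.subgroups_of_order_def)
    moreover have "conjugate g (lift 5 R) = lift 5 R" using fix_all[OF L] by (simp add: normalizer_def)
    ultimately have "S.conjugate (\<pi> g) R = R" using pi_conj[OF g, of "lift 5 R"] syl_5_card[OF L] by metis
    then show ?thesis using h.hom_closed[OF g] by (simp add: S.normalizer_def)
  qed
  then have "\<pi> g = \<one>\<^bsub>G Mod N\<^esub>"
    by (intro S.syl_core_trivial[OF primes_2_5(2)]) (use S.n60 h.hom_closed[OF g] in auto)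
  then have "\<pi> g = N" by simp
  then show ?thesis using rcos_self[OF g sN] by simp
qed

text \<open>
  If \<open>h\<close> commutes with \<open>y\<close>, it centralizes \<open>Q\<close>. Then \<open>v h\<close> normalizes all Sylow 5-subgroups for
  some \<open>v\<close> in \<open>Q\<close>, so it lies in \<open>N\<close> and has a trivial square. This square is \<open>v\<^sup>2 z\<close>, and so \<open>z\<close> would
  lie in the group \<open>Q\<close> of odd order.
\<close>

lemma not_centralizing:
  assumes Q: "Q \<in> sylows 5 (carrier G)" and y: "y \<in> Q" "y \<noteq> \<one>"
    and h: "h \<in> carrier G" "h \<otimes> h = z"
  shows "h \<otimes> y \<noteq> y \<otimes> h"
proof
  assume hy: "h \<otimes> y = y \<otimes> h"
  have sQ: "subgroup Q G" "Q \<subseteq> carrier G" "card Q = 5" using syl_5_card[OF Q] by auto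
  have yc: "y \<in> carrier G" using y sQ by auto
  have "h \<otimes> q = q \<otimes> h" if q: "q \<in> Q" for q
  proof -
    obtain i :: nat where i: "q = y [^] i" using prime_card_cyclic[OF sQ(1) _ q y] sQ(3) by auto
    have "h \<otimes> y [^] i = y [^] i \<otimes> h"
    proof (induction i)
      case (Suc i)
      have "h \<otimes> y [^] Suc i = (h \<otimes> y [^] i) \<otimes> y" using h yc by (simp add: m_assoc)
      also have "\<dots> = y [^] i \<otimes> (h \<otimes> y)" using Suc h yc by (simp add: m_assoc)
      also have "\<dots> = y [^] Suc i \<otimes> h" unfolding hy using h yc by (simp add: m_assoc)
      finally show ?case .
    qed (use h in simp)
    then show ?thesis using i by simp
  qed
  then obtain v where v: "v \<in> Q" "\<And>R. R \<in> sylows 5 (carrier G) \<Longrightarrow> v \<otimes> h \<in> normalizer R" and hv: "h \<otimes> v = v \<otimes> h"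
    using syl_centralizing[OF primes_2_5(2) Q sQ(3) _ h(1)] card_syl_5 by auto
  have vc: "v \<in> carrier G" using v sQ by auto
  have "v \<otimes> h \<in> N" using syl_5_kernel[OF _ v(2)] vc h(1) by simp
  then have "(v \<otimes> h) \<otimes> (v \<otimes> h) = \<one>" using Nz zz by auto
  moreover have "(v \<otimes> h) \<otimes> (v \<otimes> h) = v \<otimes> ((h \<otimes> v) \<otimes> h)" using vc h(1) by (simp add: m_assoc)
  moreover have "v \<otimes> ((h \<otimes> v) \<otimes> h) = (v \<otimes> v) \<otimes> z" unfolding hv using vc h zG by (simp add: m_assoc)
  ultimately have "inv z = v \<otimes> v" using vc zG by (intro inv_equality) simp_all
  then have "z = v \<otimes> v" using zz zG inv_equality by metis
  then have "N \<subseteq> Q" using Nz sQ v by (auto simp: subgroup.m_closed subgroup.one_closed)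
  moreover have "card N = 2" using z1 by (simp add: Nz)
  ultimately show False using card_dvd[OF sN sQ(1)] sQ(3) by simp
qed

text \<open>
  \<open>B\<close> is the normalizer of a Sylow 5-subgroup \<open>Q\<close> and has order 20, \<open>T\<close> is a Sylow 2-subgroup of \<open>B\<close>, and
  \<open>h\<close> an element of \<open>T\<close> outside \<open>N\<close>. The element \<open>x\<close> is taken from a Sylow 2-subgroup \<open>P\<close> of \<open>G\<close>, of
  order 8, that contains \<open>T\<close>. Since \<open>z\<close> is the only involution, \<open>h\<close> and \<open>x\<close> have the square \<open>z\<close>, and
  \<open>x\<close> and \<open>h\<close> do not commute. The Bruhat decomposition expresses that \<open>Q\<close> is transitive on the other five
  Sylow 5-subgroups.
\<close>

theorem bi_frame: "\<exists>Q B h x. bi_frame G Q B z h x"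
proof -
  obtain Q where Q: "Q \<in> sylows 5 (carrier G)" using syl_ex[OF subgroup_self primes_2_5(2)] by blast
  have sQ: "subgroup Q G" "Q \<subseteq> carrier G" and cQ: "card Q = 5" using syl_5_card[OF Q] by auto
  define B where "B = normalizer Q"
  have sB: "subgroup B G" unfolding B_def by (rule nrm_subgroup[OF sQ(2)])
  have QB: "Q \<subseteq> B" unfolding B_def by (rule sub_nrm[OF sQ(1)])
  have Bc: "B \<subseteq> carrier G" unfolding B_def by (rule nrm_closed)
  have cB: "card B = 20"
    using card_syl[OF subgroup_self primes_2_5(2) Q] card_syl_5 n120 Bc by (simp add: B_def Int_absorb1)
  have zB: "z \<in> B"
  proof -
    have "z \<otimes> q \<otimes> inv z = q" if "q \<in> Q" for q
      using zc[of q, symmetric] zG subsetD[OF sQ(2) that] by (simp add: m_assoc)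
    then have "conjugate z Q = Q" by (simp add: conjugate_def)
    then show ?thesis using zG by (simp add: B_def normalizer_def)
  qed
  obtain T where T: "subgroup T G" "T \<subseteq> B" "card T = 4"
    using prime_power_subgroup_ex[OF sB primes_2_5(1), of 2] cB by auto
  have Tc: "T \<subseteq> carrier G" by (rule subgroup.subset[OF T(1)])
  have "\<not> T \<subseteq> {\<one>, z}" using card_mono[of "{\<one>, z}" T] T(3) z1 by auto
  then obtain h where h: "h \<in> T" "h \<noteq> \<one>" "h \<noteq> z" by blast
  have hG: "h \<in> carrier G" and hB: "h \<in> B" using h T Tc by auto
  have "h [^] (4::nat) = \<one>" using pow_card_subgroup[OF T(1) h(1)] T(3) by simp
  then have "(h \<otimes> h) \<otimes> (h \<otimes> h) = \<one>" using hG by (simp add: eval_nat_numeral m_assoc)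
  then have "h \<otimes> h = \<one> \<or> h \<otimes> h = z" using hG by (intro involution) simp_all
  then have hh: "h \<otimes> h = z" using involution[OF hG] h by auto
  have zT: "z \<in> T" using subgroup.m_closed[OF T(1) h(1) h(1)] hh by simp
  have Tset: "T = {\<one>, z, h, z \<otimes> h}"
  proof (rule card_subset_eq[OF sub_fin[OF T(1)], symmetric])
    show "{\<one>, z, h, z \<otimes> h} \<subseteq> T" using zT h T(1) by (auto simp: subgroup.m_closed subgroup.one_closed)
    have "z \<otimes> h \<noteq> \<one>" using hh zz h hG zG by (metis l_cancel_one' m_closed r_cancel_one' zc right_cancel)
    moreover have "z \<otimes> h \<noteq> z" "z \<otimes> h \<noteq> h" using hG zG h z1 by simp_all
    ultimately show "card {\<one>, z, h, z \<otimes> h} = card T" using T(3) h z1 by (simp add: eq_commute)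
  qed
  have hu: "h \<otimes> u = inv u \<otimes> h" if u: "u \<in> Q" for u
  proof -
    have uc: "u \<in> carrier G" using u sQ by auto
    define f where "f = h \<otimes> u \<otimes> inv h"
    have "conjugate h Q = Q" using hB by (simp add: B_def normalizer_def)
    then have fQ: "f \<in> Q" using u unfolding f_def conjugate_def by blast
    have fc: "f \<in> carrier G" using fQ sQ by auto
    have hu': "h \<otimes> u = f \<otimes> h" using uc hG by (simp add: f_def m_assoc)
    have hf: "h \<otimes> f = u \<otimes> h"
    proof -
      have "h \<otimes> f = (h \<otimes> h) \<otimes> u \<otimes> inv h" using uc hG by (simp add: f_def m_assoc)
      also have "\<dots> = u \<otimes> (h \<otimes> h) \<otimes> inv h" using zc[OF uc] by (simp add: hh)
      finally show ?thesis using uc hG by (simp add: m_assoc)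
    qed
    \<comment> \<open>The product of \<open>u\<close> and its conjugate \<open>f\<close> commutes with \<open>h\<close>, so it is trivial by \<open>not_centralizing\<close>.\<close>
    have fu: "f \<otimes> u = u \<otimes> f" using prime_card_commute[OF sQ(1) _ fQ u] cQ by simp
    have "h \<otimes> (f \<otimes> u) = (h \<otimes> f) \<otimes> u" using hG fc uc by (simp add: m_assoc)
    also have "\<dots> = u \<otimes> (h \<otimes> u)" using hG fc uc hf by (simp add: m_assoc)
    also have "\<dots> = (f \<otimes> u) \<otimes> h" using hu' hG fc uc fu by (simp add: m_assoc[symmetric])
    finally have "f \<otimes> u = \<one>"
      using not_centralizing[OF Q _ _ hG hh, of "f \<otimes> u"] subgroup.m_closed[OF sQ(1) fQ u] by blast
    then have "inv u = f" using fc uc inv_equality by simp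
    then show ?thesis using hu' by simp
  qed
  obtain P where P: "subgroup P G" "card P = 2 ^ 3" "T \<subseteq> P"
  proof -
    obtain R where R: "R \<in> sylows 2 (carrier G)" using syl_ex[OF subgroup_self primes_2_5(1)] by blast
    then have R': "subgroup R G" "card R = 2 ^ 3"
      using syl_prime_powerI[OF primes_2_5(1), of "carrier G" 3 15] n120 by simp_all
    obtain g where g: "g \<in> carrier G" "T \<subseteq> conjugate g R"
      using syl_subset_conj[OF subgroup_self primes_2_5(1) R T(1) Tc, of 2] T(3) by auto
    show ?thesis
      by (rule that[of "conjugate g R"]) (use subgroup_cj[OF g(1) R'(1)] card_cj[OF g(1) subgroup.subset[OF R'(1)]] R' g in auto)
  qed
  have Pc: "P \<subseteq> carrier G" by (rule subgroup.subset[OF P(1)])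
  have "\<not> P \<subseteq> T" using card_mono[OF sub_fin[OF T(1)], of P] P(2) T(3) by auto
  then obtain x where x: "x \<in> P" "x \<notin> T" by blast
  have xG: "x \<in> carrier G" using x Pc by auto
  have NT: "N \<subseteq> T" using zT T(1) by (simp add: Nz subgroup.one_closed)
  have inN: "t \<in> N" if "t \<in> carrier G" "t \<otimes> t = \<one>" for t using involution[OF that] Nz by auto
  have xx: "x \<otimes> x = z"
  proof -
    interpret h: group_hom G "G Mod N" "\<lambda>x. \<pi> x" by (rule pi_hom)
    \<comment> \<open>The quotient has no elements of order 4, so \<open>x \<otimes> x\<close> lies in \<open>N\<close>.\<close>
    have "x [^] (8::nat) = \<one>" using pow_card_subgroup[OF P(1) x(1)] P(2) by simp
    then have "x [^] (4::nat) \<otimes> x [^] (4::nat) = \<one>" using xG by (simp add: nat_pow_mult)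
    then have "x [^] (4::nat) \<in> N" by (intro inN) (use xG in simp_all)
    then have "\<pi> (x [^] (4::nat)) = N" using coset_join2[OF _ sN] xG by simp
    then have "\<pi> x [^]\<^bsub>G Mod N\<^esub> (4::nat) = \<one>\<^bsub>G Mod N\<^esub>" using h.hom_nat_pow[OF xG, of 4] by simp
    then have "\<pi> x \<otimes>\<^bsub>G Mod N\<^esub> \<pi> x = \<one>\<^bsub>G Mod N\<^esub>" by (rule S.pow4_imp_square[OF h.hom_closed[OF xG]])
    then have "\<pi> (x \<otimes> x) = \<one>\<^bsub>G Mod N\<^esub>" using h.hom_mult[OF xG xG] by simp
    then have "\<pi> (x \<otimes> x) = N" by simp
    then have "x \<otimes> x \<in> N" using rcos_self[OF m_closed[OF xG xG] sN] by simp
    then show ?thesis using inN[OF xG] NT x(2) Nz by auto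
  qed
  have xh: "x \<otimes> h = z \<otimes> (h \<otimes> x)"
  proof -
    have "P \<subseteq> normalizer T" by (rule prime_index_normal[OF P(1,2) primes_2_5(1) T(1) P(3)]) (use P(2) T(3) in simp)
    then have "conjugate x T = T" using x by (auto simp: normalizer_def)
    then have m: "x \<otimes> h \<otimes> inv x \<in> T" using h(1) unfolding conjugate_def by blast
    have xh_t: "x \<otimes> h = t \<otimes> x" if "x \<otimes> h \<otimes> inv x = t" for t
      unfolding that[symmetric] using xG hG by (simp add: m_assoc)
    have "x \<otimes> h \<otimes> inv x \<noteq> \<one>" using xh_t[of \<one>] xG hG h(2) by auto
    moreover have "x \<otimes> h \<otimes> inv x \<noteq> z"
    proof
      assume "x \<otimes> h \<otimes> inv x = z"
      then have "x \<otimes> h = x \<otimes> z" using xh_t[of z] zc[OF xG] by simp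
      then show False using xG hG zG h(3) by simp
    qed
    moreover have "x \<otimes> h \<otimes> inv x \<noteq> h"
    proof
      assume "x \<otimes> h \<otimes> inv x = h"
      then have c: "h \<otimes> x = x \<otimes> h" using xh_t[of h] by simp
      have "(x \<otimes> h) \<otimes> (x \<otimes> h) = x \<otimes> ((h \<otimes> x) \<otimes> h)" using xG hG by (simp add: m_assoc)
      also have "\<dots> = (x \<otimes> x) \<otimes> (h \<otimes> h)" unfolding c using xG hG by (simp add: m_assoc)
      also have "\<dots> = \<one>" by (simp add: xx hh zz)
      finally have "x \<otimes> h \<in> T" using inN[of "x \<otimes> h"] NT xG hG by auto
      then have "(x \<otimes> h) \<otimes> inv h \<in> T" using T(1) h(1) by (simp add: subgroup.m_closed subgroup.m_inv_closed)
      then show False using x(2) xG hG by (simp add: m_assoc)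
    qed
    ultimately have "x \<otimes> h \<otimes> inv x = z \<otimes> h" using m Tset by auto
    then show ?thesis using xh_t[of "z \<otimes> h"] zG hG xG by (simp add: m_assoc)
  qed
  have xB: "x \<notin> B"
  proof
    assume "x \<in> B"
    then have "insert x T \<subseteq> P \<inter> B" using x(1) P(3) T(2) by auto
    then have "card (insert x T) \<le> card (P \<inter> B)"
      by (rule card_mono[OF finite_Int[OF disjI1[OF sub_fin[OF P(1)]]]])
    \<comment> \<open>The order of \<open>P \<inter> B\<close> divides the orders 8 of \<open>P\<close> and 20 of \<open>B\<close>.\<close>
    then have "5 \<le> card (P \<inter> B)" using x(2) T(3) sub_fin[OF T(1)] by simp
    moreover have "card (P \<inter> B) dvd 8" "card (P \<inter> B) dvd 20"
      using card_dvd[OF subgroups_Inter_pair[OF P(1) sB] P(1)] card_dvd[OF subgroups_Inter_pair[OF P(1) sB] sB] P(2) cB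
      by simp_all
    then have "card (P \<inter> B) dvd gcd 8 20" by (rule gcd_greatest)
    then have "card (P \<inter> B) \<le> 4" by (intro dvd_imp_le) (simp_all add: gcd_nat.simps)
    ultimately show False by simp
  qed
  have invx: "inv x = x \<otimes> z"
    by (rule inv_equality) (use xG zG xx zz zc[OF xG] in \<open>simp_all add: m_assoc\<close>)
  have off: "x \<otimes> v \<otimes> x \<notin> B" if v: "v \<in> Q" "v \<noteq> \<one>" for v
  proof
    assume b: "x \<otimes> v \<otimes> x \<in> B"
    have vc: "v \<in> carrier G" using v sQ by auto
    define y where "y = x \<otimes> v \<otimes> inv x"
    have "y = (x \<otimes> v \<otimes> x) \<otimes> z" using vc xG zG by (simp add: y_def invx m_assoc)
    then have yB: "y \<in> B" using b zB subgroup.m_closed[OF sB] by simp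
    have R: "conjugate x Q \<in> sylows 5 (carrier G)" by (rule syl_cj[OF subgroup_self xG Q])
    have sR: "subgroup (conjugate x Q) G" "card (conjugate x Q) = 5" using syl_5_card[OF R] by auto
    have yR: "y \<in> conjugate x Q" using v by (auto simp: y_def conjugate_def)
    have y1: "y \<noteq> \<one>"
    proof
      assume "y = \<one>"
      then have "x \<otimes> v = x" using vc xG unfolding y_def by (metis inv_equality inv_inv inv_closed m_closed)
      then show False using v vc xG by simp
    qed
    \<comment> \<open>A Sylow 5-subgroup that meets \<open>B\<close> non-trivially lies in \<open>B\<close>, where \<open>Q\<close> is the only one.\<close>
    have "conjugate x Q \<subseteq> B"
    proof (rule ccontr)
      assume "\<not> conjugate x Q \<subseteq> B"
      then have "conjugate x Q \<inter> B = {\<one>}" using prime_int_trivial[OF sR(1) sB] sR(2) by simp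
      then show False using yR yB y1 by blast
    qed
    then have "conjugate x Q = Q" using syl_normalized_eq[OF subgroup_self primes_2_5(2) Q R] by (simp add: B_def)
    then show False using xB xG by (simp add: B_def normalizer_def)
  qed
  have Bdec: "\<exists>c\<in>{\<one>, z}. \<exists>u\<in>Q. b = c \<otimes> u \<or> b = c \<otimes> (u \<otimes> h)" if b: "b \<in> B" for b
  proof -
    have int: "Q \<inter> T = {\<one>}" by (rule coprime_int_trivial[OF sQ(1) T(1)]) (simp add: cQ T(3) coprime_iff_gcd_eq_1 gcd_nat.simps)
    have inj: "inj_on (\<lambda>(u, t). u \<otimes> t) (Q \<times> T)"
    proof (rule inj_onI, clarify)
      fix u t u' t' assume a: "u \<in> Q" "t \<in> T" "u' \<in> Q" "t' \<in> T" "u \<otimes> t = u' \<otimes> t'"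
      have c: "u \<in> carrier G" "t \<in> carrier G" "u' \<in> carrier G" "t' \<in> carrier G" using a sQ Tc by auto
      have "inv u' \<otimes> u = inv u' \<otimes> (u \<otimes> t) \<otimes> inv t" using c by (simp add: m_assoc)
      also have "\<dots> = t' \<otimes> inv t" unfolding a(5) using c by (simp add: m_assoc[symmetric])
      finally have e: "inv u' \<otimes> u = t' \<otimes> inv t" .
      have "inv u' \<otimes> u \<in> Q" "t' \<otimes> inv t \<in> T"
        using a sQ(1) T(1) by (simp_all add: subgroup.m_closed subgroup.m_inv_closed)
      then have "inv u' \<otimes> u = \<one>" using int e by auto
      then have "u = u'" using c by (metis inv_equality inv_inv inv_closed)
      then show "u = u' \<and> t = t'" using a(5) c by simp
    qed
    have "(\<lambda>(u, t). u \<otimes> t) ` (Q \<times> T) = B"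
    proof (rule card_subset_eq[OF sub_fin[OF sB]])
      show "(\<lambda>(u, t). u \<otimes> t) ` (Q \<times> T) \<subseteq> B" using QB T(2) by (auto intro!: subgroup.m_closed[OF sB])
      show "card ((\<lambda>(u, t). u \<otimes> t) ` (Q \<times> T)) = card B" using card_image[OF inj] cQ T(3) cB by (simp add: card_cartesian_product)
    qed
    then obtain u t where ut: "u \<in> Q" "t \<in> T" "b = u \<otimes> t" using b by auto
    have uc: "u \<in> carrier G" using ut sQ by auto
    have "t \<in> {\<one>, z, h, z \<otimes> h}" using ut(2) Tset by simp
    then show ?thesis
    proof (elim insertE emptyE)
      assume "t = \<one>" then have "b = \<one> \<otimes> u" using ut uc by simp
      then show ?thesis using ut(1) by blast
    next
      assume "t = z" then have "b = z \<otimes> u" using ut zc[OF uc] by simp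
      then show ?thesis using ut(1) by blast
    next
      assume "t = h" then have "b = \<one> \<otimes> (u \<otimes> h)" using ut uc hG by simp
      then show ?thesis using ut(1) by blast
    next
      assume "t = z \<otimes> h"
      then have "b = (u \<otimes> z) \<otimes> h" using ut uc hG zG by (simp add: m_assoc)
      then have "b = z \<otimes> (u \<otimes> h)" using uc hG zG by (simp add: m_assoc zc)
      then show ?thesis using ut(1) by blast
    qed
  qed
  have dbl: "g \<in> B \<or> (\<exists>b\<in>B. \<exists>v\<in>Q. g = b \<otimes> x \<otimes> v)" if g: "g \<in> carrier G" for g
    unfolding disj_imp
  proof
    assume gB: "g \<notin> B"
    have moved: "conjugate (inv k) Q \<in> sylows 5 (carrier G) - {Q}" if k: "k \<in> carrier G" "k \<notin> B" for k
    proof -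
      have "conjugate (inv k) Q \<noteq> Q"
      proof
        assume "conjugate (inv k) Q = Q"
        then have "conjugate k Q = Q" using cj_inv'[OF k(1) sQ(2)] by simp
        then show False using k by (simp add: B_def normalizer_def)
      qed
      then show ?thesis using syl_cj[OF subgroup_self _ Q, of "inv k"] k(1) by simp
    qed
    \<comment> \<open>The conjugates of \<open>Q\<close> by the inverses of \<open>x\<close> and \<open>g\<close> lie in one orbit of \<open>Q\<close>.\<close>
    have "orbit Q conjugate (conjugate (inv x) Q) = sylows 5 (carrier G) - {Q}"
      by (rule syl_orbit_rest[OF primes_2_5(2) Q cQ]) (use card_syl_5 moved[OF xG xB] in auto)
    then have "conjugate (inv g) Q \<in> orbit Q conjugate (conjugate (inv x) Q)" using moved[OF g gB] by simp
    then obtain w where w: "w \<in> Q" "conjugate (inv g) Q = conjugate w (conjugate (inv x) Q)" by (auto simp: orbit_def)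
    have wc: "w \<in> carrier G" using w sQ by auto
    have "conjugate (inv g) Q = conjugate (w \<otimes> inv x) Q" using w(2) cj_mult[OF wc _ sQ(2), of "inv x"] xG by simp
    then have "conjugate (inv (w \<otimes> inv x) \<otimes> inv g) Q = Q" using cj_eq_iff[of "inv g" "w \<otimes> inv x" Q] g wc xG sQ(2) by simp
    then have "inv (w \<otimes> inv x) \<otimes> inv g \<in> B" using g wc xG by (simp add: B_def normalizer_def)
    then have "inv (inv (w \<otimes> inv x) \<otimes> inv g) \<in> B" using subgroup.m_inv_closed[OF sB] by blast
    moreover have "inv (inv (w \<otimes> inv x) \<otimes> inv g) = g \<otimes> w \<otimes> inv x"
      using g wc xG by (simp add: inv_mult_group m_assoc)
    ultimately have bB: "g \<otimes> w \<otimes> inv x \<in> B" by simp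
    have "g = (g \<otimes> w \<otimes> inv x) \<otimes> x \<otimes> inv w" using g wc xG by (simp add: m_assoc)
    then show "\<exists>b\<in>B. \<exists>v\<in>Q. g = b \<otimes> x \<otimes> v" using bB subgroup.m_inv_closed[OF sQ(1) w(1)] by blast
  qed
  have Qnt: "\<exists>v\<in>Q. v \<noteq> \<one>"
  proof (rule ccontr)
    assume "\<not> ?thesis"
    then have "Q \<subseteq> {\<one>}" by blast
    then show False using card_mono[of "{\<one>}" Q] cQ by simp
  qed
  have pQ: "prime (card Q)" using cQ by simp
  have "bi_frame G Q B z h x"
    by (intro bi_frame.intro is_group bi_frame_axioms.intro sQ(1) sB QB Qnt zB z1 zz hB hh xG xB xx xh)
      (use prime_card_commute[OF sQ(1) pQ] pow_card_subgroup[OF sQ(1)] prime_card_cyclic[OF sQ(1) pQ] cQ zc hu off Bdec dbl in simp_all)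
  then show ?thesis by blast
qed

end

section \<open>Non-solvable groups with 76 subgroups\<close>

theorem theorem2p4:
  fixes G :: "('a, 'b) monoid_scheme"
  assumes "group G"
    and "finite (carrier G)"
    and "\<not> solvable G"
    and "Sub G = 76"
  shows "G \<cong> SL_2_5"
proof -
  interpret G: fin_group G by (rule fin_groupI[OF assms(1,2)])
  have sub76: "card {K. subgroup K G} = 76" using assms(4) by (simp add: Sub_def)
  obtain H N where H: "subgroup H G" and N: "N \<lhd> G\<lparr>carrier := H\<rparr>"
    and simple: "simple_group (G\<lparr>carrier := H\<rparr> Mod N)" and np: "\<not> prime (order (G\<lparr>carrier := H\<rparr> Mod N))"
    and min: "\<forall>M. subgroup M (G\<lparr>carrier := H\<rparr> Mod N) \<longrightarrow> M \<noteq> carrier (G\<lparr>carrier := H\<rparr> Mod N) \<longrightarrow> M \<noteq> {N} \<longrightarrow>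
      \<not> prime (card M) \<longrightarrow> (\<exists>A. A \<lhd> (G\<lparr>carrier := H\<rparr> Mod N)\<lparr>carrier := M\<rparr> \<and> A \<noteq> {N} \<and> A \<noteq> M)"
    using minimal_simple_section[OF assms(1-3)] by blast
  let ?H = "G\<lparr>carrier := H\<rparr>"
  let ?S = "?H Mod N"
  interpret H: fin_group ?H by (rule G.fin_group_restrict[OF H])
  have "finite (carrier ?S)" using H.fin by (simp add: carrier_FactGroup)
  then interpret S: simple_fin ?S using simple_group_simple_fin[OF simple _ np] by simp
  have subH: "{K. subgroup K ?H} \<subseteq> {K. subgroup K G}" using G.subgroup_restrict_iff[OF H] by blast
  then have fewH: "card {K. subgroup K ?H} \<le> 76" using card_mono[OF G.finite_subgroups] sub76 by metis
  have "few_subgroups ?S"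
  proof (intro few_subgroups.intro few_subgroups_axioms.intro S.simple_fin_axioms)
    fix M assume M: "M \<in> S.proper_subgroups" "\<not> prime (card M)"
    have sM: "subgroup M ?S" "M \<noteq> {N}" "M \<noteq> carrier ?S" using M(1) by (simp_all add: S.proper_subgroups_def)
    obtain A where A: "A \<lhd> ?S\<lparr>carrier := M\<rparr>" "A \<noteq> {N}" "A \<noteq> M" using min sM M(2) by blast
    have "subgroup A ?S \<and> A \<subseteq> M \<and> M \<subseteq> S.normalizer A" by (rule S.normal_in_subgroup[OF sM(1) A(1)])
    then show "\<exists>A. subgroup A ?S \<and> A \<noteq> {\<one>\<^bsub>?S\<^esub>} \<and> A \<subset> M \<and> M \<subseteq> S.normalizer A" using A(2,3) by auto
  next
    have "S.proper_subgroups = {K. subgroup K ?S} - {{\<one>\<^bsub>?S\<^esub>}, carrier ?S}" by (auto simp: S.proper_subgroups_def)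
    moreover have "{{\<one>\<^bsub>?S\<^esub>}, carrier ?S} \<subseteq> {K. subgroup K ?S}" using S.triv_subgroup S.subgroup_self by auto
    moreover have "card {{\<one>\<^bsub>?S\<^esub>}, carrier ?S} = 2"     proof -
      have "{\<one>\<^bsub>?S\<^esub>} \<noteq> carrier ?S" using S.gt1 by (metis card_1_singleton_iff less_irrefl One_nat_def)
      then show ?thesis by simp
    qed
    ultimately have "card S.proper_subgroups = card {K. subgroup K ?S} - 2" by (simp add: card_Diff_subset)
    then show "card S.proper_subgroups \<le> 74" using H.card_subgroups_quotient[OF N] fewH by simp
  qed
  then have S60: "simple_60 ?S" by (rule few_subgroups.simple_60)
  show ?thesis
  proof (cases "N = {\<one>\<^bsub>G\<^esub>}")
    case True
    obtain \<phi> where \<phi>: "\<phi> \<in> iso ?S ?H" using H.trivial_factor_iso True by (auto simp: is_iso_def)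
    then have "simple_group ?H" by (rule simple_group.iso_simple[OF simple H.is_group])
    moreover have "order ?H = 60"
      using iso_same_card[of ?S ?H] \<phi> simple_60.n60[OF S60] by (auto simp: is_iso_def order_def)
    ultimately have H60: "simple_60 ?H" by (rule simple_group_simple_60)
    have "H = carrier G" using G.subgroups_above_simple_60[OF H _ H60] sub76 by auto
    then have "simple_60 G" using H60 by simp
    then show ?thesis using simple_60.card_subgroups sub76 by fastforce
  next
    case False
    have EH: "extension_of_simple_60 ?H N"
      by (intro extension_of_simple_60.intro extension_of_simple_60_axioms.intro H.fin_group_axioms N S60)
    have "N \<noteq> {\<one>\<^bsub>?H\<^esub>}" using False by simp
    then have H76: "card {K. subgroup K ?H} = 76" by (rule extension_of_simple_60.central_extension(3)[OF EH _ fewH])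
    have HG: "H = carrier G"
    proof (rule ccontr)
      assume "H \<noteq> carrier G"
      then have "carrier G \<notin> {K. subgroup K ?H}"
        using G.subgroup_restrict_iff[OF H, of "carrier G"] subgroup.subset[OF H] by auto
      then have "{K. subgroup K ?H} \<subset> {K. subgroup K G}" using subH G.subgroup_self by blast
      then have "card {K. subgroup K ?H} < card {K. subgroup K G}" by (rule psubset_card_mono[OF G.finite_subgroups])
      then show False using H76 sub76 by simp
    qed
    have EG: "extension_of_simple_60 G N" using EH HG by simp
    have c: "card N = 2" and inv: "\<And>t. t \<in> carrier G \<Longrightarrow> t \<otimes>\<^bsub>G\<^esub> t = \<one>\<^bsub>G\<^esub> \<Longrightarrow> t \<noteq> \<one>\<^bsub>G\<^esub> \<Longrightarrow> t \<in> N"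
      using extension_of_simple_60.central_extension(1,2)[OF EG False] sub76 by simp_all
    obtain z where z: "N = {\<one>\<^bsub>G\<^esub>, z}" "z \<noteq> \<one>\<^bsub>G\<^esub>"
      using c subgroup.one_closed[OF extension_of_simple_60.sN[OF EG]] by (auto simp: card_2_iff)
    have cover: "double_cover_of_simple_60 G N z"
      by (intro double_cover_of_simple_60.intro double_cover_of_simple_60_axioms.intro EG z)
        (use inv z(1) in blast)
    obtain Q B h x where "bi_frame G Q B z h x" using double_cover_of_simple_60.bi_frame[OF cover] by (elim exE)
    then show ?thesis by (rule bi_frame.iso_SL_2_5)
  qed
qed

end
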